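(* Let $c,p\in(0,\infty)$ and, for $i=1,2$, let $\mathfrak M_i$ be a properly infinite semifinite factor equipped with a normal semifinite faithful tracial weight $\tau_i$ such that $\mathscr P_c(\mathfrak M_i)\neq\emptyset$. Let $\phi$ be a surjective $L^p$-isometry from $\mathscr P_c(\mathfrak M_1)$ to $\mathscr P_c(\mathfrak M_2)$. Then there is a $*$-isomorphism or a $*$-anti-isomorphism $\varphi:\mathfrak M_1\to\mathfrak M_2$ such that $\tau_1=\tau_2\circ\varphi$ and $\phi(P)=\varphi(P)$ for every projection $P\in\mathscr P_c(\mathfrak M_1)$.
   Context: For a semifinite von Neumann algebra factor $\mathfrak M$ with normal semifinite faithful tracial weight $\tau$, $\mathscr P_c(\mathfrak M)$ denotes the set of all projections $P\in\mathfrak M$ with $\tau(P)=c$ (the Grassmann space). Properly infinite here means $\tau(I)=\infty$. For $A\in\mathfrak M$ whose range projection has finite trace, $\|A\|_p:=\tau(|A|^p)^{1/p}$. A map $\phi:\mathscr P_c(\mathfrak M_1)\to\mathscr P_c(\mathfrak M_2)$ is an $L^p$-isometry if $\|P-Q\|_p=\|\phi(P)-\phi(Q)\|_p$ for all $P,Q\in\mathscr P_c(\mathfrak M_1)$, each side computed with the respective $\tau_i$. A $*$-anti-isomorphism is a complex-linear bijection $\varphi$ with $\varphi(A^* )=\varphi(A)^*$ and $\varphi(AB)=\varphi(B)\varphi(A)$. *)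

theory Defs
  imports "HOL-Analysis.Analysis" "HOL-Computational_Algebra.Polynomial"
begin

section \<open>Complex Hilbert spaces\<close>

text \<open>The inner product is linear in the first argument. The norm axioms inherited from
  \<^class>\<open>banach\<close> together with \<open>cinner_self\<close> give positivity, definiteness and completeness.\<close>

class complex_hilbert = banach +
  fixes scaleC :: "complex \<Rightarrow> 'a \<Rightarrow> 'a" (infixr "*\<^sub>C" 75)
    and cinner :: "'a \<Rightarrow> 'a \<Rightarrow> complex"
  assumes scaleC_add_right: "a *\<^sub>C (x + y) = a *\<^sub>C x + a *\<^sub>C y"
    and scaleC_add_left: "(a + b) *\<^sub>C x = a *\<^sub>C x + b *\<^sub>C x"
    and scaleC_scaleC: "a *\<^sub>C b *\<^sub>C x = (a * b) *\<^sub>C x"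
    and scaleR_scaleC: "r *\<^sub>R x = complex_of_real r *\<^sub>C x"
    and cinner_add_left: "cinner (x + y) z = cinner x z + cinner y z"
    and cinner_scaleC_left: "cinner (a *\<^sub>C x) y = a * cinner x y"
    and cinner_commute: "cinner x y = cnj (cinner y x)"
    and cinner_self: "cinner x x = complex_of_real ((norm x)\<^sup>2)"

lemma norm_scaleC: "norm (a *\<^sub>C x) = cmod a * norm (x :: 'a :: complex_hilbert)"
proof -
  have "cinner (a *\<^sub>C x) (a *\<^sub>C x) = a * cnj (a * cinner x x)"
    by (metis cinner_scaleC_left cinner_commute)
  also have "\<dots> = (a * cnj a) * cinner x x"
    by (simp add: cinner_self)
  also have "\<dots> = complex_of_real ((cmod a * norm x)\<^sup>2)"
    by (simp add: cinner_self power_mult_distrib flip: complex_norm_square)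
  finally have "(norm (a *\<^sub>C x))\<^sup>2 = (cmod a * norm x)\<^sup>2"
    unfolding cinner_self of_real_eq_iff .
  then show ?thesis
    by (simp add: power2_eq_iff_nonneg)
qed

lemma bounded_linear_scaleC: "bounded_linear (\<lambda>x :: 'a :: complex_hilbert. a *\<^sub>C x)"
  by (rule bounded_linear_intro [where K = "cmod a"])
    (simp_all add: scaleC_add_right scaleR_scaleC scaleC_scaleC norm_scaleC mult.commute)


section \<open>Bounded operators\<close>

text \<open>\<open>'a \<Rightarrow>\<^sub>L 'a\<close> is the type of bounded \<^emph>\<open>real\<close>-linear maps; \<open>bounded_ops\<close> carves out \<open>B(H)\<close>.\<close>

definition bounded_ops :: "('a::complex_hilbert \<Rightarrow>\<^sub>L 'a) set" where
  "bounded_ops = {A. \<forall>a x. blinfun_apply A (a *\<^sub>C x) = a *\<^sub>C blinfun_apply A x}"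

lift_definition scaleC_op :: "complex \<Rightarrow> ('a::complex_hilbert \<Rightarrow>\<^sub>L 'a) \<Rightarrow> ('a \<Rightarrow>\<^sub>L 'a)"
  is "\<lambda>a A x. a *\<^sub>C A x"
  by (rule bounded_linear_compose [OF bounded_linear_scaleC])

definition adj :: "('a::complex_hilbert \<Rightarrow>\<^sub>L 'a) \<Rightarrow> ('a \<Rightarrow>\<^sub>L 'a)" where
  "adj A = (THE B. \<forall>x y. cinner (blinfun_apply A x) y = cinner x (blinfun_apply B y))"

definition pos_op :: "('a::complex_hilbert \<Rightarrow>\<^sub>L 'a) \<Rightarrow> bool" where
  "pos_op A \<longleftrightarrow> A \<in> bounded_ops \<and>
     (\<forall>x. cinner (blinfun_apply A x) x \<in> \<real> \<and> 0 \<le> Re (cinner (blinfun_apply A x) x))"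

definition op_le :: "('a::complex_hilbert \<Rightarrow>\<^sub>L 'a) \<Rightarrow> ('a \<Rightarrow>\<^sub>L 'a) \<Rightarrow> bool" where
  "op_le A B \<longleftrightarrow> pos_op (B - A)"

definition projection :: "('a::complex_hilbert \<Rightarrow>\<^sub>L 'a) \<Rightarrow> bool" where
  "projection P \<longleftrightarrow> P \<in> bounded_ops \<and> P o\<^sub>L P = P \<and> adj P = P"

definition spectrum :: "('a::complex_hilbert \<Rightarrow>\<^sub>L 'a) \<Rightarrow> complex set" where
  "spectrum A = {z. \<not> (\<exists>B\<in>bounded_ops.
     B o\<^sub>L (A - scaleC_op z id_blinfun) = id_blinfun \<and>
     (A - scaleC_op z id_blinfun) o\<^sub>L B = id_blinfun)}"

definition poly_op :: "real poly \<Rightarrow> ('a::complex_hilbert \<Rightarrow>\<^sub>L 'a) \<Rightarrow> ('a \<Rightarrow>\<^sub>L 'a)" where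
  "poly_op q A = (\<Sum>i\<le>degree q. coeff q i *\<^sub>R (((o\<^sub>L) A ^^ i) id_blinfun))"

text \<open>Continuous functional calculus of a self-adjoint operator \<open>A\<close>, whose spectrum is real:
  \<open>f(A)\<close> is the norm limit of \<open>q\<^sub>n(A)\<close> for polynomials \<open>q\<^sub>n\<close> tending to \<open>f\<close> uniformly on the
  spectrum.\<close>

definition cfc :: "(real \<Rightarrow> real) \<Rightarrow> ('a::complex_hilbert \<Rightarrow>\<^sub>L 'a) \<Rightarrow> ('a \<Rightarrow>\<^sub>L 'a)" where
  "cfc f A = (THE B. \<exists>q :: nat \<Rightarrow> real poly.
     uniform_limit {t. complex_of_real t \<in> spectrum A} (\<lambda>n. poly (q n)) f sequentially \<and>
     (\<lambda>n. poly_op (q n) A) \<longlonglongrightarrow> B)"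

definition abs_op :: "('a::complex_hilbert \<Rightarrow>\<^sub>L 'a) \<Rightarrow> ('a \<Rightarrow>\<^sub>L 'a)" where
  "abs_op A = cfc sqrt (adj A o\<^sub>L A)"


section \<open>Von Neumann algebras and factors\<close>

definition commutant :: "('a::complex_hilbert \<Rightarrow>\<^sub>L 'a) set \<Rightarrow> ('a \<Rightarrow>\<^sub>L 'a) set" where
  "commutant S = {A \<in> bounded_ops. \<forall>B\<in>S. A o\<^sub>L B = B o\<^sub>L A}"

text \<open>A self-adjoint set of operators equal to its bicommutant; being a unital subalgebra
  is then automatic.\<close>

definition von_neumann_algebra :: "('a::complex_hilbert \<Rightarrow>\<^sub>L 'a) set \<Rightarrow> bool" where
  "von_neumann_algebra M \<longleftrightarrow>
     M \<subseteq> bounded_ops \<and> (\<forall>A\<in>M. adj A \<in> M) \<and> commutant (commutant M) = M"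

definition factor :: "('a::complex_hilbert \<Rightarrow>\<^sub>L 'a) set \<Rightarrow> bool" where
  "factor M \<longleftrightarrow> von_neumann_algebra M \<and>
     M \<inter> commutant M = range (\<lambda>a. scaleC_op a id_blinfun)"

definition pos_cone :: "('a::complex_hilbert \<Rightarrow>\<^sub>L 'a) set \<Rightarrow> ('a \<Rightarrow>\<^sub>L 'a) set" where
  "pos_cone M = {A \<in> M. pos_op A}"


section \<open>Tracial weights\<close>

text \<open>A weight is a function on the positive cone of \<open>M\<close>; its values elsewhere are irrelevant.
  In \<^typ>\<open>ennreal\<close> we have \<open>0 * \<infinity> = 0\<close>.\<close>

definition tracial_weight ::
    "('a::complex_hilbert \<Rightarrow>\<^sub>L 'a) set \<Rightarrow> (('a \<Rightarrow>\<^sub>L 'a) \<Rightarrow> ennreal) \<Rightarrow> bool" where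
  "tracial_weight M \<tau> \<longleftrightarrow>
     (\<forall>A\<in>pos_cone M. \<forall>B\<in>pos_cone M. \<tau> (A + B) = \<tau> A + \<tau> B) \<and>
     (\<forall>A\<in>pos_cone M. \<forall>r\<ge>0. \<tau> (r *\<^sub>R A) = ennreal r * \<tau> A) \<and>
     (\<forall>A\<in>M. \<tau> (adj A o\<^sub>L A) = \<tau> (A o\<^sub>L adj A))"

definition faithful_weight ::
    "('a::complex_hilbert \<Rightarrow>\<^sub>L 'a) set \<Rightarrow> (('a \<Rightarrow>\<^sub>L 'a) \<Rightarrow> ennreal) \<Rightarrow> bool" where
  "faithful_weight M \<tau> \<longleftrightarrow> (\<forall>A\<in>pos_cone M. \<tau> A = 0 \<longrightarrow> A = 0)"

definition semifinite_weight ::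
    "('a::complex_hilbert \<Rightarrow>\<^sub>L 'a) set \<Rightarrow> (('a \<Rightarrow>\<^sub>L 'a) \<Rightarrow> ennreal) \<Rightarrow> bool" where
  "semifinite_weight M \<tau> \<longleftrightarrow>
     (\<forall>A\<in>pos_cone M. A \<noteq> 0 \<longrightarrow> (\<exists>B\<in>pos_cone M. B \<noteq> 0 \<and> op_le B A \<and> \<tau> B < \<infinity>))"

text \<open>Normality: \<open>\<tau>\<close> preserves suprema of bounded increasing nets in the positive cone,
  phrased with upward directed sets.\<close>

definition normal_weight ::
    "('a::complex_hilbert \<Rightarrow>\<^sub>L 'a) set \<Rightarrow> (('a \<Rightarrow>\<^sub>L 'a) \<Rightarrow> ennreal) \<Rightarrow> bool" where
  "normal_weight M \<tau> \<longleftrightarrow>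
     (\<forall>D A. D \<subseteq> pos_cone M \<and> D \<noteq> {} \<and>
        (\<forall>B\<in>D. \<forall>C\<in>D. \<exists>E\<in>D. op_le B E \<and> op_le C E) \<and>
        A \<in> pos_cone M \<and> (\<forall>B\<in>D. op_le B A) \<and>
        (\<forall>C\<in>pos_cone M. (\<forall>B\<in>D. op_le B C) \<longrightarrow> op_le A C)
        \<longrightarrow> \<tau> A = (SUP B\<in>D. \<tau> B))"

text \<open>A von Neumann algebra is semifinite iff it carries a weight of this kind.\<close>

definition nsf_tracial_weight ::
    "('a::complex_hilbert \<Rightarrow>\<^sub>L 'a) set \<Rightarrow> (('a \<Rightarrow>\<^sub>L 'a) \<Rightarrow> ennreal) \<Rightarrow> bool" where
  "nsf_tracial_weight M \<tau> \<longleftrightarrow> tracial_weight M \<tau> \<and> normal_weight M \<tau> \<and>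
     semifinite_weight M \<tau> \<and> faithful_weight M \<tau>"


section \<open>Grassmann spaces and \<open>L\<^sup>p\<close>-isometries\<close>

definition grassmann ::
    "('a::complex_hilbert \<Rightarrow>\<^sub>L 'a) set \<Rightarrow> (('a \<Rightarrow>\<^sub>L 'a) \<Rightarrow> ennreal) \<Rightarrow> real \<Rightarrow> ('a \<Rightarrow>\<^sub>L 'a) set" where
  "grassmann M \<tau> c = {P \<in> M. projection P \<and> \<tau> P = ennreal c}"

text \<open>Meaningful when the range projection of \<open>A\<close> has finite trace; then \<open>\<tau>(|A|\<^sup>p)\<close> is finite,
  and \<^const>\<open>enn2real\<close> loses nothing.\<close>

definition lp_norm ::
    "(('a::complex_hilbert \<Rightarrow>\<^sub>L 'a) \<Rightarrow> ennreal) \<Rightarrow> real \<Rightarrow> ('a \<Rightarrow>\<^sub>L 'a) \<Rightarrow> real" where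
  "lp_norm \<tau> p A = enn2real (\<tau> (cfc (\<lambda>t. t powr p) (abs_op A))) powr (1 / p)"

definition surjective_lp_isometry ::
    "real \<Rightarrow> real \<Rightarrow>
     ('a::complex_hilbert \<Rightarrow>\<^sub>L 'a) set \<Rightarrow> (('a \<Rightarrow>\<^sub>L 'a) \<Rightarrow> ennreal) \<Rightarrow>
     ('b::complex_hilbert \<Rightarrow>\<^sub>L 'b) set \<Rightarrow> (('b \<Rightarrow>\<^sub>L 'b) \<Rightarrow> ennreal) \<Rightarrow>
     (('a \<Rightarrow>\<^sub>L 'a) \<Rightarrow> ('b \<Rightarrow>\<^sub>L 'b)) \<Rightarrow> bool" where
  "surjective_lp_isometry p c M1 \<tau>1 M2 \<tau>2 \<phi> \<longleftrightarrow>
     \<phi> ` grassmann M1 \<tau>1 c = grassmann M2 \<tau>2 c \<and>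
     (\<forall>P\<in>grassmann M1 \<tau>1 c. \<forall>Q\<in>grassmann M1 \<tau>1 c.
        lp_norm \<tau>1 p (P - Q) = lp_norm \<tau>2 p (\<phi> P - \<phi> Q))"


section \<open>Isomorphisms and anti-isomorphisms\<close>

definition star_linear_bijection ::
    "('a::complex_hilbert \<Rightarrow>\<^sub>L 'a) set \<Rightarrow> ('b::complex_hilbert \<Rightarrow>\<^sub>L 'b) set \<Rightarrow>
     (('a \<Rightarrow>\<^sub>L 'a) \<Rightarrow> ('b \<Rightarrow>\<^sub>L 'b)) \<Rightarrow> bool" where
  "star_linear_bijection M N \<psi> \<longleftrightarrow> bij_betw \<psi> M N \<and>
     (\<forall>A\<in>M. \<forall>B\<in>M. \<psi> (A + B) = \<psi> A + \<psi> B) \<and>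
     (\<forall>a. \<forall>A\<in>M. \<psi> (scaleC_op a A) = scaleC_op a (\<psi> A)) \<and>
     (\<forall>A\<in>M. \<psi> (adj A) = adj (\<psi> A))"

definition star_isomorphism ::
    "('a::complex_hilbert \<Rightarrow>\<^sub>L 'a) set \<Rightarrow> ('b::complex_hilbert \<Rightarrow>\<^sub>L 'b) set \<Rightarrow>
     (('a \<Rightarrow>\<^sub>L 'a) \<Rightarrow> ('b \<Rightarrow>\<^sub>L 'b)) \<Rightarrow> bool" where
  "star_isomorphism M N \<psi> \<longleftrightarrow> star_linear_bijection M N \<psi> \<and>
     (\<forall>A\<in>M. \<forall>B\<in>M. \<psi> (A o\<^sub>L B) = \<psi> A o\<^sub>L \<psi> B)"

definition star_anti_isomorphism ::
    "('a::complex_hilbert \<Rightarrow>\<^sub>L 'a) set \<Rightarrow> ('b::complex_hilbert \<Rightarrow>\<^sub>L 'b) set \<Rightarrow>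
     (('a \<Rightarrow>\<^sub>L 'a) \<Rightarrow> ('b \<Rightarrow>\<^sub>L 'b)) \<Rightarrow> bool" where
  "star_anti_isomorphism M N \<psi> \<longleftrightarrow> star_linear_bijection M N \<psi> \<and>
     (\<forall>A\<in>M. \<forall>B\<in>M. \<psi> (A o\<^sub>L B) = \<psi> B o\<^sub>L \<psi> A)"

end

theory Submission
  imports Defs "HOL-Computational_Algebra.Fundamental_Theorem_Algebra"
begin

text \<open>Among projections of trace \<open>c\<close>, \<open>\<tau>(|P - Q|\<^sup>p)\<close> is at most \<open>2c\<close>, with equality exactly when
  \<open>PQ = 0\<close>. A surjective \<open>L\<^sup>p\<close>-isometry is therefore a bijection preserving
  orthogonality in both directions. For \<open>P\<close> and \<open>Q\<close> orthogonal and a partial isometry \<open>u\<close> from \<open>P\<close> onto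
  \<open>Q\<close>, the graph of \<open>u\<close> is a projection of trace \<open>c\<close>, and such graphs are characterised by a finite
  configuration of orthogonality relations; so \<open>\<phi>\<close> acts on partial isometries. Graphs of several
  partial isometries with orthogonal ranges show that this action is multiplicative; two of them are
  orthogonal when a certain sum of partial isometries vanishes, so the action also respects zero sums
  of partial isometries. Every operator from \<open>P\<close> to \<open>Q\<close> is a sum of partial isometries, hence the
  action extends to an additive, multiplicative and star preserving bijection between the algebras.
  It is linear or antilinear, since the square of the image of the scalar \<open>\<i>\<close> is \<open>-1\<close>; in the antilinear
  case, composition with the adjoint gives an anti-isomorphism. Finally, every positive contraction
  below \<open>P\<close> is encoded in a distance, so the isometry property forces the traces to agree.\<close>

section \<open>Hilbert space preliminaries\<close>

text \<open>Orthogonality is the only relation that \<open>\<phi>\<close> is known to carry over at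
  first, so each notion has to be phrased through it. Order enters as \<open>covered\<close>: to lie
  below the join of finitely many members of \<open>G\<close> is to be orthogonal to every member of
  \<open>G\<close> that is orthogonal to all of them. This works because
  \<open>\<tau> 1 = \<infinity>\<close>: outside finitely many members of \<open>G\<close> there is
  always a further one, and such auxiliary projections also carry the graphs. The graph formula
  needs \<open>P * Q = 0\<close>; a partial isometry between arbitrary \<open>P\<close> and
  \<open>Q\<close> is therefore factored through a third projection orthogonal to both. Maps given
  corner by corner must then be recognised as single operators. For unitaries this succeeds, since
  their corners form a relation that preserves inner products, and every operator is a sum of
  unitaries up to repetition. The bound \<open>2c\<close> comes from splitting a power of
  \<open>(P - Q)\<^sup>2\<close>, which commutes with \<open>P\<close> and \<open>Q\<close>, into
  the corner at \<open>P\<close> and the rest; the trace of the rest is compared with a corner at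
  \<open>Q\<close>.\<close>

lemma cinner_add_right: "cinner (x :: 'a :: complex_hilbert) (y + z) = cinner x y + cinner x z"
  by (metis cinner_commute cinner_add_left complex_cnj_add)

lemma cinner_scaleC_right: "cinner (x :: 'a :: complex_hilbert) (a *\<^sub>C y) = cnj a * cinner x y"
  by (metis cinner_commute cinner_scaleC_left complex_cnj_mult)

lemma cinner_zero_left [simp]: "cinner (0 :: 'a :: complex_hilbert) y = 0"
  using cinner_add_left[of "0 :: 'a" 0 y] by simp

lemma cinner_zero_right [simp]: "cinner (x :: 'a :: complex_hilbert) 0 = 0"
  using cinner_add_right[of x 0 0] by simp

lemma cinner_minus_left [simp]: "cinner (- (x :: 'a :: complex_hilbert)) y = - cinner x y"
  using cinner_add_left[of x "- x" y] by (simp add: eq_neg_iff_add_eq_0 add.commute)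

lemma cinner_minus_right [simp]: "cinner (x :: 'a :: complex_hilbert) (- y) = - cinner x y"
  using cinner_add_right[of x "- y" y] by (simp add: eq_neg_iff_add_eq_0)

lemma cinner_diff_left: "cinner ((x :: 'a :: complex_hilbert) - y) z = cinner x z - cinner y z"
  using cinner_add_left[of x "- y" z] by simp

lemma cinner_diff_right: "cinner (x :: 'a :: complex_hilbert) (y - z) = cinner x y - cinner x z"
  using cinner_add_right[of x y "- z"] by simp

lemma cinner_scaleR_left: "cinner (r *\<^sub>R (x :: 'a :: complex_hilbert)) y = of_real r * cinner x y"
  by (simp add: scaleR_scaleC cinner_scaleC_left)

lemma cinner_scaleR_right: "cinner (x :: 'a :: complex_hilbert) (r *\<^sub>R y) = of_real r * cinner x y"
  by (simp add: scaleR_scaleC cinner_scaleC_right)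

lemma scaleC_one [simp]: "1 *\<^sub>C (x :: 'a :: complex_hilbert) = x"
  using scaleR_scaleC[of 1 x] by simp

lemma scaleC_zero_left [simp]: "0 *\<^sub>C (x :: 'a :: complex_hilbert) = 0"
  using scaleR_scaleC[of 0 x] by simp

lemma scaleC_zero_right [simp]: "a *\<^sub>C (0 :: 'a :: complex_hilbert) = 0"
  using bounded_linear.linear[OF bounded_linear_scaleC] linear_0 by blast

lemma norm_sq_cinner: "(norm (x :: 'a :: complex_hilbert))\<^sup>2 = Re (cinner x x)"
  by (simp add: cinner_self)

lemma cinner_eq_zero_iff [simp]: "cinner x x = 0 \<longleftrightarrow> (x :: 'a :: complex_hilbert) = 0"
  by (simp add: cinner_self)

lemma norm_add_sq:
  "(norm ((x :: 'a :: complex_hilbert) + y))\<^sup>2 = (norm x)\<^sup>2 + (norm y)\<^sup>2 + 2 * Re (cinner x y)"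
proof -
  have "Re (cinner y x) = Re (cinner x y)" by (subst cinner_commute) simp
  then show ?thesis by (simp add: norm_sq_cinner cinner_add_left cinner_add_right)
qed

lemma norm_diff_sq:
  "(norm ((x :: 'a :: complex_hilbert) - y))\<^sup>2 = (norm x)\<^sup>2 + (norm y)\<^sup>2 - 2 * Re (cinner x y)"
  using norm_add_sq[of x "- y"] by simp

lemma cinner_Cauchy_Schwarz: "cmod (cinner x y) \<le> norm x * norm (y :: 'a :: complex_hilbert)"
proof (cases "y = 0")
  case False
  define t where "t = cinner x y / of_real ((norm y)\<^sup>2)"
  have "0 \<le> (norm (x - t *\<^sub>C y))\<^sup>2" by simp
  also have "\<dots> = (norm x)\<^sup>2 + (norm (t *\<^sub>C y))\<^sup>2 - 2 * Re (cnj t * cinner x y)"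
    by (simp add: norm_diff_sq cinner_scaleC_right)
  also have "(norm (t *\<^sub>C y))\<^sup>2 = (cmod (cinner x y))\<^sup>2 / (norm y)\<^sup>2"
    using False by (simp add: norm_scaleC t_def norm_divide norm_mult power2_eq_square)
  also have "cnj t * cinner x y = (cinner x y * cnj (cinner x y)) / of_real ((norm y)\<^sup>2)"
    by (simp add: t_def)
  also have "\<dots> = of_real ((cmod (cinner x y))\<^sup>2 / (norm y)\<^sup>2)"
    by (simp flip: complex_norm_square)
  finally have "(cmod (cinner x y))\<^sup>2 / (norm y)\<^sup>2 \<le> (norm x)\<^sup>2" by simp
  then have "(cmod (cinner x y))\<^sup>2 \<le> (norm x * norm y)\<^sup>2"
    using False by (simp add: field_simps power_mult_distrib)
  then show ?thesis by (simp add: abs_le_square_iff[symmetric])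
qed simp

lemma cinner_ext:
  fixes x y :: "'a :: complex_hilbert"
  assumes "\<And>z. cinner x z = cinner y z" shows "x = y"
  using assms[of "x - y"] cinner_diff_left[of x y "x - y"] by simp

lemma bounded_linear_cinner_left: "bounded_linear (\<lambda>x :: 'a :: complex_hilbert. cinner x y)"
  by (rule bounded_linear_intro[where K = "norm y"])
    (simp_all add: cinner_add_left cinner_scaleR_left cinner_Cauchy_Schwarz scaleR_conv_of_real)

lemma bounded_bilinear_cinner: "bounded_bilinear (cinner :: 'a :: complex_hilbert \<Rightarrow> _)"
proof
  show "\<exists>K. \<forall>(a :: 'a) b. norm (cinner a b) \<le> norm a * norm b * K"
    by (rule exI[of _ 1]) (simp add: cinner_Cauchy_Schwarz)
qed (simp_all add: cinner_add_left cinner_add_right cinner_scaleR_left cinner_scaleR_right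
      scaleR_conv_of_real)

lemmas continuous_on_cinner [continuous_intros] =
  bounded_bilinear.continuous_on[OF bounded_bilinear_cinner]

section \<open>Closed subspaces, the representation theorem and adjoints\<close>

definition csubspace :: "'a :: complex_hilbert set \<Rightarrow> bool" where
  "csubspace K \<longleftrightarrow> subspace K \<and> (\<forall>a. \<forall>x\<in>K. a *\<^sub>C x \<in> K)"

lemma csubspaceI:
  assumes "0 \<in> K" "\<And>x y. x \<in> K \<Longrightarrow> y \<in> K \<Longrightarrow> x + y \<in> K" "\<And>a x. x \<in> K \<Longrightarrow> a *\<^sub>C x \<in> K"
  shows "csubspace K"
  using assms unfolding csubspace_def subspace_def by (simp add: scaleR_scaleC)

text \<open>Midpoints of near-minimisers stay in \<open>K\<close>, so the parallelogram law bounds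
  the squared distance of two of them by their excess over the infimum \<open>d\<close>; a
  minimising sequence is therefore Cauchy.\<close>

lemma closest_in_closed_subspace:
  fixes K :: "'a :: complex_hilbert set"
  assumes "closed K" "subspace K"
  shows "\<exists>q\<in>K. \<forall>k\<in>K. norm (x - q) \<le> norm (x - k)"
proof -
  define d where "d = (INF k\<in>K. (norm (x - k))\<^sup>2)"
  have ne: "K \<noteq> {}" using assms(2) subspace_0 by blast
  have bdd: "bdd_below ((\<lambda>k. (norm (x - k))\<^sup>2) ` K)" by (rule bdd_belowI[of _ 0]) auto
  have dle: "d \<le> (norm (x - k))\<^sup>2" if "k \<in> K" for k
    unfolding d_def by (rule cINF_lower[OF bdd that])
  have "\<exists>k\<in>K. (norm (x - k))\<^sup>2 < d + inverse (real (Suc n))" for n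
  proof (rule ccontr)
    assume "\<not> ?thesis"
    then have "d + inverse (real (Suc n)) \<le> d"
      by (subst (2) d_def, intro cINF_greatest[OF ne]) force
    then show False by simp
  qed
  then obtain k where k: "\<And>n. k n \<in> K" "\<And>n. (norm (x - k n))\<^sup>2 < d + inverse (real (Suc n))"
    by metis
  have par: "(norm (k m - k n))\<^sup>2 \<le> 2 * inverse (real (Suc m)) + 2 * inverse (real (Suc n))" for m n
  proof -
    define a where "a = x - k m"
    define b where "b = x - k n"
    have "(1/2) *\<^sub>R (k m + k n) \<in> K" using k(1) assms(2) by (simp add: subspace_add subspace_scale)
    then have "d \<le> (norm (x - (1/2) *\<^sub>R (k m + k n)))\<^sup>2" by (rule dle)
    also have "x - (1/2) *\<^sub>R (k m + k n) = (1/2) *\<^sub>R (a + b)"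
      unfolding a_def b_def by (simp add: algebra_simps flip: scaleR_left_distrib)
    finally have d4: "4 * d \<le> (norm (a + b))\<^sup>2" by (simp add: power_mult_distrib power2_eq_square)
    have "(norm (a + b))\<^sup>2 + (norm (a - b))\<^sup>2 = 2 * (norm a)\<^sup>2 + 2 * (norm b)\<^sup>2"
      by (simp add: norm_add_sq norm_diff_sq)
    moreover have "norm (a - b) = norm (k m - k n)"
      unfolding a_def b_def by (simp add: norm_minus_commute)
    ultimately have "(norm (k m - k n))\<^sup>2 \<le> 2 * (norm a)\<^sup>2 + 2 * (norm b)\<^sup>2 - 4 * d" using d4 by simp
    then show ?thesis using k(2)[of m] k(2)[of n] unfolding a_def b_def by linarith
  qed
  have "Cauchy k"
  proof (rule metric_CauchyI)
    fix e :: real assume "0 < e"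
    then have "0 < e\<^sup>2 / 4" by simp
    then obtain N where N: "inverse (real (Suc N)) < e\<^sup>2 / 4" using reals_Archimedean by blast
    have "dist (k m) (k n) < e" if "m \<ge> N" "n \<ge> N" for m n
    proof -
      have "inverse (real (Suc m)) \<le> inverse (real (Suc N))"
        "inverse (real (Suc n)) \<le> inverse (real (Suc N))" using that by auto
      then have "(norm (k m - k n))\<^sup>2 < e\<^sup>2" using par[of m n] N by linarith
      then show ?thesis using \<open>0 < e\<close> by (simp add: dist_norm power_less_imp_less_base)
    qed
    then show "\<exists>M. \<forall>m\<ge>M. \<forall>n\<ge>M. dist (k m) (k n) < e" by blast
  qed
  then obtain q where q: "k \<longlonglongrightarrow> q" using Cauchy_convergent convergent_def by blast
  have "q \<in> K" using closed_sequentially[OF assms(1)] k(1) q by blast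
  have "(\<lambda>n. (norm (x - k n))\<^sup>2) \<longlonglongrightarrow> (norm (x - q))\<^sup>2" by (intro tendsto_intros q)
  moreover have "(\<lambda>n. d + inverse (real (Suc n))) \<longlonglongrightarrow> d + 0"
    by (intro tendsto_intros LIMSEQ_inverse_real_of_nat)
  ultimately have "(norm (x - q))\<^sup>2 \<le> d"
    using k(2) by (intro LIMSEQ_le) (auto intro: less_imp_le)
  then show ?thesis using \<open>q \<in> K\<close> dle
    by (metis abs_norm_cancel abs_le_square_iff order_trans)
qed

lemma orthogonal_decomposition:
  fixes K :: "'a :: complex_hilbert set"
  assumes "closed K" "csubspace K"
  shows "\<exists>q\<in>K. \<forall>k\<in>K. cinner (x - q) k = 0"
proof -
  have sub: "subspace K" and csc: "\<And>a x. x \<in> K \<Longrightarrow> a *\<^sub>C x \<in> K"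
    using assms(2) by (auto simp: csubspace_def)
  obtain q where q: "q \<in> K" "\<And>k. k \<in> K \<Longrightarrow> norm (x - q) \<le> norm (x - k)"
    using closest_in_closed_subspace[OF assms(1) sub] by blast
  have re0: "Re (cinner (x - q) k) = 0" if "k \<in> K" for k
  proof (rule ccontr)
    assume nz: "Re (cinner (x - q) k) \<noteq> 0"
    define r where "r = Re (cinner (x - q) k)"
    have knz: "k \<noteq> 0" using nz by auto
    \<comment> \<open>The minimiser of the quadratic
      \<open>t\<^sup>2 * (norm k)\<^sup>2 - 2 * (t * r)\<close>, whose value there is
      \<open>- (t * r)\<close>, negative unless \<open>r = 0\<close>.\<close>
    define t where "t = r / (norm k)\<^sup>2"
    have "q + t *\<^sub>R k \<in> K" using q(1) that sub by (simp add: subspace_add subspace_scale)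
    then have "norm (x - q) \<le> norm (x - (q + t *\<^sub>R k))" by (rule q(2))
    then have "(norm (x - q))\<^sup>2 \<le> (norm ((x - q) - t *\<^sub>R k))\<^sup>2"
      by (simp add: algebra_simps)
    also have "\<dots> = (norm (x - q))\<^sup>2 + t\<^sup>2 * (norm k)\<^sup>2 - 2 * (t * r)"
      by (simp add: norm_diff_sq cinner_scaleR_right r_def power_mult_distrib)
    finally have "2 * (t * r) \<le> t\<^sup>2 * (norm k)\<^sup>2" by simp
    moreover have "t\<^sup>2 * (norm k)\<^sup>2 = t * r"
      using knz by (simp add: t_def power2_eq_square)
    ultimately have "t * r \<le> 0" by linarith
    moreover have "t * r > 0" using nz knz by (simp add: t_def r_def power2_eq_square[symmetric])
    ultimately show False by simp
  qed
  have "cinner (x - q) k = 0" if "k \<in> K" for k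
  proof -
    \<comment> \<open>Real parts suffice: replacing \<open>k\<close> by
      \<open>\<i> *\<^sub>C k\<close> turns the real part into the imaginary one.\<close>
    have "Re (cinner (x - q) (\<i> *\<^sub>C k)) = 0" using csc that re0 by blast
    then have "Im (cinner (x - q) k) = 0" by (simp add: cinner_scaleC_right)
    then show ?thesis using re0[OF that] by (simp add: complex_eq_iff)
  qed
  then show ?thesis using q(1) by blast
qed

text \<open>Unless \<open>f\<close> vanishes, its kernel has a non-zero orthogonal vector
  \<open>z\<close>, and \<open>x - (f x / f z) *\<^sub>C z\<close> always lies in the kernel;
  pairing it with \<open>z\<close> gives the formula.\<close>

lemma Riesz_representation:
  fixes f :: "'a :: complex_hilbert \<Rightarrow> complex"
  assumes f: "bounded_linear f" and fC: "\<And>a x. f (a *\<^sub>C x) = a * f x"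
  shows "\<exists>y. \<forall>x. f x = cinner x y"
proof (cases "\<forall>x. f x = 0")
  case True then show ?thesis by (intro exI[of _ 0]) simp
next
  case False
  then obtain x0 where x0: "f x0 \<noteq> 0" by blast
  interpret bounded_linear f by (rule f)
  have "closed {x. f x = 0}"
    by (intro closed_Collect_eq continuous_on continuous_on_id continuous_intros)
  moreover have "csubspace {x. f x = 0}" by (rule csubspaceI) (auto simp: zero add fC)
  ultimately obtain q where q: "f q = 0" "\<And>k. f k = 0 \<Longrightarrow> cinner (x0 - q) k = 0"
    using orthogonal_decomposition[of "{x. f x = 0}" x0] by auto
  define z where "z = x0 - q"
  have fz: "f z \<noteq> 0" using x0 q(1) by (simp add: z_def diff)
  then have z0: "z \<noteq> 0" using zero by auto
  have "f x = cinner x ((cnj (f z) / cinner z z) *\<^sub>C z)" for x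
  proof -
    have "f (x - (f x / f z) *\<^sub>C z) = 0" using fz by (simp add: diff fC)
    then have "cinner z (x - (f x / f z) *\<^sub>C z) = 0" using q(2) z_def by blast
    then have "cinner (x - (f x / f z) *\<^sub>C z) z = 0" by (subst cinner_commute) simp
    then have "cinner x z = (f x / f z) * cinner z z"
      by (simp add: cinner_diff_left cinner_scaleC_left)
    then show ?thesis using fz z0 by (simp add: cinner_scaleC_right cinner_self)
  qed
  then show ?thesis by blast
qed

lemma adjoint_exists:
  fixes A :: "'a :: complex_hilbert \<Rightarrow>\<^sub>L 'a"
  assumes "A \<in> bounded_ops"
  shows "\<exists>B\<in>bounded_ops. \<forall>x y. cinner (blinfun_apply A x) y = cinner x (blinfun_apply B y)"
proof -
  have "\<exists>z. \<forall>x. cinner (A x) y = cinner x z" for y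
    using assms by (intro Riesz_representation bounded_linear_compose[OF bounded_linear_cinner_left]
      blinfun.bounded_linear_right) (auto simp: bounded_ops_def cinner_scaleC_left)
  then obtain g where g: "\<And>x y. cinner (A x) y = cinner x (g y)" by metis
  have g': "cinner (g y) x = cinner y (A x)" for x y using g by (metis cinner_commute)
  have lin: "g (y + z) = g y + g z" "g (a *\<^sub>C y) = a *\<^sub>C g y" for y z a
    by (rule cinner_ext, simp add: g' cinner_add_left cinner_scaleC_left)+
  have nb: "norm (g y) \<le> norm y * norm A" for y
  proof (cases "g y = 0")
    case False
    have "(norm (g y))\<^sup>2 = Re (cinner y (A (g y)))" by (simp add: norm_sq_cinner g')
    also have "\<dots> \<le> norm y * norm (A (g y))"
      using complex_Re_le_cmod cinner_Cauchy_Schwarz order_trans by blast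
    also have "\<dots> \<le> norm y * (norm A * norm (g y))" by (intro mult_left_mono norm_blinfun) simp
    finally show ?thesis using False by (simp add: power2_eq_square)
  qed (simp add: mult_nonneg_nonneg)
  have bl: "bounded_linear g"
    by (rule bounded_linear_intro[where K = "norm A"]) (auto simp: lin scaleR_scaleC nb)
  show ?thesis
    by (rule bexI[of _ "Blinfun g"])
      (auto simp: bounded_linear_Blinfun_apply[OF bl] g bounded_ops_def lin)
qed

lemma adj_unique:
  fixes A :: "'a :: complex_hilbert \<Rightarrow>\<^sub>L 'a"
  assumes "\<And>x y. cinner (blinfun_apply A x) y = cinner x (blinfun_apply B y)"
  shows "adj A = B"
  unfolding adj_def
proof (rule the_equality)
  fix C assume "\<forall>x y. cinner (blinfun_apply A x) y = cinner x (blinfun_apply C y)"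
  then have "cinner (blinfun_apply C y) x = cinner (blinfun_apply B y) x" for x y
    using assms by (metis cinner_commute)
  then show "C = B" by (intro blinfun_eqI cinner_ext)
qed (use assms in blast)

lemma
  fixes A :: "'a :: complex_hilbert \<Rightarrow>\<^sub>L 'a"
  assumes "A \<in> bounded_ops"
  shows adj_in_bounded_ops: "adj A \<in> bounded_ops"
    and cinner_adj: "cinner (blinfun_apply A x) y = cinner x (blinfun_apply (adj A) y)"
  using adjoint_exists[OF assms] adj_unique[of A] by metis+

section \<open>The algebra of bounded operators\<close>

lemma scaleC_minus_right: "a *\<^sub>C (- (x :: 'a :: complex_hilbert)) = - (a *\<^sub>C x)"
  using bounded_linear.linear[OF bounded_linear_scaleC] linear_neg by blast

lemma scaleC_diff_right: "a *\<^sub>C ((x :: 'a :: complex_hilbert) - y) = a *\<^sub>C x - a *\<^sub>C y"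
  using bounded_linear.linear[OF bounded_linear_scaleC] linear_diff by blast

lemma scaleC_minus_left: "(- a) *\<^sub>C (x :: 'a :: complex_hilbert) = - (a *\<^sub>C x)"
  using scaleC_add_left[of a "- a" x] by (simp add: eq_neg_iff_add_eq_0 add.commute)

lemma scaleC_diff_left: "(a - b) *\<^sub>C (x :: 'a :: complex_hilbert) = a *\<^sub>C x - b *\<^sub>C x"
  using scaleC_add_left[of a "- b" x] by (simp add: scaleC_minus_left)

lemma bounded_ops_closed:
  fixes A B :: "'a :: complex_hilbert \<Rightarrow>\<^sub>L 'a"
  shows "0 \<in> (bounded_ops :: ('a \<Rightarrow>\<^sub>L 'a) set)" "id_blinfun \<in> (bounded_ops :: ('a \<Rightarrow>\<^sub>L 'a) set)"
    and "A \<in> bounded_ops \<Longrightarrow> B \<in> bounded_ops \<Longrightarrow> A + B \<in> bounded_ops"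
    and "A \<in> bounded_ops \<Longrightarrow> B \<in> bounded_ops \<Longrightarrow> A - B \<in> bounded_ops"
    and "A \<in> bounded_ops \<Longrightarrow> - A \<in> bounded_ops"
    and "A \<in> bounded_ops \<Longrightarrow> r *\<^sub>R A \<in> bounded_ops"
    and "A \<in> bounded_ops \<Longrightarrow> scaleC_op a A \<in> bounded_ops"
    and "A \<in> bounded_ops \<Longrightarrow> B \<in> bounded_ops \<Longrightarrow> A o\<^sub>L B \<in> bounded_ops"
  by (auto simp: bounded_ops_def blinfun.add_left blinfun.diff_left blinfun.minus_left blinfun.scaleR_left
      scaleC_add_right scaleC_diff_right scaleC_minus_right scaleC_op.rep_eq scaleC_scaleC scaleR_scaleC
      mult.commute)

text \<open>\<open>B(H)\<close> becomes a type of its own. There the operators form a Banach algebra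
  and an ordered vector space in the sense of the type classes, so ring simplification and limit
  theorems apply without membership conditions; \<open>blf\<close> and \<open>Cop\<close> lead back
  to the original setting at the end.\<close>

typedef (overloaded) 'a cop = "bounded_ops :: ('a :: complex_hilbert \<Rightarrow>\<^sub>L 'a) set"
  morphisms blf Cop
  by (rule exI[of _ 0]) (rule bounded_ops_closed)

setup_lifting type_definition_cop

text \<open>A unit is obtained through \<open>monoid_mult\<close>, since the unital ring classes
  demand \<open>0 \<noteq> 1\<close>, which fails on the zero space.\<close>

instantiation cop :: (complex_hilbert) "{real_algebra, monoid_mult}"
begin
lift_definition zero_cop :: "'a cop" is 0 by (rule bounded_ops_closed)
lift_definition one_cop :: "'a cop" is id_blinfun by (rule bounded_ops_closed)
lift_definition plus_cop :: "'a cop \<Rightarrow> 'a cop \<Rightarrow> 'a cop" is "(+)" by (rule bounded_ops_closed)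
lift_definition minus_cop :: "'a cop \<Rightarrow> 'a cop \<Rightarrow> 'a cop" is "(-)" by (rule bounded_ops_closed)
lift_definition uminus_cop :: "'a cop \<Rightarrow> 'a cop" is "uminus" by (rule bounded_ops_closed)
lift_definition scaleR_cop :: "real \<Rightarrow> 'a cop \<Rightarrow> 'a cop" is "scaleR" by (rule bounded_ops_closed)
lift_definition times_cop :: "'a cop \<Rightarrow> 'a cop \<Rightarrow> 'a cop" is "(o\<^sub>L)" by (rule bounded_ops_closed)
instance
  by standard (transfer; auto intro!: blinfun_eqI simp: blinfun.bilinear_simps algebra_simps)+
end

instantiation cop :: (complex_hilbert) real_normed_algebra
begin
lift_definition norm_cop :: "'a cop \<Rightarrow> real" is norm .
definition dist_cop :: "'a cop \<Rightarrow> 'a cop \<Rightarrow> real" where "dist_cop a b = norm (a - b)"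
definition sgn_cop :: "'a cop \<Rightarrow> 'a cop" where "sgn_cop x = x /\<^sub>R norm x"
definition uniformity_cop :: "('a cop \<times> 'a cop) filter"
  where "uniformity_cop = (INF e\<in>{0<..}. principal {(x, y). dist x y < e})"
definition open_cop :: "'a cop set \<Rightarrow> bool"
  where "open_cop U \<longleftrightarrow> (\<forall>x\<in>U. \<forall>\<^sub>F (x', y) in uniformity. x' = x \<longrightarrow> y \<in> U)"
instance
proof
  fix x y :: "'a cop"
  show "norm (x * y) \<le> norm x * norm y" by transfer (rule norm_blinfun_compose)
  show "norm (x + y) \<le> norm x + norm y" by transfer (rule norm_triangle_ineq)
qed (simp_all add: dist_cop_def sgn_cop_def uniformity_cop_def open_cop_def, (transfer; simp)+)
end

lemma blf_in [simp]: "blf A \<in> bounded_ops"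
  using blf .

instance cop :: (complex_hilbert) banach
proof
  fix X :: "nat \<Rightarrow> 'a cop" assume X: "Cauchy X"
  have d: "dist (blf A) (blf B) = dist A B" for A B :: "'a cop"
    by (simp add: dist_norm norm_cop.rep_eq minus_cop.rep_eq)
  have "Cauchy (\<lambda>n. blf (X n))" using X by (simp add: Cauchy_def d)
  then obtain L where L: "(\<lambda>n. blf (X n)) \<longlonglongrightarrow> L" using Cauchy_convergent convergent_def by blast
  have "L \<in> bounded_ops"
  proof -
    have "blinfun_apply L (a *\<^sub>C x) = a *\<^sub>C blinfun_apply L x" for a x
    proof (rule LIMSEQ_unique)
      show "(\<lambda>n. blinfun_apply (blf (X n)) (a *\<^sub>C x)) \<longlonglongrightarrow> blinfun_apply L (a *\<^sub>C x)"
        by (intro tendsto_intros L)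
      have "(\<lambda>n. a *\<^sub>C blinfun_apply (blf (X n)) x) \<longlonglongrightarrow> a *\<^sub>C blinfun_apply L x"
        by (intro bounded_linear.tendsto[OF bounded_linear_scaleC] tendsto_intros L)
      then show "(\<lambda>n. blinfun_apply (blf (X n)) (a *\<^sub>C x)) \<longlonglongrightarrow> a *\<^sub>C blinfun_apply L x"
        using blf_in[of "X _"] by (simp add: bounded_ops_def del: blf_in)
    qed
    then show ?thesis by (simp add: bounded_ops_def)
  qed
  then have "X \<longlonglongrightarrow> Cop L"
    using L unfolding tendsto_dist_iff[of X] tendsto_dist_iff[of "\<lambda>n. blf (X n)"]
    by (simp add: d[symmetric] Cop_inverse)
  then show "convergent X" by (auto simp: convergent_def)
qed

lift_definition app :: "'a :: complex_hilbert cop \<Rightarrow> 'a \<Rightarrow> 'a" (infixr "\<cdot>" 75) is blinfun_apply .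

lift_definition star :: "'a :: complex_hilbert cop \<Rightarrow> 'a cop" is adj by (rule adj_in_bounded_ops)

text \<open>Complex scalars enter as operators: multiplication by \<open>cof a\<close> stands for
  complex scaling. The real algebra classes then suffice, and linearity and antilinearity both
  become statements about where \<open>cof a\<close> goes.\<close>

lift_definition cof :: "complex \<Rightarrow> 'a :: complex_hilbert cop" is "\<lambda>a. scaleC_op a id_blinfun"
  by (intro bounded_ops_closed)

lemma app_simps [simp]:
  "(A + B) \<cdot> x = A \<cdot> x + B \<cdot> x" "(A - B) \<cdot> x = A \<cdot> x - B \<cdot> x" "(- A) \<cdot> x = - (A \<cdot> x)"
  "(r *\<^sub>R A) \<cdot> x = r *\<^sub>R (A \<cdot> x)" "(A * B) \<cdot> x = A \<cdot> B \<cdot> x" "1 \<cdot> x = x" "0 \<cdot> x = 0"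
  "cof a \<cdot> x = a *\<^sub>C x"
  by (transfer; simp add: blinfun.bilinear_simps scaleC_op.rep_eq)+

lemma app_right [simp]:
  "A \<cdot> (x + y) = A \<cdot> x + A \<cdot> y" "A \<cdot> (x - y) = A \<cdot> x - A \<cdot> y" "A \<cdot> (- x) = - (A \<cdot> x)"
  "A \<cdot> (r *\<^sub>R x) = r *\<^sub>R (A \<cdot> x)" "A \<cdot> 0 = 0" "A \<cdot> (a *\<^sub>C x) = a *\<^sub>C (A \<cdot> x)"
  by (transfer; simp add: blinfun.bilinear_simps bounded_ops_def)+

lemma cop_eqI: "(\<And>x. A \<cdot> x = B \<cdot> x) \<Longrightarrow> A = B"
  by transfer (rule blinfun_eqI)

lemma norm_app: "norm (A \<cdot> x) \<le> norm A * norm x"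
  by transfer (rule norm_blinfun)

lemma norm_cop_bound: "0 \<le> b \<Longrightarrow> (\<And>x. norm (A \<cdot> x) \<le> b * norm x) \<Longrightarrow> norm A \<le> b"
  by transfer (rule norm_blinfun_bound)

lemma bounded_bilinear_app: "bounded_bilinear (\<cdot>)"
proof
  show "\<exists>K. \<forall>(a :: 'a cop) b. norm (a \<cdot> b) \<le> norm a * norm b * K"
    by (rule exI[of _ 1]) (simp add: norm_app)
qed simp_all

lemmas continuous_on_app [continuous_intros] =
  bounded_bilinear.continuous_on[OF bounded_bilinear_app]

lemma cinner_app_left: "cinner (A \<cdot> x) y = cinner x (star A \<cdot> y)"
  by transfer (rule cinner_adj)

lemma cinner_app_right: "cinner x (A \<cdot> y) = cinner (star A \<cdot> x) y"
  by (metis cinner_app_left cinner_commute)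

lemma cop_eqI2: "(\<And>x y. cinner (A \<cdot> x) y = cinner (B \<cdot> x) y) \<Longrightarrow> A = B"
  by (intro cop_eqI cinner_ext)

lemma star_star [simp]: "star (star A) = A"
  by (rule cop_eqI2) (metis cinner_app_left cinner_app_right)

lemma cinner_star_left: "cinner (star A \<cdot> x) y = cinner x (A \<cdot> y)"
  by (simp add: cinner_app_left)

lemma star_simps [simp]:
  "star (A * B) = star B * star A" "star (A + B) = star A + star B" "star (A - B) = star A - star B"
  "star (- A) = - star A" "star (r *\<^sub>R A) = r *\<^sub>R star A" "star 1 = 1" "star 0 = 0"
  "star (cof a) = cof (cnj a)"
  by (rule cop_eqI2; simp add: cinner_star_left cinner_app_left cinner_add_left cinner_add_right
      cinner_diff_left cinner_diff_right cinner_scaleR_left cinner_scaleR_right cinner_scaleC_left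
      cinner_scaleC_right)+

lemma star_sum: "star (\<Sum>i\<in>I. f i) = (\<Sum>i\<in>I. star (f i))"
  by (induction I rule: infinite_finite_induct) simp_all

lemma star_sum_list: "star (sum_list xs) = sum_list (map star xs)"
  by (induction xs) simp_all

lemma norm_app_sq: "(norm (A \<cdot> x))\<^sup>2 = Re (cinner ((star A * A) \<cdot> x) x)"
  by (simp add: norm_sq_cinner cinner_star_left)

text \<open>Cauchy-Schwarz applied to \<open>star B * B\<close> bounds
  \<open>norm (B \<cdot> x)\<close>. With submultiplicativity this gives
  \<open>norm B \<le> norm (star B)\<close>, hence equality by symmetry, and then the
  C*-identity.\<close>

lemma norm_star_mult: "norm (star A * A) = (norm A)\<^sup>2"
  and norm_star [simp]: "norm (star A) = norm A"
proof -
  have *: "(norm B)\<^sup>2 \<le> norm (star B * B)" for B :: "'a cop"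
  proof -
    have "norm (B \<cdot> x) \<le> sqrt (norm (star B * B)) * norm x" for x
    proof -
      have "(norm (B \<cdot> x))\<^sup>2 \<le> norm ((star B * B) \<cdot> x) * norm x"
        unfolding norm_app_sq using complex_Re_le_cmod cinner_Cauchy_Schwarz order_trans by blast
      also have "\<dots> \<le> norm (star B * B) * norm x * norm x" by (intro mult_right_mono norm_app) simp
      also have "\<dots> = (sqrt (norm (star B * B)) * norm x)\<^sup>2"
        by (simp add: power_mult_distrib) (simp add: power2_eq_square)
      finally have "(norm (B \<cdot> x))\<^sup>2 \<le> (sqrt (norm (star B * B)) * norm x)\<^sup>2" .
      then show ?thesis by (rule power2_le_imp_le) simp
    qed
    then have "norm B \<le> sqrt (norm (star B * B))" by (intro norm_cop_bound) simp_all
    then have "(norm B)\<^sup>2 \<le> (sqrt (norm (star B * B)))\<^sup>2" by (intro power_mono) simp_all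
    then show ?thesis by simp
  qed
  have le: "norm B \<le> norm (star B)" for B :: "'a cop"
  proof (cases "norm B = 0")
    case False
    have "norm B * norm B \<le> norm (star B) * norm B"
      using *[of B] norm_mult_ineq[of "star B" B] by (simp add: power2_eq_square)
    then show ?thesis using False by simp
  qed simp
  show n: "norm (star A) = norm A" using le[of A] le[of "star A"] by simp
  show "norm (star A * A) = (norm A)\<^sup>2"
    using *[of A] norm_mult_ineq[of "star A" A] n by (simp add: power2_eq_square)
qed

lemma star_mult_eq_0 [simp]: "star A * A = 0 \<longleftrightarrow> A = 0"
  using norm_star_mult[of A] by auto

lemma bounded_linear_star: "bounded_linear star"
  by (rule bounded_linear_intro[where K = 1]) simp_all

lemmas tendsto_star = bounded_linear.tendsto[OF bounded_linear_star]

lemma cof_simps: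
  "cof (a + b) = cof a + cof b" "cof (a - b) = cof a - cof b" "cof (- a) = - cof a"
  "cof (a * b) = cof a * cof b" "cof (of_real r) = r *\<^sub>R 1"
  by (rule cop_eqI; simp add: scaleC_add_left scaleC_diff_left scaleC_minus_left scaleC_scaleC
      scaleR_scaleC mult.commute)+

lemma cof_0 [simp]: "cof 0 = 0" and cof_1 [simp]: "cof 1 = 1"
  by (rule cop_eqI; simp)+

lemma cof_commute: "A * cof a = cof a * A"
  by (rule cop_eqI) simp

lemma cof_real_mult: "cof (of_real r) * A = r *\<^sub>R A"
  by (rule cop_eqI) (simp add: scaleR_scaleC)

lemma cof_eq_iff: "(1 :: 'a :: complex_hilbert cop) \<noteq> 0 \<Longrightarrow> cof a = (cof b :: 'a cop) \<longleftrightarrow> a = b"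
proof
  assume "(1 :: 'a cop) \<noteq> 0" "cof a = (cof b :: 'a cop)"
  then obtain x :: 'a where "x \<noteq> 0" by (metis app_simps(6) app_simps(7) cop_eqI)
  moreover have "(a - b) *\<^sub>C x = 0"
    using \<open>cof a = cof b\<close> by (metis app_simps(2,8) cof_simps(2) diff_self)
  then have "cmod (a - b) * norm x = 0" by (metis norm_scaleC norm_zero)
  ultimately show "a = b" by simp
qed simp

lemma norm_one_le: "norm (1 :: 'a :: complex_hilbert cop) \<le> 1"
  by (rule norm_cop_bound) simp_all

section \<open>Order and projections\<close>

text \<open>Polarisation with \<open>x + y\<close> and \<open>x + \<i> *\<^sub>C y\<close>. It rests
  on the complex scalars and allows equality and self-adjointness to be tested on quadratic
  forms.\<close>

lemma cop_zeroI:
  assumes "\<And>x. cinner (C \<cdot> x) x = 0" shows "C = 0"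
proof (rule cop_eqI2)
  fix x y
  have "cinner (C \<cdot> (x + y)) (x + y) = 0" "cinner (C \<cdot> (x + \<i> *\<^sub>C y)) (x + \<i> *\<^sub>C y) = 0"
    using assms by blast+
  then have "cinner (C \<cdot> x) y + cinner (C \<cdot> y) x = 0" "- cinner (C \<cdot> x) y + cinner (C \<cdot> y) x = 0"
    using assms[of x] assms[of y]
    by (simp_all add: cinner_add_left cinner_add_right cinner_scaleC_left cinner_scaleC_right
        complex_eq_iff add.commute)
  then show "cinner (C \<cdot> x) y = cinner (0 \<cdot> x) y" by (simp add: eq_neg_iff_add_eq_0[symmetric])
qed

definition cpos :: "'a :: complex_hilbert cop \<Rightarrow> bool" where
  "cpos A \<longleftrightarrow> (\<forall>x. cinner (A \<cdot> x) x \<in> \<real> \<and> 0 \<le> Re (cinner (A \<cdot> x) x))"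

lemma cpos_selfadj: assumes "cpos A" shows "star A = A"
proof -
  have "cinner ((A - star A) \<cdot> x) x = 0" for x
  proof -
    have "cinner (star A \<cdot> x) x = cnj (cinner (A \<cdot> x) x)"
      by (metis cinner_star_left cinner_commute)
    then show ?thesis using assms by (simp add: cpos_def cinner_diff_left Reals_cnj_iff)
  qed
  then have "A - star A = 0" by (rule cop_zeroI)
  then show ?thesis by simp
qed

lemma selfadj_real: assumes "star A = A" shows "cinner (A \<cdot> x) x \<in> \<real>"
proof -
  have "cnj (cinner (A \<cdot> x) x) = cinner (A \<cdot> x) x"
    using assms by (metis cinner_commute cinner_app_left)
  then show ?thesis by (simp add: Reals_cnj_iff)
qed

lemma cpos_iff: "cpos A \<longleftrightarrow> star A = A \<and> (\<forall>x. 0 \<le> Re (cinner (A \<cdot> x) x))"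
  using cpos_selfadj selfadj_real cpos_def by blast

instantiation cop :: (complex_hilbert) ordered_real_vector
begin
definition less_eq_cop :: "'a cop \<Rightarrow> 'a cop \<Rightarrow> bool" where "less_eq_cop A B = cpos (B - A)"
definition less_cop :: "'a cop \<Rightarrow> 'a cop \<Rightarrow> bool" where "less_cop A B = (A \<le> B \<and> \<not> B \<le> A)"
instance
proof
  fix A B C :: "'a cop" and a b :: real
  show "A \<le> A" by (simp add: less_eq_cop_def cpos_def)
  show "A \<le> B \<Longrightarrow> B \<le> C \<Longrightarrow> A \<le> C"
    unfolding less_eq_cop_def cpos_iff
  proof safe
    fix x assume h: "\<forall>x. 0 \<le> Re (cinner ((B - A) \<cdot> x) x)" "\<forall>x. 0 \<le> Re (cinner ((C - B) \<cdot> x) x)"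
    show "0 \<le> Re (cinner ((C - A) \<cdot> x) x)"
      using h(1)[rule_format, of x] h(2)[rule_format, of x] by (simp add: cinner_diff_left)
  next
    assume "star (B - A) = B - A" "star (C - B) = C - B"
    then have "star ((B - A) + (C - B)) = (B - A) + (C - B)" by (simp only: star_simps)
    then show "star (C - A) = C - A" by simp
  qed
  show "A \<le> B \<Longrightarrow> B \<le> A \<Longrightarrow> A = B"
  proof -
    assume h: "A \<le> B" "B \<le> A"
    have "cinner ((B - A) \<cdot> x) x = 0" for x
    proof -
      have "0 \<le> Re (cinner ((B - A) \<cdot> x) x)" "0 \<le> Re (cinner ((A - B) \<cdot> x) x)"
        "cinner ((B - A) \<cdot> x) x \<in> \<real>"
        using h unfolding less_eq_cop_def cpos_def by blast+
      then show ?thesis by (simp add: cinner_diff_left complex_eq_iff complex_is_Real_iff)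
    qed
    then have "B - A = 0" by (rule cop_zeroI)
    then show ?thesis by simp
  qed
  show "A \<le> B \<Longrightarrow> C + A \<le> C + B" by (simp add: less_eq_cop_def)
  show "A \<le> B \<Longrightarrow> 0 \<le> a \<Longrightarrow> a *\<^sub>R A \<le> a *\<^sub>R B"
    by (simp add: less_eq_cop_def cpos_iff cinner_scaleR_left flip: scaleR_diff_right del: app_simps(2))
  show "a \<le> b \<Longrightarrow> 0 \<le> A \<Longrightarrow> a *\<^sub>R A \<le> b *\<^sub>R A"
    by (simp add: less_eq_cop_def cpos_iff cinner_scaleR_left flip: scaleR_diff_left del: app_simps(2))
qed (simp add: less_cop_def)
end

lemma pos_selfadj: "0 \<le> A \<Longrightarrow> star A = (A :: 'a :: complex_hilbert cop)"
  using cpos_selfadj by (simp add: less_eq_cop_def)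

lemma pos_iff: "0 \<le> A \<longleftrightarrow> star A = A \<and> (\<forall>x. 0 \<le> Re (cinner (A \<cdot> x) x))"
  by (simp add: less_eq_cop_def cpos_iff)

lemma le_imp_Re_le: "A \<le> B \<Longrightarrow> Re (cinner (A \<cdot> x) x) \<le> Re (cinner (B \<cdot> x) x)"
  by (simp add: less_eq_cop_def cpos_iff cinner_diff_left)

lemma leI_cop:
  assumes "star A = A" "star B = B" "\<And>x. Re (cinner (A \<cdot> x) x) \<le> Re (cinner (B \<cdot> x) x)"
  shows "A \<le> B"
  using assms by (simp add: less_eq_cop_def cpos_iff cinner_diff_left)

lemma star_mult_pos [simp]: "0 \<le> star A * A"
  by (simp add: pos_iff cinner_star_left cinner_self)

lemma conj_mono: "A \<le> B \<Longrightarrow> star C * A * C \<le> star C * B * C"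
proof -
  assume "A \<le> B"
  then have h: "star (B - A) = B - A" "\<And>x. 0 \<le> Re (cinner ((B - A) \<cdot> x) x)"
    unfolding less_eq_cop_def cpos_iff by blast+
  have "star C * B * C - star C * A * C = star C * (B - A) * C" by (simp add: algebra_simps)
  moreover have "star (star C * (B - A) * C) = star C * (B - A) * C"
    using h(1) by (simp add: mult.assoc del: star_simps(3))
  moreover have "0 \<le> Re (cinner ((star C * (B - A) * C) \<cdot> x) x)" for x
    using h(2)[of "C \<cdot> x"] by (simp add: cinner_star_left cinner_diff_left)
  ultimately show ?thesis unfolding less_eq_cop_def cpos_iff by metis
qed

lemma conj_pos: "0 \<le> A \<Longrightarrow> 0 \<le> star C * A * C"
  using conj_mono[of 0 A C] by simp

lemma closed_pos: "closed {A :: 'a :: complex_hilbert cop. 0 \<le> A}"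
proof -
  have "{A :: 'a cop. 0 \<le> A} = {A. star A = A} \<inter> (\<Inter>x. {A. 0 \<le> Re (cinner (A \<cdot> x) x)})"
    by (auto simp: pos_iff)
  moreover have "closed {A :: 'a cop. star A = A}"
    by (intro closed_Collect_eq continuous_intros
        bounded_linear.continuous_on[OF bounded_linear_star])
  moreover have "closed (\<Inter>x. {A :: 'a cop. 0 \<le> Re (cinner (A \<cdot> x) x)})"
    by (intro closed_INT ballI closed_Collect_le continuous_intros)
  ultimately show ?thesis by auto
qed

lemma pos_limit: "X \<longlonglongrightarrow> (L :: 'a :: complex_hilbert cop) \<Longrightarrow> (\<And>n. 0 \<le> X n) \<Longrightarrow> 0 \<le> L"
  using closed_sequentially[OF closed_pos] by (metis mem_Collect_eq)

definition proj :: "'a :: complex_hilbert cop \<Rightarrow> bool" where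
  "proj P \<longleftrightarrow> P * P = P \<and> star P = P"

lemma projD: "proj P \<Longrightarrow> P * P = P" "proj P \<Longrightarrow> star P = P"
  by (simp_all add: proj_def)

lemma proj_assoc: "proj P \<Longrightarrow> P * (P * A) = P * A"
  by (simp add: projD flip: mult.assoc)

lemma proj_0 [simp]: "proj 0" and proj_1 [simp]: "proj 1"
  by (simp_all add: proj_def)

lemma proj_compl: "proj P \<Longrightarrow> proj (1 - P)"
  by (simp add: proj_def algebra_simps)

lemma proj_pos: "proj P \<Longrightarrow> 0 \<le> P"
  by (metis projD star_mult_pos)

lemma proj_le_1: "proj P \<Longrightarrow> P \<le> 1"
  using proj_pos[OF proj_compl] by (simp add: algebra_simps)

lemma proj_orth_commute: "proj P \<Longrightarrow> proj Q \<Longrightarrow> P * Q = 0 \<Longrightarrow> Q * P = 0"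
  by (metis projD(2) star_simps(1) star_simps(7))

lemma proj_sub_commute: "proj P \<Longrightarrow> proj Q \<Longrightarrow> P * Q = Q \<Longrightarrow> Q * P = Q"
  by (metis projD(2) star_simps(1))

lemma proj_add: "proj P \<Longrightarrow> proj Q \<Longrightarrow> P * Q = 0 \<Longrightarrow> proj (P + Q)"
  using proj_orth_commute[of P Q] by (simp add: proj_def algebra_simps)

lemma proj_diff: "proj P \<Longrightarrow> proj Q \<Longrightarrow> P * Q = Q \<Longrightarrow> proj (P - Q)"
  using proj_sub_commute[of P Q] by (simp add: proj_def algebra_simps)

lemma proj_sub_le: "proj P \<Longrightarrow> proj Q \<Longrightarrow> P * Q = Q \<Longrightarrow> Q \<le> P"
  using proj_pos[OF proj_diff] by (simp add: algebra_simps)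

lemma norm_proj: assumes "proj P" shows "norm P \<le> 1"
proof -
  have "norm P * norm P = norm P"
    using norm_star_mult[of P] projD[OF assms] by (simp add: power2_eq_square)
  then show ?thesis by (cases "norm P = 0") auto
qed

lemma conj_proj: "proj P \<Longrightarrow> 0 \<le> A \<Longrightarrow> 0 \<le> P * A * P"
  using conj_pos[of A P] by (simp add: projD)

section \<open>Projections onto generated subspaces\<close>

lemma proj_onto_exists:
  fixes K :: "'a :: complex_hilbert set"
  assumes "closed K" "csubspace K"
  shows "\<exists>P. proj P \<and> (\<forall>x. P \<cdot> x \<in> K) \<and> (\<forall>x\<in>K. P \<cdot> x = x)"
proof -
  have K: "subspace K" "\<And>a x. x \<in> K \<Longrightarrow> a *\<^sub>C x \<in> K" using assms(2) by (auto simp: csubspace_def)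
  obtain q where q: "\<And>x. q x \<in> K" "\<And>x k. k \<in> K \<Longrightarrow> cinner (x - q x) k = 0"
    using orthogonal_decomposition[OF assms] by metis
  have uniq: "q x = y" if "y \<in> K" "\<And>k. k \<in> K \<Longrightarrow> cinner (x - y) k = 0" for x y
  proof -
    have "cinner (x - y) (q x - y) = 0" "cinner (x - q x) (q x - y) = 0"
      using that q subspace_diff[OF K(1)] by auto
    then have "cinner (q x - y) (q x - y) = 0" by (simp add: cinner_diff_left)
    then show ?thesis by simp
  qed
  have add: "q (x + y) = q x + q y" for x y
  proof (rule uniq)
    fix k assume "k \<in> K"
    then show "cinner (x + y - (q x + q y)) k = 0"
      using q(2)[of k x] q(2)[of k y] by (simp add: cinner_diff_left cinner_add_left)
  qed (simp add: q(1) subspace_add[OF K(1)])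
  have scale: "q (a *\<^sub>C x) = a *\<^sub>C q x" for a x
  proof (rule uniq)
    fix k assume "k \<in> K"
    then show "cinner (a *\<^sub>C x - a *\<^sub>C q x) k = 0"
      using q(2)[of k x] by (simp add: cinner_scaleC_left flip: scaleC_diff_right)
  qed (simp add: q(1) K(2))
  have nb: "norm (q x) \<le> norm x * 1" for x
  proof -
    have "(norm x)\<^sup>2 = (norm (q x))\<^sup>2 + (norm (x - q x))\<^sup>2"
      using norm_add_sq[of "x - q x" "q x"] q(2)[OF q(1), of x x] by simp
    then have "(norm (q x))\<^sup>2 \<le> (norm x)\<^sup>2" by simp
    then show ?thesis using power2_le_imp_le by force
  qed
  have bl: "bounded_linear q"
    by (rule bounded_linear_intro[OF add _ nb]) (simp only: scale scaleR_scaleC)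
  define P where "P = Cop (Blinfun q)"
  have "Blinfun q \<in> bounded_ops"
    by (simp add: bounded_ops_def bounded_linear_Blinfun_apply[OF bl] scale)
  then have P: "P \<cdot> x = q x" for x
    by (simp add: P_def app.rep_eq Cop_inverse bounded_linear_Blinfun_apply[OF bl])
  have fixK: "q x = x" if "x \<in> K" for x using uniq that by simp
  have "cinner (q x) y = cinner x (q y)" for x y
  proof -
    have "cinner (q x) (y - q y) = 0" by (subst cinner_commute) (simp add: q)
    then have "cinner (q x) y = cinner (q x) (q y)" by (simp add: cinner_diff_right)
    moreover have "cinner x (q y) = cinner (q x) (q y)"
      using q(2)[OF q(1), of x y] by (simp add: cinner_diff_left)
    ultimately show ?thesis by simp
  qed
  then have "star P = P" by (intro cop_eqI2) (simp add: cinner_star_left P)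
  moreover have "P * P = P" by (rule cop_eqI) (simp add: P fixK q)
  ultimately show ?thesis using P fixK q(1) by (auto simp: proj_def)
qed

lemma pspan_exists:
  "\<exists>P. proj P \<and> (\<forall>x\<in>G. P \<cdot> x = x) \<and> (\<forall>C. (\<forall>x\<in>G. C \<cdot> x = 0) \<longrightarrow> C * P = (0 :: 'a :: complex_hilbert cop))"
proof -
  \<comment> \<open>The closed complex span of \<open>G\<close>, taken as a double annihilator: the
    common kernel of all operators that vanish on \<open>G\<close>. The last clause of the statement
    is then immediate.\<close>
  define K where "K = (\<Inter>C\<in>{C. \<forall>x\<in>G. C \<cdot> x = 0}. {x. C \<cdot> x = 0})"
  have clK: "closed K" unfolding K_def by (intro closed_INT ballI closed_Collect_eq continuous_intros)
  have csK: "csubspace K" by (rule csubspaceI) (auto simp: K_def)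
  obtain P where P: "proj P" "\<And>x. P \<cdot> x \<in> K" "\<And>x. x \<in> K \<Longrightarrow> P \<cdot> x = x"
    using proj_onto_exists[OF clK csK] by metis
  have "C * P = 0" if "\<forall>x\<in>G. C \<cdot> x = 0" for C
    by (rule cop_eqI) (use P(2) that in \<open>simp add: K_def\<close>)
  moreover have "P \<cdot> x = x" if "x \<in> G" for x
    by (rule P(3)) (use that in \<open>simp add: K_def\<close>)
  ultimately show ?thesis using P(1) by (intro exI[of _ P]) simp
qed

text \<open>The projection onto the closed complex span of \<open>G\<close>. The clauses about
  \<open>G\<close> determine it (\<open>pspan_unique\<close>) and are the working access to it:
  identities on the span are checked on generators.\<close>

definition pspan :: "'a :: complex_hilbert set \<Rightarrow> 'a cop" where
  "pspan G = (SOME P. proj P \<and> (\<forall>x\<in>G. P \<cdot> x = x) \<and> (\<forall>C. (\<forall>x\<in>G. C \<cdot> x = 0) \<longrightarrow> C * P = 0))"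

lemma proj_pspan [simp]: "proj (pspan G)"
  and pspan_fix: "x \<in> G \<Longrightarrow> pspan G \<cdot> x = x"
  and pspan_kill: "(\<And>x. x \<in> G \<Longrightarrow> C \<cdot> x = 0) \<Longrightarrow> C * pspan G = 0"
  using someI_ex[OF pspan_exists, of G] unfolding pspan_def by auto

lemma pspan_unique:
  assumes "proj P" "\<And>x. x \<in> G \<Longrightarrow> P \<cdot> x = x" "\<And>C. (\<And>x. x \<in> G \<Longrightarrow> C \<cdot> x = 0) \<Longrightarrow> C * P = 0"
  shows "pspan G = P"
proof -
  have "(1 - pspan G) * P = 0" by (rule assms(3)) (simp add: pspan_fix)
  moreover have "(1 - P) * pspan G = 0" by (rule pspan_kill) (simp add: assms(2))
  ultimately have *: "P = pspan G * P" "pspan G = P * pspan G" by (simp_all add: algebra_simps)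
  show ?thesis using proj_sub_commute[OF proj_pspan assms(1)] * by metis
qed

lemma closure_subspace:
  fixes S :: "'a :: real_normed_vector set"
  assumes "subspace S" shows "subspace (closure S)"
  unfolding subspace_def
proof (intro conjI ballI allI)
  show "0 \<in> closure S" using subspace_0[OF assms] closure_subset by blast
  fix x y assume "x \<in> closure S" "y \<in> closure S"
  then obtain f g where "\<And>n. f n \<in> S" "f \<longlonglongrightarrow> x" "\<And>n. g n \<in> S" "g \<longlonglongrightarrow> y"
    unfolding closure_sequential by blast
  then show "x + y \<in> closure S" unfolding closure_sequential
    by (intro exI[of _ "\<lambda>n. f n + g n"]) (auto intro: tendsto_intros subspace_add[OF assms])
next
  fix c x assume "x \<in> closure S"
  then obtain f where "\<And>n. f n \<in> S" "f \<longlonglongrightarrow> x" unfolding closure_sequential by blast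
  then show "c *\<^sub>R x \<in> closure S" unfolding closure_sequential
    by (intro exI[of _ "\<lambda>n. c *\<^sub>R f n"]) (auto intro: tendsto_intros subspace_scale[OF assms])
qed

text \<open>All partial isometries below arise from this lemma: a relation that preserves inner products
  extends uniquely to a partial isometry on the subspace its first components generate.\<close>

lemma isometric_relation:
  fixes D :: "('a :: complex_hilbert \<times> 'a) set"
  assumes scale: "\<And>a x y. (x, y) \<in> D \<Longrightarrow> (a *\<^sub>C x, a *\<^sub>C y) \<in> D"
    and iso: "\<And>x y x' y'. (x, y) \<in> D \<Longrightarrow> (x', y') \<in> D \<Longrightarrow> cinner y y' = cinner x x'"
  shows "\<exists>W. (\<forall>(x, y)\<in>D. W \<cdot> x = y) \<and> star W * W = pspan (fst ` D) \<and> W * pspan (fst ` D) = W \<and>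
    (\<forall>C. (\<forall>(x, y)\<in>D. C \<cdot> y = 0) \<longrightarrow> C * W = 0)"
proof -
  \<comment> \<open>The graph of the extension is built first, as a closed real subspace of pairs.
    Properties of \<open>D\<close> pass to it by \<open>minT\<close>, and complex scaling is
    restored by \<open>scaleT\<close>.\<close>
  define T where "T = closure (span D)"
  have subT: "subspace T" unfolding T_def by (intro closure_subspace subspace_span)
  have DT: "D \<subseteq> T" unfolding T_def using span_superset closure_subset by blast
  have minT: "T \<subseteq> X" if "closed X" "subspace X" "D \<subseteq> X" for X
    unfolding T_def using that by (intro closure_minimal span_minimal)
  have isoT: "cinner (snd s) (snd t) = cinner (fst s) (fst t)" if "s \<in> T" "t \<in> T" for s t
  proof -
    have 1: "T \<subseteq> {s. cinner (snd s) (snd t) = cinner (fst s) (fst t)}" if "t \<in> D" for t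
    proof (rule minT)
      show "closed {s. cinner (snd s) (snd t) = cinner (fst s) (fst t)}"
        by (intro closed_Collect_eq continuous_intros)
      show "subspace {s. cinner (snd s) (snd t) = cinner (fst s) (fst t)}"
        by (auto simp: subspace_def cinner_add_left cinner_scaleR_left)
      show "D \<subseteq> {s. cinner (snd s) (snd t) = cinner (fst s) (fst t)}" using iso that by (cases t) auto
    qed
    have "T \<subseteq> {t. cinner (snd s) (snd t) = cinner (fst s) (fst t)}"
    proof (rule minT)
      show "closed {t. cinner (snd s) (snd t) = cinner (fst s) (fst t)}"
        by (intro closed_Collect_eq continuous_intros)
      show "subspace {t. cinner (snd s) (snd t) = cinner (fst s) (fst t)}"
        by (auto simp: subspace_def cinner_add_right cinner_scaleR_right)
      show "D \<subseteq> {t. cinner (snd s) (snd t) = cinner (fst s) (fst t)}" using 1 that by auto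
    qed
    then show ?thesis using that by auto
  qed
  have normT: "norm (snd s) = norm (fst s)" if "s \<in> T" for s
    using isoT[OF that that] by (metis norm_sq_cinner norm_ge_zero power2_eq_iff_nonneg)
  have scaleT: "(a *\<^sub>C fst s, a *\<^sub>C snd s) \<in> T" if "s \<in> T" for a s
  proof -
    have cl: "closed T" by (simp add: T_def)
    have "T \<subseteq> (\<lambda>s. (a *\<^sub>C fst s, a *\<^sub>C snd s)) -` T"
    proof (rule minT)
      have lin: "bounded_linear (\<lambda>s :: 'a \<times> 'a. (a *\<^sub>C fst s, a *\<^sub>C snd s))"
        by (intro bounded_linear_Pair bounded_linear_compose[OF bounded_linear_scaleC]
            bounded_linear_fst bounded_linear_snd)
      show "closed ((\<lambda>s. (a *\<^sub>C fst s, a *\<^sub>C snd s)) -` T)"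
        by (intro continuous_closed_vimage cl linear_continuous_at lin)
      show "subspace ((\<lambda>s. (a *\<^sub>C fst s, a *\<^sub>C snd s)) -` T)"
        by (intro linear_subspace_vimage bounded_linear.linear[OF lin] subT)
      show "D \<subseteq> (\<lambda>s. (a *\<^sub>C fst s, a *\<^sub>C snd s)) -` T"
      proof clarify
        fix x y assume "(x, y) \<in> D"
        then show "(x, y) \<in> (\<lambda>s. (a *\<^sub>C fst s, a *\<^sub>C snd s)) -` T" using subsetD[OF DT scale] by simp
      qed
    qed
    then show ?thesis using that by blast
  qed
  define K where "K = fst ` T"
  have K_iff: "x \<in> K \<longleftrightarrow> (\<exists>y. (x, y) \<in> T)" for x by (force simp: K_def)
  \<comment> \<open>Second components depend isometrically on first ones, so a convergent sequence
    of first components lifts to a convergent sequence in \<open>T\<close>.\<close>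
  have clK: "closed K"
    unfolding closed_sequential_limits
  proof safe
    fix f x assume f: "\<forall>n. f n \<in> K" "f \<longlonglongrightarrow> x"
    have "\<exists>y. (f n, y) \<in> T" for n using f(1) by (simp add: K_iff)
    then obtain g where g: "\<And>n. (f n, g n) \<in> T" by metis
    have "dist (g m) (g n) = dist (f m) (f n)" for m n
      using normT[OF subspace_diff[OF subT g[of m] g[of n]]] by (simp add: dist_norm)
    moreover have "Cauchy f" using f(2) LIMSEQ_imp_Cauchy by blast
    ultimately have "Cauchy g" by (simp add: Cauchy_def)
    then obtain y where "g \<longlonglongrightarrow> y" using Cauchy_convergent convergent_def by blast
    then have lim: "(\<lambda>n. (f n, g n)) \<longlonglongrightarrow> (x, y)" using f(2) by (intro tendsto_intros)
    have clT: "closed T" by (simp add: T_def)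
    have "(x, y) \<in> T" by (rule closed_sequentially[OF clT _ lim]) (rule g)
    then show "x \<in> K" unfolding K_iff by (rule exI)
  qed
  have csK: "csubspace K"
  proof (rule csubspaceI)
    show "0 \<in> K" using subspace_0[OF subT] by (auto simp: K_iff zero_prod_def)
    show "x + y \<in> K" if x: "x \<in> K" and y: "y \<in> K" for x y
    proof -
      obtain x' y' where "(x, x') \<in> T" "(y, y') \<in> T" using x y by (auto simp: K_iff)
      from subspace_add[OF subT this] show ?thesis by (auto simp: K_iff)
    qed
    show "a *\<^sub>C x \<in> K" if x: "x \<in> K" for a x
    proof -
      obtain x' where "(x, x') \<in> T" using x by (auto simp: K_iff)
      from scaleT[OF this, of a] show ?thesis by (auto simp: K_iff)
    qed
  qed
  obtain P where P: "proj P" "\<And>x. P \<cdot> x \<in> K" "\<And>x. x \<in> K \<Longrightarrow> P \<cdot> x = x"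
    using proj_onto_exists[OF clK csK] by metis
  have "\<exists>y. (P \<cdot> x, y) \<in> T" for x using P(2)[of x] by (simp add: K_iff)
  then obtain w where w: "\<And>x. (P \<cdot> x, w x) \<in> T" by metis
  have uniq: "w x = y" if "(P \<cdot> x, y) \<in> T" for x y
    using normT[OF subspace_diff[OF subT w[of x] that]] by simp
  have bl: "bounded_linear w"
  proof (rule bounded_linear_intro)
    show "w (x + y) = w x + w y" for x y
      by (rule uniq) (use subspace_add[OF subT w[of x] w[of y]] in simp)
    show "w (r *\<^sub>R x) = r *\<^sub>R w x" for r x
      by (rule uniq) (use subspace_scale[OF subT w[of x], of r] in simp)
    show "norm (w x) \<le> norm x * norm P" for x
      using normT[OF w[of x]] norm_app[of P x] by (simp add: mult.commute)
  qed
  have "w (a *\<^sub>C x) = a *\<^sub>C w x" for a x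
    by (rule uniq) (use scaleT[OF w[of x], of a] in simp)
  then have "Blinfun w \<in> bounded_ops"
    by (simp add: bounded_ops_def bounded_linear_Blinfun_apply[OF bl])
  then have "Cop (Blinfun w) \<cdot> x = w x" for x
    by (simp add: app.rep_eq Cop_inverse bounded_linear_Blinfun_apply[OF bl])
  then obtain W :: "'a cop" where W: "\<And>x. W \<cdot> x = w x" by metis
  have DK: "x \<in> K" if "(x, y) \<in> D" for x y
    unfolding K_iff using subsetD[OF DT that] by (rule exI)
  have PD: "pspan (fst ` D) = P"
  proof (rule pspan_unique)
    show "P \<cdot> x = x" if "x \<in> fst ` D" for x using that DK P(3) by force
    show "C * P = 0" if C: "\<And>x. x \<in> fst ` D \<Longrightarrow> C \<cdot> x = 0" for C
    proof (rule cop_eqI)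
      have "T \<subseteq> {s. C \<cdot> fst s = 0}"
      proof (rule minT)
        show "closed {s. C \<cdot> fst s = 0}" by (intro closed_Collect_eq continuous_intros)
        show "subspace {s. C \<cdot> fst s = 0}" by (auto simp: subspace_def)
      qed (use C in auto)
      then show "(C * P) \<cdot> x = 0 \<cdot> x" for x using w[of x] by auto
    qed
  qed (rule P(1))
  show ?thesis
  proof (intro exI[of _ W] conjI)
    show "\<forall>(x, y)\<in>D. W \<cdot> x = y"
    proof clarify
      fix x y assume "(x, y) \<in> D"
      then have "(x, y) \<in> T" "P \<cdot> x = x" using DT DK P(3) by auto
      then show "W \<cdot> x = y" using uniq[of x y] W by simp
    qed
    show "star W * W = pspan (fst ` D)" unfolding PD
    proof (rule cop_eqI2)
      fix x y
      have "cinner ((star W * W) \<cdot> x) y = cinner (P \<cdot> x) (P \<cdot> y)"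
        using isoT[OF w[of x] w[of y]] by (simp add: cinner_star_left W)
      also have "\<dots> = cinner (P \<cdot> P \<cdot> x) y" by (metis cinner_app_left projD(2)[OF P(1)])
      also have "P \<cdot> P \<cdot> x = P \<cdot> x" using projD(1)[OF P(1)] by (metis app_simps(5))
      finally show "cinner ((star W * W) \<cdot> x) y = cinner (P \<cdot> x) y" .
    qed
    show "W * pspan (fst ` D) = W" unfolding PD
    proof (rule cop_eqI)
      fix x
      have "P \<cdot> P \<cdot> x = P \<cdot> x" using projD(1)[OF P(1)] by (metis app_simps(5))
      then have "w (P \<cdot> x) = w x" using w by (intro uniq) simp
      then show "(W * P) \<cdot> x = W \<cdot> x" by (simp add: W)
    qed
    show "\<forall>C. (\<forall>(x, y)\<in>D. C \<cdot> y = 0) \<longrightarrow> C * W = 0"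
    proof (intro allI impI cop_eqI)
      fix C x assume C: "\<forall>(x, y)\<in>D. C \<cdot> y = 0"
      have "T \<subseteq> {s. C \<cdot> snd s = 0}"
      proof (rule minT)
        show "closed {s. C \<cdot> snd s = 0}" by (intro closed_Collect_eq continuous_intros)
        show "subspace {s. C \<cdot> snd s = 0}" by (auto simp: subspace_def)
      qed (use C in auto)
      then show "(C * W) \<cdot> x = 0 \<cdot> x" using w[of x] by (auto simp: W)
    qed
  qed
qed

section \<open>Polynomials in an operator\<close>

text \<open>The parameter \<open>h\<close> lets one development serve two coefficient fields: real
  polynomials feed the functional calculus, complex ones can be factored into linear terms.\<close>

definition gpop :: "('c :: comm_ring_1 \<Rightarrow> complex) \<Rightarrow> 'c poly \<Rightarrow> 'a :: complex_hilbert cop \<Rightarrow> 'a cop" where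
  "gpop h q A = (\<Sum>i\<le>degree q. cof (h (coeff q i)) * A ^ i)"

context
  fixes h :: "'c :: comm_ring_1 \<Rightarrow> complex"
  assumes h: "h 0 = 0" "\<And>a b. h (a + b) = h a + h b" "\<And>a b. h (a * b) = h a * h b"
begin

lemma gpop_ge: assumes "degree q \<le> n" shows "gpop h q A = (\<Sum>i\<le>n. cof (h (coeff q i)) * A ^ i)"
  unfolding gpop_def using assms
  by (intro sum.mono_neutral_left) (auto simp: coeff_eq_0 h)

lemma gpop_add: "gpop h (p + q) A = gpop h p A + gpop h q A"
proof -
  let ?n = "max (degree p) (degree q)"
  have "degree (p + q) \<le> ?n" by (rule degree_add_le) auto
  then show ?thesis
    by (simp add: gpop_ge[of _ ?n] h cof_simps distrib_right sum.distrib)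
qed

lemma gpop_smult: "gpop h (smult a q) A = cof (h a) * gpop h q A"
  by (simp add: gpop_ge[of _ "degree q"] degree_smult_le h cof_simps sum_distrib_left mult.assoc)

lemma gpop_pCons: "gpop h (pCons a q) A = cof (h a) + A * gpop h q A"
proof -
  have "gpop h (pCons a q) A = (\<Sum>i\<le>Suc (degree q). cof (h (coeff (pCons a q) i)) * A ^ i)"
    by (rule gpop_ge) (simp add: degree_pCons_le)
  also have "\<dots> = cof (h a) + (\<Sum>i\<le>degree q. cof (h (coeff q i)) * A ^ Suc i)"
    unfolding sum.atMost_Suc_shift by simp
  also have "(\<Sum>i\<le>degree q. cof (h (coeff q i)) * A ^ Suc i) = A * gpop h q A"
    unfolding gpop_def sum_distrib_left by (intro sum.cong) (simp_all add: cof_commute flip: mult.assoc)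
  finally show ?thesis .
qed

lemma gpop_mult: "gpop h (p * q) A = gpop h p A * gpop h q A"
proof (induction p)
  case 0 then show ?case by (simp add: gpop_def h)
next
  case (pCons a p)
  then show ?case
    by (simp add: gpop_add gpop_smult gpop_pCons h distrib_right mult.assoc)
qed

end

definition pop :: "real poly \<Rightarrow> 'a :: complex_hilbert cop \<Rightarrow> 'a cop" where
  "pop = gpop complex_of_real"

lemma
  shows pop_add: "pop (p + q) A = pop p A + pop q A"
    and pop_smult: "pop (smult a q) A = a *\<^sub>R pop q A"
    and pop_pCons: "pop (pCons a q) A = a *\<^sub>R 1 + A * pop q A"
    and pop_mult: "pop (p * q) A = pop p A * pop q A"
  by (simp_all add: pop_def gpop_add gpop_smult gpop_pCons gpop_mult cof_simps cof_real_mult)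

lemma pop_0 [simp]: "pop 0 A = 0" and pop_1 [simp]: "pop 1 A = 1"
  by (simp_all add: pop_def gpop_def)

lemma pop_diff: "pop (p - q) A = pop p A - pop q A"
  using pop_add[of "p - q" q A] by simp

lemma pop_complex: "pop q A = gpop id (map_poly complex_of_real q) A"
proof (induction q)
  case (pCons a q)
  then show ?case by (simp add: pop_pCons gpop_pCons cof_simps map_poly_pCons)
qed (simp add: gpop_def)

lemma pop_intertwine: "A * C = C * B \<Longrightarrow> pop q A * C = C * pop q B"
proof (induction q)
  case (pCons a q)
  have "A * (pop q A * C) = C * B * pop q B" using pCons by (simp flip: mult.assoc)
  then show ?case by (simp add: pop_pCons algebra_simps)
qed simp

lemma pop_star: "star A = A \<Longrightarrow> star (pop q A) = pop q A"
proof (induction q)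
  case (pCons a q)
  then show ?case using pop_intertwine[of A A A q] by (simp add: pop_pCons)
qed simp

lemma blf_power: "blf (A ^ n) = ((o\<^sub>L) (blf A) ^^ n) id_blinfun"
  by (induction n) (simp_all add: one_cop.rep_eq times_cop.rep_eq)

lemma blf_sum: "blf (\<Sum>i\<in>I. f i) = (\<Sum>i\<in>I. blf (f i))"
  by (induction I rule: infinite_finite_induct) (simp_all add: zero_cop.rep_eq plus_cop.rep_eq)

lemma blf_pop: "blf (pop q A) = poly_op q (blf A)"
  by (simp add: pop_def gpop_def poly_op_def blf_sum cof_real_mult scaleR_cop.rep_eq blf_power)

section \<open>The spectrum of a self-adjoint operator\<close>

text \<open>Stands in for invertibility: it passes to products at once, and its failure for
  \<open>A - t\<close> places \<open>t\<close> in the spectrum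
  (\<open>not_bbelow_spec\<close>).\<close>

definition bbelow :: "'a :: complex_hilbert cop \<Rightarrow> bool" where
  "bbelow A \<longleftrightarrow> (\<exists>e>0. \<forall>x. e * norm x \<le> norm (A \<cdot> x))"

lemma bbelow_mult: assumes "bbelow A" "bbelow B" shows "bbelow (A * B)"
proof -
  obtain a where a: "a > 0" "\<And>x. a * norm x \<le> norm (A \<cdot> x)" using assms(1) bbelow_def by metis
  obtain b where b: "b > 0" "\<And>x. b * norm x \<le> norm (B \<cdot> x)" using assms(2) bbelow_def by metis
  have "(a * b) * norm x \<le> norm ((A * B) \<cdot> x)" for x
  proof -
    have "a * (b * norm x) \<le> a * norm (B \<cdot> x)" using a(1) by (intro mult_left_mono b) simp
    also have "\<dots> \<le> norm (A \<cdot> B \<cdot> x)" by (rule a)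
    finally show ?thesis by (simp add: mult.assoc)
  qed
  then show ?thesis using a(1) b(1) unfolding bbelow_def by (intro exI[of _ "a * b"]) simp
qed

text \<open>The imaginary part of \<open>cinner ((A - cof z) \<cdot> x) x\<close> is
  \<open>- Im z * (norm x)\<^sup>2\<close>, and Cauchy-Schwarz does the rest.\<close>

lemma bbelow_nonreal:
  assumes "star A = A" "Im z \<noteq> 0" shows "bbelow (A - cof z)"
proof -
  have "\<bar>Im z\<bar> * norm x \<le> norm ((A - cof z) \<cdot> x)" for x
  proof (cases "x = 0")
    case False
    have "Im (cinner (A \<cdot> x) x) = 0"
      using selfadj_real[OF assms(1)] by (simp add: complex_is_Real_iff)
    then have "\<bar>Im (cinner ((A - cof z) \<cdot> x) x)\<bar> = \<bar>Im z\<bar> * norm x * norm x"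
      by (simp add: cinner_diff_left cinner_scaleC_left cinner_self abs_mult power2_eq_square)
    then have "\<bar>Im z\<bar> * norm x * norm x \<le> norm ((A - cof z) \<cdot> x) * norm x"
      using abs_Im_le_cmod[of "cinner ((A - cof z) \<cdot> x) x"] cinner_Cauchy_Schwarz[of "(A - cof z) \<cdot> x" x]
      by linarith
    then show ?thesis using False by simp
  qed simp
  then show ?thesis using assms(2) unfolding bbelow_def by (intro exI[of _ "\<bar>Im z\<bar>"]) simp
qed

lemma bbelow_const: "c \<noteq> 0 \<Longrightarrow> bbelow (cof c)"
  unfolding bbelow_def by (rule exI[of _ "cmod c"]) (simp add: norm_scaleC)

text \<open>Split off one linear factor at a time: if a product is not bounded below, some factor is
  not, and a non-real root cannot be responsible by \<open>bbelow_nonreal\<close>.\<close>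

lemma not_bbelow_root:
  fixes q :: "complex poly"
  assumes A: "star A = A"
  shows "q \<noteq> 0 \<Longrightarrow> \<not> bbelow (gpop id q A) \<Longrightarrow>
    \<exists>t. poly q (complex_of_real t) = 0 \<and> \<not> bbelow (A - cof (complex_of_real t))"
proof (induction "degree q" arbitrary: q)
  case 0
  then obtain c where "q = [:c:]" by (metis degree_eq_zeroE)
  then show ?case using 0 by (simp add: gpop_def bbelow_const)
next
  case (Suc n)
  then have "\<not> constant (poly q)" by (simp add: constant_degree)
  then obtain z where z: "poly q z = 0" using fundamental_theorem_of_algebra by blast
  then obtain s where s: "q = [:- z, 1:] * s" using poly_eq_0_iff_dvd by (metis dvdE)
  have s0: "s \<noteq> 0" using s Suc.prems by auto
  have "degree ([:- z, 1:] * s) = Suc (degree s)" by (subst degree_mult_eq) (use s0 in auto)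
  then have ds: "n = degree s" using Suc.hyps(2) unfolding s by simp
  have "gpop id q A = (A - cof z) * gpop id s A"
  proof -
    have e: "[:- z, 1:] * s = smult (- z) s + pCons 0 s" by simp
    show ?thesis unfolding s e
      by (simp add: gpop_add gpop_smult gpop_pCons cof_simps left_diff_distrib del: smult_minus_left)
  qed
  then consider "\<not> bbelow (A - cof z)" | "\<not> bbelow (gpop id s A)"
    using Suc.prems bbelow_mult by metis
  then show ?case
  proof cases
    case 1
    then have "Im z = 0" using bbelow_nonreal[OF A] by blast
    then have "z = complex_of_real (Re z)" by (simp add: complex_eq_iff)
    then show ?thesis using 1 z by metis
  next
    case 2
    then obtain t where "poly s (complex_of_real t) = 0" "\<not> bbelow (A - cof (complex_of_real t))"
      using Suc.hyps(1)[OF ds s0] by blast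
    then show ?thesis using s by auto
  qed
qed

definition spec :: "'a :: complex_hilbert cop \<Rightarrow> real set" where
  "spec A = {t. \<not> (\<exists>B. B * (A - t *\<^sub>R 1) = 1 \<and> (A - t *\<^sub>R 1) * B = 1)}"

lemma spectrum_blf: "{t. complex_of_real t \<in> spectrum (blf A)} = spec A"
proof -
  have "(\<exists>B\<in>bounded_ops. B o\<^sub>L (blf A - scaleC_op (complex_of_real t) id_blinfun) = id_blinfun \<and>
      (blf A - scaleC_op (complex_of_real t) id_blinfun) o\<^sub>L B = id_blinfun) \<longleftrightarrow>
    (\<exists>B. B * (A - t *\<^sub>R 1) = 1 \<and> (A - t *\<^sub>R 1) * B = 1)" (is "(\<exists>B\<in>_. ?P B) \<longleftrightarrow> (\<exists>B. ?Q B)") for t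
  proof -
    have eq: "?P (blf B) \<longleftrightarrow> ?Q B" for B
      by (simp add: blf_inject[symmetric] cof_simps(5)[symmetric] cof.rep_eq times_cop.rep_eq
          minus_cop.rep_eq one_cop.rep_eq)
    show ?thesis
    proof
      assume "\<exists>B\<in>bounded_ops. ?P B"
      then obtain B where "B \<in> bounded_ops" "?P B" by blast
      then have "?Q (Cop B)" unfolding eq[symmetric] by (simp add: Cop_inverse)
      then show "\<exists>B. ?Q B" by (rule exI)
    next
      assume "\<exists>B. ?Q B"
      then obtain B where "?Q B" by (rule exE)
      then have "?P (blf B)" unfolding eq .
      then show "\<exists>B\<in>bounded_ops. ?P B" by (rule bexI) simp
    qed
  qed
  then show ?thesis by (simp only: spectrum_def spec_def mem_Collect_eq)
qed

lemma not_bbelow_spec: assumes "\<not> bbelow (A - t *\<^sub>R 1)" shows "t \<in> spec A"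
proof (rule ccontr)
  assume "t \<notin> spec A"
  then obtain B where B: "B * (A - t *\<^sub>R 1) = 1" by (auto simp: spec_def)
  have "norm x \<le> norm B * norm ((A - t *\<^sub>R 1) \<cdot> x)" for x
    using norm_app[of B "(A - t *\<^sub>R 1) \<cdot> x"] B by (metis app_simps(5) app_simps(6))
  then have le: "norm x \<le> (norm B + 1) * norm ((A - t *\<^sub>R 1) \<cdot> x)" for x
    by (smt (verit) mult_right_mono norm_ge_zero)
  have "inverse (norm B + 1) * norm x \<le> norm ((A - t *\<^sub>R 1) \<cdot> x)" for x
  proof -
    have "inverse (norm B + 1) * norm x \<le> inverse (norm B + 1) * ((norm B + 1) * norm ((A - t *\<^sub>R 1) \<cdot> x))"
      by (intro mult_left_mono le) (simp add: add_nonneg_nonneg)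
    also have "\<dots> = norm ((A - t *\<^sub>R 1) \<cdot> x)"
      using norm_ge_zero[of B] by (simp add: mult.assoc[symmetric] del: norm_ge_zero)
    finally show ?thesis .
  qed
  moreover have "inverse (norm B + 1) > 0" using norm_ge_zero[of B] by (simp add: add_nonneg_pos)
  ultimately show False using assms unfolding bbelow_def by blast
qed

text \<open>For \<open>\<bar>t\<bar> > norm A\<close> the Neumann series of
  \<open>X = (1 / t) *\<^sub>R A\<close> inverts \<open>1 - X\<close>, and with it
  \<open>A - t\<close>.\<close>

lemma spec_bounded: assumes "t \<in> spec A" shows "\<bar>t\<bar> \<le> norm A"
proof (rule ccontr)
  assume "\<not> \<bar>t\<bar> \<le> norm A"
  then have lt: "norm A < \<bar>t\<bar>" and t0: "t \<noteq> 0" by auto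
  define X where "X = (1 / t) *\<^sub>R A"
  define r where "r = norm A / \<bar>t\<bar>"
  have r: "0 \<le> r" "r < 1" using lt t0 by (simp_all add: r_def)
  have nX: "norm X = r" by (simp add: X_def r_def)
  have pw: "norm (X ^ n) \<le> r ^ n" for n
  proof (induction n)
    case (Suc n)
    have "norm (X ^ Suc n) \<le> norm X * norm (X ^ n)" by (simp add: norm_mult_ineq)
    also have "\<dots> \<le> r * r ^ n" using Suc r by (simp add: nX mult_left_mono)
    finally show ?case by simp
  qed (simp add: norm_one_le)
  have "summable (\<lambda>n. r ^ n)" using r by (simp add: summable_geometric)
  then have summ: "summable (\<lambda>n. X ^ n)" by (rule summable_comparison_test'[where N = 0]) (use pw in auto)
  have tel: "(\<lambda>n. X ^ n - X ^ Suc n) sums (X ^ 0 - 0)"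
    by (rule telescope_sums'[OF summable_LIMSEQ_zero[OF summ]])
  define S where "S = (\<Sum>n. X ^ n)"
  have "(\<lambda>n. X ^ n * (1 - X)) sums (S * (1 - X))"
    unfolding S_def by (intro sums_mult2 summable_sums summ)
  moreover have "(\<lambda>n. X ^ n * (1 - X)) = (\<lambda>n. X ^ n - X ^ Suc n)"
    by (simp add: fun_eq_iff algebra_simps power_commutes)
  ultimately have "S * (1 - X) = X ^ 0 - 0" using tel sums_unique2 by metis
  then have 1: "S * (1 - X) = 1" by simp
  have "(\<lambda>n. (1 - X) * X ^ n) sums ((1 - X) * S)"
    unfolding S_def by (intro sums_mult summable_sums summ)
  moreover have "(\<lambda>n. (1 - X) * X ^ n) = (\<lambda>n. X ^ n - X ^ Suc n)"
    by (simp add: fun_eq_iff algebra_simps)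
  ultimately have "(1 - X) * S = X ^ 0 - 0" using tel sums_unique2 by metis
  then have 2: "(1 - X) * S = 1" by simp
  have "A - t *\<^sub>R 1 = (- t) *\<^sub>R (1 - X)" using t0 by (simp add: X_def algebra_simps)
  then have "((- 1 / t) *\<^sub>R S) * (A - t *\<^sub>R 1) = 1" "(A - t *\<^sub>R 1) * ((- 1 / t) *\<^sub>R S) = 1"
    using 1 2 t0 by (simp_all del: scaleR_minus_left)
  then show False using assms unfolding spec_def by blast
qed

text \<open>Expanding the square of
  \<open>norm (T \<cdot> T \<cdot> x - m\<^sup>2 *\<^sub>R x)\<close> with \<open>m = norm T\<close>
  shows that a lower bound \<open>e\<close> would improve the operator bound on \<open>T\<close> to
  \<open>sqrt (m\<^sup>2 - e\<^sup>2 / m\<^sup>2)\<close>, which is below its norm.\<close>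

lemma norm_attained:
  assumes "star T = T" "(1 :: 'a :: complex_hilbert cop) \<noteq> 0"
  shows "\<not> bbelow ((T :: 'a cop) * T - (norm T)\<^sup>2 *\<^sub>R 1)"
proof
  assume "bbelow (T * T - (norm T)\<^sup>2 *\<^sub>R 1)"
  then obtain e where e: "e > 0" "\<And>x. e * norm x \<le> norm ((T * T - (norm T)\<^sup>2 *\<^sub>R 1) \<cdot> x)"
    unfolding bbelow_def by blast
  define m where "m = norm T"
  have key: "m\<^sup>2 * (norm (T \<cdot> x))\<^sup>2 \<le> (m\<^sup>2 * m\<^sup>2 - e\<^sup>2) * (norm x)\<^sup>2" for x
  proof -
    have c: "cinner (T \<cdot> T \<cdot> x) x = of_real ((norm (T \<cdot> x))\<^sup>2)"
      using assms(1) by (simp add: cinner_app_left[of T "T \<cdot> x"] cinner_self)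
    have "(e * norm x)\<^sup>2 \<le> (norm (T \<cdot> T \<cdot> x - m\<^sup>2 *\<^sub>R x))\<^sup>2"
      using e(2)[of x] e(1) by (intro power_mono) (simp_all add: m_def)
    also have "\<dots> = (norm (T \<cdot> T \<cdot> x))\<^sup>2 + (m\<^sup>2 * m\<^sup>2) * (norm x)\<^sup>2 - 2 * m\<^sup>2 * (norm (T \<cdot> x))\<^sup>2"
      by (simp add: norm_diff_sq cinner_scaleR_right c power_mult_distrib)
    also have "(norm (T \<cdot> T \<cdot> x))\<^sup>2 \<le> (m * norm (T \<cdot> x))\<^sup>2"
      unfolding m_def by (intro power_mono norm_app) simp
    finally show ?thesis by (simp add: power_mult_distrib algebra_simps)
  qed
  obtain x0 :: 'a where x0: "x0 \<noteq> 0"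
    using assms(2) by (metis app_simps(6) app_simps(7) cop_eqI)
  show False
  proof (cases "m = 0")
    case True
    then have "e\<^sup>2 * (norm x0)\<^sup>2 \<le> 0" using key[of x0] by simp
    then show False using e(1) x0 by (simp add: mult_le_0_iff)
  next
    case False
    then have m: "m > 0" by (simp add: m_def)
    define r where "r = (m\<^sup>2 * m\<^sup>2 - e\<^sup>2) / m\<^sup>2"
    have le: "(norm (T \<cdot> x))\<^sup>2 \<le> r * (norm x)\<^sup>2" for x
      using key[of x] m unfolding r_def by (simp add: field_simps)
    have "0 \<le> r * (norm x0)\<^sup>2" using le[of x0] zero_le_power2 order_trans by blast
    then have r0: "0 \<le> r" using x0 by (simp add: zero_le_mult_iff)
    have "norm (T \<cdot> x) \<le> sqrt r * norm x" for x
      using real_sqrt_le_mono[OF le[of x]] by (simp add: real_sqrt_mult)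
    then have "m \<le> sqrt r" unfolding m_def using r0 by (intro norm_cop_bound) simp_all
    then have "m\<^sup>2 \<le> r" using m r0 real_le_rsqrt sqrt_le_D by (metis real_sqrt_le_iff real_sqrt_pow2 power_mono less_imp_le)
    then have "m\<^sup>2 * m\<^sup>2 \<le> m\<^sup>2 * m\<^sup>2 - e\<^sup>2" using m unfolding r_def by (simp add: field_simps)
    then show False using e(1) by simp
  qed
qed

lemma poly_map_poly_of_real: "poly (map_poly complex_of_real r) (complex_of_real t) = complex_of_real (poly r t)"
  by (induction r) (simp_all add: map_poly_pCons)

text \<open>By \<open>norm_attained\<close> the polynomial
  \<open>q\<^sup>2 - (norm (pop q A))\<^sup>2\<close>, evaluated at \<open>A\<close>, is not bounded
  below. So it vanishes at a point of \<open>spec A\<close>, and there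
  \<open>\<bar>poly q t\<bar>\<close> equals the norm. This estimate is what makes the functional
  calculus well defined.\<close>

lemma norm_pop_le:
  assumes A: "star A = (A :: 'a :: complex_hilbert cop)" and K: "0 \<le> K" "\<And>t. t \<in> spec A \<Longrightarrow> \<bar>poly q t\<bar> \<le> K"
  shows "norm (pop q A) \<le> K"
proof (cases "(1 :: 'a cop) = 0")
  case True
  then have "pop q A = 0" by (metis mult_1 mult_zero_left)
  then show ?thesis using K by simp
next
  case nt: False
  have root: "\<exists>t\<in>spec A. (poly p t)\<^sup>2 = (norm (pop p A))\<^sup>2" if "p * p - [:(norm (pop p A))\<^sup>2:] \<noteq> 0" for p
  proof -
    let ?r = "p * p - [:(norm (pop p A))\<^sup>2:]"
    have "pop ?r A = pop p A * pop p A - (norm (pop p A))\<^sup>2 *\<^sub>R 1"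
      by (simp add: pop_diff pop_mult pop_pCons)
    then have "\<not> bbelow (pop ?r A)" using norm_attained[OF pop_star[OF A] nt, of p] by simp
    then have "\<not> bbelow (gpop id (map_poly complex_of_real ?r) A)" unfolding pop_complex[of ?r] .
    moreover have "map_poly complex_of_real ?r \<noteq> 0"
      using that by (metis map_poly_eq_0_iff of_real_0 of_real_eq_0_iff)
    ultimately obtain t where t: "poly (map_poly complex_of_real ?r) (complex_of_real t) = 0"
      "\<not> bbelow (A - cof (complex_of_real t))" using not_bbelow_root[OF A] by blast
    have "poly ?r t = 0"
      using t(1) by (simp only: poly_map_poly_of_real of_real_eq_0_iff)
    moreover have "t \<in> spec A" using t(2) by (intro not_bbelow_spec) (simp add: cof_simps)
    ultimately show ?thesis by (intro bexI[of _ t]) (simp_all add: power2_eq_square)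
  qed
  have sq: "\<bar>poly p t\<bar> = norm (pop p A)" if "(poly p t)\<^sup>2 = (norm (pop p A))\<^sup>2" for p t
    using that by (metis abs_norm_cancel power2_eq_iff_nonneg abs_ge_zero power2_abs)
  show ?thesis
  proof (cases "q * q - [:(norm (pop q A))\<^sup>2:] = 0")
    case False
    then show ?thesis using root sq K(2) by metis
  next
    case True
    \<comment> \<open>Here \<open>q\<^sup>2\<close> is constant and offers no root. Any point of the
      spectrum will do, and the identity polynomial, whose square is not constant, supplies
      one.\<close>
    have "[:0, 1:] * [:0, 1:] - [:(norm (pop [:0, 1:] A))\<^sup>2:] \<noteq> 0" by simp
    then obtain t where t: "t \<in> spec A" using root by blast
    have "poly (q * q - [:(norm (pop q A))\<^sup>2:]) t = 0" unfolding True by simp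
    then have "(poly q t)\<^sup>2 = (norm (pop q A))\<^sup>2" by (simp add: power2_eq_square)
    then show ?thesis using sq K(2) t by metis
  qed
qed

section \<open>Continuous functional calculus\<close>

text \<open>\<open>cfc\<close> moved to the operator type, with the same description by uniform
  polynomial approximation so that \<open>cfc_blf\<close> can identify the two.\<close>

definition fc :: "(real \<Rightarrow> real) \<Rightarrow> 'a :: complex_hilbert cop \<Rightarrow> 'a cop" where
  "fc f A = (THE B. \<exists>q :: nat \<Rightarrow> real poly.
     uniform_limit (spec A) (\<lambda>n. poly (q n)) f sequentially \<and> (\<lambda>n. pop (q n) A) \<longlonglongrightarrow> B)"

lemma poly_approximation:
  fixes f :: "real \<Rightarrow> real"
  assumes "continuous_on UNIV f"
  shows "\<exists>q. uniform_limit {-K..K} (\<lambda>n. poly (q n)) f sequentially"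
proof -
  have "\<exists>q. \<forall>t\<in>{-K..K}. \<bar>f t - poly q t\<bar> < inverse (Suc n)" for n
  proof -
    obtain g where g: "real_polynomial_function g" "\<And>x. x \<in> {-K..K} \<Longrightarrow> \<bar>f x - g x\<bar> < inverse (Suc n)"
      using Stone_Weierstrass_real_polynomial_function[of "{-K..K}" f "inverse (Suc n)"]
        continuous_on_subset[OF assms] by (metis compact_Icc inverse_Suc of_nat_0_less_iff subset_UNIV)
    obtain a m where "g = (\<lambda>x. \<Sum>i\<le>m. a i * x ^ i)"
      using g(1) unfolding real_polynomial_function_iff_sum by blast
    then have "g = poly (\<Sum>i\<le>m. monom (a i) i)" by (simp add: fun_eq_iff poly_sum poly_monom)
    then show ?thesis using g(2) by (intro exI[of _ "\<Sum>i\<le>m. monom (a i) i"]) simp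
  qed
  then obtain q where q: "\<And>n t. t \<in> {-K..K} \<Longrightarrow> \<bar>f t - poly (q n) t\<bar> < inverse (Suc n)" by metis
  have "uniform_limit {-K..K} (\<lambda>n. poly (q n)) f sequentially"
  proof (rule uniform_limitI)
    fix e :: real assume "0 < e"
    with LIMSEQ_inverse_real_of_nat have "\<forall>\<^sub>F n in sequentially. inverse (Suc n) < e"
      by (rule order_tendstoD)
    then show "\<forall>\<^sub>F n in sequentially. \<forall>t\<in>{-K..K}. dist (poly (q n) t) (f t) < e"
    proof (rule eventually_mono)
      fix n assume "inverse (real (Suc n)) < e"
      then show "\<forall>t\<in>{-K..K}. dist (poly (q n) t) (f t) < e"
        using less_trans[OF q] by (simp add: dist_real_def abs_minus_commute)
    qed
  qed
  then show ?thesis by blast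
qed

lemma spec_subset: "norm A \<le> K \<Longrightarrow> spec A \<subseteq> {-K..K}"
  using spec_bounded by fastforce

lemma pop_close:
  assumes A: "star A = A"
    and p: "uniform_limit (spec A) (\<lambda>n. poly (p n)) f sequentially"
    and q: "uniform_limit (spec A) (\<lambda>n. poly (q n)) f sequentially" and e: "0 < e"
  shows "\<exists>N. \<forall>m\<ge>N. \<forall>n\<ge>N. norm (pop (p m) A - pop (q n) A) \<le> e"
proof -
  have e2: "0 < e / 2" using e by simp
  obtain N1 where N1: "\<And>n t. n \<ge> N1 \<Longrightarrow> t \<in> spec A \<Longrightarrow> dist (poly (p n) t) (f t) < e / 2"
    using uniform_limitD[OF p e2] unfolding eventually_sequentially by blast
  obtain N2 where N2: "\<And>n t. n \<ge> N2 \<Longrightarrow> t \<in> spec A \<Longrightarrow> dist (poly (q n) t) (f t) < e / 2"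
    using uniform_limitD[OF q e2] unfolding eventually_sequentially by blast
  have "norm (pop (p m) A - pop (q n) A) \<le> e" if "m \<ge> max N1 N2" "n \<ge> max N1 N2" for m n
  proof -
    have "\<bar>poly (p m - q n) t\<bar> \<le> e" if "t \<in> spec A" for t
    proof -
      have "\<bar>poly (p m) t - f t\<bar> < e / 2" "\<bar>poly (q n) t - f t\<bar> < e / 2"
        using N1[of m t] N2[of n t] \<open>m \<ge> _\<close> \<open>n \<ge> _\<close> that by (simp_all add: dist_real_def)
      then show ?thesis unfolding poly_diff by linarith
    qed
    then show ?thesis using norm_pop_le[OF A, of e "p m - q n"] e by (simp add: pop_diff)
  qed
  then show ?thesis by blast
qed

lemma fc_eqI:
  assumes A: "star A = A" and q: "uniform_limit (spec A) (\<lambda>n. poly (q n)) f sequentially"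
    and B: "(\<lambda>n. pop (q n) A) \<longlonglongrightarrow> B"
  shows "fc f A = B"
  unfolding fc_def
proof (rule the_equality)
  fix C assume "\<exists>p. uniform_limit (spec A) (\<lambda>n. poly (p n)) f sequentially \<and> (\<lambda>n. pop (p n) A) \<longlonglongrightarrow> C"
  then obtain p where p: "uniform_limit (spec A) (\<lambda>n. poly (p n)) f sequentially"
    "(\<lambda>n. pop (p n) A) \<longlonglongrightarrow> C" by blast
  have "(\<lambda>n. norm (pop (p n) A - pop (q n) A)) \<longlonglongrightarrow> norm (C - B)" by (intro tendsto_intros B p)
  moreover have "(\<lambda>n. norm (pop (p n) A - pop (q n) A)) \<longlonglongrightarrow> 0"
  proof (rule LIMSEQ_I)
    fix r :: real assume r: "0 < r"
    then obtain N where N: "\<forall>m\<ge>N. \<forall>n\<ge>N. norm (pop (p m) A - pop (q n) A) \<le> r / 2"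
      using pop_close[OF A p(1) q, of "r / 2"] by auto
    show "\<exists>N. \<forall>n\<ge>N. norm (norm (pop (p n) A - pop (q n) A) - 0) < r"
    proof (intro exI[of _ N] allI impI)
      fix n assume "N \<le> n"
      then have "norm (pop (p n) A - pop (q n) A) \<le> r / 2" using N by blast
      then show "norm (norm (pop (p n) A - pop (q n) A) - 0) < r" using r by simp
    qed
  qed
  ultimately have "norm (C - B) = 0" by (rule LIMSEQ_unique)
  then show "C = B" by simp
qed (use q B in blast)

lemma fc_tendsto:
  assumes A: "star A = A" and q: "uniform_limit (spec A) (\<lambda>n. poly (q n)) f sequentially"
  shows "(\<lambda>n. pop (q n) A) \<longlonglongrightarrow> fc f A"
proof -
  have "Cauchy (\<lambda>n. pop (q n) A)"
  proof (rule CauchyI)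
    fix e :: real assume e: "0 < e"
    then obtain N where "\<forall>m\<ge>N. \<forall>n\<ge>N. norm (pop (q m) A - pop (q n) A) \<le> e / 2"
      using pop_close[OF A q q, of "e / 2"] by auto
    moreover have "e / 2 < e" using e by simp
    ultimately show "\<exists>M. \<forall>m\<ge>M. \<forall>n\<ge>M. norm (pop (q m) A - pop (q n) A) < e"
      by (meson order_le_less_trans)
  qed
  then have "convergent (\<lambda>n. pop (q n) A)" by (rule Cauchy_convergent)
  then obtain B where B: "(\<lambda>n. pop (q n) A) \<longlonglongrightarrow> B" unfolding convergent_def by (rule exE)
  show ?thesis using B unfolding fc_eqI[OF A q B] .
qed

lemma cfc_blf:
  assumes A: "star A = A" and f: "continuous_on UNIV f"
  shows "cfc f (blf A) = blf (fc f A)"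
proof -
  have lim: "(\<lambda>n. poly_op (q n) (blf A)) \<longlonglongrightarrow> blf (fc f A)"
    if "uniform_limit (spec A) (\<lambda>n. poly (q n)) f sequentially" for q
  proof -
    have "(\<lambda>n. dist (pop (q n) A) (fc f A)) \<longlonglongrightarrow> 0"
      using fc_tendsto[OF A that] by (rule tendsto_dist_iff[THEN iffD1])
    then show ?thesis unfolding tendsto_dist_iff[of _ "blf _"]
      by (simp add: dist_norm norm_cop.rep_eq minus_cop.rep_eq blf_pop)
  qed
  obtain q where q: "uniform_limit {-norm A..norm A} (\<lambda>n. poly (q n)) f sequentially"
    using poly_approximation[OF f] by blast
  then have q': "uniform_limit (spec A) (\<lambda>n. poly (q n)) f sequentially"
    by (rule uniform_limit_on_subset) (rule spec_subset, simp)
  show ?thesis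
    unfolding cfc_def spectrum_blf
  proof (rule the_equality)
    show "\<exists>q. uniform_limit (spec A) (\<lambda>n. poly (q n)) f sequentially \<and>
        (\<lambda>n. poly_op (q n) (blf A)) \<longlonglongrightarrow> blf (fc f A)"
      using q' lim by blast
    fix B assume "\<exists>q. uniform_limit (spec A) (\<lambda>n. poly (q n)) f sequentially \<and>
        (\<lambda>n. poly_op (q n) (blf A)) \<longlonglongrightarrow> B"
    then show "B = blf (fc f A)" using lim by (auto intro: LIMSEQ_unique)
  qed
qed

lemma fc_approx:
  assumes A: "star A = A" and f: "continuous_on UNIV f" and K: "norm A \<le> K"
    and q: "uniform_limit {-K..K} (\<lambda>n. poly (q n)) f sequentially"
  shows "(\<lambda>n. pop (q n) A) \<longlonglongrightarrow> fc f A"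
  by (rule fc_tendsto[OF A uniform_limit_on_subset[OF q spec_subset[OF K]]])

text \<open>One sequence of polynomials serves both operators if it approximates \<open>f\<close> on
  an interval containing both spectra. With \<open>B\<close> a scalar multiple of \<open>1\<close>
  this evaluates \<open>f\<close> on eigenspaces; with \<open>B = A\<close> it gives
  commutation.\<close>

lemma fc_intertwine:
  assumes A: "star A = A" and B: "star B = B" and f: "continuous_on UNIV f" and C: "A * C = C * B"
  shows "fc f A * C = C * fc f B"
proof -
  let ?K = "max (norm A) (norm B)"
  obtain q where q: "uniform_limit {-?K..?K} (\<lambda>n. poly (q n)) f sequentially"
    using poly_approximation[OF f] by blast
  have "(\<lambda>n. pop (q n) A * C) \<longlonglongrightarrow> fc f A * C" by (intro tendsto_intros fc_approx[OF A f _ q]) simp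
  moreover have "(\<lambda>n. C * pop (q n) B) \<longlonglongrightarrow> C * fc f B"
    by (intro tendsto_intros fc_approx[OF B f _ q]) simp
  ultimately show ?thesis unfolding pop_intertwine[OF C] by (rule LIMSEQ_unique)
qed

lemma fc_commute:
  "star A = A \<Longrightarrow> continuous_on UNIV f \<Longrightarrow> A * C = C * A \<Longrightarrow> fc f A * C = C * fc f A"
  by (rule fc_intertwine)

lemma star_fc: assumes A: "star A = A" and f: "continuous_on UNIV f" shows "star (fc f A) = fc f A"
proof -
  obtain q where q: "uniform_limit {-norm A..norm A} (\<lambda>n. poly (q n)) f sequentially"
    using poly_approximation[OF f] by blast
  have lim: "(\<lambda>n. pop (q n) A) \<longlonglongrightarrow> fc f A" by (rule fc_approx[OF A f _ q]) simp
  then have "(\<lambda>n. star (pop (q n) A)) \<longlonglongrightarrow> star (fc f A)" by (rule tendsto_star)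
  then show ?thesis unfolding pop_star[OF A] using lim by (rule LIMSEQ_unique)
qed

lemma norm_fc_le:
  assumes A: "star A = A" and f: "continuous_on UNIV f"
    and K: "\<And>t. \<bar>t\<bar> \<le> norm A \<Longrightarrow> \<bar>f t\<bar> \<le> K"
  shows "norm (fc f A) \<le> K"
proof (rule field_le_epsilon)
  fix e :: real assume e: "0 < e"
  obtain q where q: "uniform_limit {-norm A..norm A} (\<lambda>n. poly (q n)) f sequentially"
    using poly_approximation[OF f] by blast
  have lim: "(\<lambda>n. norm (pop (q n) A)) \<longlonglongrightarrow> norm (fc f A)"
    by (intro tendsto_intros fc_approx[OF A f _ q]) simp
  obtain N where N: "\<And>n t. n \<ge> N \<Longrightarrow> t \<in> {-norm A..norm A} \<Longrightarrow> dist (poly (q n) t) (f t) < e"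
    using uniform_limitD[OF q e] unfolding eventually_sequentially by blast
  have K0: "0 \<le> K" using K[of 0] by simp
  have "norm (pop (q n) A) \<le> K + e" if "n \<ge> N" for n
  proof (rule norm_pop_le[OF A])
    fix t assume "t \<in> spec A"
    then have t: "\<bar>t\<bar> \<le> norm A" by (rule spec_bounded)
    then have "t \<in> {-norm A..norm A}" by (auto simp: abs_le_iff minus_le_iff)
    then have "dist (poly (q n) t) (f t) < e" by (rule N[OF that])
    then show "\<bar>poly (q n) t\<bar> \<le> K + e" using K[OF t] unfolding dist_real_def by linarith
  qed (use K0 e in simp)
  then show "norm (fc f A) \<le> K + e" by (intro LIMSEQ_le_const2[OF lim]) blast
qed

lemma poly_fun: "poly (p + q) = (\<lambda>t. poly p t + poly q t)" "poly (p * q) = (\<lambda>t. poly p t * poly q t)"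
  by (simp_all add: fun_eq_iff)

lemma fc_add:
  assumes A: "star A = A" and f: "continuous_on UNIV f" and g: "continuous_on UNIV g"
  shows "fc (\<lambda>t. f t + g t) A = fc f A + fc g A"
proof -
  obtain p where p: "uniform_limit {-norm A..norm A} (\<lambda>n. poly (p n)) f sequentially"
    using poly_approximation[OF f] by blast
  obtain q where q: "uniform_limit {-norm A..norm A} (\<lambda>n. poly (q n)) g sequentially"
    using poly_approximation[OF g] by blast
  have "uniform_limit {-norm A..norm A} (\<lambda>n. poly (p n + q n)) (\<lambda>t. f t + g t) sequentially"
    using uniform_limit_add[OF p q] by (simp only: poly_fun)
  then have "(\<lambda>n. pop (p n + q n) A) \<longlonglongrightarrow> fc (\<lambda>t. f t + g t) A"
    by (intro fc_approx[OF A _ order_refl] continuous_intros f g)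
  moreover have "(\<lambda>n. pop (p n + q n) A) \<longlonglongrightarrow> fc f A + fc g A"
    unfolding pop_add by (intro tendsto_intros fc_approx[OF A f order_refl p] fc_approx[OF A g order_refl q])
  ultimately show ?thesis by (rule LIMSEQ_unique)
qed

lemma fc_mult:
  assumes A: "star A = A" and f: "continuous_on UNIV f" and g: "continuous_on UNIV g"
  shows "fc (\<lambda>t. f t * g t) A = fc f A * fc g A"
proof -
  obtain p where p: "uniform_limit {-norm A..norm A} (\<lambda>n. poly (p n)) f sequentially"
    using poly_approximation[OF f] by blast
  obtain q where q: "uniform_limit {-norm A..norm A} (\<lambda>n. poly (q n)) g sequentially"
    using poly_approximation[OF g] by blast
  have bd: "bounded (h ` {-norm A..norm A})" if "continuous_on UNIV h" for h :: "real \<Rightarrow> real"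
    by (intro compact_imp_bounded compact_continuous_image continuous_on_subset[OF that]) auto
  have "uniform_limit {-norm A..norm A} (\<lambda>n. poly (p n * q n)) (\<lambda>t. f t * g t) sequentially"
    using uniform_lim_mult[OF p q bd[OF f] bd[OF g]] by (simp only: poly_fun)
  then have "(\<lambda>n. pop (p n * q n) A) \<longlonglongrightarrow> fc (\<lambda>t. f t * g t) A"
    by (intro fc_approx[OF A _ order_refl] continuous_intros f g)
  moreover have "(\<lambda>n. pop (p n * q n) A) \<longlonglongrightarrow> fc f A * fc g A"
    unfolding pop_mult by (intro tendsto_intros fc_approx[OF A f order_refl p] fc_approx[OF A g order_refl q])
  ultimately show ?thesis by (rule LIMSEQ_unique)
qed

lemma fc_poly: assumes A: "star A = A" shows "fc (poly q) A = pop q A"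
  by (rule fc_eqI[OF A, of "\<lambda>_. q"]) (auto simp: uniform_limit_iff)

lemma fc_id: "star A = A \<Longrightarrow> fc (\<lambda>t. t) A = A"
proof -
  assume "star A = A"
  then have "fc (poly [:0, 1:]) A = A" by (simp add: fc_poly pop_pCons)
  moreover have "poly [:0, 1:] = (\<lambda>t :: real. t)" by (simp add: fun_eq_iff)
  ultimately show ?thesis by (simp only:)
qed

lemma fc_const: "star A = A \<Longrightarrow> fc (\<lambda>_. c) A = c *\<^sub>R 1"
proof -
  assume "star A = A"
  then have "fc (poly [:c:]) A = c *\<^sub>R 1" by (simp add: fc_poly pop_pCons)
  moreover have "poly [:c:] = (\<lambda>_. c)" by (simp add: fun_eq_iff)
  ultimately show ?thesis by (simp only:)
qed

lemma fc_scale: "star A = A \<Longrightarrow> continuous_on UNIV f \<Longrightarrow> fc (\<lambda>t. c * f t) A = c *\<^sub>R fc f A"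
  using fc_mult[of A "\<lambda>_. c" f] by (simp add: fc_const)

lemma fc_diff:
  assumes "star A = A" "continuous_on UNIV f" "continuous_on UNIV g"
  shows "fc (\<lambda>t. f t - g t) A = fc f A - fc g A"
  using fc_add[OF assms(1,2), of "\<lambda>t. -1 * g t"] fc_scale[OF assms(1,3), of "-1"] assms(3)
  by (simp add: continuous_intros)

lemma fc_cong:
  assumes A: "star A = A" and "continuous_on UNIV f" "continuous_on UNIV g"
    and "\<And>t. \<bar>t\<bar> \<le> norm A \<Longrightarrow> f t = g t"
  shows "fc f A = fc g A"
proof -
  have "norm (fc (\<lambda>t. f t - g t) A) \<le> 0"
    by (rule norm_fc_le[OF A]) (use assms in \<open>auto intro!: continuous_intros\<close>)
  then show ?thesis using fc_diff[OF assms(1-3)] by simp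
qed

text \<open>Polynomials in \<open>fc g A\<close> are computed exactly; uniform approximation of
  \<open>f\<close> on an interval that contains the relevant values of \<open>g\<close> carries the
  identity to the limit.\<close>

lemma fc_compose:
  assumes A: "star A = A" and f: "continuous_on UNIV f" and g: "continuous_on UNIV g"
  shows "fc f (fc g A) = fc (\<lambda>t. f (g t)) A"
proof -
  have fg: "continuous_on UNIV (\<lambda>t. f (g t))"
    by (rule continuous_on_compose2[OF f g]) simp
  have bd: "bounded (g ` {-norm A..norm A})"
    by (intro compact_imp_bounded compact_continuous_image continuous_on_subset[OF g]) auto
  then obtain K0 where "\<forall>x\<in>g ` {-norm A..norm A}. norm x \<le> K0" unfolding bounded_iff by (rule exE)
  then have K0: "\<bar>g t\<bar> \<le> K0" if "t \<in> {-norm A..norm A}" for t using that by simp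
  define K where "K = max K0 (norm (fc g A))"
  obtain q where q: "uniform_limit {-K..K} (\<lambda>n. poly (q n)) f sequentially"
    using poly_approximation[OF f] by blast
  have pg: "continuous_on UNIV (\<lambda>t. poly p (g t))" for p by (intro continuous_intros g)
  have pop_g: "pop p (fc g A) = fc (\<lambda>t. poly p (g t)) A" for p
  proof (induction p)
    case 0 then show ?case using fc_const[OF A, of 0] by simp
  next
    case (pCons a p)
    have "fc (\<lambda>t. a + g t * poly p (g t)) A = a *\<^sub>R 1 + fc g A * fc (\<lambda>t. poly p (g t)) A"
      using fc_add[OF A continuous_on_const continuous_on_mult[OF g pg]] fc_mult[OF A g pg] fc_const[OF A]
      by simp
    then show ?case using pCons by (simp add: pop_pCons)
  qed
  have "(\<lambda>n. pop (q n) (fc g A)) \<longlonglongrightarrow> fc f (fc g A)"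
    by (rule fc_approx[OF star_fc[OF A g] f _ q]) (simp add: K_def)
  moreover have "(\<lambda>n. pop (q n) (fc g A)) \<longlonglongrightarrow> fc (\<lambda>t. f (g t)) A"
  proof (rule LIMSEQ_I)
    fix e :: real assume e: "0 < e"
    then have e2: "0 < e / 2" by simp
    obtain N where N: "\<And>n t. n \<ge> N \<Longrightarrow> t \<in> {-K..K} \<Longrightarrow> dist (poly (q n) t) (f t) < e / 2"
      using uniform_limitD[OF q e2] unfolding eventually_sequentially by blast
    show "\<exists>N. \<forall>n\<ge>N. norm (pop (q n) (fc g A) - fc (\<lambda>t. f (g t)) A) < e"
    proof (intro exI[of _ N] allI impI)
      fix n assume n: "N \<le> n"
      have "norm (fc (\<lambda>t. poly (q n) (g t) - f (g t)) A) \<le> e / 2"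
      proof (rule norm_fc_le[OF A])
        fix t assume "\<bar>t\<bar> \<le> norm A"
        then have "\<bar>g t\<bar> \<le> K0" by (intro K0) auto
        then have "g t \<in> {-K..K}" by (auto simp: K_def)
        then show "\<bar>poly (q n) (g t) - f (g t)\<bar> \<le> e / 2" using N[OF n] by (force simp: dist_real_def)
      qed (intro continuous_intros pg fg)
      then show "norm (pop (q n) (fc g A) - fc (\<lambda>t. f (g t)) A) < e"
        using e fc_diff[OF A pg fg, of "q n"] by (simp add: pop_g)
    qed
  qed
  ultimately show ?thesis by (rule LIMSEQ_unique)
qed

lemma fc_pos:
  assumes A: "star A = A" and f: "continuous_on UNIV f" and pos: "\<And>t. \<bar>t\<bar> \<le> norm A \<Longrightarrow> 0 \<le> f t"
  shows "0 \<le> fc f A"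
proof -
  have s: "continuous_on UNIV (\<lambda>t. sqrt \<bar>f t\<bar>)" by (intro continuous_intros f)
  have "fc f A = fc (\<lambda>t. sqrt \<bar>f t\<bar> * sqrt \<bar>f t\<bar>) A"
    by (rule fc_cong[OF A f]) (auto intro!: continuous_intros f dest: pos)
  also have "\<dots> = star (fc (\<lambda>t. sqrt \<bar>f t\<bar>) A) * fc (\<lambda>t. sqrt \<bar>f t\<bar>) A"
    unfolding star_fc[OF A s] by (rule fc_mult[OF A s s])
  finally show ?thesis by simp
qed

lemma fc_mono:
  assumes A: "star A = A" and f: "continuous_on UNIV f" and g: "continuous_on UNIV g"
    and le: "\<And>t. \<bar>t\<bar> \<le> norm A \<Longrightarrow> f t \<le> g t"
  shows "fc f A \<le> fc g A"
proof -
  have "0 \<le> fc (\<lambda>t. g t - f t) A" by (rule fc_pos[OF A]) (auto intro!: continuous_intros f g le)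
  then show ?thesis using fc_diff[OF A g f] by simp
qed

text \<open>With \<open>n\<close> the negative part of \<open>A\<close> we have \<open>n A n = - n\<^sup>3\<close>, which is both positive and negative.\<close>

lemma fc_abs: assumes "0 \<le> A" shows "fc abs A = A"
proof -
  have A: "star A = A" by (rule pos_selfadj[OF assms])
  define n where "n t = max (- t) 0" for t :: real
  have n: "continuous_on UNIV n" unfolding n_def by (intro continuous_intros)
  define N where "N = fc n A"
  have N0: "0 \<le> N" unfolding N_def by (rule fc_pos[OF A n]) (simp add: n_def)
  have sN: "star N = N" by (rule pos_selfadj[OF N0])
  have "0 \<le> star N * N * N" using conj_pos[OF N0, of N] sN by simp
  have nn: "continuous_on UNIV (\<lambda>t. n t * n t)" by (intro continuous_intros n)
  have N2: "fc (\<lambda>t. n t * n t) A = N * N" unfolding N_def by (rule fc_mult[OF A n n])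
  have "N * A * N = fc (\<lambda>t. t * (n t * n t)) A"
  proof -
    have "fc (\<lambda>t. t * (n t * n t)) A = A * (N * N)"
      using fc_mult[OF A continuous_on_id nn] N2 fc_id[OF A] by simp
    moreover have "N * A = A * N" unfolding N_def by (rule fc_commute[OF A n refl])
    ultimately show ?thesis by (simp add: mult.assoc)
  qed
  also have "\<dots> = fc (\<lambda>t. -1 * (n t * (n t * n t))) A"
    by (rule fc_cong[OF A]; (intro continuous_intros n)?; simp add: n_def max_def)
  also have "\<dots> = - (N * (N * N))"
    using fc_scale[OF A continuous_on_mult[OF n nn], of "-1"] fc_mult[OF A n nn] N2 by (simp add: N_def)
  finally have "N * A * N = - (N * (N * N))" .
  moreover have "0 \<le> N * A * N" using conj_pos[OF assms, of N] sN by simp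
  moreover have "0 \<le> N * (N * N)" using conj_pos[OF N0, of N] sN by (simp add: mult.assoc)
  ultimately have "N * (N * N) = 0" by (simp add: antisym)
  then have "star (N * N) * (N * N) = 0" using sN by (simp add: mult.assoc)
  then have "N * N = 0" by (simp only: star_mult_eq_0)
  then have "star N * N = 0" using sN by simp
  then have "N = 0" by (simp only: star_mult_eq_0)
  moreover have "fc abs A = fc (\<lambda>t. t + 2 * n t) A"
    by (rule fc_cong[OF A]; (intro continuous_intros n)?; simp add: n_def max_def)
  then have "fc abs A = A + 2 *\<^sub>R N"
    using fc_add[OF A continuous_on_id continuous_on_mult[OF continuous_on_const n], of 2] fc_scale[OF A n, of 2]
      fc_id[OF A] by (simp add: N_def)
  ultimately show ?thesis by simp
qed

text \<open>Since \<open>fc abs A = A\<close>, both functions may be composed with the absolute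
  value first.\<close>

lemma fc_cong_pos:
  assumes A: "0 \<le> A" and f: "continuous_on UNIV f" and g: "continuous_on UNIV g"
    and eq: "\<And>t. 0 \<le> t \<Longrightarrow> t \<le> norm A \<Longrightarrow> f t = g t"
  shows "fc f A = fc g A"
proof -
  have sA: "star A = A" by (rule pos_selfadj[OF A])
  have c: "continuous_on UNIV (\<lambda>t :: real. \<bar>t\<bar>)" by (intro continuous_intros)
  have "fc f A = fc (\<lambda>t. f \<bar>t\<bar>) A" using fc_compose[OF sA f c] fc_abs[OF A] by simp
  also have "\<dots> = fc (\<lambda>t. g \<bar>t\<bar>) A"
    by (rule fc_cong[OF sA]) (auto intro!: continuous_on_compose2[OF f c] continuous_on_compose2[OF g c] eq)
  also have "\<dots> = fc g A" using fc_compose[OF sA g c] fc_abs[OF A] by simp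
  finally show ?thesis .
qed

text \<open>\<open>E\<close> intertwines itself with \<open>1\<close>, and \<open>1 - E\<close>
  intertwines \<open>E\<close> with \<open>0\<close>; on these two scalars \<open>f\<close> acts by
  its values.\<close>

lemma fc_proj:
  assumes E: "proj E" and f: "continuous_on UNIV f"
  shows "fc f E = f 1 *\<^sub>R E + f 0 *\<^sub>R (1 - E)"
proof -
  have sE: "star E = E" and ee: "E * E = E" using projD[OF E] by auto
  have s1: "star (1 :: 'a cop) = 1" by simp
  have s0: "star (0 :: 'a cop) = 0" by simp
  have one: "fc f (1 :: 'a cop) = f 1 *\<^sub>R 1"
  proof -
    have "fc f (fc (\<lambda>_. 1) (0 :: 'a cop)) = fc (\<lambda>_. f 1) (0 :: 'a cop)"
      by (rule fc_compose[OF s0 f]) simp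
    then show ?thesis by (simp add: fc_const)
  qed
  have zero: "fc f (0 :: 'a cop) = f 0 *\<^sub>R 1"
  proof -
    have "fc f (fc (\<lambda>_. 0) (0 :: 'a cop)) = fc (\<lambda>_. f 0) (0 :: 'a cop)"
      by (rule fc_compose[OF s0 f]) simp
    then show ?thesis by (simp add: fc_const)
  qed
  have "fc f E * E = E * fc f 1" by (rule fc_intertwine[OF sE s1 f]) (simp add: ee)
  moreover have "fc f E * (1 - E) = (1 - E) * fc f 0"
    by (rule fc_intertwine[OF sE s0 f]) (simp add: ee algebra_simps)
  ultimately have "fc f E * E + fc f E * (1 - E) = f 1 *\<^sub>R E + f 0 *\<^sub>R (1 - E)" by (simp add: one zero)
  then show ?thesis by (simp add: algebra_simps)
qed

lemma fc_eigen:
  assumes A: "star A = A" and f: "continuous_on UNIV f" and "A * C = c *\<^sub>R C"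
  shows "fc f A * C = f c *\<^sub>R C"
proof -
  have s0: "star (0 :: 'a cop) = 0" by simp
  have "fc f (fc (\<lambda>_. c) (0 :: 'a cop)) = fc (\<lambda>_. f c) (0 :: 'a cop)"
    by (rule fc_compose[OF s0 f]) simp
  then have "fc f (c *\<^sub>R 1 :: 'a cop) = f c *\<^sub>R 1" by (simp add: fc_const)
  moreover have "fc f A * C = C * fc f (c *\<^sub>R 1)"
    by (rule fc_intertwine[OF A _ f]) (use assms(3) in simp_all)
  ultimately show ?thesis by simp
qed

text \<open>The absolute value keeps the function nonnegative on the whole line, whereas
  \<open>sqrt\<close> in HOL is odd; on positive operators \<open>fc_abs\<close> removes it
  again.\<close>

definition csqrt :: "'a :: complex_hilbert cop \<Rightarrow> 'a cop" where
  "csqrt A = fc (\<lambda>t. sqrt \<bar>t\<bar>) A"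

lemma continuous_sqrt_abs: "continuous_on UNIV (\<lambda>t :: real. sqrt \<bar>t\<bar>)"
  by (intro continuous_intros)

lemma csqrt_pos: "0 \<le> A \<Longrightarrow> 0 \<le> csqrt A"
  unfolding csqrt_def by (intro fc_pos pos_selfadj continuous_sqrt_abs) simp_all

lemma csqrt_selfadj: "0 \<le> A \<Longrightarrow> star (csqrt A) = csqrt A"
  by (intro pos_selfadj csqrt_pos)

lemma csqrt_sq: assumes "0 \<le> A" shows "csqrt A * csqrt A = A"
proof -
  have sA: "star A = A" by (rule pos_selfadj[OF assms])
  have "csqrt A * csqrt A = fc (\<lambda>t. sqrt \<bar>t\<bar> * sqrt \<bar>t\<bar>) A"
    unfolding csqrt_def by (rule fc_mult[OF sA continuous_sqrt_abs continuous_sqrt_abs, symmetric])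
  also have "\<dots> = fc abs A" by (rule arg_cong[where f = "\<lambda>f. fc f A"]) (simp add: fun_eq_iff)
  finally show ?thesis using fc_abs[OF assms] by simp
qed

lemma csqrt_commute: "0 \<le> A \<Longrightarrow> A * C = C * A \<Longrightarrow> csqrt A * C = C * csqrt A"
  unfolding csqrt_def by (intro fc_commute pos_selfadj continuous_sqrt_abs)

section \<open>Von Neumann algebras\<close>

definition comm :: "'a :: complex_hilbert cop set \<Rightarrow> 'a cop set" where
  "comm S = {A. \<forall>B\<in>S. A * B = B * A}"

locale vna =
  fixes M :: "'a :: complex_hilbert cop set"
  assumes star_in: "A \<in> M \<Longrightarrow> star A \<in> M" and bicomm: "comm (comm M) = M"
begin

lemma in_M_iff: "A \<in> M \<longleftrightarrow> (\<forall>B\<in>comm M. A * B = B * A)"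
  using bicomm unfolding comm_def[of "comm M"] by blast

lemma in_M_I: "(\<And>B. B \<in> comm M \<Longrightarrow> A * B = B * A) \<Longrightarrow> A \<in> M"
  unfolding in_M_iff by blast

lemma in_M_D: "A \<in> M \<Longrightarrow> B \<in> comm M \<Longrightarrow> A * B = B * A"
  unfolding in_M_iff by blast

lemma star_comm: assumes "B \<in> comm M" shows "star B \<in> comm M"
  unfolding comm_def
proof (intro CollectI ballI)
  fix A assume "A \<in> M"
  then have "star A * B = B * star A" using in_M_D star_in assms by blast
  then have "star (star A * B) = star (B * star A)" by simp
  then show "star B * A = A * star B" by simp
qed

lemma M_closed [simp, intro]:
  "0 \<in> M" "1 \<in> M" "cof a \<in> M"
  "A \<in> M \<Longrightarrow> B \<in> M \<Longrightarrow> A + B \<in> M" "A \<in> M \<Longrightarrow> B \<in> M \<Longrightarrow> A - B \<in> M" "A \<in> M \<Longrightarrow> - A \<in> M"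
  "A \<in> M \<Longrightarrow> B \<in> M \<Longrightarrow> A * B \<in> M" "A \<in> M \<Longrightarrow> r *\<^sub>R A \<in> M" "A \<in> M \<Longrightarrow> star A \<in> M"
proof -
  show "A \<in> M \<Longrightarrow> B \<in> M \<Longrightarrow> A * B \<in> M"
  proof (rule in_M_I)
    fix C assume "A \<in> M" "B \<in> M" "C \<in> comm M"
    then have "A * C = C * A" "B * C = C * B" using in_M_D by blast+
    then show "A * B * C = C * (A * B)" by (metis mult.assoc)
  qed
qed (auto intro!: in_M_I star_in simp: in_M_D cof_commute distrib_left distrib_right left_diff_distrib
    right_diff_distrib)

lemma M_sum: "(\<And>i. i \<in> I \<Longrightarrow> f i \<in> M) \<Longrightarrow> sum f I \<in> M"
  by (induction I rule: infinite_finite_induct) auto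

lemma fc_in: "A \<in> M \<Longrightarrow> star A = A \<Longrightarrow> continuous_on UNIV f \<Longrightarrow> fc f A \<in> M"
  by (intro in_M_I fc_commute) (auto dest: in_M_D)

lemma csqrt_in: "A \<in> M \<Longrightarrow> 0 \<le> A \<Longrightarrow> csqrt A \<in> M"
  unfolding csqrt_def by (intro fc_in pos_selfadj continuous_sqrt_abs)

text \<open>An operator of the commutant leaves the span invariant, and so does its adjoint; a
  projection whose range is invariant under both commutes with the operator.\<close>

lemma pspan_in:
  assumes "\<And>B x. B \<in> comm M \<Longrightarrow> x \<in> G \<Longrightarrow> B \<cdot> x \<in> G"
  shows "pspan G \<in> M"
proof (rule in_M_I)
  have half: "B * pspan G = pspan G * B * pspan G" if B: "B \<in> comm M" for B
  proof -
    have "((1 - pspan G) * B) * pspan G = 0"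
      by (rule pspan_kill) (simp add: pspan_fix assms[OF B])
    then show ?thesis by (simp add: algebra_simps)
  qed
  fix B assume B: "B \<in> comm M"
  have "star (star B * pspan G) = star (pspan G * star B * pspan G)"
    using half[OF star_comm[OF B]] by simp
  then have "pspan G * B = pspan G * B * pspan G" by (simp add: projD mult.assoc)
  then show "pspan G * B = B * pspan G" using half[OF B] by simp
qed

lemma pspan_span_in:
  assumes "\<And>P. P \<in> S \<Longrightarrow> P \<in> M"
  shows "pspan (\<Union>P\<in>S. range ((\<cdot>) P)) \<in> M"
proof (rule pspan_in)
  fix B x assume B: "B \<in> comm M" and "x \<in> (\<Union>P\<in>S. range ((\<cdot>) P))"
  then obtain P y where P: "P \<in> S" "x = P \<cdot> y" by blast
  have "B \<cdot> x = P \<cdot> B \<cdot> y" using in_M_D[OF assms[OF P(1)] B] P(2) by (metis app_simps(5))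
  then show "B \<cdot> x \<in> (\<Union>P\<in>S. range ((\<cdot>) P))" using P(1) by blast
qed

text \<open>For \<open>B\<close> in the commutant, \<open>W * B\<close> and \<open>B * W\<close>
  agree on the generators by invariance of \<open>D\<close>, and both vanish on the orthogonal
  complement of the span, because the projection onto the span lies in \<open>M\<close>.\<close>

lemma isometric_relation_in:
  assumes scale: "\<And>a x y. (x, y) \<in> D \<Longrightarrow> (a *\<^sub>C x, a *\<^sub>C y) \<in> D"
    and iso: "\<And>x y x' y'. (x, y) \<in> D \<Longrightarrow> (x', y') \<in> D \<Longrightarrow> cinner y y' = cinner x x'"
    and inv: "\<And>B x y. B \<in> comm M \<Longrightarrow> (x, y) \<in> D \<Longrightarrow> (B \<cdot> x, B \<cdot> y) \<in> D"
  shows "\<exists>W\<in>M. (\<forall>(x, y)\<in>D. W \<cdot> x = y) \<and> star W * W = pspan (fst ` D) \<and>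
    (\<forall>C. (\<forall>(x, y)\<in>D. C \<cdot> y = 0) \<longrightarrow> C * W = 0)"
proof -
  obtain W where W: "\<forall>(x, y)\<in>D. W \<cdot> x = y" "star W * W = pspan (fst ` D)" "W * pspan (fst ` D) = W"
    "\<forall>C. (\<forall>(x, y)\<in>D. C \<cdot> y = 0) \<longrightarrow> C * W = 0"
    using isometric_relation[OF scale iso] by metis
  have WD: "W \<cdot> x = y" if "(x, y) \<in> D" for x y using W(1) that by auto
  have PM: "pspan (fst ` D) \<in> M" by (rule pspan_in) (use inv in force)
  have "W \<in> M"
  proof (rule in_M_I)
    fix B assume B: "B \<in> comm M"
    have "(W * B - B * W) * pspan (fst ` D) = 0"
    proof (rule pspan_kill)
      fix x assume "x \<in> fst ` D"
      then obtain y where "(x, y) \<in> D" by force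
      then show "(W * B - B * W) \<cdot> x = 0" using WD inv[OF B] by simp
    qed
    then have "W * B * pspan (fst ` D) = B * W" using W(3) by (simp add: algebra_simps)
    moreover have "W * B * pspan (fst ` D) = W * B"
      using W(3) in_M_D[OF PM B] by (metis mult.assoc)
    ultimately show "W * B = B * W" by simp
  qed
  then show ?thesis using W by (intro bexI[of _ W]) auto
qed

end

lemma csqrt_kill: assumes "0 \<le> A" "A * C = 0" shows "csqrt A * C = 0"
proof -
  have "star (csqrt A * C) * (csqrt A * C) = star C * ((csqrt A * csqrt A) * C)"
    using csqrt_selfadj[OF assms(1)] by (simp add: mult.assoc)
  then have "star (csqrt A * C) * (csqrt A * C) = 0" using csqrt_sq[OF assms(1)] assms(2) by simp
  then show ?thesis by (simp only: star_mult_eq_0)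
qed

lemma partial_isometry:
  assumes "proj (star W * W)"
  shows "W * (star W * W) = W" and "proj (W * star W)" and "star W * (W * star W) = star W"
proof -
  let ?p = "star W * W"
  have "star (W * (1 - ?p)) * (W * (1 - ?p)) = (1 - ?p) * (?p * (1 - ?p))"
    using projD[OF assms] by (simp add: mult.assoc)
  also have "\<dots> = 0" using projD(1)[OF assms] by (simp add: algebra_simps)
  finally have "W * (1 - ?p) = 0" by (simp only: star_mult_eq_0)
  then show 1: "W * (star W * W) = W" by (simp add: algebra_simps)
  then show "proj (W * star W)" by (simp add: proj_def flip: mult.assoc)
  have "star (W * (star W * W)) = star W" using 1 by simp
  then show "star W * (W * star W) = star W" by (simp add: mult.assoc)
qed

section \<open>Semifinite factors\<close>

locale tracial_factor = vna M for M :: "'a :: complex_hilbert cop set" +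
  fixes \<tau> :: "'a cop \<Rightarrow> ennreal" and c :: real
  assumes center: "A \<in> M \<Longrightarrow> A \<in> comm M \<Longrightarrow> \<exists>a. A = cof a"
    and tr_add: "A \<in> M \<Longrightarrow> 0 \<le> A \<Longrightarrow> B \<in> M \<Longrightarrow> 0 \<le> B \<Longrightarrow> \<tau> (A + B) = \<tau> A + \<tau> B"
    and tr_scale: "A \<in> M \<Longrightarrow> 0 \<le> A \<Longrightarrow> 0 \<le> r \<Longrightarrow> \<tau> (r *\<^sub>R A) = ennreal r * \<tau> A"
    and tr_star: "A \<in> M \<Longrightarrow> \<tau> (star A * A) = \<tau> (A * star A)"
    and tr_faithful: "A \<in> M \<Longrightarrow> 0 \<le> A \<Longrightarrow> \<tau> A = 0 \<Longrightarrow> A = 0"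
    and tr_normal: "D \<subseteq> M \<Longrightarrow> D \<noteq> {} \<Longrightarrow> (\<And>B. B \<in> D \<Longrightarrow> 0 \<le> B) \<Longrightarrow>
      (\<And>B C. B \<in> D \<Longrightarrow> C \<in> D \<Longrightarrow> \<exists>E\<in>D. B \<le> E \<and> C \<le> E) \<Longrightarrow> A \<in> M \<Longrightarrow> 0 \<le> A \<Longrightarrow>
      (\<And>B. B \<in> D \<Longrightarrow> B \<le> A) \<Longrightarrow> (\<And>C. C \<in> M \<Longrightarrow> 0 \<le> C \<Longrightarrow> (\<And>B. B \<in> D \<Longrightarrow> B \<le> C) \<Longrightarrow> A \<le> C) \<Longrightarrow>
      \<tau> A = (SUP B\<in>D. \<tau> B)"
    and tr_infinite: "\<tau> 1 = \<infinity>"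
    and c_pos: "0 < c"
    and G_ne: "\<exists>P\<in>M. proj P \<and> \<tau> P = ennreal c"
begin

definition G :: "'a cop set" where "G = {P \<in> M. proj P \<and> \<tau> P = ennreal c}"

lemma GD: "P \<in> G \<Longrightarrow> P \<in> M" "P \<in> G \<Longrightarrow> proj P" "P \<in> G \<Longrightarrow> \<tau> P = ennreal c"
  "P \<in> G \<Longrightarrow> P * P = P" "P \<in> G \<Longrightarrow> star P = P"
  by (auto simp: G_def projD)

lemma G_nonzero: "P \<in> G \<Longrightarrow> P \<noteq> 0"
proof
  assume P: "P \<in> G" "P = 0"
  have "\<tau> 0 = 0" using tr_scale[of 0 0] by simp
  then show False using GD(3)[OF P(1)] P(2) c_pos by (simp add: ennreal_eq_0_iff)
qed

lemma tr_0: "\<tau> 0 = 0"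
  using tr_scale[of 0 0] by simp

lemma tr_diff: "A \<in> M \<Longrightarrow> 0 \<le> A \<Longrightarrow> B \<in> M \<Longrightarrow> A \<le> B \<Longrightarrow> \<tau> B = \<tau> A + \<tau> (B - A)"
  using tr_add[of A "B - A"] by auto

lemma tr_mono: "A \<in> M \<Longrightarrow> 0 \<le> A \<Longrightarrow> B \<in> M \<Longrightarrow> A \<le> B \<Longrightarrow> \<tau> A \<le> \<tau> B"
  using tr_diff[of A B] by simp

text \<open>\<open>C * A * star C\<close> is \<open>X * star X\<close> for
  \<open>X = C * csqrt A\<close>; the trace allows the two factors to be exchanged.\<close>

lemma tr_conj:
  assumes A: "A \<in> M" "0 \<le> A" and C: "C \<in> M"
  shows "\<tau> (C * A * star C) = \<tau> (csqrt A * (star C * C) * csqrt A)"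
proof -
  have s: "csqrt A \<in> M" "star (csqrt A) = csqrt A" "csqrt A * csqrt A = A"
    using csqrt_in[OF A] csqrt_selfadj[OF A(2)] csqrt_sq[OF A(2)] by auto
  have "\<tau> ((C * csqrt A) * star (C * csqrt A)) = \<tau> (star (C * csqrt A) * (C * csqrt A))"
    by (rule tr_star[symmetric]) (use C s in auto)
  moreover have "(C * csqrt A) * star (C * csqrt A) = C * (csqrt A * csqrt A) * star C"
    using s(2) by (simp add: mult.assoc)
  ultimately show ?thesis using s(2,3) by (simp add: mult.assoc)
qed

lemma tr_conj_isometry:
  assumes A: "A \<in> M" "0 \<le> A" and w: "w \<in> M" and "star w * w * A = A"
  shows "\<tau> (w * A * star w) = \<tau> A"
proof -
  have "A * (1 - star w * w) = 0"
  proof -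
    have "star ((1 - star w * w) * A) = 0" using assms(4) by (simp add: algebra_simps)
    then show ?thesis using pos_selfadj[OF A(2)] by (simp add: algebra_simps)
  qed
  then have "csqrt A * (1 - star w * w) = 0" by (rule csqrt_kill[OF A(2)])
  then have "csqrt A * (star w * w) = csqrt A" by (simp add: algebra_simps)
  then show ?thesis using tr_conj[OF A w] csqrt_sq[OF A(2)] by simp
qed

lemma tr_compress:
  assumes A: "A \<in> M" "0 \<le> A" and P: "P \<in> M" "proj P"
  shows "\<tau> (csqrt A * P * csqrt A) = \<tau> (P * A * P)"
  using tr_conj[OF A P(1)] projD[OF P(2)] by (simp add: mult.assoc)

text \<open>The norm limit of an increasing sequence is its least upper bound, since positivity is
  closed in norm; normality then applies to the range of the sequence.\<close>

lemma tr_limit: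
  assumes X: "\<And>n :: nat. X n \<in> M" "\<And>n. 0 \<le> X n" "\<And>m n. m \<le> n \<Longrightarrow> X m \<le> X n"
    and L: "X \<longlonglongrightarrow> L" "L \<in> M" and b: "\<And>n. \<tau> (X n) \<le> b"
  shows "\<tau> L \<le> b"
proof -
  have le: "X n \<le> L" for n
  proof -
    have "0 \<le> L - X n"
    proof (rule pos_limit)
      show "(\<lambda>k. X (n + k) - X n) \<longlonglongrightarrow> L - X n"
        by (intro tendsto_intros) (use LIMSEQ_ignore_initial_segment[OF L(1), of n] in \<open>simp add: add.commute\<close>)
      show "0 \<le> X (n + k) - X n" for k using X(3)[of n "n + k"] by simp
    qed
    then show ?thesis by simp
  qed
  have "\<tau> L = (SUP B\<in>range X. \<tau> B)"
  proof (rule tr_normal)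
    show "range X \<subseteq> M" using X(1) by blast
    show "\<exists>E\<in>range X. B \<le> E \<and> C \<le> E" if "B \<in> range X" "C \<in> range X" for B C
    proof -
      obtain m n where "B = X m" "C = X n" using \<open>B \<in> _\<close> \<open>C \<in> _\<close> by auto
      then show ?thesis using X(3)[of m "max m n"] X(3)[of n "max m n"] by auto
    qed
    show "0 \<le> L" using X(2)[of 0] le[of 0] by simp
    show "L \<le> C" if "C \<in> M" "0 \<le> C" "\<And>B. B \<in> range X \<Longrightarrow> B \<le> C" for C
    proof -
      have "0 \<le> C - L"
        by (rule pos_limit[OF tendsto_diff[OF tendsto_const L(1)]]) (use that in auto)
      then show ?thesis by simp
    qed
  qed (use X L le in auto)
  also have "\<dots> \<le> b" using b by (auto intro: SUP_least)
  finally show ?thesis .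
qed

text \<open>The difference \<open>Q - P\<close> is a projection of trace zero, because the finite
  trace of \<open>Q\<close> can be cancelled. For members of \<open>G\<close> one inclusion is thus
  enough for equality.\<close>

lemma proj_eqI:
  assumes "P \<in> M" "proj P" "Q \<in> M" "proj Q" "Q * P = P" "\<tau> P = \<tau> Q" "\<tau> Q < \<infinity>"
  shows "P = Q"
proof -
  have pq: "proj (Q - P)" using assms by (intro proj_diff)
  have "\<tau> Q = \<tau> P + \<tau> (Q - P)"
    using assms pq proj_pos by (intro tr_diff proj_sub_le) auto
  then have "\<tau> Q + 0 = \<tau> Q + \<tau> (Q - P)" using assms(6) by simp
  then have "\<tau> (Q - P) = 0" using assms(7) by (metis ennreal_add_left_cancel infinity_ennreal_def less_irrefl)
  then have "Q - P = 0" using assms proj_pos[OF pq] by (intro tr_faithful) auto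
  then show ?thesis by simp
qed

lemma G_eqI: "P \<in> G \<Longrightarrow> Q \<in> G \<Longrightarrow> Q * P = P \<Longrightarrow> P = Q"
  by (rule proj_eqI) (auto simp: G_def)

text \<open>Otherwise \<open>e\<close> kills every vector \<open>A \<cdot> f \<cdot> x\<close>. The
  projection onto their span commutes with \<open>M\<close>, so it is a scalar; it fixes the range
  of the non-zero \<open>f\<close>, so it is \<open>1\<close>, and then
  \<open>e = 0\<close>.\<close>

lemma factor_link:
  assumes e: "e \<in> M" "proj e" "e \<noteq> 0" and f: "f \<in> M" "proj f" "f \<noteq> 0"
  shows "\<exists>A\<in>M. e * A * f \<noteq> 0"
proof (rule ccontr)
  assume no: "\<not> ?thesis"
  define K where "K = {A \<cdot> f \<cdot> x | A x. A \<in> M}"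
  let ?z = "pspan K"
  have zM: "?z \<in> M"
  proof (rule pspan_in)
    fix B x assume B: "B \<in> comm M" and "x \<in> K"
    then obtain A y where A: "A \<in> M" "x = A \<cdot> f \<cdot> y" by (auto simp: K_def)
    have "B \<cdot> x = A \<cdot> f \<cdot> B \<cdot> y"
      using in_M_D[OF A(1) B] in_M_D[OF f(1) B] A(2) by (metis app_simps(5))
    then show "B \<cdot> x \<in> K" using A(1) unfolding K_def by blast
  qed
  have half: "B * ?z = ?z * B * ?z" if B: "B \<in> M" for B
  proof -
    have "((1 - ?z) * B) * ?z = 0"
    proof (rule pspan_kill)
      fix x assume "x \<in> K"
      then obtain A y where A: "A \<in> M" "x = A \<cdot> f \<cdot> y" by (auto simp: K_def)
      have "B \<cdot> x = (B * A) \<cdot> f \<cdot> y" using A(2) by simp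
      then have "B \<cdot> x \<in> K" using A(1) B unfolding K_def by blast
      then show "((1 - ?z) * B) \<cdot> x = 0" by (simp add: pspan_fix)
    qed
    then show ?thesis by (simp add: algebra_simps)
  qed
  have "?z \<in> comm M"
    unfolding comm_def
  proof (intro CollectI ballI)
    fix B assume B: "B \<in> M"
    have "star (star B * ?z) = star (?z * star B * ?z)" using half[OF star_in[OF B]] by simp
    then have "?z * B = ?z * B * ?z" by (simp add: projD mult.assoc)
    then show "?z * B = B * ?z" using half[OF B] by simp
  qed
  then obtain a where a: "?z = cof a" using center zM by blast
  have "(1 - ?z) * f = 0"
  proof (rule cop_eqI)
    fix x
    have "1 \<cdot> f \<cdot> x \<in> K" unfolding K_def by blast
    then show "((1 - ?z) * f) \<cdot> x = 0 \<cdot> x" using pspan_fix[of "f \<cdot> x" K] by simp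
  qed
  then have f0: "cof (1 - a) * f = 0" by (simp add: cof_simps a)
  have "a = 1"
  proof (rule ccontr)
    assume "a \<noteq> 1"
    then have "cof (inverse (1 - a)) * (cof (1 - a) * f) = f"
      by (simp flip: mult.assoc cof_simps(4))
    then show False using f0 f(3) by simp
  qed
  then have "?z = 1" using a by simp
  moreover have "e * ?z = 0"
  proof (rule pspan_kill)
    fix x assume "x \<in> K"
    then obtain A y where A: "A \<in> M" "x = A \<cdot> f \<cdot> y" by (auto simp: K_def)
    then have "e * A * f = 0" using no by blast
    then have "(e * A * f) \<cdot> y = 0" by simp
    then show "e \<cdot> x = 0" using A(2) by simp
  qed
  ultimately show False using e(3) by simp
qed

text \<open>With \<open>S = csqrt (star T * T)\<close> the relation between
  \<open>S \<cdot> x\<close> and \<open>T \<cdot> x\<close> preserves inner products and defines the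
  partial isometry. Its support and range are recorded through the operators that fix
  \<open>T\<close> from the right or the left.\<close>

lemma polar:
  assumes T: "T \<in> M"
  shows "\<exists>W\<in>M. proj (star W * W) \<and> (\<forall>Q. proj Q \<longrightarrow> T * Q = T \<longrightarrow> W * Q = W) \<and>
    (\<forall>E. E * T = T \<longrightarrow> E * W = W) \<and> W * star W * T = T"
proof -
  define S where "S = csqrt (star T * T)"
  have S: "S \<in> M" "star S = S" "S * S = star T * T"
    unfolding S_def using T by (auto intro: csqrt_in csqrt_selfadj csqrt_sq)
  define D where "D = {(S \<cdot> x, T \<cdot> x) | x. True}"
  have "\<exists>W\<in>M. (\<forall>(x, y)\<in>D. W \<cdot> x = y) \<and> star W * W = pspan (fst ` D) \<and>
    (\<forall>C. (\<forall>(x, y)\<in>D. C \<cdot> y = 0) \<longrightarrow> C * W = 0)"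
  proof (rule isometric_relation_in)
    show "(a *\<^sub>C x, a *\<^sub>C y) \<in> D" if "(x, y) \<in> D" for a x y
    proof -
      obtain z where "x = S \<cdot> z" "y = T \<cdot> z" using \<open>(x, y) \<in> D\<close> unfolding D_def by auto
      then have "a *\<^sub>C x = S \<cdot> a *\<^sub>C z" "a *\<^sub>C y = T \<cdot> a *\<^sub>C z" by simp_all
      then show ?thesis unfolding D_def by blast
    qed
    show "cinner y y' = cinner x x'" if xy: "(x, y) \<in> D" "(x', y') \<in> D" for x y x' y'
    proof -
      obtain z z' where z: "x = S \<cdot> z" "y = T \<cdot> z" "x' = S \<cdot> z'" "y' = T \<cdot> z'"
        using xy unfolding D_def by auto
      have "cinner y y' = cinner ((star T * T) \<cdot> z) z'" by (simp add: z cinner_star_left)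
      also have "\<dots> = cinner x x'" by (simp add: z cinner_app_left[of S "S \<cdot> z"] S flip: S(3))
      finally show ?thesis .
    qed
    show "(B \<cdot> x, B \<cdot> y) \<in> D" if B: "B \<in> comm M" and xy: "(x, y) \<in> D" for B x y
    proof -
      obtain z where "x = S \<cdot> z" "y = T \<cdot> z" using xy unfolding D_def by auto
      then have "B \<cdot> x = S \<cdot> B \<cdot> z" "B \<cdot> y = T \<cdot> B \<cdot> z"
        using in_M_D[OF T B] in_M_D[OF S(1) B] by (metis app_simps(5))+
      then show ?thesis unfolding D_def by blast
    qed
  qed
  then obtain W where W: "W \<in> M" "\<forall>(x, y)\<in>D. W \<cdot> x = y" "star W * W = pspan (fst ` D)"
    "\<And>C. \<forall>(x, y)\<in>D. C \<cdot> y = 0 \<Longrightarrow> C * W = 0" by blast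
  have WS: "W * S = T"
  proof (rule cop_eqI)
    fix x
    have "(S \<cdot> x, T \<cdot> x) \<in> D" unfolding D_def by blast
    then show "(W * S) \<cdot> x = T \<cdot> x" using W(2) by auto
  qed
  have p: "proj (star W * W)" using W(3) by simp
  show ?thesis
  proof (intro bexI[of _ W] conjI allI impI)
    fix Q assume Q: "proj Q" "T * Q = T"
    have "star T * T * (1 - Q) = 0" using Q(2) by (simp add: algebra_simps mult.assoc)
    then have "S * (1 - Q) = 0" unfolding S_def by (intro csqrt_kill) simp_all
    then have "star (S * (1 - Q)) = 0" by simp
    then have "(1 - Q) * S = 0" using S(2) projD(2)[OF Q(1)] by simp
    then have "(1 - Q) \<cdot> S \<cdot> x = 0" for x by (metis app_simps(5) app_simps(7))
    then have "(1 - Q) * pspan (fst ` D) = 0" by (intro pspan_kill) (auto simp: D_def)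
    then have "star ((1 - Q) * (star W * W)) = 0" using W(3) by simp
    moreover have "star ((1 - Q) * (star W * W)) = star W * W * (1 - Q)"
      using projD(2)[OF Q(1)] by (simp add: mult.assoc)
    ultimately have "star W * W * Q = star W * W"
      by (metis eq_iff_diff_eq_0 mult_1_right right_diff_distrib)
    then have "W * (star W * W) * Q = W * (star W * W)" by (simp only: mult.assoc)
    then show "W * Q = W" unfolding partial_isometry(1)[OF p] .
  next
    fix E assume "E * T = T"
    then have "(E - 1) \<cdot> T \<cdot> x = 0" for x by (metis app_simps(2,5,6) diff_self)
    then have "(E - 1) * W = 0" by (intro W(4)) (auto simp: D_def)
    then show "E * W = W" by (simp add: algebra_simps)
  next
    have "W * star W * T = W * (star W * W) * S" using WS by (simp add: mult.assoc)
    then show "W * star W * T = T" using partial_isometry(1)[OF p] WS by simp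
  qed (use W p in auto)
qed

lemma polar_link:
  assumes e: "e \<in> M" "proj e" "e \<noteq> 0" and f: "f \<in> M" "proj f" "f \<noteq> 0"
  shows "\<exists>w\<in>M. w \<noteq> 0 \<and> proj (star w * w) \<and> e * w = w \<and> w * f = w"
proof -
  obtain A where A: "A \<in> M" "e * A * f \<noteq> 0" using factor_link[OF e f] by blast
  have "e * A * f \<in> M" using e f A by auto
  then obtain W where W: "W \<in> M" "proj (star W * W)" "\<And>Q. proj Q \<Longrightarrow> e * A * f * Q = e * A * f \<Longrightarrow> W * Q = W"
    "\<And>E. E * (e * A * f) = e * A * f \<Longrightarrow> E * W = W" "W * star W * (e * A * f) = e * A * f"
    using polar by metis
  have "W \<noteq> 0" using W(5) A(2) by auto
  moreover have "e * W = W" by (rule W(4)) (simp add: projD e(2) flip: mult.assoc)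
  moreover have "W * f = W" by (rule W(3)) (simp_all add: f(2) projD mult.assoc)
  ultimately show ?thesis using W by blast
qed

text \<open>The range projection is \<open>W * star W\<close> from the polar decomposition; its
  trace equals that of \<open>star W * W\<close>, which lies below \<open>Q\<close>.\<close>

lemma range_proj:
  assumes T: "T \<in> M" and Q: "Q \<in> M" "proj Q" "T * Q = T"
  shows "\<exists>r\<in>M. proj r \<and> r * T = T \<and> (\<forall>E. E * T = T \<longrightarrow> E * r = r) \<and> \<tau> r \<le> \<tau> Q"
proof -
  obtain W where W: "W \<in> M" "proj (star W * W)" "\<And>Q. proj Q \<Longrightarrow> T * Q = T \<Longrightarrow> W * Q = W"
    "\<And>E. E * T = T \<Longrightarrow> E * W = W" "W * star W * T = T"
    using polar[OF T] by metis
  have "Q * (star W * W) = star W * W"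
  proof -
    have "star (W * Q) = star W" using W(3)[OF Q(2,3)] by simp
    then show ?thesis using projD(2)[OF Q(2)] by (metis mult.assoc star_simps(1))
  qed
  then have "\<tau> (star W * W) \<le> \<tau> Q" using W Q by (intro tr_mono proj_sub_le) auto
  then have "\<tau> (W * star W) \<le> \<tau> Q" using tr_star[OF W(1)] by simp
  moreover have "E * (W * star W) = W * star W" if "E * T = T" for E
    using W(4)[OF that] by (simp flip: mult.assoc)
  ultimately show ?thesis using W partial_isometry(2)[OF W(2)] by (intro bexI[of _ "W * star W"]) auto
qed

text \<open>A maximal orthogonal family of non-zero partial isometries from below \<open>P\<close>
  to below \<open>E\<close> is glued into one \<open>W\<close>. If both \<open>P\<close> and
  \<open>E\<close> had something left over, \<open>polar_link\<close> would enlarge the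
  family.\<close>

lemma comparison:
  assumes P: "P \<in> M" "proj P" and E: "E \<in> M" "proj E"
  shows "\<exists>W\<in>M. proj (star W * W) \<and> W * P = W \<and> E * W = W \<and> (star W * W = P \<or> W * star W = E)"
proof -
  define PI where "PI = {w \<in> M. w \<noteq> 0 \<and> proj (star w * w) \<and> w * P = w \<and> E * w = w}"
  define orth where "orth w v \<longleftrightarrow> w * star v = 0 \<and> star w * v = 0" for w v :: "'a cop"
  define \<A> where "\<A> = {S. S \<subseteq> PI \<and> (\<forall>w\<in>S. \<forall>v\<in>S. w \<noteq> v \<longrightarrow> orth w v)}"
  have "\<Union>C \<in> \<A>" if C: "subset.chain \<A> C" for C
  proof -
    have CA: "X \<in> \<A>" if "X \<in> C" for X using C that unfolding subset_chain_def by auto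
    have lin: "X \<subseteq> Y \<or> Y \<subseteq> X" if "X \<in> C" "Y \<in> C" for X Y
      using C that unfolding subset_chain_def by auto
    have "orth w v" if w: "w \<in> \<Union>C" and v: "v \<in> \<Union>C" and ne: "w \<noteq> v" for w v
    proof -
      obtain X where X: "w \<in> X" "X \<in> C" using w by (rule UnionE)
      obtain Y where Y: "v \<in> Y" "Y \<in> C" using v by (rule UnionE)
      obtain Z where Z: "w \<in> Z" "v \<in> Z" "Z \<in> C" using lin[OF X(2) Y(2)] X Y by (metis subsetD)
      then show ?thesis using CA[OF Z(3)] ne unfolding \<A>_def by simp
    qed
    moreover have "\<Union>C \<subseteq> PI" using CA unfolding \<A>_def by auto
    ultimately show ?thesis unfolding \<A>_def by simp
  qed
  then obtain S where S: "S \<in> \<A>" "\<And>X. X \<in> \<A> \<Longrightarrow> S \<subseteq> X \<Longrightarrow> X = S"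
    using subset_Zorn'[of \<A>] by blast
  have SI: "w \<in> M" "proj (star w * w)" "w * P = w" "E * w = w" "w * (star w * w) = w" if "w \<in> S" for w
    using that S(1) partial_isometry(1)[of w] unfolding \<A>_def PI_def by auto
  have So: "w * star v = 0" "star w * v = 0" if "w \<in> S" "v \<in> S" "w \<noteq> v" for w v
    using that S(1) unfolding \<A>_def orth_def by auto
  \<comment> \<open>Each member of the family is prescribed on its own initial space; orthogonality
    within the family makes the union isometric.\<close>
  define D where "D = {((star w * w) \<cdot> x, w \<cdot> x) | w x. w \<in> S}"
  have "\<exists>W\<in>M. (\<forall>(x, y)\<in>D. W \<cdot> x = y) \<and> star W * W = pspan (fst ` D) \<and>
    (\<forall>C. (\<forall>(x, y)\<in>D. C \<cdot> y = 0) \<longrightarrow> C * W = 0)"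
  proof (rule isometric_relation_in)
    show "(a *\<^sub>C x, a *\<^sub>C y) \<in> D" if xy: "(x, y) \<in> D" for a x y
    proof -
      obtain w z where w: "w \<in> S" "x = (star w * w) \<cdot> z" "y = w \<cdot> z" using xy unfolding D_def by blast
      then have "a *\<^sub>C x = (star w * w) \<cdot> a *\<^sub>C z" "a *\<^sub>C y = w \<cdot> a *\<^sub>C z" by simp_all
      then show ?thesis using w(1) unfolding D_def by blast
    qed
    show "cinner y y' = cinner x x'" if xy: "(x, y) \<in> D" "(x', y') \<in> D" for x y x' y'
    proof -
      obtain w z where w: "w \<in> S" "x = (star w * w) \<cdot> z" "y = w \<cdot> z" using xy(1) unfolding D_def by blast
      obtain v z' where v: "v \<in> S" "x' = (star v * v) \<cdot> z'" "y' = v \<cdot> z'" using xy(2) unfolding D_def by blast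
      have 1: "cinner y y' = cinner ((star v * w) \<cdot> z) z'" by (simp add: w v cinner_star_left)
      have 2: "cinner x x' = cinner ((star v * v * (star w * w)) \<cdot> z) z'"
        by (simp add: w v cinner_star_left cinner_app_left[of v])
      show ?thesis
      proof (cases "v = w")
        case True
        then show ?thesis using 1 2 projD(1)[OF SI(2)[OF w(1)]] by metis
      next
        case False
        have "star v * v * (star w * w) = star v * (v * star w) * w" by (simp add: mult.assoc)
        then show ?thesis using 1 2 So[OF v(1) w(1) False] by simp
      qed
    qed
    show "(B \<cdot> x, B \<cdot> y) \<in> D" if B: "B \<in> comm M" and xy: "(x, y) \<in> D" for B x y
    proof -
      obtain w z where w: "w \<in> S" "x = (star w * w) \<cdot> z" "y = w \<cdot> z" using xy unfolding D_def by blast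
      have "(star w * w) * B = B * (star w * w)" "w * B = B * w"
        using SI(1)[OF w(1)] by (auto intro!: in_M_D[OF _ B])
      then have "B \<cdot> x = (star w * w) \<cdot> B \<cdot> z" "B \<cdot> y = w \<cdot> B \<cdot> z"
        using w by (metis app_simps(5))+
      then show ?thesis using w(1) unfolding D_def by blast
    qed
  qed
  then obtain W where W: "W \<in> M" "\<forall>(x, y)\<in>D. W \<cdot> x = y" "star W * W = pspan (fst ` D)"
    "\<And>C. \<forall>(x, y)\<in>D. C \<cdot> y = 0 \<Longrightarrow> C * W = 0" by blast
  define p where "p = star W * W"
  define g where "g = W * star W"
  have p: "proj p" using W(3) by (simp add: p_def)
  have pM: "p \<in> M" unfolding p_def using W(1) by auto
  have g: "proj g" using p partial_isometry(2) by (simp add: p_def g_def)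
  have gM: "g \<in> M" unfolding g_def using W(1) by auto
  have Ww: "W * (star w * w) = w" if "w \<in> S" for w
  proof (rule cop_eqI)
    fix x
    have "((star w * w) \<cdot> x, w \<cdot> x) \<in> D" using that unfolding D_def by blast
    then show "(W * (star w * w)) \<cdot> x = w \<cdot> x" using W(2) by auto
  qed
  have pw: "p * (star w * w) = star w * w" if "w \<in> S" for w
  proof (rule cop_eqI)
    fix x
    have "(star w * w) \<cdot> x \<in> fst ` D" using that unfolding D_def by force
    then show "(p * (star w * w)) \<cdot> x = (star w * w) \<cdot> x" unfolding p_def W(3) using pspan_fix by simp
  qed
  have Pp: "P * p = p"
  proof -
    have "(1 - P) * pspan (fst ` D) = 0"
    proof (rule pspan_kill)
      fix x assume "x \<in> fst ` D"
      then obtain w z where w: "w \<in> S" "x = (star w * w) \<cdot> z" unfolding D_def by auto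
      have "star (w * P) = star w" using SI(3)[OF w(1)] by simp
      then have "P * star w = star w" using projD(2)[OF P(2)] by simp
      then have "(1 - P) * (star w * w) = 0" by (simp add: algebra_simps flip: mult.assoc)
      then show "(1 - P) \<cdot> x = 0" using w(2) by (metis app_simps(5,7))
    qed
    then show ?thesis unfolding p_def W(3) by (simp add: algebra_simps)
  qed
  have WP: "W * P = W"
    using proj_sub_commute[OF P(2) p Pp] partial_isometry(1)[of W] p unfolding p_def
    by (metis mult.assoc)
  have EW: "E * W = W"
  proof -
    have "(E - 1) * W = 0"
    proof (rule W(4), clarify)
      fix x y assume "(x, y) \<in> D"
      then obtain w z where w: "w \<in> S" "y = w \<cdot> z" unfolding D_def by blast
      have "E \<cdot> y = y" using SI(4)[OF w(1)] w(2) by (metis app_simps(5))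
      then show "(E - 1) \<cdot> y = 0" by simp
    qed
    then show ?thesis by (simp add: algebra_simps)
  qed
  have "p = P \<or> g = E"
  proof (rule ccontr)
    assume no: "\<not> (p = P \<or> g = E)"
    define e where "e = E - g"
    define f where "f = P - p"
    have Eg: "E * g = g" unfolding g_def using EW by (simp flip: mult.assoc)
    have e: "e \<in> M" "proj e" "e \<noteq> 0" and f: "f \<in> M" "proj f" "f \<noteq> 0"
      using E P g p gM pM Eg Pp no by (auto simp: e_def f_def intro: proj_diff)
    obtain w where w: "w \<in> M" "w \<noteq> 0" "proj (star w * w)" "e * w = w" "w * f = w"
      using polar_link[OF e f] by blast
    have "E * e = e" "f * P = f" using Eg proj_sub_commute[OF P(2) p Pp] projD(1)[OF E(2)] projD(1)[OF P(2)]
      by (simp_all add: e_def f_def algebra_simps)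
    then have wPI: "w \<in> PI" using w unfolding PI_def by (metis (mono_tags, lifting) mem_Collect_eq mult.assoc)
    have o1: "w * star v = 0" "star w * v = 0" if v: "v \<in> S" for v
    proof -
      have "star v * (v * star v) = star v" using partial_isometry(3)[OF SI(2)[OF v]] .
      moreover have "star (v * P) = star v" using SI(3)[OF v] by simp
      then have "P * star v = star v" using projD(2)[OF P(2)] by simp
      moreover have "p * star v = star v" using pw[OF v] calculation(1) by (metis mult.assoc)
      ultimately have "f * star v = 0" by (simp add: f_def algebra_simps)
      then show "w * star v = 0" using w(5) by (metis mult.assoc mult_zero_right)
      have "g * v = W * p * (star v * v)" unfolding g_def p_def using Ww[OF v] by (simp add: mult.assoc)
      also have "\<dots> = v" using pw[OF v] Ww[OF v] by (simp add: mult.assoc)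
      finally have "e * v = 0" using SI(4)[OF v] by (simp add: e_def algebra_simps)
      moreover have "star w = star w * e" using w(4) projD(2)[OF e(2)] by (metis star_simps(1))
      ultimately show "star w * v = 0" by (metis mult.assoc mult_zero_right)
    qed
    have o2: "v * star w = 0" "star v * w = 0" if v: "v \<in> S" for v
      using o1[OF v] by (metis star_simps(1,7) star_star)+
    have "insert w S \<in> \<A>" using wPI S(1) o1 o2 unfolding \<A>_def orth_def by auto
    \<comment> \<open>Maximality forces \<open>w\<close> into the family, yet \<open>w\<close> is
      orthogonal to all members of it, hence to itself.\<close>
    then have "w \<in> S" using S(2) by blast
    then have "w * star w = 0" by (rule o1)
    then show False using partial_isometry(1)[OF w(3)] w(2) by (metis mult.assoc mult_zero_left)
  qed
  then show ?thesis using W(1) WP EW p unfolding p_def g_def by blast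
qed

section \<open>Equivalence inside the Grassmann space, and room outside finitely many of its
  members\<close>

lemma G_range:
  assumes W: "W \<in> M" "star W * W \<in> G" shows "W * star W \<in> G"
  using W GD[OF W(2)] partial_isometry(2)[of W] tr_star[OF W(1)] unfolding G_def by auto

lemma below_G:
  assumes "W \<in> M" "proj (star W * W)" "proj P" "W * P = W"
  shows "P * (star W * W) = star W * W" "star W * W * P = star W * W"
proof -
  have "star (W * P) = star W" using assms(4) by simp
  then show "P * (star W * W) = star W * W" using projD(2)[OF assms(3)] by (simp flip: mult.assoc)
  show "star W * W * P = star W * W" using assms(4) by (simp add: mult.assoc)
qed

text \<open>Either outcome of the comparison gives a partial isometry that is full on one side;
  equal finite traces make it full on the other.\<close>

lemma G_equivalent:
  assumes P: "P \<in> G" and Q: "Q \<in> G"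
  shows "\<exists>u\<in>M. star u * u = P \<and> u * star u = Q"
proof -
  have *: "\<exists>u\<in>M. star u * u = P \<and> u * star u = Q"
    if W: "W \<in> M" "star W * W = P" "Q * W = W" and PQ: "P \<in> G" "Q \<in> G" for W P Q
  proof -
    have "W * star W \<in> G" using G_range W PQ(1) by simp
    moreover have "Q * (W * star W) = W * star W" using W(3) by (simp flip: mult.assoc)
    ultimately have "W * star W = Q" using G_eqI PQ(2) by blast
    then show ?thesis using W by blast
  qed
  obtain W where W: "W \<in> M" "proj (star W * W)" "W * P = W" "Q * W = W"
    "star W * W = P \<or> W * star W = Q"
    using comparison[OF GD(1,2)[OF P] GD(1,2)[OF Q]] by blast
  from W(5) show ?thesis
  proof
    assume "star W * W = P"
    then show ?thesis using * W(1,4) P Q by blast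
  next
    assume "W * star W = Q"
    moreover have "P * star W = star W" using W(3) GD(5)[OF P] by (metis star_simps(1))
    ultimately obtain u where "u \<in> M" "star u * u = Q" "u * star u = P"
      using *[of "star W" Q P] W(1) P Q by auto
    then show ?thesis by (intro bexI[of _ "star u"]) auto
  qed
qed

text \<open>Enlarging \<open>F\<close> by \<open>Q\<close> adds only the range projection of
  \<open>(1 - F) * Q\<close>, whose trace is at most \<open>\<tau> Q\<close>.\<close>

lemma finite_join:
  assumes "finite S" "S \<subseteq> G"
  shows "\<exists>F\<in>M. proj F \<and> \<tau> F < \<infinity> \<and> (\<forall>B\<in>S. F * B = B)"
  using assms
proof (induction S rule: finite_induct)
  case empty
  then show ?case using tr_0 by (intro bexI[of _ 0]) auto
next
  case (insert Q S)
  then obtain F where F: "F \<in> M" "proj F" "\<tau> F < \<infinity>" "\<forall>B\<in>S. F * B = B" by auto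
  have Q: "Q \<in> G" using insert by blast
  have T: "(1 - F) * Q \<in> M" "(1 - F) * Q * Q = (1 - F) * Q" using F(1) GD[OF Q] by (auto simp: mult.assoc)
  obtain r where r: "r \<in> M" "proj r" "r * ((1 - F) * Q) = (1 - F) * Q"
    "\<And>E. E * ((1 - F) * Q) = (1 - F) * Q \<Longrightarrow> E * r = r" "\<tau> r \<le> \<tau> Q"
    using range_proj[OF T(1) GD(1,2)[OF Q] T(2)] by blast
  have "(1 - F) * r = r" by (rule r(4)) (simp add: projD proj_compl[OF F(2)] flip: mult.assoc)
  then have Fr: "F * r = 0" by (simp add: algebra_simps)
  have pr: "proj (F + r)" by (rule proj_add[OF F(2) r(2) Fr])
  have rF: "r * F = 0" by (rule proj_orth_commute[OF F(2) r(2) Fr])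
  have "\<tau> (F + r) = \<tau> F + \<tau> r" using F r proj_pos by (intro tr_add) auto
  moreover have "\<tau> r < \<infinity>" using r(5) GD(3)[OF Q] by (simp add: order_le_less_trans)
  ultimately have "\<tau> (F + r) < \<infinity>" using F(3) by simp
  moreover have "(F + r) * B = B" if "B \<in> insert Q S" for B
  proof (cases "B = Q")
    case True
    have "r * Q = Q - F * Q" using r(3) rF by (simp add: algebra_simps flip: mult.assoc)
    then show ?thesis using True by (simp add: algebra_simps)
  next
    case False
    then have FB: "F * B = B" using that F(4) by simp
    have "r * B = r * (F * B)" using FB by simp
    also have "\<dots> = 0" using rF by (simp flip: mult.assoc)
    finally show ?thesis using FB by (simp add: algebra_simps)
  qed
  ultimately show ?case using pr F(1) r(1) by (intro bexI[of _ "F + r"]) auto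
qed

text \<open>The infinite trace of \<open>1\<close> enters here: \<open>1 - F\<close> still has
  infinite trace, so a part of \<open>P\<close> cannot exhaust it, and comparison must embed all of
  \<open>P\<close> below it.\<close>

lemma G_avoid:
  assumes "finite S" "S \<subseteq> G"
  shows "\<exists>R\<in>G. \<forall>B\<in>S. R * B = 0"
proof -
  obtain F where F: "F \<in> M" "proj F" "\<tau> F < \<infinity>" "\<forall>B\<in>S. F * B = B"
    using finite_join[OF assms] by blast
  obtain P where P: "P \<in> G" using G_ne unfolding G_def by blast
  have E: "1 - F \<in> M" "proj (1 - F)" using F proj_compl by auto
  obtain W where W: "W \<in> M" "proj (star W * W)" "W * P = W" "(1 - F) * W = W"
    "star W * W = P \<or> W * star W = 1 - F"
    using comparison[OF GD(1,2)[OF P] E] by blast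
  have "\<tau> (1 - F) = \<infinity>"
  proof (rule ccontr)
    have "\<tau> 1 = \<tau> F + \<tau> (1 - F)" using F by (intro tr_diff) (auto simp: proj_pos proj_le_1)
    moreover assume "\<tau> (1 - F) \<noteq> \<infinity>"
    ultimately show False
      using F(3) tr_infinite unfolding infinity_ennreal_def by (metis ennreal_add_eq_top less_irrefl)
  qed
  moreover have "\<tau> (W * star W) < \<infinity>"
  proof -
    have "\<tau> (star W * W) \<le> \<tau> P"
      using W(1,2) GD[OF P] below_G[OF W(1,2) GD(2)[OF P] W(3)] by (intro tr_mono proj_sub_le) auto
    then show ?thesis using GD(3)[OF P] tr_star[OF W(1)] by (simp add: order_le_less_trans)
  qed
  ultimately have "star W * W = P" using W(5) by auto
  then have "W * star W \<in> G" using G_range W(1) P by simp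
  moreover have "W * star W * B = 0" if "B \<in> S" for B
  proof -
    have "star ((1 - F) * W) = star W" using W(4) by simp
    then have "star W = star W * (1 - F)" using projD(2)[OF F(2)] by simp
    then have "star W * B = star W * ((1 - F) * B)" by (metis mult.assoc)
    also have "\<dots> = 0" using F(4) that by (simp add: left_diff_distrib)
    finally show ?thesis by (simp add: mult.assoc)
  qed
  ultimately show ?thesis by blast
qed

section \<open>Joins, and the order recovered from orthogonality\<close>

definition join :: "'a cop set \<Rightarrow> 'a cop" where
  "join S = pspan (\<Union>P\<in>S. range ((\<cdot>) P))"

lemma proj_join [simp]: "proj (join S)"
  by (simp add: join_def)

lemma join_absorb: "P \<in> S \<Longrightarrow> join S * P = P"
  by (rule cop_eqI) (auto simp: join_def intro!: pspan_fix)

lemma join_kill: assumes "\<And>P. P \<in> S \<Longrightarrow> C * P = 0" shows "C * join S = 0"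
  unfolding join_def
proof (rule pspan_kill)
  fix x assume "x \<in> (\<Union>P\<in>S. range ((\<cdot>) P))"
  then obtain P y where "P \<in> S" "x = P \<cdot> y" by blast
  then show "C \<cdot> x = 0" using assms by (metis app_simps(5,7))
qed

lemma join_in: "S \<subseteq> M \<Longrightarrow> join S \<in> M"
  unfolding join_def by (rule pspan_span_in) blast

text \<open>If the remainder \<open>e\<close> were non-zero, part of some \<open>R \<in> G\<close> orthogonal to \<open>S\<close> could be exchanged
  for an equivalent part of \<open>e\<close>, giving another element of \<open>G\<close> orthogonal to \<open>S\<close>.\<close>

lemma join_complement:
  assumes S: "finite S" "S \<subseteq> G"
  shows "1 = join S + join {R \<in> G. \<forall>B\<in>S. R * B = 0}"
proof (rule ccontr)
  define H where "H = {R \<in> G. \<forall>B\<in>S. R * B = 0}"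
  define J where "J = join S"
  define L where "L = join H"
  define E where "E = 1 - J"
  define e where "e = E - L"
  assume "1 \<noteq> join S + join {R \<in> G. \<forall>B\<in>S. R * B = 0}"
  then have e0: "e \<noteq> 0" by (simp add: e_def E_def J_def L_def H_def algebra_simps)
  have GM: "G \<subseteq> M" by (auto simp: G_def)
  have JM: "J \<in> M" and LM: "L \<in> M"
    using S GM unfolding J_def L_def H_def by (auto intro!: join_in)
  have pJ: "proj J" and pL: "proj L" and pE: "proj E" by (simp_all add: J_def L_def E_def proj_compl)
  have EH: "E * R = R" if "R \<in> H" for R
  proof -
    have "R * J = 0" unfolding J_def by (rule join_kill) (use that in \<open>auto simp: H_def\<close>)
    then have "J * R = 0" using proj_orth_commute pJ GD(2) that unfolding H_def by blast
    then show ?thesis by (simp add: E_def algebra_simps)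
  qed
  have "(1 - E) * L = 0" unfolding L_def by (rule join_kill) (simp add: EH algebra_simps)
  then have EL: "E * L = L" by (simp add: algebra_simps)
  have pe: "proj e" unfolding e_def by (rule proj_diff[OF pE pL EL])
  have eM: "e \<in> M" using JM LM by (auto simp: e_def E_def)
  have eL: "e * L = 0" using EL projD(1)[OF pL] by (simp add: e_def algebra_simps)
  have eS: "e * B = 0" if "B \<in> S" for B
  proof -
    have "E * B = 0" using join_absorb[OF that] by (simp add: E_def J_def algebra_simps)
    moreover have "e * E = e"
      using proj_sub_commute[OF pE pL EL] projD(1)[OF pE] by (simp add: e_def algebra_simps)
    ultimately show ?thesis by (metis mult.assoc mult_zero_right)
  qed
  obtain R where R: "R \<in> H" using G_avoid[OF S] unfolding H_def by blast
  then have RG: "R \<in> G" by (simp add: H_def)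
  obtain w where w: "w \<in> M" "w \<noteq> 0" "proj (star w * w)" "e * w = w" "w * R = w"
    using polar_link[OF eM pe e0 GD(1,2)[OF RG] G_nonzero[OF RG]] by blast
  define q where "q = star w * w"
  define h where "h = w * star w"
  have q: "proj q" "q \<in> M" and h: "proj h" "h \<in> M"
    using w partial_isometry(2)[OF w(3)] by (auto simp: q_def h_def)
  have Rq: "R * q = q" unfolding q_def using below_G[OF w(1,3) GD(2)[OF RG] w(5)] by simp
  have eh: "e * h = h" unfolding h_def using w(4) by (simp flip: mult.assoc)
  have he: "h * e = h" by (rule proj_sub_commute[OF pe h(1) eh])
  have hL: "h * L = 0" using he eL by (metis mult.assoc mult_zero_right)
  have "L * R = R" unfolding L_def by (rule join_absorb[OF R])
  then have hR: "h * R = 0" using hL by (metis mult.assoc mult_zero_left)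
  have Rh: "R * h = 0" by (rule proj_orth_commute[OF h(1) GD(2)[OF RG] hR])
  \<comment> \<open>The part \<open>q\<close> of \<open>R\<close> is exchanged for the equivalent
    \<open>h\<close> below \<open>e\<close>. Then \<open>R1\<close> belongs to the family spanning
    \<open>L\<close>, which would put \<open>h\<close> below \<open>L\<close>, although
    \<open>h\<close> is orthogonal to \<open>L\<close>.\<close>
  define R1 where "R1 = R - q + h"
  have pRq: "proj (R - q)" by (rule proj_diff[OF GD(2)[OF RG] q(1) Rq])
  have qh: "q * h = 0"
    using proj_sub_commute[OF GD(2)[OF RG] q(1) Rq] Rh by (metis mult.assoc mult_zero_right)
  have pR1: "proj R1" unfolding R1_def by (rule proj_add[OF pRq h(1)]) (simp add: Rh qh left_diff_distrib)
  have "\<tau> R1 = \<tau> (R - q) + \<tau> h"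
    unfolding R1_def using proj_pos[OF pRq] h GD[OF RG] q by (intro tr_add) (auto simp: proj_pos)
  also have "\<tau> h = \<tau> q" using tr_star[OF w(1)] by (simp add: h_def q_def)
  also have "\<tau> (R - q) + \<tau> q = \<tau> R"
    using tr_diff[of q R] q GD[OF RG] proj_sub_le[OF GD(2)[OF RG] q(1) Rq] by (simp add: proj_pos add.commute)
  finally have "R1 \<in> G" using pR1 GD[OF RG] q h by (auto simp: G_def R1_def)
  moreover have "R1 * B = 0" if B: "B \<in> S" for B
  proof -
    have "R * B = 0" using R B by (simp add: H_def)
    moreover have "q * B = 0"
      using calculation proj_sub_commute[OF GD(2)[OF RG] q(1) Rq] by (metis mult.assoc mult_zero_right)
    moreover have "h * B = 0" using he eS[OF B] by (metis mult.assoc mult_zero_right)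
    ultimately show ?thesis by (simp add: R1_def algebra_simps)
  qed
  ultimately have "L * R1 = R1" unfolding L_def by (intro join_absorb) (simp add: H_def)
  then have "L * (R1 * h) = R1 * h" by (metis mult.assoc)
  moreover have "R1 * h = h" using Rh qh projD(1)[OF h(1)] by (simp add: R1_def algebra_simps)
  moreover have "L * h = 0" by (rule proj_orth_commute[OF h(1) pL hL])
  ultimately have "w * star w = 0" by (simp add: h_def)
  then show False using partial_isometry(1)[OF w(3)] w(2) by (metis mult.assoc mult_zero_left)
qed

text \<open>For finite \<open>S\<close> inside \<open>G\<close> this says that \<open>A\<close> lies
  below the join of \<open>S\<close>, in terms of nothing but orthogonality to members of
  \<open>G\<close>, so that \<open>\<phi>\<close> can transport it.\<close>

definition covered :: "'a cop \<Rightarrow> 'a cop set \<Rightarrow> bool" where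
  "covered A S \<longleftrightarrow> (\<forall>R\<in>G. (\<forall>B\<in>S. R * B = 0) \<longrightarrow> R * A = 0)"

text \<open>\<open>A\<close> is orthogonal to the complement that \<open>join_complement\<close>
  describes, hence \<open>A = join S * A\<close>; an operator that kills all of \<open>S\<close>
  kills the join and with it \<open>A\<close>.\<close>

lemma covered_kill:
  assumes S: "finite S" "S \<subseteq> G" and A: "covered A S" "star A = A" and C: "\<And>B. B \<in> S \<Longrightarrow> C * B = 0"
  shows "C * A = 0"
proof -
  let ?H = "{R \<in> G. \<forall>B\<in>S. R * B = 0}"
  have "A * join ?H = 0"
  proof (rule join_kill)
    fix R assume R: "R \<in> ?H"
    then have "R * A = 0" using A(1) by (simp add: covered_def)
    then have "star (R * A) = 0" by simp
    then show "A * R = 0" using A(2) GD(5)[of R] R by simp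
  qed
  then have "star (A * join ?H) = 0" by simp
  then have "join ?H * A = 0" using A(2) by (simp add: projD)
  moreover have "A = (join S + join ?H) * A" using join_complement[OF S] by simp
  ultimately have "A = join S * A" by (simp add: distrib_right)
  then have "C * A = C * join S * A" by (metis mult.assoc)
  then show ?thesis using join_kill[OF C] by simp
qed

lemma G_dense: assumes "\<And>R. R \<in> G \<Longrightarrow> C * R = 0" shows "C = 0"
proof -
  have "C * join G = 0" by (rule join_kill[OF assms])
  moreover have "join {} = 0" using join_kill[of "{}" 1] by simp
  then have "1 = join G" using join_complement[of "{}"] by simp
  ultimately show ?thesis by simp
qed

text \<open>The ranges of the members of \<open>G\<close> span the space (\<open>G_dense\<close>),
  so an operator is determined by its corners. The induced isomorphism is defined and compared in
  this way.\<close>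

lemma G_ext: assumes "\<And>P Q. P \<in> G \<Longrightarrow> Q \<in> G \<Longrightarrow> Q * A * P = Q * B * P" shows "A = B"
proof -
  have "star (star (A - B)) = 0"
  proof (subst G_dense[of "star (A - B)"])
    fix Q assume Q: "Q \<in> G"
    have "Q * (A - B) = 0"
      by (rule G_dense) (use assms Q in \<open>simp add: right_diff_distrib left_diff_distrib\<close>)
    then have "star (Q * (A - B)) = 0" by simp
    then show "star (A - B) * Q = 0" using GD(5)[OF Q] by simp
  qed simp
  then show ?thesis by simp
qed

end

section \<open>The metric of the Grassmann space\<close>

text \<open>The absolute value makes the power continuous on the whole line for positive exponents,
  as the lemmas on \<open>fc\<close> demand.\<close>

definition apowr :: "real \<Rightarrow> real \<Rightarrow> real" where "apowr a t = \<bar>t\<bar> powr a"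

lemma continuous_apowr: "0 < a \<Longrightarrow> continuous_on UNIV (apowr a)"
  unfolding apowr_def by (intro continuous_on_powr' continuous_intros) auto

text \<open>\<open>ln\<close> takes the same value at \<open>t\<close> and \<open>- t\<close>, so
  \<open>powr\<close> ignores the sign of its base.\<close>

lemma powr_eq_apowr: "t powr a = apowr a t"
  by (cases "t \<ge> 0") (auto simp: apowr_def powr_def ln_minus)

lemma apowr_simps [simp]: "0 \<le> apowr a t" "apowr a 1 = 1" "apowr a 0 = 0"
  by (simp_all add: apowr_def)

lemma apowr_apowr: "apowr a (apowr b t) = apowr (a * b) t"
  by (simp add: apowr_def powr_powr mult.commute)

lemma apowr_one: "apowr 1 t = \<bar>t\<bar>"
  by (simp add: apowr_def)

lemma apowr_sqrt: "apowr a (sqrt t) = apowr (a / 2) t"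
proof -
  have "\<bar>sqrt t\<bar> = \<bar>t\<bar> powr (1 / 2)"
    by (cases "0 \<le> t") (simp_all add: powr_half_sqrt flip: real_sqrt_minus)
  then show ?thesis by (simp add: apowr_def powr_powr)
qed

lemma apowr_mono: "0 \<le> a \<Longrightarrow> \<bar>s\<bar> \<le> \<bar>t\<bar> \<Longrightarrow> apowr a s \<le> apowr a t"
  by (simp add: apowr_def powr_mono2)

lemma apowr_le_1: "0 \<le> a \<Longrightarrow> \<bar>t\<bar> \<le> 1 \<Longrightarrow> apowr a t \<le> 1"
  using apowr_mono[of a t 1] by simp

text \<open>The power \<open>p\<close> of the absolute value is the power \<open>p / 2\<close> of
  \<open>star A * A\<close>; this is the origin of the exponent \<open>p / 2\<close> in the final
  argument.\<close>

lemma cfc_abs_op: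
  assumes p: "0 < p"
  shows "cfc (\<lambda>t. t powr p) (abs_op (blf A)) = blf (fc (apowr (p / 2)) (star A * A))"
proof -
  have s: "star (star A * A) = star A * A" by simp
  have c: "continuous_on UNIV sqrt" by (intro continuous_intros)
  have "adj (blf A) o\<^sub>L blf A = blf (star A * A)" by (simp add: star.rep_eq times_cop.rep_eq)
  then have "abs_op (blf A) = blf (fc sqrt (star A * A))" unfolding abs_op_def by (simp add: cfc_blf[OF s c])
  moreover have "(\<lambda>t. t powr p) = apowr p" by (simp add: fun_eq_iff powr_eq_apowr)
  ultimately have "cfc (\<lambda>t. t powr p) (abs_op (blf A)) = blf (fc (apowr p) (fc sqrt (star A * A)))"
    by (simp add: cfc_blf[OF star_fc[OF s c] continuous_apowr[OF p]])
  also have "fc (apowr p) (fc sqrt (star A * A)) = fc (\<lambda>t. apowr p (sqrt t)) (star A * A)"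
    by (rule fc_compose[OF s continuous_apowr[OF p] c])
  finally show ?thesis by (simp add: apowr_sqrt)
qed

lemma norm_proj_diff: assumes P: "proj P" and Q: "proj Q" shows "norm ((P - Q) * (P - Q)) \<le> 1"
proof -
  have s: "star (P - Q) = P - Q" using P Q by (simp add: projD)
  have s': "star (1 - P - Q) = 1 - P - Q" using P Q by (simp add: projD)
  \<comment> \<open>This identity exhibits \<open>1 - (P - Q)\<^sup>2\<close> as the square of a
    self-adjoint operator.\<close>
  have "(P - Q) * (P - Q) + (1 - P - Q) * (1 - P - Q) = 1"
    using projD(1)[OF P] projD(1)[OF Q] by (simp add: algebra_simps)
  moreover have "0 \<le> (1 - P - Q) * (1 - P - Q)" using star_mult_pos[of "1 - P - Q"] by (simp only: s')
  ultimately have le: "(P - Q) * (P - Q) \<le> 1" by (metis add.commute add_le_same_cancel1 le_add_same_cancel1)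
  have "norm ((P - Q) \<cdot> x) \<le> 1 * norm x" for x
  proof -
    have "(norm ((P - Q) \<cdot> x))\<^sup>2 = Re (cinner (((P - Q) * (P - Q)) \<cdot> x) x)"
      unfolding norm_app_sq s ..
    also have "\<dots> \<le> Re (cinner (1 \<cdot> x) x)" by (rule le_imp_Re_le[OF le])
    also have "\<dots> = (norm x)\<^sup>2" by (simp add: norm_sq_cinner)
    finally show ?thesis using power2_le_imp_le by force
  qed
  then have "norm (P - Q) \<le> 1" by (intro norm_cop_bound) simp_all
  then have "norm (P - Q) * norm (P - Q) \<le> 1" by (simp add: mult_le_one)
  then show ?thesis using norm_mult_ineq[of "P - Q" "P - Q"] by linarith
qed

lemma fc_le_1: "star A = A \<Longrightarrow> continuous_on UNIV f \<Longrightarrow> (\<And>t. \<bar>t\<bar> \<le> norm A \<Longrightarrow> f t \<le> 1) \<Longrightarrow> fc f A \<le> 1"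
  using fc_mono[of A f "\<lambda>_. 1"] by (simp add: fc_const)

context tracial_factor
begin

lemma tr_sub_conj: assumes "A \<in> M" "0 \<le> A" "A \<le> 1" "P \<in> G" shows "\<tau> (P * A * P) \<le> ennreal c"
proof -
  have "P * A * P \<le> P" using conj_mono[OF assms(3), of P] GD[OF assms(4)] by simp
  then have "\<tau> (P * A * P) \<le> \<tau> P" using assms GD[OF assms(4)] by (intro tr_mono conj_proj) auto
  then show ?thesis using GD(3)[OF assms(4)] by simp
qed

text \<open>With \<open>B = (P - Q)\<^sup>2\<close> and \<open>T = (1 - P) * Q\<close> one has
  \<open>T * star T = (1 - P) * B\<close> and \<open>star T * T = Q * B\<close>, and
  \<open>B\<close> commutes with \<open>P\<close> and \<open>Q\<close>. Up to approximation, the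
  part of \<open>X\<close> outside \<open>P\<close> therefore has the trace of a corner at
  \<open>Q\<close>, which is at most \<open>c\<close> because \<open>X \<le> 1\<close>.\<close>

lemma
  fixes p :: real
  assumes p: "0 < p" and P: "P \<in> G" and Q: "Q \<in> G"
  defines "X \<equiv> fc (apowr p) ((P - Q) * (P - Q))"
  shows tr_dist_compress: "\<tau> X = \<tau> (P * X * P) + \<tau> ((1 - P) * X * (1 - P))"
    and tr_dist_compl_le: "\<tau> ((1 - P) * X * (1 - P)) \<le> ennreal c"
    and dist_in: "X \<in> M" and dist_pos: "0 \<le> X" and dist_le_1: "X \<le> 1" and dist_commute: "X * P = P * X"
proof -
  define B where "B = (P - Q) * (P - Q)"
  have h: "continuous_on UNIV (apowr p)" by (rule continuous_apowr[OF p])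
  have PQ: "P * P = P" "star P = P" "Q * Q = Q" "star Q = Q" "P \<in> M" "Q \<in> M" using GD[OF P] GD[OF Q] by auto
  have PQx: "P * (P * A) = P * A" "Q * (Q * A) = Q * A" for A using PQ by (simp_all flip: mult.assoc)
  have sB: "star B = B" using PQ by (simp add: B_def)
  have B0: "0 \<le> B" using star_mult_pos[of "P - Q"] PQ by (simp add: B_def)
  have BM: "B \<in> M" using PQ by (auto simp: B_def)
  have nB: "norm B \<le> 1" unfolding B_def by (rule norm_proj_diff) (use GD(2) P Q in auto)
  have BP: "B * P = P * B" and BQ: "B * Q = Q * B"
    using PQ PQx by (simp_all add: B_def algebra_simps)
  show XM: "X \<in> M" unfolding X_def B_def[symmetric] by (rule fc_in[OF BM sB h])
  show X0: "0 \<le> X" unfolding X_def B_def[symmetric] by (rule fc_pos[OF sB h]) simp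
  show X1: "X \<le> 1" unfolding X_def B_def[symmetric]
    by (rule fc_le_1[OF sB h]) (use nB p in \<open>auto intro!: apowr_le_1\<close>)
  show XP: "X * P = P * X" unfolding X_def B_def[symmetric] by (rule fc_commute[OF sB h BP])
  have XQ: "X * Q = Q * X" unfolding X_def B_def[symmetric] by (rule fc_commute[OF sB h BQ])
  have "X = P * X * P + (1 - P) * X * (1 - P)"
    using PQ PQx XP by (simp add: algebra_simps)
  moreover have "0 \<le> P * X * P" "0 \<le> (1 - P) * X * (1 - P)"
    using conj_pos[OF X0, of P] conj_pos[OF X0, of "1 - P"] PQ by simp_all
  ultimately show "\<tau> X = \<tau> (P * X * P) + \<tau> ((1 - P) * X * (1 - P))"
    using tr_add[of "P * X * P" "(1 - P) * X * (1 - P)"] XM PQ by auto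
  define T where "T = (1 - P) * Q"
  have TM: "T \<in> M" using PQ by (auto simp: T_def)
  \<comment> \<open>Writing \<open>X = K * K * B\<close> directly would need a square root of
    \<open>\<bar>t\<bar> powr (p - 1)\<close>, singular at \<open>0\<close> when
    \<open>p < 1\<close>. The function \<open>g n\<close> cuts this off:
    \<open>g n t * \<bar>t\<bar>\<close> increases to \<open>apowr p t\<close> with error at most
    \<open>apowr p (1 / Suc n)\<close>.\<close>
  define g where "g n t = apowr p t * (real (Suc n) / max 1 (real (Suc n) * \<bar>t\<bar>))" for n t
  define k where "k n t = sqrt (g n t)" for n t
  have cg: "continuous_on UNIV (g n)" for n
    unfolding g_def by (intro continuous_intros h) auto
  have ck: "continuous_on UNIV (k n)" for n
    unfolding k_def by (intro continuous_intros cg)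
  have g0: "0 \<le> g n t" for n t by (simp add: g_def)
  define Xn where "Xn n = fc (\<lambda>t. g n t * \<bar>t\<bar>) B" for n
  have cgt: "continuous_on UNIV (\<lambda>t. g n t * \<bar>t\<bar>)" for n by (intro continuous_intros cg)
  have gt: "g n t * \<bar>t\<bar> = apowr p t * min 1 (real (Suc n) * \<bar>t\<bar>)" for n t
    unfolding g_def by (cases "real (Suc n) * \<bar>t\<bar> \<le> 1") (auto simp: max_def min_def)
  have XnM: "Xn n \<in> M" for n unfolding Xn_def by (rule fc_in[OF BM sB cgt])
  have Xn0: "0 \<le> Xn n" for n unfolding Xn_def by (rule fc_pos[OF sB cgt]) (simp add: g0)
  have Xn1: "Xn n \<le> 1" for n unfolding Xn_def
  proof (rule fc_le_1[OF sB cgt])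
    fix t assume "\<bar>t\<bar> \<le> norm B"
    then have "apowr p t \<le> 1" using nB p by (intro apowr_le_1) auto
    then show "g n t * \<bar>t\<bar> \<le> 1" unfolding gt by (intro mult_le_one) auto
  qed
  have mono: "Xn m \<le> Xn n" if "m \<le> n" for m n unfolding Xn_def
  proof (rule fc_mono[OF sB cgt cgt])
    fix t :: real
    have "real (Suc m) * \<bar>t\<bar> \<le> real (Suc n) * \<bar>t\<bar>" using that by (intro mult_right_mono) auto
    then show "g m t * \<bar>t\<bar> \<le> g n t * \<bar>t\<bar>" unfolding gt by (intro mult_left_mono) auto
  qed
  have nb: "norm (Xn n - X) \<le> apowr p (1 / real (Suc n))" for n
  proof -
    have "Xn n - X = fc (\<lambda>t. g n t * \<bar>t\<bar> - apowr p t) B"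
      unfolding Xn_def X_def B_def[symmetric] by (rule fc_diff[OF sB cgt h, symmetric])
    moreover have "norm (fc (\<lambda>t. g n t * \<bar>t\<bar> - apowr p t) B) \<le> apowr p (1 / real (Suc n))"
    proof (rule norm_fc_le[OF sB])
      show "continuous_on UNIV (\<lambda>t. g n t * \<bar>t\<bar> - apowr p t)" by (intro continuous_intros cgt h)
      fix t :: real
      show "\<bar>g n t * \<bar>t\<bar> - apowr p t\<bar> \<le> apowr p (1 / real (Suc n))"
      proof (cases "real (Suc n) * \<bar>t\<bar> \<le> 1")
        case True
        then have "\<bar>t\<bar> \<le> \<bar>1 / real (Suc n)\<bar>" by (simp add: field_simps)
        then have "apowr p t \<le> apowr p (1 / real (Suc n))" using p by (intro apowr_mono) auto
        moreover have "0 \<le> apowr p t * min 1 (real (Suc n) * \<bar>t\<bar>)" by simp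
        moreover have "apowr p t * min 1 (real (Suc n) * \<bar>t\<bar>) \<le> apowr p t * 1" by (intro mult_left_mono) auto
        ultimately show ?thesis unfolding gt by linarith
      next
        case False
        then have "min 1 (real (Suc n) * \<bar>t\<bar>) = 1" by simp
        then show ?thesis unfolding gt by simp
      qed
    qed
    ultimately show ?thesis by simp
  qed
  have lim: "Xn \<longlonglongrightarrow> X"
  proof -
    have "(\<lambda>n. apowr p (1 / real (Suc n))) \<longlonglongrightarrow> apowr p 0"
    proof (rule continuous_on_tendsto_compose[OF h])
      show "(\<lambda>n. 1 / real (Suc n)) \<longlonglongrightarrow> 0" using LIMSEQ_inverse_real_of_nat by (simp add: inverse_eq_divide)
    qed auto
    then have "(\<lambda>n. norm (Xn n - X)) \<longlonglongrightarrow> 0"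
      using tendsto_sandwich[of "\<lambda>_. 0" "\<lambda>n. norm (Xn n - X)" sequentially "\<lambda>n. apowr p (1 / real (Suc n))" 0] nb
      by simp
    then show ?thesis by (simp add: tendsto_norm_zero_iff LIM_zero_iff)
  qed
  have bound: "\<tau> ((1 - P) * Xn n * (1 - P)) \<le> ennreal c" for n
  proof -
    define K where "K = fc (k n) B"
    have KM: "K \<in> M" unfolding K_def by (rule fc_in[OF BM sB ck])
    have sK: "star K = K" unfolding K_def by (rule star_fc[OF sB ck])
    have KP: "K * P = P * K" unfolding K_def by (rule fc_commute[OF sB ck BP])
    have KQ: "K * Q = Q * K" unfolding K_def by (rule fc_commute[OF sB ck BQ])
    have KT: "K * T = T * K" unfolding T_def using KP KQ 
      by (simp add: right_diff_distrib left_diff_distrib flip: mult.assoc) (simp add: mult.assoc)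
    have KKB: "K * K * B = Xn n"
    proof -
      have "K * K = fc (g n) B"
        unfolding K_def using fc_mult[OF sB ck ck, of n n] g0 by (simp add: k_def)
      then have "K * K * B = fc (\<lambda>t. g n t * t) B"
        using fc_mult[OF sB cg continuous_on_id, of n] fc_id[OF sB] by simp
      also have "\<dots> = Xn n" unfolding Xn_def by (rule fc_cong_pos[OF B0]) (auto intro!: continuous_intros cg)
      finally show ?thesis .
    qed
    have TT: "T * star T = (1 - P) * B" and TT': "star T * T = Q * B"
      using PQ PQx by (simp_all add: T_def B_def algebra_simps)
    have KB: "K * B = B * K" unfolding K_def by (rule fc_commute[OF sB ck refl])
    have "(K * T) * star (K * T) = K * (T * star T) * K" using sK by (simp add: mult.assoc)
    also have "\<dots> = (1 - P) * (K * K * B)"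
    proof -
      have "K * ((1 - P) * B) * K = (K * (1 - P)) * (B * K)" by (simp only: mult.assoc)
      also have "\<dots> = ((1 - P) * K) * (K * B)" using KP KB by (simp add: right_diff_distrib left_diff_distrib)
      finally show ?thesis unfolding TT by (simp only: mult.assoc)
    qed
    also have "\<dots> = (1 - P) * Xn n" unfolding KKB ..
    also have "\<dots> = (1 - P) * Xn n * (1 - P)"
    proof -
      have "Xn n * P = P * Xn n" unfolding Xn_def by (rule fc_commute[OF sB cgt BP])
      then show ?thesis using PQ PQx by (simp add: algebra_simps)
    qed
    finally have 1: "(K * T) * star (K * T) = (1 - P) * Xn n * (1 - P)" .
    have "star (K * T) * (K * T) = star T * (K * (K * T))" using sK by (simp add: mult.assoc)
    also have "\<dots> = star T * T * (K * K)" unfolding KT by (simp only: KT flip: mult.assoc)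
    also have "\<dots> = Q * (K * K * B)"
      unfolding TT' by (metis KB mult.assoc)
    also have "\<dots> = Q * Xn n" unfolding KKB ..
    also have "\<dots> = Q * Xn n * Q"
    proof -
      have "Xn n * Q = Q * Xn n" unfolding Xn_def by (rule fc_commute[OF sB cgt BQ])
      then show ?thesis using PQ PQx by (simp add: mult.assoc)
    qed
    finally have 2: "star (K * T) * (K * T) = Q * Xn n * Q" .
    have "\<tau> ((1 - P) * Xn n * (1 - P)) = \<tau> (Q * Xn n * Q)"
      using tr_star[of "K * T"] KM TM unfolding 1 2 by auto
    then show ?thesis using tr_sub_conj[OF XnM Xn0 Xn1 Q] by simp
  qed
  show "\<tau> ((1 - P) * X * (1 - P)) \<le> ennreal c"
  proof (rule tr_limit[where X = "\<lambda>n. (1 - P) * Xn n * (1 - P)"])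
    show "(\<lambda>n. (1 - P) * Xn n * (1 - P)) \<longlonglongrightarrow> (1 - P) * X * (1 - P)" by (intro tendsto_intros lim)
    show "0 \<le> (1 - P) * Xn n * (1 - P)" for n using conj_pos[OF Xn0, of "1 - P"] PQ by simp
    show "(1 - P) * Xn m * (1 - P) \<le> (1 - P) * Xn n * (1 - P)" if "m \<le> n" for m n
      using conj_mono[OF mono[OF that], of "1 - P"] PQ by simp
  qed (use XnM XM PQ bound in auto)
qed

lemma dist_le:
  assumes "0 < p" "P \<in> G" "Q \<in> G"
  shows "\<tau> (fc (apowr p) ((P - Q) * (P - Q))) \<le> ennreal (2 * c)"
proof -
  have "\<tau> (fc (apowr p) ((P - Q) * (P - Q))) \<le> ennreal c + ennreal c"
    unfolding tr_dist_compress[OF assms]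
    by (intro add_mono tr_dist_compl_le tr_sub_conj dist_in dist_pos dist_le_1 assms)
  then show ?thesis using c_pos by (simp flip: ennreal_plus)
qed

text \<open>Equality leaves no loss in the corner at \<open>P\<close>, so \<open>X * P = P\<close>
  by faithfulness; undoing the power gives \<open>B * P = P\<close>, that is
  \<open>P * Q * P = 0\<close>. Conversely, for orthogonal projections
  \<open>(P - Q)\<^sup>2\<close> is the projection \<open>P + Q\<close>, which every power
  fixes.\<close>

lemma orth_iff_dist:
  assumes p: "0 < p" and P: "P \<in> G" and Q: "Q \<in> G"
  shows "P * Q = 0 \<longleftrightarrow> \<tau> (fc (apowr p) ((P - Q) * (P - Q))) = ennreal (2 * c)"
proof
  assume PQ: "P * Q = 0"
  then have QP: "Q * P = 0" using proj_orth_commute GD(2) P Q by blast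
  have e: "(P - Q) * (P - Q) = P + Q" using PQ QP GD(4)[OF P] GD(4)[OF Q] by (simp add: algebra_simps)
  have "fc (apowr p) (P + Q) = P + Q"
    using fc_proj[OF proj_add[OF GD(2)[OF P] GD(2)[OF Q] PQ] continuous_apowr[OF p]] by simp
  moreover have "\<tau> (P + Q) = ennreal c + ennreal c"
    using tr_add[of P Q] GD[OF P] GD[OF Q] by (simp add: proj_pos)
  ultimately show "\<tau> (fc (apowr p) ((P - Q) * (P - Q))) = ennreal (2 * c)"
    unfolding e using c_pos by (simp flip: ennreal_plus)
next
  define B where "B = (P - Q) * (P - Q)"
  define X where "X = fc (apowr p) B"
  assume "\<tau> (fc (apowr p) ((P - Q) * (P - Q))) = ennreal (2 * c)"
  then have "ennreal c + ennreal c = \<tau> (P * X * P) + \<tau> ((1 - P) * X * (1 - P))"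
    using tr_dist_compress[OF p P Q] c_pos unfolding X_def B_def by (simp flip: ennreal_plus)
  also have "\<dots> = \<tau> ((1 - P) * X * (1 - P)) + \<tau> (P * X * P)" by (rule add.commute)
  also have "\<dots> \<le> ennreal c + \<tau> (P * X * P)"
    unfolding X_def B_def by (intro add_right_mono tr_dist_compl_le p P Q)
  finally have ge: "ennreal c \<le> \<tau> (P * X * P)" by simp
  have X: "X \<in> M" "0 \<le> X" "X \<le> 1" "X * P = P * X"
    unfolding X_def B_def by (rule dist_in[OF p P Q] dist_pos[OF p P Q] dist_le_1[OF p P Q] dist_commute[OF p P Q])+
  have XP: "0 \<le> P * X * P" "P * X * P \<le> P" "P * X * P \<in> M"
    using conj_proj[OF GD(2)[OF P] X(2)] conj_mono[OF X(3), of P] GD[OF P] X(1) by auto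
  have "\<tau> (P * X * P) + \<tau> (P - P * X * P) = ennreal c"
    using tr_diff[OF XP(3,1) GD(1)[OF P] XP(2)] GD(3)[OF P] by simp
  moreover have "\<tau> (P * X * P) = ennreal c"
    using ge tr_sub_conj[OF X(1-3) P] by (rule antisym[rotated])
  ultimately have "ennreal c + \<tau> (P - P * X * P) = ennreal c + 0" by simp
  then have "\<tau> (P - P * X * P) = 0" by simp
  then have "P - P * X * P = 0" using XP GD(1)[OF P] by (intro tr_faithful) auto
  then have XP1: "X * P = P" using X(4) by (simp add: mult.assoc proj_assoc[OF GD(2)[OF P]])
  have sB: "star B = B" using GD(5)[OF P] GD(5)[OF Q] by (simp add: B_def)
  have B0: "0 \<le> B" using star_mult_pos[of "P - Q"] GD(5)[OF P] GD(5)[OF Q] by (simp add: B_def)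
  have ip: "0 < inverse p" using p by simp
  have "fc (apowr (inverse p)) X * P = apowr (inverse p) 1 *\<^sub>R P"
    by (rule fc_eigen[OF pos_selfadj[OF X(2)] continuous_apowr[OF ip]]) (simp add: XP1)
  moreover have "fc (apowr (inverse p)) X = B"
  proof -
    have "fc (apowr (inverse p)) X = fc (\<lambda>t. apowr (inverse p) (apowr p t)) B"
      unfolding X_def by (rule fc_compose[OF sB continuous_apowr[OF ip] continuous_apowr[OF p]])
    then show ?thesis using p fc_abs[OF B0] by (simp add: apowr_apowr apowr_one)
  qed
  ultimately have "B * P = P" by simp
  then have "P * (B * P) = P * P" by simp
  moreover have "P * (B * P) = P - P * Q * P"
    by (simp add: B_def algebra_simps GD(4)[OF P] GD(4)[OF Q] proj_assoc[OF GD(2)[OF P]])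
  ultimately have "P * Q * P = 0" using GD(4)[OF P] by simp
  then have "star (Q * P) * (Q * P) = 0" 
    by (simp add: GD(5)[OF P] GD(5)[OF Q] proj_assoc[OF GD(2)[OF Q]] mult.assoc)
  then have "Q * P = 0" by (simp only: star_mult_eq_0)
  then show "P * Q = 0" using proj_orth_commute GD(2) P Q by blast
qed

end

section \<open>Coordinates\<close>

text \<open>Under \<open>coords P I w\<close> this operator maps \<open>P\<close> onto the graph and
  is \<open>sqrt (1 + card I)\<close> times a partial isometry; orthogonality of graphs is computed
  with it in place of the projection.\<close>

definition vec :: "'a :: complex_hilbert cop \<Rightarrow> nat set \<Rightarrow> (nat \<Rightarrow> 'a cop) \<Rightarrow> 'a cop" where
  "vec P I w = P + (\<Sum>i\<in>I. w i)"

text \<open>The projection onto \<open>{x + \<Sum>\<^sub>i w\<^sub>i x | x \<in> P}\<close>, for partial isometries \<open>w\<^sub>i\<close> with initial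
  projection \<open>P\<close> and mutually orthogonal ranges.\<close>

definition graph :: "'a :: complex_hilbert cop \<Rightarrow> nat set \<Rightarrow> (nat \<Rightarrow> 'a cop) \<Rightarrow> 'a cop" where
  "graph P I w = (1 / (1 + real (card I))) *\<^sub>R (vec P I w * star (vec P I w))"

text \<open>One half of the matrix with diagonal \<open>P, Q\<close> and off-diagonal entries
  \<open>u, star u\<close>: the graph of a single \<open>u\<close> from \<open>P\<close> to
  \<open>Q\<close>, with both projections expressed by \<open>u\<close>.\<close>

definition gr :: "'a :: complex_hilbert cop \<Rightarrow> 'a cop" where
  "gr u = (1 / 2) *\<^sub>R (star u * u + u * star u + u + star u)"

context tracial_factor
begin

definition U :: "'a cop \<Rightarrow> 'a cop \<Rightarrow> 'a cop set" where
  "U P Q = {u \<in> M. star u * u = P \<and> u * star u = Q}"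

lemma UD:
  assumes "u \<in> U P Q" "P \<in> G"
  shows "u \<in> M" "star u * u = P" "u * star u = Q" "u * P = u" "Q * u = u" "star u * Q = star u" "P * star u = star u"
    "Q \<in> G"
proof -
  show u: "u \<in> M" "star u * u = P" "u * star u = Q" using assms(1) by (auto simp: U_def)
  have p: "proj (star u * u)" using u(2) GD(2)[OF assms(2)] by simp
  show "u * P = u" using partial_isometry(1)[OF p] u(2) by simp
  then show "P * star u = star u" using GD(5)[OF assms(2)] by (metis star_simps(1))
  show "star u * Q = star u" using partial_isometry(3)[OF p] u(3) by simp
  show "Q * u = u" unfolding u(3)[symmetric] mult.assoc by (rule partial_isometry(1)[OF p])
  show "Q \<in> G" using G_range[OF u(1)] u(2,3) assms(2) by simp
qed

lemma U_star: "u \<in> U P Q \<Longrightarrow> star u \<in> U Q P"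
  by (auto simp: U_def)

lemma U_minus: "u \<in> U P Q \<Longrightarrow> - u \<in> U P Q"
  by (auto simp: U_def)

lemma U_mult: assumes "u \<in> U P Q" "v \<in> U Q R" "P \<in> G" shows "v * u \<in> U P R"
proof -
  note u = UD[OF assms(1,3)]
  note v = UD[OF assms(2) u(8)]
  have "star (v * u) * (v * u) = star u * (star v * v) * u" by (simp add: mult.assoc)
  moreover have "(v * u) * star (v * u) = v * (u * star u) * star v" by (simp add: mult.assoc)
  ultimately show ?thesis using u v by (simp add: U_def mult.assoc)
qed

lemma U_nonempty: "P \<in> G \<Longrightarrow> Q \<in> G \<Longrightarrow> \<exists>u. u \<in> U P Q"
  using G_equivalent[of P Q] by (auto simp: U_def)

text \<open>Orthogonality of ranges is stated as \<open>star (w j) * w i = 0\<close>, the form in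
  which products of two \<open>vec\<close> terms expand.\<close>

definition coords :: "'a cop \<Rightarrow> nat set \<Rightarrow> (nat \<Rightarrow> 'a cop) \<Rightarrow> bool" where
  "coords P I w \<longleftrightarrow> finite I \<and> P \<in> G \<and> (\<forall>i\<in>I. w i \<in> U P (w i * star (w i)) \<and> P * w i = 0 \<and>
     (\<forall>j\<in>I. j \<noteq> i \<longrightarrow> star (w j) * w i = 0))"

lemma coordsD:
  assumes "coords P I w"
  shows "finite I" "P \<in> G" "\<And>i. i \<in> I \<Longrightarrow> w i \<in> U P (w i * star (w i))" "\<And>i. i \<in> I \<Longrightarrow> P * w i = 0"
    "\<And>i j. i \<in> I \<Longrightarrow> j \<in> I \<Longrightarrow> j \<noteq> i \<Longrightarrow> star (w j) * w i = 0"
    "\<And>i. i \<in> I \<Longrightarrow> w i * star (w i) \<in> G" "\<And>i. i \<in> I \<Longrightarrow> star (w i) * P = 0"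
proof -
  show 1: "finite I" "P \<in> G" "\<And>i. i \<in> I \<Longrightarrow> w i \<in> U P (w i * star (w i))" "\<And>i. i \<in> I \<Longrightarrow> P * w i = 0"
    "\<And>i j. i \<in> I \<Longrightarrow> j \<in> I \<Longrightarrow> j \<noteq> i \<Longrightarrow> star (w j) * w i = 0"
    using assms by (auto simp: coords_def)
  show "w i * star (w i) \<in> G" if "i \<in> I" for i using UD(8)[OF 1(3)[OF that] 1(2)] .
  show "star (w i) * P = 0" if "i \<in> I" for i
    using 1(4)[OF that] GD(5)[OF 1(2)] by (metis star_simps(1,7))
qed

lemma vec_in: "coords P I w \<Longrightarrow> vec P I w \<in> M"
  unfolding vec_def by (intro M_closed(4) M_sum GD(1) UD(1)[OF coordsD(3) coordsD(2)] coordsD(2))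

lemma vec_right: assumes "coords P I w" shows "vec P I w * P = vec P I w"
proof -
  have "(\<Sum>i\<in>I. w i * P) = (\<Sum>i\<in>I. w i)"
    by (rule sum.cong) (use UD(4) coordsD(2,3)[OF assms] in auto)
  then show ?thesis using GD(4)[OF coordsD(2)[OF assms]] by (simp add: vec_def distrib_right sum_distrib_right)
qed

text \<open>Common final projections leave only the diagonal products. Together with
  \<open>graph_orth_iff\<close> this is the dictionary between orthogonality of two graphs and the
  vanishing of a sum of operators from \<open>P\<close> to \<open>Q\<close>.\<close>

lemma star_vec_mult:
  assumes v: "coords P I v" and w: "coords Q I w"
    and same: "\<And>i. i \<in> I \<Longrightarrow> v i * star (v i) = w i * star (w i)"
    and o: "\<And>i. i \<in> I \<Longrightarrow> Q * v i = 0" "\<And>i. i \<in> I \<Longrightarrow> P * w i = 0"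
  shows "star (vec Q I w) * vec P I v = Q * P + (\<Sum>i\<in>I. star (w i) * v i)"
proof -
  have cross: "star (w i) * v j = (if i = j then star (w i) * v i else 0)" if "i \<in> I" "j \<in> I" for i j
  proof (cases "i = j")
    case False
    have "star (w i) * v j = star (w i) * (w i * star (w i)) * v j"
      using UD(6)[OF coordsD(3)[OF w that(1)] coordsD(2)[OF w]] by simp
    also have "\<dots> = star (w i) * v i * (star (v i) * v j)"
      using same[OF that(1)] by (simp add: mult.assoc) (metis mult.assoc)
    also have "star (v i) * v j = 0" using coordsD(5)[OF v that(2,1)] False by simp
    finally show ?thesis using False by simp
  qed simp
  have wP: "star (w i) * P = 0" if "i \<in> I" for i
    using o(2)[OF that] GD(5)[OF coordsD(2)[OF v]] by (metis star_simps(1,7))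
  have "star (vec Q I w) = Q + (\<Sum>i\<in>I. star (w i))"
    using GD(5)[OF coordsD(2)[OF w]] by (simp add: vec_def star_sum)
  moreover have "(\<Sum>i\<in>I. star (w i)) * (\<Sum>j\<in>I. v j) = (\<Sum>i\<in>I. \<Sum>j\<in>I. star (w i) * v j)"
    by (rule sum_product)
  moreover have "(\<Sum>i\<in>I. star (w i)) * P = (\<Sum>i\<in>I. star (w i) * P)" by (rule sum_distrib_right)
  ultimately have "star (vec Q I w) * vec P I v = Q * P + Q * (\<Sum>j\<in>I. v j) + (\<Sum>i\<in>I. star (w i) * P) +
      (\<Sum>i\<in>I. \<Sum>j\<in>I. star (w i) * v j)"
    by (simp add: vec_def distrib_left distrib_right ac_simps)
  also have "Q * (\<Sum>j\<in>I. v j) = 0" using o(1) by (simp add: sum_distrib_left)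
  also have "(\<Sum>i\<in>I. star (w i) * P) = 0" using wP by simp
  also have "(\<Sum>i\<in>I. \<Sum>j\<in>I. star (w i) * v j) = (\<Sum>i\<in>I. star (w i) * v i)"
  proof (rule sum.cong)
    fix i assume i: "i \<in> I"
    have "(\<Sum>j\<in>I. star (w i) * v j) = (\<Sum>j\<in>I. if i = j then star (w i) * v i else 0)"
      by (rule sum.cong) (use cross[OF i] in auto)
    then show "(\<Sum>j\<in>I. star (w i) * v j) = star (w i) * v i"
      using i coordsD(1)[OF v] by simp
  qed simp
  finally show ?thesis by simp
qed

lemma star_vec_vec: assumes "coords P I w" shows "star (vec P I w) * vec P I w = (1 + real (card I)) *\<^sub>R P"
proof -
  have "star (vec P I w) * vec P I w = P * P + (\<Sum>i\<in>I. star (w i) * w i)"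
    by (rule star_vec_mult) (use assms coordsD(4) in auto)
  also have "(\<Sum>i\<in>I. star (w i) * w i) = (\<Sum>i\<in>I. P)"
    by (rule sum.cong) (use UD(2) coordsD(2,3)[OF assms] in auto)
  finally show ?thesis using GD(4)[OF coordsD(2)[OF assms]]
    by (simp add: scaleR_left_distrib sum_constant_scaleR)
qed

lemma graph_vec: assumes "coords P I w" shows "graph P I w * vec P I w = vec P I w"
proof -
  have "graph P I w * vec P I w = (1 / (1 + real (card I))) *\<^sub>R (vec P I w * (star (vec P I w) * vec P I w))"
    by (simp add: graph_def mult.assoc)
  then show ?thesis unfolding star_vec_vec[OF assms] by (simp add: vec_right[OF assms])
qed

lemma graph_in_G: assumes "coords P I w" shows "graph P I w \<in> G"
proof -
  \<comment> \<open>Normalised like this, \<open>V\<close> is a partial isometry with initial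
    projection \<open>P\<close>, so its range projection has trace \<open>c\<close>.\<close>
  define V where "V = (1 / sqrt (1 + real (card I))) *\<^sub>R vec P I w"
  have n: "1 / sqrt (1 + real (card I)) * (1 / sqrt (1 + real (card I))) = 1 / (1 + real (card I))"
    by simp
  have "star V * V = P" unfolding V_def by (simp add: star_vec_vec[OF assms])
  moreover have "V * star V = graph P I w" unfolding V_def graph_def by simp
  moreover have "V \<in> M" unfolding V_def using vec_in[OF assms] by auto
  ultimately show ?thesis using G_range[of V] coordsD(2)[OF assms] by simp
qed

lemma mult_graph_iff: assumes "coords P I w" shows "C * graph P I w = 0 \<longleftrightarrow> C * vec P I w = 0"
proof
  assume "C * graph P I w = 0"
  then show "C * vec P I w = 0" using graph_vec[OF assms] by (metis mult.assoc mult_zero_left)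
next
  assume "C * vec P I w = 0"
  then show "C * graph P I w = 0" by (simp add: graph_def flip: mult.assoc)
qed

lemma graph_orth_iff:
  assumes v: "coords P I v" and w: "coords Q J w"
  shows "graph Q J w * graph P I v = 0 \<longleftrightarrow> star (vec Q J w) * vec P I v = 0"
proof -
  have "graph Q J w * vec P I v = 0 \<longleftrightarrow> star (vec P I v) * graph Q J w = 0"
    using GD(5)[OF graph_in_G[OF w]] by (metis star_simps(1,7) star_star)
  also have "\<dots> \<longleftrightarrow> star (vec P I v) * vec Q J w = 0" by (rule mult_graph_iff[OF w])
  also have "\<dots> \<longleftrightarrow> star (vec Q J w) * vec P I v = 0" by (metis star_simps(1,7) star_star)
  finally show ?thesis unfolding mult_graph_iff[OF v] .
qed

lemma graph_covered:
  assumes "coords P I w" shows "covered (graph P I w) (insert P ((\<lambda>i. w i * star (w i)) ` I))"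
  unfolding covered_def
proof (intro ballI impI)
  fix R assume R: "R \<in> G" "\<forall>B\<in>insert P ((\<lambda>i. w i * star (w i)) ` I). R * B = 0"
  have "R * w i = 0" if "i \<in> I" for i
  proof -
    have "R * (w i * star (w i)) * w i = 0" using R(2) that by simp
    moreover have "(w i * star (w i)) * w i = w i" by (rule UD(5)[OF coordsD(3)[OF assms that] coordsD(2)[OF assms]])
    ultimately show ?thesis by (metis mult.assoc)
  qed
  then have "R * vec P I w = 0" using R(2) by (simp add: vec_def distrib_left sum_distrib_left)
  then show "R * graph P I w = 0" by (simp only: mult_graph_iff[OF assms])
qed

lemma U_orth: assumes "u \<in> U P Q" "P \<in> G" "R * Q = 0" shows "R * u = 0"
proof -
  have "R * u = R * Q * u" using UD(5)[OF assms(1,2)] by (simp add: mult.assoc)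
  then show ?thesis using assms(3) by simp
qed

lemma coords_single:
  assumes "P \<in> G" "u \<in> U P Q" "P * Q = 0" shows "coords P {i} (\<lambda>_. u)"
  using assms U_orth[OF assms(2,1,3)] by (simp add: coords_def UD(3)[OF assms(2,1)])

lemma gr_graph:
  assumes "P \<in> G" "u \<in> U P Q" "P * Q = 0" shows "gr u = graph P {i} (\<lambda>_. u)"
proof -
  have "(P + u) * star (P + u) = P * P + P * star u + u * P + u * star u"
    using GD(5)[OF assms(1)] by (simp add: distrib_left distrib_right add.assoc)
  then show ?thesis using UD[OF assms(2,1)] GD(4)[OF assms(1)]
    by (simp add: gr_def graph_def vec_def ac_simps)
qed

lemma gr_in_G: "P \<in> G \<Longrightarrow> u \<in> U P Q \<Longrightarrow> P * Q = 0 \<Longrightarrow> gr u \<in> G"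
  using gr_graph[of P u Q 0] graph_in_G[OF coords_single] by simp

lemma mult_gr_iff:
  assumes "P \<in> G" "u \<in> U P Q" "P * Q = 0" shows "C * gr u = 0 \<longleftrightarrow> C * (P + u) = 0"
  unfolding gr_graph[OF assms, of 0] mult_graph_iff[OF coords_single[OF assms]] by (simp add: vec_def)

lemma gr_mult_iff:
  assumes "P \<in> G" "u \<in> U P Q" "P * Q = 0" shows "gr u * C = 0 \<longleftrightarrow> (P + star u) * C = 0"
proof -
  have "gr u * C = 0 \<longleftrightarrow> star C * gr u = 0"
    using GD(5)[OF gr_in_G[OF assms]] by (metis star_simps(1,7) star_star)
  also have "\<dots> \<longleftrightarrow> star C * (P + u) = 0" by (rule mult_gr_iff[OF assms])
  also have "\<dots> \<longleftrightarrow> (P + star u) * C = 0"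
    using GD(5)[OF assms(1)] by (metis star_simps(1,2,7) star_star)
  finally show ?thesis .
qed

lemma gr_covered:
  assumes "P \<in> G" "u \<in> U P Q" "P * Q = 0" shows "covered (gr u) {P, Q}"
  using graph_covered[OF coords_single[OF assms, of 0]] UD(3)[OF assms(2,1)] gr_graph[OF assms, of 0]
  by simp

text \<open>The off-diagonal block of \<open>gr u\<close> is half of \<open>u\<close>, so a partial
  isometry can be read off from its graph.\<close>

lemma gr_corner:
  assumes "P \<in> G" "u \<in> U P Q" "P * Q = 0" shows "2 *\<^sub>R (Q * gr u * P) = u"
proof -
  note u = UD[OF assms(2,1)]
  have QP: "Q * P = 0" using proj_orth_commute GD(2) assms(1,3) u(8) by blast
  have 1: "Q * star u = 0" using u(7) QP by (metis mult.assoc mult_zero_left)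
  have "Q * (P + Q + u + star u) = Q + u" by (simp add: distrib_left QP 1 u(5) GD(4)[OF u(8)])
  then have "Q * (P + Q + u + star u) * P = u" by (simp add: distrib_right QP u(4))
  then show ?thesis unfolding gr_def u(2,3) by simp
qed

lemma gr_inject:
  assumes "P \<in> G" "u \<in> U P Q" "v \<in> U P Q" "P * Q = 0" "gr u = gr v" shows "u = v"
  using gr_corner[OF assms(1,2,4)] unfolding assms(5) gr_corner[OF assms(1,3,4)] by (rule sym)

text \<open>The covering condition splits \<open>X\<close> into components at \<open>P\<close> and
  at the final projections. Orthogonality to \<open>gr (- w i)\<close> says that component
  \<open>i\<close> is \<open>w i\<close> applied to the component at \<open>P\<close>. Hence
  \<open>X\<close> lies below the graph, and equal traces finish.\<close>

lemma graph_unique: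
  assumes w: "coords P I w" and X: "X \<in> G" and cov: "covered X (insert P ((\<lambda>i. w i * star (w i)) ` I))"
    and orth: "\<And>i. i \<in> I \<Longrightarrow> gr (- w i) * X = 0"
  shows "X = graph P I w"
proof -
  let ?R = "\<lambda>i. w i * star (w i)"
  have PR: "P * ?R i = 0" if "i \<in> I" for i using coordsD(4)[OF w that] by (simp flip: mult.assoc)
  have "(1 - P - (\<Sum>i\<in>I. ?R i)) * X = 0"
  proof (rule covered_kill[OF _ _ cov GD(5)[OF X]])
    show "finite (insert P (?R ` I))" "insert P (?R ` I) \<subseteq> G" using coordsD[OF w] by auto
    fix B assume "B \<in> insert P (?R ` I)"
    then consider "B = P" | j where "j \<in> I" "B = ?R j" by blast
    then show "(1 - P - (\<Sum>i\<in>I. ?R i)) * B = 0"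
    proof cases
      case 1
      have "?R i * P = 0" if "i \<in> I" for i using coordsD(7)[OF w that] by (simp add: mult.assoc)
      then show ?thesis using 1 GD(4)[OF coordsD(2)[OF w]] by (simp add: left_diff_distrib sum_distrib_right)
    next
      case (2 j)
      have "?R i * ?R j = (if i = j then ?R j else 0)" if "i \<in> I" for i
      proof (cases "i = j")
        case True
        then show ?thesis using GD(4)[OF coordsD(6)[OF w that]] by simp
      next
        case False
        have "?R i * ?R j = w i * (star (w i) * w j) * star (w j)" by (simp add: mult.assoc)
        then show ?thesis using coordsD(5)[OF w 2(1) that] False by simp
      qed
      then have "(\<Sum>i\<in>I. ?R i * ?R j) = ?R j"
        using 2(1) coordsD(1)[OF w] by simp
      then show ?thesis using 2 PR by (simp add: left_diff_distrib sum_distrib_right)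
    qed
  qed
  then have X1: "X = P * X + (\<Sum>i\<in>I. ?R i * X)"
    by (simp add: left_diff_distrib sum_distrib_right algebra_simps)
  have "?R i * X = w i * (P * X)" if i: "i \<in> I" for i
  proof -
    have "P * ?R i = 0" by (rule PR[OF i])
    then have "(P + star (- w i)) * X = 0"
      using gr_mult_iff[OF coordsD(2)[OF w] U_minus[OF coordsD(3)[OF w i]], of X] orth[OF i] by simp
    then have "P * X = star (w i) * X" by (simp add: algebra_simps)
    then show ?thesis by (simp add: mult.assoc)
  qed
  then have "X = P * X + (\<Sum>i\<in>I. w i * (P * X))" using X1 by (metis (no_types, lifting) sum.cong)
  also have "P * X = P * (P * X)" using GD(4)[OF coordsD(2)[OF w]] by (simp flip: mult.assoc)
  finally have "X = vec P I w * (P * X)"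
    using GD(4)[OF coordsD(2)[OF w]] by (simp add: vec_def distrib_right sum_distrib_right flip: mult.assoc)
  then have "graph P I w * X = X" using graph_vec[OF w] by (metis mult.assoc)
  then show ?thesis by (rule G_eqI[OF X graph_in_G[OF w]])
qed

text \<open>Covering and \<open>iso\<close> make both \<open>X * P * X\<close> and
  \<open>X * Q * X\<close> equal to half of \<open>X\<close>: the angle is the same in all
  directions. The compressions of \<open>2 *\<^sub>R X\<close> to \<open>P\<close> and
  \<open>Q\<close> are then \<open>P\<close> and \<open>Q\<close> themselves, and its off-diagonal
  corner is the partial isometry.\<close>

lemma isoclinic_gr:
  assumes P: "P \<in> G" and Q: "Q \<in> G" and PQ: "P * Q = 0" and X: "X \<in> G"
    and cov: "covered X {P, Q}" and iso: "X * (P - Q) * X = 0"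
  shows "\<exists>u\<in>U P Q. X = gr u"
proof -
  have QP: "Q * P = 0" using proj_orth_commute GD(2) P Q PQ by blast
  note p = GD(4,5)[OF P] and q = GD(4,5)[OF Q] and x = GD(4,5)[OF X]
  have "(1 - P - Q) * X = 0"
    by (rule covered_kill[OF _ _ cov x(2)]) (use P Q PQ QP p q in \<open>auto simp: left_diff_distrib\<close>)
  then have X1: "X = P * X + Q * X" by (simp add: algebra_simps)
  then have "star X = star (P * X + Q * X)" by simp
  then have X2: "X = X * P + X * Q" using p q x by simp
  have "X * X = X * P * X + X * Q * X" using X2 by (metis distrib_right)
  moreover have eq: "X * P * X = X * Q * X" using iso by (simp add: algebra_simps)
  ultimately have h: "2 *\<^sub>R (X * P * X) = X" "2 *\<^sub>R (X * Q * X) = X" using x by (simp_all add: scaleR_2)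
  \<comment> \<open>Twice \<open>A * X * A\<close> is a projection below \<open>A\<close>, and
    traciality gives it the trace of \<open>2 *\<^sub>R (X * A * X) = X\<close>, which is
    \<open>c\<close>.\<close>
  have corner: "2 *\<^sub>R (A * X * A) = A" if A: "A \<in> G" "2 *\<^sub>R (X * A * X) = X" for A
  proof -
    note a = GD(4,5)[OF A(1)]
    let ?f = "2 *\<^sub>R (A * X * A)"
    have "?f * ?f = 2 *\<^sub>R (A * (2 *\<^sub>R (X * A * X)) * A)"
      by (simp add: mult.assoc proj_assoc[OF GD(2)[OF A(1)]])
    then have "?f * ?f = ?f" unfolding A(2) .
    moreover have "star ?f = ?f" using a x by (simp add: mult.assoc)
    ultimately have "proj ?f" unfolding proj_def by (rule conjI)
    have "\<tau> (star (A * X) * (A * X)) = \<tau> (A * X * star (A * X))"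
      by (rule tr_star) (use GD(1) A X in auto)
    then have t: "\<tau> (X * A * X) = \<tau> (A * X * A)"
      by (simp add: a x mult.assoc proj_assoc[OF GD(2)[OF A(1)]] proj_assoc[OF GD(2)[OF X]])
    have "0 \<le> A * X * A" "0 \<le> X * A * X" using conj_proj GD(2) proj_pos A X by auto
    then have "\<tau> ?f = \<tau> (2 *\<^sub>R (X * A * X))"
      using tr_scale[of "A * X * A" 2] tr_scale[of "X * A * X" 2] t GD(1) A X by auto
    then have "\<tau> ?f = ennreal c" using A(2) GD(3)[OF X] by simp
    then have "?f \<in> G" using \<open>proj ?f\<close> GD(1) A X by (auto simp: G_def)
    moreover have "A * ?f = ?f" using a by (simp flip: mult.assoc)
    ultimately show ?thesis using G_eqI A(1) by blast
  qed
  define u where "u = 2 *\<^sub>R (Q * X * P)"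
  have su: "star u = 2 *\<^sub>R (P * X * Q)" using p q x by (simp add: u_def mult.assoc)
  have "star u * u = 2 *\<^sub>R (P * (2 *\<^sub>R (X * Q * X)) * P)"
    unfolding su by (simp add: u_def mult.assoc proj_assoc[OF GD(2)[OF Q]])
  then have uu: "star u * u = P" using h corner[OF P] by simp
  have "u * star u = 2 *\<^sub>R (Q * (2 *\<^sub>R (X * P * X)) * Q)"
    unfolding su by (simp add: u_def mult.assoc proj_assoc[OF GD(2)[OF P]])
  then have uu': "u * star u = Q" using h corner[OF Q] by simp
  have "u \<in> U P Q" using uu uu' GD(1) P Q X by (auto simp: U_def u_def)
  moreover have "gr u = X"
  proof -
    have "gr u = (1 / 2) *\<^sub>R (2 *\<^sub>R (P * X * P) + 2 *\<^sub>R (Q * X * Q) + u + star u)"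
      unfolding gr_def uu uu' using corner[OF P h(1)] corner[OF Q h(2)] by simp
    also have "\<dots> = P * X * P + Q * X * Q + Q * X * P + P * X * Q"
      unfolding su by (simp add: u_def scaleR_add_right)
    also have "\<dots> = (P + Q) * X * (P + Q)" by (simp add: algebra_simps)
    also have "\<dots> = X" using X1 X2 by (metis distrib_left distrib_right)
    finally show ?thesis .
  qed
  ultimately show ?thesis by blast
qed

end

section \<open>Recognising graphs by orthogonality\<close>

context tracial_factor
begin

lemma G_orth_sym: "P \<in> G \<Longrightarrow> Q \<in> G \<Longrightarrow> P * Q = 0 \<Longrightarrow> Q * P = 0"
  using proj_orth_commute GD(2) by blast

lemma covered_orth: "covered A S \<Longrightarrow> R \<in> G \<Longrightarrow> (\<And>B. B \<in> S \<Longrightarrow> R * B = 0) \<Longrightarrow> R * A = 0"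
  unfolding covered_def by blast

lemma coords_pair:
  assumes "P \<in> G" "u \<in> U P Q" "w \<in> U P R" "P * Q = 0" "P * R = 0" "Q * R = 0"
  shows "coords P {0, 1} (\<lambda>i. if i = 0 then u else w)"
proof -
  have QG: "Q \<in> G" "R \<in> G" using UD(8) assms(1-3) by auto
  have "star u * w = star u * Q * (R * w)" using UD(6)[OF assms(2,1)] UD(5)[OF assms(3,1)] by simp
  also have "\<dots> = star u * (Q * R) * w" by (simp add: mult.assoc)
  finally have 1: "star u * w = 0" using assms(6) by simp
  then have "star (star u * w) = 0" by simp
  then have "star w * u = 0" by simp
  then show ?thesis
    using assms 1 U_orth[OF assms(2,1,4)] U_orth[OF assms(3,1,5)]
    by (auto simp: coords_def UD(3)[OF assms(2,1)] UD(3)[OF assms(3,1)])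
qed

lemma vec_pair: "vec P {0, 1} (\<lambda>i. if i = 0 then u else w) = P + u + w"
  by (simp add: vec_def add.assoc)

lemma orthogonal_gr_minus:
  assumes "P \<in> G" "u \<in> U P Q" "P * Q = 0" shows "gr (- u) * gr u = 0"
proof -
  have "P * u = 0" by (rule U_orth[OF assms(2,1,3)])
  moreover have "star u * P = 0" using calculation GD(5)[OF assms(1)] by (metis star_simps(1,7))
  ultimately have "(P + star (- u)) * (P + u) = 0"
    using UD(2)[OF assms(2,1)] GD(4)[OF assms(1)] by (simp add: distrib_left left_diff_distrib)
  then have "(P + star (- u)) * gr u = 0" unfolding mult_gr_iff[OF assms] .
  then show ?thesis unfolding gr_mult_iff[OF assms(1) U_minus[OF assms(2)] assms(3)] .
qed

text \<open>The configuration that characterises \<open>x = gr u\<close> by orthogonality alone: \<open>y, y'\<close> and \<open>z, z'\<close>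
  play the roles of \<open>gr (\<plusminus> v)\<close> and \<open>gr (\<plusminus> v u)\<close>, and \<open>l0, l1\<close> those of the projections onto
  \<open>{\<xi> + u \<xi> \<plusminus> v u \<xi>}\<close>.\<close>

lemma isoclinic_configuration:
  assumes G: "p0 \<in> G" "p1 \<in> G" "p2 \<in> G" "y \<in> G" "y' \<in> G" "z \<in> G" "z' \<in> G" "l0 \<in> G" "l1 \<in> G" "x \<in> G"
    and o: "p0 * p2 = 0" "p1 * p2 = 0" "y' * y = 0" "p0 * y = 0" "p0 * y' = 0"
      "z' * z = 0" "p1 * z = 0" "p1 * z' = 0"
    and c: "covered l0 {y, p0}" "covered l1 {y', p0}" "covered l0 {z, p1}" "covered l1 {z', p1}"
      "covered x {l0, p2}" "covered x {l1, p2}"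
  shows "x * (p0 - p1) * x = 0"
proof -
  \<comment> \<open>Outside \<open>p\<close> the range of \<open>l0\<close> lies in that of
    \<open>y\<close> and the range of \<open>l1\<close> in that of \<open>y'\<close>, and these are
    orthogonal. Taking \<open>p0\<close> and \<open>p1\<close> for \<open>p\<close> and subtracting
    yields \<open>l1 * (p0 - p1) * l0 = 0\<close>.\<close>
  have half: "l1 * (1 - p) * l0 = 0"
    if p: "p \<in> G" and y: "y \<in> G" "y' \<in> G" "y' * y = 0" "p * y = 0" "p * y' = 0"
      and c: "covered l0 {y, p}" "covered l1 {y', p}" for p y y'
  proof -
    have pp: "(1 - p) * p = 0" using GD(4)[OF p] by (simp add: left_diff_distrib)
    have *: "(1 - p) * l = t * ((1 - p) * l)"
      if t: "t \<in> G" "p * t = 0" and l: "l \<in> G" "covered l {t, p}" for t l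
    proof -
      have "(1 - t) * (1 - p) * l = 0"
      proof (rule covered_kill[OF _ _ l(2) GD(5)[OF l(1)]])
        fix B assume "B \<in> {t, p}"
        moreover have "(1 - p) * t = t" using t(2) by (simp add: left_diff_distrib)
        then have "(1 - t) * (1 - p) * t = 0" using GD(4)[OF t(1)] by (simp add: mult.assoc left_diff_distrib)
        moreover have "(1 - t) * (1 - p) * p = 0" using pp by (simp add: mult.assoc)
        ultimately show "(1 - t) * (1 - p) * B = 0" by blast
      qed (use t p in auto)
      then show ?thesis by (simp add: mult.assoc left_diff_distrib)
    qed
    have a: "(1 - p) * l0 = y * ((1 - p) * l0)" by (rule *) (use y c G in auto)
    have "star ((1 - p) * l1) = star (y' * ((1 - p) * l1))" by (rule arg_cong[OF *]) (use y c G in auto)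
    moreover have "star ((1 - p) * l1) = l1 * (1 - p)" "star (y' * ((1 - p) * l1)) = l1 * (1 - p) * y'"
      using GD(5)[OF G(9)] GD(5)[OF p] GD(5)[OF y(2)] by (simp_all add: mult.assoc)
    ultimately have b: "l1 * (1 - p) = l1 * (1 - p) * y'" by (simp only:)
    have "l1 * (1 - p) * l0 = l1 * ((1 - p) * (1 - p)) * l0"
      using pp by (simp add: right_diff_distrib)
    also have "\<dots> = (l1 * (1 - p)) * ((1 - p) * l0)" by (simp only: mult.assoc)
    also have "\<dots> = (l1 * (1 - p) * y') * (y * ((1 - p) * l0))" using a b by simp
    also have "\<dots> = l1 * (1 - p) * (y' * y) * ((1 - p) * l0)" by (simp only: mult.assoc)
    finally show ?thesis using y(3) by simp
  qed
  define D where "D = p0 - p1"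
  have sD: "star D = D" using GD(5) G by (simp add: D_def)
  have Dp: "D * p2 = 0" using o by (simp add: D_def left_diff_distrib)
  have "l1 * (1 - p0) * l0 = 0" by (rule half) (use G o c in auto)
  moreover have "l1 * (1 - p1) * l0 = 0" by (rule half) (use G o c in auto)
  ultimately have "l1 * D * l0 = 0" by (simp add: D_def algebra_simps)
  \<comment> \<open>\<open>D\<close> kills \<open>p2\<close>, so the covering of \<open>x\<close> by
    \<open>l0, p2\<close> and, after passing to adjoints, by \<open>l1, p2\<close> replaces both
    outer factors by \<open>x\<close>.\<close>
  have "l1 * D * x = 0"
    by (rule covered_kill[OF _ _ c(5) GD(5)[OF G(10)]]) (use G \<open>l1 * D * l0 = 0\<close> Dp in \<open>auto simp: mult.assoc\<close>)
  then have "star (l1 * D * x) = 0" by simp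
  then have "x * D * l1 = 0" using sD GD(5) G by (simp add: mult.assoc)
  have "x * D * x = 0"
    by (rule covered_kill[OF _ _ c(6) GD(5)[OF G(10)]]) (use G \<open>x * D * l1 = 0\<close> Dp in \<open>auto simp: mult.assoc\<close>)
  then show ?thesis by (simp add: D_def)
qed

end

section \<open>Orthogonality preserving bijections of Grassmann spaces\<close>

locale grassmann_pair =
  F1: tracial_factor M1 \<tau>1 c + F2: tracial_factor M2 \<tau>2 c
  for M1 :: "'a :: complex_hilbert cop set" and \<tau>1 and c
    and M2 :: "'b :: complex_hilbert cop set" and \<tau>2 +
  fixes \<phi> :: "'a cop \<Rightarrow> 'b cop"
  assumes onto: "\<phi> ` F1.G = F2.G"
    and orth: "P \<in> F1.G \<Longrightarrow> Q \<in> F1.G \<Longrightarrow> P * Q = 0 \<longleftrightarrow> \<phi> P * \<phi> Q = 0"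
begin

lemma \<phi>_in: "P \<in> F1.G \<Longrightarrow> \<phi> P \<in> F2.G"
  using onto by blast

lemma \<phi>_orth: "P \<in> F1.G \<Longrightarrow> Q \<in> F1.G \<Longrightarrow> P * Q = 0 \<Longrightarrow> \<phi> P * \<phi> Q = 0"
  using orth by blast

text \<open>Every test projection on the image side is itself an image, so surjectivity and both
  directions of \<open>orth\<close> combine.\<close>

lemma \<phi>_covered:
  assumes A: "A \<in> F1.G" "S \<subseteq> F1.G" and c: "F1.covered A S"
  shows "F2.covered (\<phi> A) (\<phi> ` S)"
  unfolding F2.covered_def
proof (intro ballI impI)
  fix R assume R: "R \<in> F2.G" "\<forall>B\<in>\<phi> ` S. R * B = 0"
  then obtain T where T: "T \<in> F1.G" "R = \<phi> T" using onto by blast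
  have "T * B = 0" if "B \<in> S" for B using R T A(2) that orth[OF T(1), of B] by auto
  then have "T * A = 0" using F1.covered_orth[OF c T(1)] by blast
  then show "R * \<phi> A = 0" using \<phi>_orth T A by simp
qed

text \<open>Projections with equal images are orthogonal to the same members of \<open>G\<close>, so
  each of the two is covered by the other.\<close>

lemma \<phi>_inj: "inj_on \<phi> F1.G"
proof (rule inj_onI)
  fix P Q assume PQ: "P \<in> F1.G" "Q \<in> F1.G" "\<phi> P = \<phi> Q"
  have "F1.covered P {Q}" unfolding F1.covered_def using orth PQ by auto
  then have "(1 - Q) * P = 0"
    by (rule F1.covered_kill[rotated 2, OF _ F1.GD(5)[OF PQ(1)]])
      (use PQ F1.GD(4)[OF PQ(2)] in \<open>auto simp: left_diff_distrib\<close>)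
  then have "Q * P = P" by (simp add: left_diff_distrib)
  then show "P = Q" by (rule F1.G_eqI[OF PQ(1,2)])
qed

text \<open>A third projection \<open>R\<close> and a partial isometry from \<open>Q\<close> to
  \<open>R\<close> complete \<open>gr u\<close> to the pattern of
  \<open>isoclinic_configuration\<close>. Its relations are orthogonalities and coverings, so the
  images satisfy them too, and \<open>isoclinic_gr\<close> recognises the image as a graph.\<close>

lemma \<phi>_gr:
  assumes P: "P \<in> F1.G" and u: "u \<in> F1.U P Q" and PQ: "P * Q = 0"
  shows "\<exists>v\<in>F2.U (\<phi> P) (\<phi> Q). \<phi> (gr u) = gr v"
proof -
  have Q: "Q \<in> F1.G" by (rule F1.UD(8)[OF u P])
  obtain R where R: "R \<in> F1.G" "R * P = 0" "R * Q = 0"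
    using F1.G_avoid[of "{P, Q}"] P Q by auto
  have PR: "P * R = 0" and QR: "Q * R = 0" and QP: "Q * P = 0"
    using F1.G_orth_sym R P Q PQ by auto
  obtain v where v: "v \<in> F1.U Q R" using F1.U_nonempty[OF Q R(1)] by blast
  define w where "w = v * u"
  have w: "w \<in> F1.U P R" unfolding w_def by (rule F1.U_mult[OF u v P])
  have mv: "- v \<in> F1.U Q R" and mw: "- w \<in> F1.U P R" using F1.U_minus v w by auto
  define l0 where "l0 = graph P {0, 1} (\<lambda>i. if i = 0 then u else w)"
  define l1 where "l1 = graph P {0, 1} (\<lambda>i. if i = 0 then u else - w)"
  have c0: "F1.coords P {0, 1} (\<lambda>i. if i = 0 then u else w)" by (rule F1.coords_pair[OF P u w PQ PR QR])
  have c1: "F1.coords P {0, 1} (\<lambda>i. if i = 0 then u else - w)" by (rule F1.coords_pair[OF P u mw PQ PR QR])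
  have l0: "l0 \<in> F1.G" unfolding l0_def by (rule F1.graph_in_G[OF c0])
  have l1: "l1 \<in> F1.G" unfolding l1_def by (rule F1.graph_in_G[OF c1])
  have ml0: "T * l0 = 0 \<longleftrightarrow> T * (P + u + w) = 0" for T
    unfolding l0_def F1.mult_graph_iff[OF c0] F1.vec_pair ..
  have ml1: "T * l1 = 0 \<longleftrightarrow> T * (P + u - w) = 0" for T
    unfolding l1_def F1.mult_graph_iff[OF c1] F1.vec_pair by simp
  have gG: "gr u \<in> F1.G" "gr v \<in> F1.G" "gr (- v) \<in> F1.G" "gr w \<in> F1.G" "gr (- w) \<in> F1.G"
    using F1.gr_in_G P Q u v w mv mw PQ PR QR by blast+
  have Qu: "Q * u = u" and Rw: "R * w = w" using F1.UD(5)[OF u P] F1.UD(5)[OF w P] by auto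
  have Tu: "T * u = 0" if "T * Q = 0" for T by (rule F1.U_orth[OF u P that])
  have Tw: "T * w = 0" if "T * R = 0" for T by (rule F1.U_orth[OF w P that])
  have cov: "F1.covered l0 {gr v, P}" "F1.covered l1 {gr (- v), P}" "F1.covered l0 {gr w, Q}"
    "F1.covered l1 {gr (- w), Q}" "F1.covered (gr u) {l0, R}" "F1.covered (gr u) {l1, R}"
  proof -
    show "F1.covered l0 {gr v, P}" unfolding F1.covered_def
    proof (intro ballI impI)
      fix T assume "\<forall>B\<in>{gr v, P}. T * B = 0"
      then have T: "T * (Q + v) = 0" "T * P = 0" using F1.mult_gr_iff[OF Q v QR] by auto
      have "T * u + T * w = T * (Q + v) * u" using Qu by (simp add: w_def distrib_left distrib_right mult.assoc)
      then show "T * l0 = 0" unfolding ml0 using T by (simp add: distrib_left)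
    qed
    show "F1.covered l1 {gr (- v), P}" unfolding F1.covered_def
    proof (intro ballI impI)
      fix T assume "\<forall>B\<in>{gr (- v), P}. T * B = 0"
      then have T: "T * (Q + - v) = 0" "T * P = 0" using F1.mult_gr_iff[OF Q mv QR] by auto
      have "T * u - T * w = T * (Q + - v) * u"
        using Qu by (simp add: w_def right_diff_distrib left_diff_distrib mult.assoc)
      then show "T * l1 = 0" unfolding ml1 using T by (simp add: distrib_left right_diff_distrib)
    qed
    show "F1.covered l0 {gr w, Q}" unfolding F1.covered_def
      using F1.mult_gr_iff[OF P w PR] Tu by (auto simp: ml0 distrib_left)
    show "F1.covered l1 {gr (- w), Q}" unfolding F1.covered_def
      using F1.mult_gr_iff[OF P mw PR] Tu by (auto simp: ml1 distrib_left right_diff_distrib)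
    show "F1.covered (gr u) {l0, R}" unfolding F1.covered_def
      using F1.mult_gr_iff[OF P u PQ] Tw by (auto simp: ml0 distrib_left)
    show "F1.covered (gr u) {l1, R}" unfolding F1.covered_def
      using F1.mult_gr_iff[OF P u PQ] Tw by (auto simp: ml1 distrib_left right_diff_distrib)
  qed
  have pv: "P * gr v = 0" "P * gr (- v) = 0"
    using F1.covered_orth[OF F1.gr_covered[OF Q v QR] P] F1.covered_orth[OF F1.gr_covered[OF Q mv QR] P] PQ PR
    by auto
  have qw: "Q * gr w = 0" "Q * gr (- w) = 0"
    using F1.covered_orth[OF F1.gr_covered[OF P w PR] Q] F1.covered_orth[OF F1.gr_covered[OF P mw PR] Q] QP QR
    by auto
  have "\<phi> (gr u) * (\<phi> P - \<phi> Q) * \<phi> (gr u) = 0"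
  proof (rule F2.isoclinic_configuration)
    show "\<phi> P \<in> F2.G" "\<phi> Q \<in> F2.G" "\<phi> R \<in> F2.G" "\<phi> (gr v) \<in> F2.G" "\<phi> (gr (- v)) \<in> F2.G"
      "\<phi> (gr w) \<in> F2.G" "\<phi> (gr (- w)) \<in> F2.G" "\<phi> l0 \<in> F2.G" "\<phi> l1 \<in> F2.G" "\<phi> (gr u) \<in> F2.G"
      using \<phi>_in P Q R gG l0 l1 by auto
    show "\<phi> P * \<phi> R = 0" "\<phi> Q * \<phi> R = 0" "\<phi> P * \<phi> (gr v) = 0" "\<phi> P * \<phi> (gr (- v)) = 0"
      "\<phi> Q * \<phi> (gr w) = 0" "\<phi> Q * \<phi> (gr (- w)) = 0"
      using \<phi>_orth P Q R PR QR pv qw gG by auto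
    show "\<phi> (gr (- v)) * \<phi> (gr v) = 0" "\<phi> (gr (- w)) * \<phi> (gr w) = 0"
      using \<phi>_orth gG F1.orthogonal_gr_minus[OF Q v QR] F1.orthogonal_gr_minus[OF P w PR] by auto
    show "F2.covered (\<phi> l0) {\<phi> (gr v), \<phi> P}" "F2.covered (\<phi> l1) {\<phi> (gr (- v)), \<phi> P}"
      "F2.covered (\<phi> l0) {\<phi> (gr w), \<phi> Q}" "F2.covered (\<phi> l1) {\<phi> (gr (- w)), \<phi> Q}"
      "F2.covered (\<phi> (gr u)) {\<phi> l0, \<phi> R}" "F2.covered (\<phi> (gr u)) {\<phi> l1, \<phi> R}"
      using \<phi>_covered[OF l0 _ cov(1)] \<phi>_covered[OF l1 _ cov(2)] \<phi>_covered[OF l0 _ cov(3)]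
        \<phi>_covered[OF l1 _ cov(4)] \<phi>_covered[OF gG(1) _ cov(5)] \<phi>_covered[OF gG(1) _ cov(6)]
        gG P Q R l0 l1 by auto
  qed
  moreover have "F2.covered (\<phi> (gr u)) {\<phi> P, \<phi> Q}"
    using \<phi>_covered[OF gG(1) _ F1.gr_covered[OF P u PQ]] P Q by auto
  ultimately show ?thesis
    using F2.isoclinic_gr[OF \<phi>_in[OF P] \<phi>_in[OF Q] \<phi>_orth[OF P Q PQ] \<phi>_in[OF gG(1)]] by blast
qed

text \<open>The shape is that of \<open>gr_corner\<close>, with \<open>u * star u\<close> for
  \<open>Q\<close> and \<open>star u * u\<close> for \<open>P\<close>; an explicit formula avoids a
  choice.\<close>

definition \<theta> :: "'a cop \<Rightarrow> 'b cop" where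
  "\<theta> u = 2 *\<^sub>R (\<phi> (u * star u) * \<phi> (gr u) * \<phi> (star u * u))"

lemma
  assumes P: "P \<in> F1.G" and u: "u \<in> F1.U P Q" and PQ: "P * Q = 0"
  shows \<theta>_in: "\<theta> u \<in> F2.U (\<phi> P) (\<phi> Q)" and \<phi>_gr_\<theta>: "\<phi> (gr u) = gr (\<theta> u)"
proof -
  have Q: "Q \<in> F1.G" by (rule F1.UD(8)[OF u P])
  obtain v where v: "v \<in> F2.U (\<phi> P) (\<phi> Q)" "\<phi> (gr u) = gr v" using \<phi>_gr[OF assms] by blast
  have "\<theta> u = v" unfolding \<theta>_def v(2) F1.UD(2,3)[OF u P]
    by (rule F2.gr_corner[OF \<phi>_in[OF P] v(1) \<phi>_orth[OF P Q PQ]])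
  then show "\<theta> u \<in> F2.U (\<phi> P) (\<phi> Q)" "\<phi> (gr u) = gr (\<theta> u)" using v by auto
qed

lemma \<theta>_eqI:
  assumes P: "P \<in> F1.G" and u: "u \<in> F1.U P Q" and PQ: "P * Q = 0"
    and v: "v \<in> F2.U (\<phi> P) (\<phi> Q)" "\<phi> (gr u) = gr v"
  shows "\<theta> u = v"
  using F2.gr_inject[OF \<phi>_in[OF P] \<theta>_in[OF P u PQ] v(1) \<phi>_orth[OF P F1.UD(8)[OF u P] PQ]]
    \<phi>_gr_\<theta>[OF P u PQ] v(2) by simp

text \<open>\<open>gr (- u)\<close> is orthogonal to \<open>gr u\<close>. For the images this reads
  \<open>\<phi> P + star (\<theta> (- u)) * \<theta> u = 0\<close>, which only
  \<open>- \<theta> u\<close> satisfies.\<close>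

lemma \<theta>_minus:
  assumes P: "P \<in> F1.G" and u: "u \<in> F1.U P Q" and PQ: "P * Q = 0"
  shows "\<theta> (- u) = - \<theta> u"
proof -
  have Q: "Q \<in> F1.G" by (rule F1.UD(8)[OF u P])
  have mu: "- u \<in> F1.U P Q" by (rule F1.U_minus[OF u])
  note t = \<theta>_in[OF P u PQ] and mt = \<theta>_in[OF P mu PQ] and o = \<phi>_orth[OF P Q PQ] and p = \<phi>_in[OF P]
  note t' = F2.UD[OF t p] and mt' = F2.UD[OF mt p]
  have "\<phi> (gr (- u)) * \<phi> (gr u) = 0"
    using \<phi>_orth F1.orthogonal_gr_minus[OF P u PQ] F1.gr_in_G[OF P u PQ] F1.gr_in_G[OF P mu PQ] by blast
  then have "gr (\<theta> (- u)) * gr (\<theta> u) = 0" unfolding \<phi>_gr_\<theta>[OF P u PQ] \<phi>_gr_\<theta>[OF P mu PQ] .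
  then have "(\<phi> P + star (\<theta> (- u))) * (\<phi> P + \<theta> u) = 0"
    unfolding F2.gr_mult_iff[OF p mt o] F2.mult_gr_iff[OF p t o] .
  moreover have "\<phi> P * \<theta> u = 0" by (rule F2.U_orth[OF t p o])
  moreover have "star (\<theta> (- u)) * \<phi> P = 0"
    using F2.U_orth[OF mt p o] F2.GD(5)[OF p] by (metis star_simps(1,7))
  ultimately have "\<phi> P + star (\<theta> (- u)) * \<theta> u = 0"
    using F2.GD(4)[OF p] by (simp add: distrib_left distrib_right)
  then have "\<theta> (- u) * (\<phi> P + star (\<theta> (- u)) * \<theta> u) = 0" by simp
  then have "\<theta> (- u) * \<phi> P + (\<theta> (- u) * star (\<theta> (- u))) * \<theta> u = 0" by (simp add: distrib_left mult.assoc)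
  then have "\<theta> (- u) + \<theta> u = 0" unfolding mt'(3,4) t'(5) .
  then show ?thesis by (simp add: eq_neg_iff_add_eq_0)
qed

text \<open>\<open>F2.graph_unique\<close> is applied to \<open>\<phi> (graph P I w)\<close>: the
  covering is transported, and the graph is orthogonal to each \<open>gr (- w i)\<close>, whose
  image is known by \<open>\<theta>_minus\<close>.\<close>

lemma
  assumes w: "F1.coords P I w"
  shows \<theta>_coords: "F2.coords (\<phi> P) I (\<lambda>i. \<theta> (w i))"
    and \<phi>_graph: "\<phi> (graph P I w) = graph (\<phi> P) I (\<lambda>i. \<theta> (w i))"
    and \<theta>_range: "\<And>i. i \<in> I \<Longrightarrow> \<theta> (w i) * star (\<theta> (w i)) = \<phi> (w i * star (w i))"
proof -
  let ?R = "\<lambda>i. w i * star (w i)"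
  have P: "P \<in> F1.G" by (rule F1.coordsD(2)[OF w])
  have p: "\<phi> P \<in> F2.G" by (rule \<phi>_in[OF P])
  have R: "?R i \<in> F1.G" "P * ?R i = 0" "w i \<in> F1.U P (?R i)" if "i \<in> I" for i
    using F1.coordsD(3,4,6)[OF w that] by (simp_all flip: mult.assoc)
  have t: "\<theta> (w i) \<in> F2.U (\<phi> P) (\<phi> (?R i))" if "i \<in> I" for i by (rule \<theta>_in[OF P R(3,2)[OF that]])
  show range: "\<theta> (w i) * star (\<theta> (w i)) = \<phi> (?R i)" if "i \<in> I" for i
    by (rule F2.UD(3)[OF t[OF that] p])
  have po: "\<phi> P * \<phi> (?R i) = 0" if "i \<in> I" for i using \<phi>_orth P R that by blast
  have RR: "?R j * ?R i = 0" if "i \<in> I" "j \<in> I" "j \<noteq> i" for i j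
  proof -
    have "?R j * ?R i = w j * (star (w j) * w i) * star (w i)" by (simp only: mult.assoc)
    then show ?thesis using F1.coordsD(5)[OF w that] by simp
  qed
  have "star (\<theta> (w j)) * \<theta> (w i) = 0" if "i \<in> I" "j \<in> I" "j \<noteq> i" for i j
  proof -
    have "star (\<theta> (w j)) * \<theta> (w i) = (star (\<theta> (w j)) * \<phi> (?R j)) * (\<phi> (?R i) * \<theta> (w i))"
      using F2.UD(5)[OF t[OF that(1)] p] F2.UD(6)[OF t[OF that(2)] p] by simp
    also have "\<dots> = star (\<theta> (w j)) * (\<phi> (?R j) * \<phi> (?R i)) * \<theta> (w i)" by (simp only: mult.assoc)
    also have "\<phi> (?R j) * \<phi> (?R i) = 0" using \<phi>_orth R(1) RR that by blast
    finally show ?thesis by simp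
  qed
  then show coords: "F2.coords (\<phi> P) I (\<lambda>i. \<theta> (w i))"
    unfolding F2.coords_def using F1.coordsD(1)[OF w] p t range F2.U_orth[OF t p po] by simp
  show "\<phi> (graph P I w) = graph (\<phi> P) I (\<lambda>i. \<theta> (w i))"
  proof (rule F2.graph_unique[OF coords])
    have gG: "graph P I w \<in> F1.G" by (rule F1.graph_in_G[OF w])
    then show "\<phi> (graph P I w) \<in> F2.G" by (rule \<phi>_in)
    have "F2.covered (\<phi> (graph P I w)) (\<phi> ` insert P (?R ` I))"
      by (rule \<phi>_covered[OF gG _ F1.graph_covered[OF w]]) (use P R in auto)
    also have "\<phi> ` insert P (?R ` I) = insert (\<phi> P) ((\<lambda>i. \<theta> (w i) * star (\<theta> (w i))) ` I)"
      using range by (auto simp: image_image)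
    finally show "F2.covered (\<phi> (graph P I w)) (insert (\<phi> P) ((\<lambda>i. \<theta> (w i) * star (\<theta> (w i))) ` I))" .
    fix i assume i: "i \<in> I"
    have mw: "- w i \<in> F1.U P (?R i)" by (rule F1.U_minus[OF R(3)[OF i]])
    have "(P + star (- w i)) * vec P I w = P * P + (P * (\<Sum>j\<in>I. w j) - star (w i) * P - star (w i) * (\<Sum>j\<in>I. w j))"
      by (simp add: vec_def distrib_left left_diff_distrib)
    also have "P * (\<Sum>j\<in>I. w j) = 0" using F1.coordsD(4)[OF w] by (simp add: sum_distrib_left)
    also have "star (w i) * P = 0" by (rule F1.coordsD(7)[OF w i])
    also have "star (w i) * (\<Sum>j\<in>I. w j) = (\<Sum>j\<in>I. if j = i then P else 0)"
      unfolding sum_distrib_left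
      by (rule sum.cong) (use F1.coordsD(5)[OF w _ i] F1.UD(2)[OF R(3)[OF i] P] in auto)
    also have "\<dots> = P" using i F1.coordsD(1)[OF w] by simp
    finally have "(P + star (- w i)) * graph P I w = 0"
      unfolding F1.mult_graph_iff[OF w] using F1.GD(4)[OF P] by simp
    then have "gr (- w i) * graph P I w = 0" unfolding F1.gr_mult_iff[OF P mw R(2)[OF i]] .
    then have "\<phi> (gr (- w i)) * \<phi> (graph P I w) = 0"
      using \<phi>_orth gG F1.gr_in_G[OF P mw R(2)[OF i]] by blast
    then show "gr (- \<theta> (w i)) * \<phi> (graph P I w) = 0"
      unfolding \<phi>_gr_\<theta>[OF P mw R(2)[OF i]] \<theta>_minus[OF P R(3)[OF i] R(2)[OF i]] .
  qed
qed

text \<open>The vectors \<open>\<xi> + u \<xi> + v u \<xi>\<close> are orthogonal to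
  \<open>\<eta> - v \<eta>\<close> for \<open>\<eta>\<close> in \<open>Q\<close>, since the
  contributions of \<open>u \<xi>\<close> and \<open>v u \<xi>\<close> cancel. The image of this
  single orthogonality says
  \<open>\<theta> u = star (\<theta> v) * \<theta> (v * u)\<close>.\<close>

lemma \<theta>_mult:
  assumes P: "P \<in> F1.G" and u: "u \<in> F1.U P Q" and v: "v \<in> F1.U Q R"
    and o: "P * Q = 0" "P * R = 0" "Q * R = 0"
  shows "\<theta> (v * u) = \<theta> v * \<theta> u"
proof -
  have Q: "Q \<in> F1.G" by (rule F1.UD(8)[OF u P])
  have R: "R \<in> F1.G" by (rule F1.UD(8)[OF v Q])
  let ?w = "\<lambda>i :: nat. if i = 0 then u else v * u"
  have vu: "v * u \<in> F1.U P R" by (rule F1.U_mult[OF u v P])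
  have c: "F1.coords P {0, 1} ?w" by (rule F1.coords_pair[OF P u vu o])
  have mv: "- v \<in> F1.U Q R" by (rule F1.U_minus[OF v])
  have "gr (- v) * P = 0"
    using F1.covered_orth[OF F1.gr_covered[OF Q mv o(3)] P] o F1.G_orth_sym[OF P F1.gr_in_G[OF Q mv o(3)]] by auto
  then have "(Q + star (- v)) * P = 0" unfolding F1.gr_mult_iff[OF Q mv o(3)] .
  moreover have "(Q + star (- v)) * (u + v * u) = 0"
  proof -
    have "Q * v = 0" by (rule F1.U_orth[OF v Q o(3)])
    moreover have "star v * Q = 0" using calculation F1.GD(5)[OF Q] by (metis star_simps(1,7))
    moreover have "(Q + star (- v)) * (u + v * u) = (Q + star (- v)) * (Q + v) * u"
      using F1.UD(5)[OF u P] by (simp add: distrib_left distrib_right mult.assoc left_diff_distrib)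
    ultimately show ?thesis
      using F1.GD(4)[OF Q] F1.UD(2)[OF v Q] by (simp add: distrib_left left_diff_distrib)
  qed
  ultimately have "(Q + star (- v)) * graph P {0, 1} ?w = 0"
    unfolding F1.mult_graph_iff[OF c] F1.vec_pair by (simp add: distrib_left add.assoc)
  then have "gr (- v) * graph P {0, 1} ?w = 0" unfolding F1.gr_mult_iff[OF Q mv o(3)] .
  then have "\<phi> (gr (- v)) * \<phi> (graph P {0, 1} ?w) = 0"
    using \<phi>_orth F1.gr_in_G[OF Q mv o(3)] F1.graph_in_G[OF c] by blast
  note p = \<phi>_in[OF P] and q = \<phi>_in[OF Q] and qr = \<phi>_orth[OF Q R o(3)]
  note tu = \<theta>_in[OF P u o(1)] and tv = \<theta>_in[OF Q v o(3)] and tw = \<theta>_in[OF P vu o(2)]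
  have "\<phi> (gr (- v)) * \<phi> (graph P {0, 1} ?w) = 0" by fact
  then have "(\<phi> Q + star (- \<theta> v)) * vec (\<phi> P) {0, 1} (\<lambda>i. \<theta> (?w i)) = 0"
    unfolding \<phi>_graph[OF c] \<phi>_gr_\<theta>[OF Q mv o(3)] \<theta>_minus[OF Q v o(3)]
      F2.gr_mult_iff[OF q F2.U_minus[OF tv] qr] F2.mult_graph_iff[OF \<theta>_coords[OF c]] .
  then have e: "(\<phi> Q - star (\<theta> v)) * (\<phi> P + \<theta> u + \<theta> (v * u)) = 0" by (simp add: vec_def add.assoc)
  have "\<phi> Q * \<phi> P = 0" using \<phi>_orth F1.G_orth_sym P Q o(1) by blast
  moreover have "\<phi> Q * \<theta> (v * u) = 0" by (rule F2.U_orth[OF tw p qr])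
  moreover have "star (\<theta> v) * \<phi> P = 0" "star (\<theta> v) * \<theta> u = 0"
  proof -
    have s: "star (\<theta> v) = star (\<theta> v) * \<phi> R" using F2.UD(6)[OF tv q] by simp
    have rp: "\<phi> R * \<phi> P = 0" "\<phi> R * \<phi> Q = 0" using \<phi>_orth F1.G_orth_sym P Q R o by blast+
    have "star (\<theta> v) * \<phi> P = star (\<theta> v) * (\<phi> R * \<phi> P)" using s by (metis mult.assoc)
    then show "star (\<theta> v) * \<phi> P = 0" using rp by simp
    have "star (\<theta> v) * \<theta> u = star (\<theta> v) * (\<phi> R * \<theta> u)" using s by (metis mult.assoc)
    then show "star (\<theta> v) * \<theta> u = 0" using F2.U_orth[OF tu p rp(2)] by simp
  qed
  ultimately have "\<theta> u = star (\<theta> v) * \<theta> (v * u)"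
    using e F2.UD(5)[OF tu p] by (simp add: distrib_left left_diff_distrib)
  then have "\<theta> v * \<theta> u = (\<theta> v * star (\<theta> v)) * \<theta> (v * u)" by (simp add: mult.assoc)
  then show ?thesis using F2.UD(3)[OF tv q] F2.UD(5)[OF tw p] by simp
qed

end

section \<open>Operators as sums of unitaries\<close>

context vna
begin

text \<open>A self-adjoint contraction \<open>k\<close> below \<open>P\<close> is the real part of
  \<open>k + \<i> s\<close> with \<open>s = csqrt (P - k * k)\<close>, and this is unitary in the
  corner at \<open>P\<close>.\<close>

lemma selfadjoint_unitary_sum:
  assumes P: "P \<in> M" "proj P" and h: "h \<in> M" "star h = h" "P * h = h"
  shows "\<exists>us. set us \<subseteq> {u \<in> M. star u * u = P \<and> u * star u = P} \<and> sum_list us = h"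
proof -
  obtain n :: nat where n: "norm h \<le> real n" using real_arch_simple by blast
  \<comment> \<open>\<open>Suc\<close> keeps \<open>m\<close> positive. Division by
    \<open>2 * m\<close> makes \<open>k\<close> a contraction and lets \<open>m\<close> copies of
    \<open>u\<close> and \<open>m\<close> copies of \<open>star u\<close> add up to \<open>h\<close>
    without any scalar factor.\<close>
  define m where "m = Suc n"
  define k where "k = (1 / (2 * real m)) *\<^sub>R h"
  have k: "k \<in> M" "star k = k" "P * k = k" using h by (auto simp: k_def)
  have "star (P * k) = star k" using k(3) by simp
  then have kP: "k * P = k" using k(2) projD(2)[OF P(2)] by simp
  have nk: "norm k \<le> 1"
  proof -
    have "norm k = norm h / (2 * real m)" by (simp add: k_def)
    also have "\<dots> \<le> 1" using n by (simp add: m_def field_simps)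
    finally show ?thesis .
  qed
  have "k * k \<le> 1"
  proof (rule leI_cop)
    fix x
    have "Re (cinner ((k * k) \<cdot> x) x) = (norm (k \<cdot> x))\<^sup>2" using norm_app_sq[of k x] k(2) by simp
    also have "\<dots> \<le> (1 * norm x)\<^sup>2"
      by (intro power_mono order_trans[OF norm_app] mult_right_mono nk) simp_all
    finally show "Re (cinner ((k * k) \<cdot> x) x) \<le> Re (cinner (1 \<cdot> x) x)" by (simp add: norm_sq_cinner)
  qed (use k in auto)
  then have "star P * (k * k) * P \<le> star P * 1 * P" by (rule conj_mono)
  then have le: "0 \<le> P - k * k"
    using projD[OF P(2)] k(3) kP by (simp add: mult.assoc) (simp flip: mult.assoc)
  define s where "s = csqrt (P - k * k)"
  have s: "s \<in> M" "star s = s" "s * s = P - k * k"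
    unfolding s_def using csqrt_in[OF _ le] csqrt_selfadj[OF le] csqrt_sq[OF le] P k by auto
  have sk: "s * k = k * s"
    unfolding s_def using k(3) kP by (intro csqrt_commute le) (simp add: left_diff_distrib right_diff_distrib mult.assoc)
  define u where "u = k + cof \<i> * s"
  have su: "star u = k - cof \<i> * s"
    using k(2) s(2) by (simp add: u_def cof_commute cof_simps)
  have ii: "cof \<i> * (cof \<i> * A) = - A" for A :: "'a cop"
    by (simp add: cof_simps flip: mult.assoc cof_simps(4))
  have com: "A * (cof \<i> * B) = cof \<i> * (A * B)" for A B :: "'a cop"
    by (metis cof_commute mult.assoc)
  have "star u * u = P" "u * star u = P"
    unfolding su using s(3) sk ii by (simp_all add: u_def algebra_simps com[of k] com[of s])
  moreover have "u \<in> M" unfolding u_def using k s by auto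
  ultimately have uU: "u \<in> {u \<in> M. star u * u = P \<and> u * star u = P}"
    "star u \<in> {u \<in> M. star u * u = P \<and> u * star u = P}" by auto
  have rep: "sum_list (replicate j A) = real j *\<^sub>R A" for j and A :: "'a cop"
    by (induction j) (simp_all add: scaleR_left_distrib)
  have "sum_list (replicate m u @ replicate m (star u)) = real m *\<^sub>R (u + star u)"
    by (simp add: rep scaleR_add_right)
  also have "u + star u = 2 *\<^sub>R k" unfolding su by (simp add: u_def scaleR_2)
  also have "real m *\<^sub>R (2 *\<^sub>R k) = h"
  proof -
    have "real m \<noteq> 0" by (simp add: m_def)
    then show ?thesis by (simp add: k_def)
  qed
  finally have "sum_list (replicate m u @ replicate m (star u)) = h" .
  moreover have "set (replicate m u @ replicate m (star u)) \<subseteq> {u \<in> M. star u * u = P \<and> u * star u = P}"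
    using uU by (auto simp: set_replicate_conv_if)
  ultimately show ?thesis by blast
qed

text \<open>Real and imaginary parts are treated separately, and the factor \<open>\<i>\<close> is
  absorbed into the unitaries. Sums instead of linear combinations matter: the map to be extended is
  not yet known to respect scalars.\<close>

lemma unitary_sum:
  assumes P: "P \<in> M" "proj P" and A: "A \<in> M" "P * A = A" "A * P = A"
  shows "\<exists>us. set us \<subseteq> {u \<in> M. star u * u = P \<and> u * star u = P} \<and> sum_list us = A"
proof -
  have "star (A * P) = star A" using A by simp
  then have PA: "P * star A = star A" using projD(2)[OF P(2)] by simp
  define h1 where "h1 = (1 / 2) *\<^sub>R (A + star A)"
  define h2 where "h2 = (1 / 2) *\<^sub>R (cof (- \<i>) * (A - star A))"
  have com: "P * (cof z * C) = cof z * (P * C)" for z and C :: "'a cop" by (metis cof_commute mult.assoc)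
  have h1: "h1 \<in> M" "star h1 = h1" "P * h1 = h1" using A PA by (auto simp: h1_def distrib_left)
  have h2: "h2 \<in> M" "star h2 = h2" "P * h2 = h2"
    using A PA by (auto simp: h2_def right_diff_distrib left_diff_distrib com cof_commute[of A]
        cof_commute[of "star A"] cof_simps)
  obtain us1 where us1: "set us1 \<subseteq> {u \<in> M. star u * u = P \<and> u * star u = P}" "sum_list us1 = h1"
    using selfadjoint_unitary_sum[OF P h1] by blast
  obtain us2 where us2: "set us2 \<subseteq> {u \<in> M. star u * u = P \<and> u * star u = P}" "sum_list us2 = h2"
    using selfadjoint_unitary_sum[OF P h2] by blast
  have ii: "cof \<i> * (cof (- \<i>) * B) = B" "cof (- \<i>) * (cof \<i> * B) = B" for B :: "'a cop"
    by (simp_all flip: mult.assoc cof_simps(4))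
  have "sum_list (map ((*) (cof \<i>)) us2) = cof \<i> * h2"
    unfolding us2(2)[symmetric] by (simp add: sum_list_const_mult)
  also have "\<dots> = (1 / 2) *\<^sub>R (A - star A)" by (simp add: h2_def ii)
  finally have "sum_list (us1 @ map ((*) (cof \<i>)) us2) = A"
    using us1(2) by (simp add: h1_def flip: scaleR_add_right scaleR_2)
  moreover have "set (us1 @ map ((*) (cof \<i>)) us2) \<subseteq> {u \<in> M. star u * u = P \<and> u * star u = P}"
  proof -
    have "star (cof \<i> * u) * (cof \<i> * u) = star u * u" for u :: "'a cop"
      by (simp add: ii mult.assoc)
    moreover have "(cof \<i> * u) * star (cof \<i> * u) = u * star u" for u :: "'a cop"
    proof -
      have "(cof \<i> * u) * star (cof \<i> * u) = cof \<i> * ((u * star u) * cof (- \<i>))" by (simp add: mult.assoc)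
      then show ?thesis unfolding cof_commute[of "u * star u"] ii .
    qed
    ultimately show ?thesis using us1(1) us2(1) by auto
  qed
  ultimately show ?thesis by blast
qed

end

section \<open>Spaces of operators between two projections\<close>

context tracial_factor
begin

definition hom :: "'a cop \<Rightarrow> 'a cop \<Rightarrow> 'a cop set" where
  "hom P Q = {A \<in> M. Q * A = A \<and> A * P = A}"

lemma homD: "A \<in> hom P Q \<Longrightarrow> A \<in> M" "A \<in> hom P Q \<Longrightarrow> Q * A = A" "A \<in> hom P Q \<Longrightarrow> A * P = A"
  by (auto simp: hom_def)

lemma hom_mult: assumes A: "A \<in> hom P Q" and B: "B \<in> hom Q R" shows "B * A \<in> hom P R"
proof -
  have "R * (B * A) = (R * B) * A" "(B * A) * P = B * (A * P)" by (simp_all only: mult.assoc)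
  then show ?thesis using homD[OF A] homD[OF B] by (simp add: hom_def M_closed(7))
qed

lemma U_hom: "u \<in> U P Q \<Longrightarrow> P \<in> G \<Longrightarrow> u \<in> hom P Q"
  using UD[of u P Q] by (auto simp: hom_def)

text \<open>Multiplication by \<open>star u\<close>, for some \<open>u\<close> from \<open>P\<close>
  to \<open>Q\<close>, moves \<open>A\<close> into the corner at \<open>P\<close>, where it is a sum
  of unitaries; multiplication by \<open>u\<close> moves them back.\<close>

lemma hom_sum:
  assumes P: "P \<in> G" and Q: "Q \<in> G" and A: "A \<in> hom P Q"
  shows "\<exists>us. set us \<subseteq> U P Q \<and> sum_list us = A"
proof -
  obtain u where u: "u \<in> U P Q" using U_nonempty[OF P Q] by blast
  note u' = UD[OF u P]
  have "\<exists>us. set us \<subseteq> {v \<in> M. star v * v = P \<and> v * star v = P} \<and> sum_list us = star u * A"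
    by (rule unitary_sum) (use P GD u' homD[OF A] in \<open>auto simp: mult.assoc[symmetric]\<close>, simp add: mult.assoc)
  then obtain us where us: "set us \<subseteq> {v \<in> M. star v * v = P \<and> v * star v = P}" "sum_list us = star u * A"
    by blast
  have "set (map ((*) u) us) \<subseteq> U P Q" using us(1) U_mult[OF _ u P] by (auto simp: U_def[of P P])
  moreover have "sum_list (map ((*) u) us) = A"
  proof -
    have "sum_list (map ((*) u) us) = u * star u * A"
      using us(2) by (simp add: sum_list_const_mult mult.assoc)
    then show ?thesis unfolding u'(3) homD(2)[OF A] .
  qed
  ultimately show ?thesis by blast
qed

lemma G_orthogonal_sequence:
  assumes S: "finite S" "S \<subseteq> G"
  shows "\<exists>R :: nat \<Rightarrow> 'a cop. (\<forall>i<n. R i \<in> G \<and> (\<forall>B\<in>S. R i * B = 0)) \<and> (\<forall>i<n. \<forall>j<n. i \<noteq> j \<longrightarrow> R i * R j = 0)"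
proof (induction n)
  case (Suc n)
  then obtain R :: "nat \<Rightarrow> 'a cop" where R: "\<forall>i<n. R i \<in> G \<and> (\<forall>B\<in>S. R i * B = 0)"
    "\<forall>i<n. \<forall>j<n. i \<noteq> j \<longrightarrow> R i * R j = 0" by blast
  obtain T where T: "T \<in> G" "\<forall>B\<in>S \<union> R ` {..<n}. T * B = 0"
    using G_avoid[of "S \<union> R ` {..<n}"] S R(1) by auto
  have T': "T * R i = 0" "R i * T = 0" if "i < n" for i
    using T R(1) that G_orth_sym[OF T(1)] by auto
  show ?case
  proof (intro exI[of _ "R(n := T)"] conjI)
    show "\<forall>i<Suc n. (R(n := T)) i \<in> G \<and> (\<forall>B\<in>S. (R(n := T)) i * B = 0)"
      using R(1) T by (auto simp: less_Suc_eq)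
    show "\<forall>i<Suc n. \<forall>j<Suc n. i \<noteq> j \<longrightarrow> (R(n := T)) i * (R(n := T)) j = 0"
      using R(2) T' by (auto simp: less_Suc_eq)
  qed
qed simp

end

section \<open>The functor on partial isometries\<close>

context grassmann_pair
begin

text \<open>The facts about \<open>\<theta>\<close> require \<open>P * Q = 0\<close>. For arbitrary
  \<open>P, Q\<close> the partial isometry is factored as \<open>u = star (w * star u) * w\<close>
  through some \<open>R\<close> orthogonal to both, and \<open>\<theta>\<close> is applied to the
  two legs; the choice is harmless by \<open>hat_independent\<close>.\<close>

definition hat :: "'a cop \<Rightarrow> 'b cop" where
  "hat u = (SOME v. \<exists>R w. R \<in> F1.G \<and> R * (star u * u) = 0 \<and> R * (u * star u) = 0 \<and>
     w \<in> F1.U (star u * u) R \<and> v = star (\<theta> (w * star u)) * \<theta> w)"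

text \<open>For orthogonal \<open>R\<close> and \<open>S\<close> the legs of the two factorisations
  differ by \<open>\<theta> (v * star w)\<close>, which cancels by \<open>\<theta>_mult\<close>. In
  general both are compared with a third choice that is orthogonal to all projections
  involved.\<close>

lemma hat_independent:
  assumes P: "P \<in> F1.G" and u: "u \<in> F1.U P Q"
    and R: "R \<in> F1.G" "R * P = 0" "R * Q = 0" and w: "w \<in> F1.U P R"
    and S: "S \<in> F1.G" "S * P = 0" "S * Q = 0" and v: "v \<in> F1.U P S"
  shows "star (\<theta> (w * star u)) * \<theta> w = star (\<theta> (v * star u)) * \<theta> v"
proof -
  have Q: "Q \<in> F1.G" by (rule F1.UD(8)[OF u P])
  have *: "star (\<theta> (w * star u)) * \<theta> w = star (\<theta> (v * star u)) * \<theta> v"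
    if R: "R \<in> F1.G" "R * P = 0" "R * Q = 0" and w: "w \<in> F1.U P R"
      and S: "S \<in> F1.G" "S * P = 0" "S * Q = 0" and v: "v \<in> F1.U P S" and RS: "R * S = 0" for R S w v
  proof -
    have o: "P * R = 0" "P * S = 0" "Q * R = 0" "Q * S = 0" using F1.G_orth_sym P Q R S by blast+
    define z where "z = v * star w"
    have z: "z \<in> F1.U R S" unfolding z_def by (rule F1.U_mult[OF F1.U_star[OF w] v R(1)])
    have zw: "z * w = v" unfolding z_def using F1.UD(2)[OF w P] F1.UD(4)[OF v P] by (simp add: mult.assoc)
    have wu: "w * star u \<in> F1.U Q R" by (rule F1.U_mult[OF F1.U_star[OF u] w Q])
    have "\<theta> v = \<theta> z * \<theta> w" using \<theta>_mult[OF P w z o(1,2) RS] zw by simp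
    moreover have "\<theta> (v * star u) = \<theta> z * \<theta> (w * star u)"
      using \<theta>_mult[OF Q wu z o(3,4) RS] zw by (simp flip: mult.assoc)
    ultimately have "star (\<theta> (v * star u)) * \<theta> v = star (\<theta> (w * star u)) * (star (\<theta> z) * \<theta> z) * \<theta> w"
      by (simp add: mult.assoc)
    also have "star (\<theta> z) * \<theta> z = \<phi> R" by (rule F2.UD(2)[OF \<theta>_in[OF R(1) z RS] \<phi>_in[OF R(1)]])
    also have "star (\<theta> (w * star u)) * \<phi> R * \<theta> w = star (\<theta> (w * star u)) * \<theta> w"
      using F2.UD(5)[OF \<theta>_in[OF P w o(1)] \<phi>_in[OF P]] by (simp add: mult.assoc)
    finally show ?thesis by simp
  qed
  obtain T where T: "T \<in> F1.G" "\<forall>B\<in>{P, Q, R, S}. T * B = 0" using F1.G_avoid[of "{P, Q, R, S}"] P Q R S by auto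
  obtain t where t: "t \<in> F1.U P T" using F1.U_nonempty[OF P T(1)] by blast
  have T': "T * P = 0" "T * Q = 0" "R * T = 0" "S * T = 0" using T F1.G_orth_sym[OF T(1)] R S by auto
  show ?thesis using *[OF R w T(1) T'(1,2) t T'(3)] *[OF S v T(1) T'(1,2) t T'(4)] by simp
qed

lemma hat_eq:
  assumes P: "P \<in> F1.G" and u: "u \<in> F1.U P Q" and R: "R \<in> F1.G" "R * P = 0" "R * Q = 0" and w: "w \<in> F1.U P R"
  shows "hat u = star (\<theta> (w * star u)) * \<theta> w"
proof -
  have "\<exists>R w. R \<in> F1.G \<and> R * P = 0 \<and> R * Q = 0 \<and> w \<in> F1.U P R \<and> hat u = star (\<theta> (w * star u)) * \<theta> w"
    unfolding hat_def F1.UD(2,3)[OF u P] by (rule someI_ex) (use R w in blast)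
  then obtain S v where S: "S \<in> F1.G" "S * P = 0" "S * Q = 0" "v \<in> F1.U P S" "hat u = star (\<theta> (v * star u)) * \<theta> v"
    by blast
  then show ?thesis using hat_independent[OF P u S(1-4) R w] by simp
qed

lemma hat_witness:
  assumes "P \<in> F1.G" "finite S" "S \<subseteq> F1.G"
  shows "\<exists>R w. R \<in> F1.G \<and> (\<forall>B\<in>S. R * B = 0 \<and> B * R = 0) \<and> w \<in> F1.U P R"
proof -
  obtain R where R: "R \<in> F1.G" "\<forall>B\<in>S. R * B = 0" using F1.G_avoid[OF assms(2,3)] by blast
  moreover obtain w where "w \<in> F1.U P R" using F1.U_nonempty[OF assms(1) R(1)] by blast
  ultimately show ?thesis using F1.G_orth_sym[OF R(1)] assms(3) by blast
qed

lemma
  assumes P: "P \<in> F1.G" and u: "u \<in> F1.U P Q"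
  shows hat_in: "hat u \<in> F2.U (\<phi> P) (\<phi> Q)" and hat_star: "hat (star u) = star (hat u)"
    and hat_minus: "hat (- u) = - hat u"
proof -
  have Q: "Q \<in> F1.G" by (rule F1.UD(8)[OF u P])
  obtain R w where R: "R \<in> F1.G" "R * P = 0" "R * Q = 0" "P * R = 0" "Q * R = 0" and w: "w \<in> F1.U P R"
    using hat_witness[OF P, of "{P, Q}"] P Q by auto
  have wu: "w * star u \<in> F1.U Q R" by (rule F1.U_mult[OF F1.U_star[OF u] w Q])
  note h = hat_eq[OF P u R(1-3) w]
  note t = \<theta>_in[OF P w R(4)] and t' = \<theta>_in[OF Q wu R(5)]
  show "hat u \<in> F2.U (\<phi> P) (\<phi> Q)"
    unfolding h by (rule F2.U_mult[OF t F2.U_star[OF t'] \<phi>_in[OF P]])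
  have "w * star u * u = w" using F1.UD(2)[OF u P] F1.UD(4)[OF w P] by (simp add: mult.assoc)
  then show "hat (star u) = star (hat u)"
    unfolding h using hat_eq[OF Q F1.U_star[OF u] R(1,3,2) wu] by simp
  have "\<theta> (- (w * star u)) = - \<theta> (w * star u)" by (rule \<theta>_minus[OF Q wu R(5)])
  then show "hat (- u) = - hat u" unfolding h using hat_eq[OF P F1.U_minus[OF u] R(1-3) w] by simp
qed

text \<open>A single \<open>R\<close> that avoids \<open>P\<close>, \<open>Q\<close> and
  \<open>S\<close> serves all three factorisations, and the inner legs cancel.\<close>

lemma hat_mult:
  assumes P: "P \<in> F1.G" and u: "u \<in> F1.U P Q" and v: "v \<in> F1.U Q S"
  shows "hat (v * u) = hat v * hat u"
proof -
  have Q: "Q \<in> F1.G" by (rule F1.UD(8)[OF u P])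
  have S: "S \<in> F1.G" by (rule F1.UD(8)[OF v Q])
  obtain R w where R: "R \<in> F1.G" "R * P = 0" "R * Q = 0" "R * S = 0" "P * R = 0" "Q * R = 0"
    and w: "w \<in> F1.U P R"
    using hat_witness[OF P, of "{P, Q, S}"] P Q S by auto
  have wu: "w * star u \<in> F1.U Q R" by (rule F1.U_mult[OF F1.U_star[OF u] w Q])
  note t = \<theta>_in[OF P w R(5)] and t' = \<theta>_in[OF Q wu R(6)]
  have "hat v * hat u = star (\<theta> (w * star u * star v)) * (\<theta> (w * star u) * star (\<theta> (w * star u))) * \<theta> w"
    unfolding hat_eq[OF P u R(1-3) w] hat_eq[OF Q v R(1,3,4) wu] by (simp only: mult.assoc)
  also have "\<theta> (w * star u) * star (\<theta> (w * star u)) = \<phi> R" by (rule F2.UD(3)[OF t' \<phi>_in[OF Q]])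
  also have "star (\<theta> (w * star u * star v)) * \<phi> R * \<theta> w = star (\<theta> (w * star u * star v)) * \<theta> w"
    using F2.UD(5)[OF t \<phi>_in[OF P]] by (simp add: mult.assoc)
  finally show ?thesis
    using hat_eq[OF P F1.U_mult[OF u v P] R(1,2,4) w] by (simp add: mult.assoc)
qed

text \<open>Each summand is factored as \<open>star (v i) * w i\<close> through its own
  \<open>R i\<close>. The graph of the \<open>w i\<close> over \<open>P\<close> and that of the
  \<open>v i\<close> over \<open>Q\<close> are orthogonal exactly when \<open>Q * P\<close> plus the
  sum vanishes, and \<open>\<phi>\<close> preserves this. The term \<open>Q * P\<close> is
  contributed by the base components of the two graphs.\<close>

lemma hat_sum_anchored:
  assumes P: "P \<in> F1.G" and Q: "Q \<in> F1.G" and us: "set us \<subseteq> F1.U P Q" and z: "Q * P + sum_list us = 0"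
  shows "\<phi> Q * \<phi> P + sum_list (map hat us) = 0"
proof -
  define I where "I = {..<length us}"
  obtain R where R: "\<forall>i<length us. R i \<in> F1.G \<and> (\<forall>B\<in>{P, Q}. R i * B = 0)"
    "\<forall>i<length us. \<forall>j<length us. i \<noteq> j \<longrightarrow> R i * R j = 0"
    using F1.G_orthogonal_sequence[of "{P, Q}" "length us"] P Q by auto
  have R': "R i \<in> F1.G" "R i * P = 0" "R i * Q = 0" "P * R i = 0" "Q * R i = 0" if "i \<in> I" for i
    using R(1) that F1.G_orth_sym P Q unfolding I_def by auto
  have "\<exists>w. w \<in> F1.U P (R i)" if "i \<in> I" for i using F1.U_nonempty[OF P R'(1)[OF that]] .
  then obtain w where w: "\<And>i. i \<in> I \<Longrightarrow> w i \<in> F1.U P (R i)" by metis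
  have u: "us ! i \<in> F1.U P Q" if "i \<in> I" for i using us that unfolding I_def by auto
  define v where "v i = w i * star (us ! i)" for i
  have v: "v i \<in> F1.U Q (R i)" if "i \<in> I" for i
    unfolding v_def by (rule F1.U_mult[OF F1.U_star[OF u[OF that]] w[OF that] Q])
  have ort: "star (x j) * x i = 0"
    if x: "\<And>i. i \<in> I \<Longrightarrow> x i \<in> F1.U S (R i)" and S: "S \<in> F1.G" and ij: "i \<in> I" "j \<in> I" "j \<noteq> i" for x S i j
  proof -
    have "star (x j) * x i = star (x j) * (R j * R i) * x i"
      using F1.UD(6)[OF x[OF ij(2)] S] F1.UD(5)[OF x[OF ij(1)] S] by (metis mult.assoc)
    then show ?thesis using R(2) ij unfolding I_def by simp
  qed
  have cw: "F1.coords P I w" unfolding F1.coords_def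
    using P w ort[OF w P] F1.UD(3)[OF w P] F1.U_orth[OF w P R'(4)] by (simp add: I_def)
  have cv: "F1.coords Q I v" unfolding F1.coords_def
    using Q v ort[OF v Q] F1.UD(3)[OF v Q] F1.U_orth[OF v Q R'(5)] by (simp add: I_def)
  have range: "w i * star (w i) = R i" "v i * star (v i) = R i" if "i \<in> I" for i
    using F1.UD(3)[OF w[OF that] P] F1.UD(3)[OF v[OF that] Q] by auto
  have "star (vec Q I v) * vec P I w = Q * P + (\<Sum>i\<in>I. star (v i) * w i)"
    by (rule F1.star_vec_mult[OF cw cv])
      (use range F1.U_orth[OF w P R'(5)] F1.U_orth[OF v Q R'(4)] in auto)
  also have "(\<Sum>i\<in>I. star (v i) * w i) = (\<Sum>i\<in>I. us ! i)"
  proof (rule sum.cong)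
    fix i assume i: "i \<in> I"
    have "star (v i) * w i = us ! i * (star (w i) * w i)" by (simp add: v_def mult.assoc)
    then show "star (v i) * w i = us ! i" using F1.UD(2)[OF w[OF i] P] F1.UD(4)[OF u[OF i] P] by simp
  qed simp
  also have "(\<Sum>i\<in>I. us ! i) = sum_list us" by (simp add: sum_list_sum_nth I_def atLeast0LessThan)
  finally have "graph Q I v * graph P I w = 0" using z F1.graph_orth_iff[OF cw cv] by simp
  then have "\<phi> (graph Q I v) * \<phi> (graph P I w) = 0"
    using \<phi>_orth F1.graph_in_G cv cw by blast
  then have "star (vec (\<phi> Q) I (\<lambda>i. \<theta> (v i))) * vec (\<phi> P) I (\<lambda>i. \<theta> (w i)) = 0"
    unfolding \<phi>_graph[OF cw] \<phi>_graph[OF cv] F2.graph_orth_iff[OF \<theta>_coords[OF cw] \<theta>_coords[OF cv]] .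
  moreover have "star (vec (\<phi> Q) I (\<lambda>i. \<theta> (v i))) * vec (\<phi> P) I (\<lambda>i. \<theta> (w i)) =
      \<phi> Q * \<phi> P + (\<Sum>i\<in>I. star (\<theta> (v i)) * \<theta> (w i))"
  proof (rule F2.star_vec_mult[OF \<theta>_coords[OF cw] \<theta>_coords[OF cv]])
    fix i assume i: "i \<in> I"
    show "\<theta> (w i) * star (\<theta> (w i)) = \<theta> (v i) * star (\<theta> (v i))"
      unfolding \<theta>_range[OF cw i] \<theta>_range[OF cv i] range[OF i] ..
    have "\<phi> Q * \<phi> (R i) = 0" "\<phi> P * \<phi> (R i) = 0" using \<phi>_orth P Q R' i by blast+
    then show "\<phi> Q * \<theta> (w i) = 0" "\<phi> P * \<theta> (v i) = 0"
      using F2.U_orth[OF \<theta>_in[OF P w[OF i] R'(4)[OF i]] \<phi>_in[OF P]]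
        F2.U_orth[OF \<theta>_in[OF Q v[OF i] R'(5)[OF i]] \<phi>_in[OF Q]] by auto
  qed
  moreover have "(\<Sum>i\<in>I. star (\<theta> (v i)) * \<theta> (w i)) = (\<Sum>i\<in>I. hat (us ! i))"
  proof (rule sum.cong)
    fix i assume i: "i \<in> I"
    show "star (\<theta> (v i)) * \<theta> (w i) = hat (us ! i)"
      unfolding v_def by (rule hat_eq[OF P u[OF i] R'(1-3)[OF i] w[OF i], symmetric])
  qed simp
  moreover have "(\<Sum>i\<in>I. hat (us ! i)) = sum_list (map hat us)"
    by (simp add: sum_list_sum_nth I_def atLeast0LessThan)
  ultimately show ?thesis by simp
qed

text \<open>The term \<open>Q * P\<close> disappears on subtracting two anchored relations, one for
  a list \<open>vs\<close> with sum \<open>- (Q * P)\<close> and one for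
  \<open>vs @ us\<close>.\<close>

lemma hat_sum_zero:
  assumes P: "P \<in> F1.G" and Q: "Q \<in> F1.G" and us: "set us \<subseteq> F1.U P Q" and z: "sum_list us = 0"
  shows "sum_list (map hat us) = 0"
proof -
  have "- (Q * P) \<in> F1.hom P Q" using F1.GD P Q by (auto simp: F1.hom_def mult.assoc) (simp flip: mult.assoc)
  then obtain vs where vs: "set vs \<subseteq> F1.U P Q" "sum_list vs = - (Q * P)" using F1.hom_sum[OF P Q] by blast
  have "\<phi> Q * \<phi> P + sum_list (map hat vs) = 0" by (rule hat_sum_anchored[OF P Q vs(1)]) (simp add: vs(2))
  moreover have "\<phi> Q * \<phi> P + sum_list (map hat (vs @ us)) = 0"
    by (rule hat_sum_anchored[OF P Q]) (use vs us z in auto)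
  ultimately show ?thesis by (simp flip: add.assoc)
qed

text \<open>The value does not depend on the chosen list: of two lists with the same sum, one
  followed by the negatives of the other sums to zero, and \<open>hat_sum_zero\<close> applies
  (\<open>\<Theta>_eq\<close>).\<close>

definition \<Theta> :: "'a cop \<Rightarrow> 'a cop \<Rightarrow> 'a cop \<Rightarrow> 'b cop" where
  "\<Theta> P Q A = sum_list (map hat (SOME us. set us \<subseteq> F1.U P Q \<and> sum_list us = A))"

lemma \<Theta>_eq:
  assumes P: "P \<in> F1.G" and Q: "Q \<in> F1.G" and us: "set us \<subseteq> F1.U P Q"
  shows "\<Theta> P Q (sum_list us) = sum_list (map hat us)"
proof -
  define vs where "vs = (SOME vs. set vs \<subseteq> F1.U P Q \<and> sum_list vs = sum_list us)"
  have vs: "set vs \<subseteq> F1.U P Q \<and> sum_list vs = sum_list us" unfolding vs_def by (rule someI) (use us in simp)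
  have neg: "sum_list (map uminus us) = - sum_list us" for us :: "'c :: ab_group_add list" by (induction us) simp_all
  have hneg: "sum_list (map hat (map uminus us)) = - sum_list (map hat us)"
    using us by (induction us) (auto simp: hat_minus[OF P])
  have "sum_list (map hat (vs @ map uminus us)) = 0"
    by (rule hat_sum_zero[OF P Q]) (use vs us F1.U_minus in \<open>auto simp: neg\<close>)
  then have "sum_list (map hat vs) = sum_list (map hat us)" using hneg by simp
  then show ?thesis unfolding \<Theta>_def vs_def .
qed

lemma \<Theta>_hat: "P \<in> F1.G \<Longrightarrow> u \<in> F1.U P Q \<Longrightarrow> \<Theta> P Q u = hat u"
  using \<Theta>_eq[of P Q "[u]"] F1.UD(8)[of u P Q] by simp

lemma \<Theta>_add:
  assumes P: "P \<in> F1.G" and Q: "Q \<in> F1.G" and A: "A \<in> F1.hom P Q" and B: "B \<in> F1.hom P Q"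
  shows "\<Theta> P Q (A + B) = \<Theta> P Q A + \<Theta> P Q B"
proof -
  obtain us vs where us: "set us \<subseteq> F1.U P Q" "sum_list us = A" and vs: "set vs \<subseteq> F1.U P Q" "sum_list vs = B"
    using F1.hom_sum[OF P Q] A B by metis
  then show ?thesis using \<Theta>_eq[OF P Q, of "us @ vs"] \<Theta>_eq[OF P Q us(1)] \<Theta>_eq[OF P Q vs(1)] by simp
qed

lemma \<Theta>_star:
  assumes P: "P \<in> F1.G" and Q: "Q \<in> F1.G" and A: "A \<in> F1.hom P Q"
  shows "\<Theta> Q P (star A) = star (\<Theta> P Q A)"
proof -
  obtain us where us: "set us \<subseteq> F1.U P Q" "sum_list us = A" using F1.hom_sum[OF P Q A] by blast
  have "sum_list (map hat (map star us)) = star (sum_list (map hat us))"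
    using us(1) by (induction us) (auto simp: hat_star[OF P])
  moreover have "set (map star us) \<subseteq> F1.U Q P" using us(1) F1.U_star by auto
  ultimately show ?thesis
    using \<Theta>_eq[OF Q P, of "map star us"] \<Theta>_eq[OF P Q us(1)] unfolding us(2)[symmetric] by (simp add: star_sum_list)
qed

lemma \<Theta>_mult:
  assumes P: "P \<in> F1.G" and Q: "Q \<in> F1.G" and R: "R \<in> F1.G"
    and A: "A \<in> F1.hom P Q" and B: "B \<in> F1.hom Q R"
  shows "\<Theta> P R (B * A) = \<Theta> Q R B * \<Theta> P Q A"
proof -
  obtain us where us: "set us \<subseteq> F1.U P Q" "sum_list us = A" using F1.hom_sum[OF P Q A] by blast
  obtain vs where vs: "set vs \<subseteq> F1.U Q R" "sum_list vs = B" using F1.hom_sum[OF Q R B] by blast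
  define ws where "ws = concat (map (\<lambda>v. map ((*) v) us) vs)"
  have "set ws \<subseteq> F1.U P R" unfolding ws_def using F1.U_mult[OF _ _ P] us(1) vs(1) by auto blast
  moreover have "sum_list ws = B * A"
    unfolding ws_def us(2)[symmetric] vs(2)[symmetric]
    by (induction vs) (simp_all add: sum_list_const_mult distrib_right)
  moreover have "sum_list (map hat ws) = sum_list (map hat vs) * sum_list (map hat us)"
    unfolding ws_def using vs(1)
  proof (induction vs)
    case (Cons v vs)
    have "sum_list (map hat (map ((*) v) us)) = hat v * sum_list (map hat us)"
      using us(1) by (induction us) (use Cons.prems in \<open>auto simp: hat_mult[OF P] distrib_left\<close>)
    then show ?case using Cons by (simp add: distrib_right)
  qed simp
  ultimately show ?thesis
    using \<Theta>_eq[OF P R, of ws] \<Theta>_eq[OF P Q us(1)] \<Theta>_eq[OF Q R vs(1)] us(2) vs(2) by simp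
qed

lemma hom_compress: "P \<in> F1.G \<Longrightarrow> Q \<in> F1.G \<Longrightarrow> A \<in> M1 \<Longrightarrow> Q * A * P \<in> F1.hom P Q"
  using F1.GD[of P] F1.GD[of Q] by (auto simp: F1.hom_def mult.assoc) (simp flip: mult.assoc)

text \<open>The anchored relation for \<open>- (Q * P)\<close> is compared with additivity of
  \<open>\<Theta>\<close>. This links the map on operators back to \<open>\<phi>\<close>.\<close>

lemma \<Theta>_proj:
  assumes P: "P \<in> F1.G" and Q: "Q \<in> F1.G"
  shows "\<Theta> P Q (Q * P) = \<phi> Q * \<phi> P"
proof -
  have QP: "Q * P \<in> F1.hom P Q" using hom_compress[OF P Q, of 1] by auto
  then have mQP: "- (Q * P) \<in> F1.hom P Q" by (auto simp: F1.hom_def)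
  then obtain vs where vs: "set vs \<subseteq> F1.U P Q" "sum_list vs = - (Q * P)" using F1.hom_sum[OF P Q] by blast
  have "\<phi> Q * \<phi> P + sum_list (map hat vs) = 0" by (rule hat_sum_anchored[OF P Q vs(1)]) (simp add: vs(2))
  moreover have "\<Theta> P Q (Q * P) + sum_list (map hat vs) = 0"
    using \<Theta>_add[OF P Q QP mQP] \<Theta>_eq[OF P Q vs(1)] \<Theta>_eq[OF P Q, of "[]"] vs(2) by simp
  ultimately show ?thesis by (metis add_right_cancel)
qed

end

section \<open>The induced isomorphism\<close>

context grassmann_pair
begin

lemma \<phi>_ext:
  assumes "\<And>P R. P \<in> F1.G \<Longrightarrow> R \<in> F1.G \<Longrightarrow> \<phi> R * A * \<phi> P = \<phi> R * B * \<phi> P" shows "A = B"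
proof (rule F2.G_ext)
  fix P Q assume P: "P \<in> F2.G" and Q: "Q \<in> F2.G"
  obtain P' where "P' \<in> F1.G" "P = \<phi> P'" using P unfolding onto[symmetric] by (rule imageE)
  moreover obtain Q' where "Q' \<in> F1.G" "Q = \<phi> Q'" using Q unfolding onto[symmetric] by (rule imageE)
  ultimately show "Q * A * P = Q * B * P" using assms by simp
qed

lemma unitary_U:
  assumes U: "U \<in> M1" "star U * U = 1" and P: "P \<in> F1.G"
  shows "U * P \<in> F1.U P (U * P * star U)"
proof -
  have "star (U * P) * (U * P) = P * (star U * U) * P" using F1.GD(5)[OF P] by (simp add: mult.assoc)
  moreover have "(U * P) * star (U * P) = U * (P * P) * star U" using F1.GD(5)[OF P] by (simp add: mult.assoc)
  ultimately show ?thesis using U F1.GD(1,4)[OF P] by (simp add: F1.U_def)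
qed

text \<open>The values on corners must be seen to belong to one operator. By \<open>key\<close> the
  operators \<open>hat (U * P)\<close> have the same mutual products as the projections
  \<open>\<phi> P\<close>, so sending a vector of the range of \<open>\<phi> P\<close> to its image
  under \<open>hat (U * P)\<close> preserves inner products across all \<open>P\<close> and
  extends.\<close>

lemma unitary_image:
  assumes U: "U \<in> M1" "star U * U = 1"
  shows "\<exists>W\<in>M2. \<forall>P\<in>F1.G. W * \<phi> P = hat (U * P)"
proof -
  have UP: "U * P \<in> F1.U P (U * P * star U)" if "P \<in> F1.G" for P by (rule unitary_U[OF U that])
  have QG: "U * P * star U \<in> F1.G" if "P \<in> F1.G" for P by (rule F1.UD(8)[OF UP[OF that] that])
  note hin = hat_in[OF _ UP]
  \<comment> \<open>\<open>U * P\<close> is itself a partial isometry from \<open>P\<close> to a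
    member \<open>P1\<close> of \<open>G\<close>, and likewise for \<open>S\<close>. The product can
    thus be routed through \<open>S1 * P1\<close>, where \<open>\<Theta>_mult\<close> and
    \<open>\<Theta>_proj\<close> evaluate it.\<close>
  have key: "star (hat (U * S)) * hat (U * P) = \<phi> S * \<phi> P" if S: "S \<in> F1.G" and P: "P \<in> F1.G" for S P
  proof -
    define S1 where "S1 = U * S * star U"
    define P1 where "P1 = U * P * star U"
    note s1 = QG[OF S, folded S1_def] and p1 = QG[OF P, folded P1_def]
    have us: "U * S \<in> F1.U S S1" and up: "U * P \<in> F1.U P P1" using UP S P by (auto simp: S1_def P1_def)
    have sh: "star (U * S) \<in> F1.hom S1 S" by (rule F1.U_hom[OF F1.U_star[OF us] s1])
    have ph: "U * P \<in> F1.hom P P1" by (rule F1.U_hom[OF up P])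
    have sp: "S1 * P1 \<in> F1.hom P1 S1" using hom_compress[OF p1 s1, of 1] by auto
    have m: "S1 * P1 * (U * P) \<in> F1.hom P S1"
      by (rule F1.hom_mult[OF ph sp])
    have "star (hat (U * S)) * hat (U * P) = star (hat (U * S)) * \<phi> S1 * (\<phi> P1 * hat (U * P))"
      using F2.UD(6)[OF hat_in[OF S us] \<phi>_in[OF S]] F2.UD(5)[OF hat_in[OF P up] \<phi>_in[OF P]] by simp
    also have "\<dots> = hat (star (U * S)) * ((\<phi> S1 * \<phi> P1) * hat (U * P))"
      unfolding hat_star[OF S us] by (simp only: mult.assoc)
    also have "\<dots> = \<Theta> S1 S (star (U * S)) * (\<Theta> P1 S1 (S1 * P1) * \<Theta> P P1 (U * P))"
      unfolding \<Theta>_proj[OF p1 s1] \<Theta>_hat[OF P up] \<Theta>_hat[OF s1 F1.U_star[OF us]] ..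
    also have "\<dots> = \<Theta> P S (star (U * S) * (S1 * P1 * (U * P)))"
      unfolding \<Theta>_mult[OF P p1 s1 ph sp, symmetric] by (rule \<Theta>_mult[OF P s1 S m sh, symmetric])
    also have "star (U * S) * (S1 * P1 * (U * P)) = (star (U * S) * S1) * (P1 * (U * P))" by (simp only: mult.assoc)
    also have "\<dots> = star (U * S) * (U * P)" using F1.UD(6)[OF us S] F1.UD(5)[OF up P] by simp
    also have "\<dots> = S * (star U * U) * P" using F1.GD(5)[OF S] by (simp add: mult.assoc)
    finally show ?thesis using \<Theta>_proj[OF P S] U(2) by simp
  qed
  define D where "D = {(\<xi>, hat (U * P) \<cdot> \<xi>) | \<xi> P. P \<in> F1.G \<and> \<phi> P \<cdot> \<xi> = \<xi>}"
  have "\<exists>W\<in>M2. (\<forall>(x, y)\<in>D. W \<cdot> x = y) \<and> star W * W = pspan (fst ` D) \<and>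
    (\<forall>C. (\<forall>(x, y)\<in>D. C \<cdot> y = 0) \<longrightarrow> C * W = 0)"
  proof (rule F2.isometric_relation_in)
    show "(b *\<^sub>C x, b *\<^sub>C y) \<in> D" if xy: "(x, y) \<in> D" for b x y
    proof -
      obtain P where P: "P \<in> F1.G" "\<phi> P \<cdot> x = x" "y = hat (U * P) \<cdot> x" using xy unfolding D_def by auto
      then have "\<phi> P \<cdot> b *\<^sub>C x = b *\<^sub>C x" "b *\<^sub>C y = hat (U * P) \<cdot> b *\<^sub>C x" by simp_all
      then show ?thesis unfolding D_def using P(1) by auto
    qed
    show "cinner y y' = cinner x x'" if xy: "(x, y) \<in> D" "(x', y') \<in> D" for x y x' y'
    proof -
      obtain P where P: "P \<in> F1.G" "\<phi> P \<cdot> x = x" "y = hat (U * P) \<cdot> x" using xy(1) unfolding D_def by auto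
      obtain S where S: "S \<in> F1.G" "\<phi> S \<cdot> x' = x'" "y' = hat (U * S) \<cdot> x'" using xy(2) unfolding D_def by auto
      have "cinner y y' = cinner ((star (hat (U * S)) * hat (U * P)) \<cdot> x) x'"
        by (simp add: P(3) S(3) cinner_star_left)
      also have "\<dots> = cinner (\<phi> S \<cdot> x) x'" unfolding key[OF S(1) P(1)] using P(2) by simp
      also have "\<dots> = cinner x x'"
        using S(2) F2.GD(5)[OF \<phi>_in[OF S(1)]] by (simp add: cinner_app_left)
      finally show ?thesis .
    qed
    show "(B \<cdot> x, B \<cdot> y) \<in> D" if B: "B \<in> comm M2" and xy: "(x, y) \<in> D" for B x y
    proof -
      obtain P where P: "P \<in> F1.G" "\<phi> P \<cdot> x = x" "y = hat (U * P) \<cdot> x" using xy unfolding D_def by auto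
      have "\<phi> P \<cdot> B \<cdot> x = B \<cdot> x"
        using F2.in_M_D[OF F2.GD(1)[OF \<phi>_in[OF P(1)]] B] P(2) by (metis app_simps(5))
      moreover have "B \<cdot> y = hat (U * P) \<cdot> B \<cdot> x"
        using F2.in_M_D[OF F2.UD(1)[OF hin[OF P(1) P(1)] \<phi>_in[OF P(1)]] B] P(3) by (metis app_simps(5))
      ultimately show ?thesis unfolding D_def using P(1) by auto
    qed
  qed
  then obtain W where W: "W \<in> M2" "\<forall>(x, y)\<in>D. W \<cdot> x = y" by blast
  have "W * \<phi> P = hat (U * P)" if P: "P \<in> F1.G" for P
  proof (rule cop_eqI)
    fix x
    have "\<phi> P \<cdot> \<phi> P \<cdot> x = \<phi> P \<cdot> x" using F2.GD(4)[OF \<phi>_in[OF P]] by (metis app_simps(5))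
    then have "(\<phi> P \<cdot> x, hat (U * P) \<cdot> \<phi> P \<cdot> x) \<in> D" unfolding D_def using P by blast
    then have "W \<cdot> \<phi> P \<cdot> x = hat (U * P) \<cdot> \<phi> P \<cdot> x" using W(2) by auto
    then show "(W * \<phi> P) \<cdot> x = hat (U * P) \<cdot> x"
      using F2.UD(4)[OF hin[OF P P] \<phi>_in[OF P]] by (metis app_simps(5))
  qed
  then show ?thesis using W(1) by blast
qed

lemma unitary_corner:
  assumes U: "U \<in> M1" "star U * U = 1" and W: "\<And>P. P \<in> F1.G \<Longrightarrow> W * \<phi> P = hat (U * P)"
    and P: "P \<in> F1.G" and R: "R \<in> F1.G"
  shows "\<phi> R * W * \<phi> P = \<Theta> P R (R * U * P)"
proof -
  define Q where "Q = U * P * star U"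
  have up: "U * P \<in> F1.U P Q" unfolding Q_def by (rule unitary_U[OF U P])
  have Q: "Q \<in> F1.G" by (rule F1.UD(8)[OF up P])
  have rq: "R * Q \<in> F1.hom Q R" using hom_compress[OF Q R, of 1] by auto
  have "\<phi> R * W * \<phi> P = \<phi> R * (\<phi> Q * hat (U * P))"
    using W[OF P] F2.UD(5)[OF hat_in[OF P up] \<phi>_in[OF P]] by (simp add: mult.assoc)
  also have "\<dots> = \<Theta> Q R (R * Q) * \<Theta> P Q (U * P)"
    unfolding \<Theta>_proj[OF Q R] \<Theta>_hat[OF P up] by (simp only: mult.assoc)
  also have "\<dots> = \<Theta> P R (R * Q * (U * P))" by (rule \<Theta>_mult[OF P Q R F1.U_hom[OF up P] rq, symmetric])
  also have "R * Q * (U * P) = R * U * P" using F1.UD(5)[OF up P] by (simp add: mult.assoc)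
  finally show ?thesis .
qed

lemma unitaries:
  assumes "A \<in> M1"
  shows "\<exists>us. set us \<subseteq> {u \<in> M1. star u * u = 1 \<and> u * star u = 1} \<and> sum_list us = A"
  by (rule F1.unitary_sum) (use assms in auto)

text \<open>Write \<open>A\<close> as a sum of unitaries and add the operators from
  \<open>unitary_image\<close>. The corner identity carried through the induction mentions only the
  sum, not the decomposition.\<close>

lemma \<psi>_exists:
  assumes "A \<in> M1"
  shows "\<exists>B\<in>M2. \<forall>P\<in>F1.G. \<forall>R\<in>F1.G. \<phi> R * B * \<phi> P = \<Theta> P R (R * A * P)"
proof -
  obtain us where us: "set us \<subseteq> {u \<in> M1. star u * u = 1 \<and> u * star u = 1}" "sum_list us = A"
    using unitaries[OF assms] by blast
  from us(1) have "sum_list us \<in> M1 \<and> (\<exists>B\<in>M2. \<forall>P\<in>F1.G. \<forall>R\<in>F1.G. \<phi> R * B * \<phi> P = \<Theta> P R (R * sum_list us * P))"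
  proof (induction us)
    case Nil
    have "\<Theta> P R 0 = 0" if "P \<in> F1.G" "R \<in> F1.G" for P R using \<Theta>_eq[OF that, of "[]"] by simp
    then show ?case by (auto intro!: bexI[of _ 0])
  next
    case (Cons u us)
    then have u: "u \<in> M1" "star u * u = 1" by auto
    obtain W where W: "W \<in> M2" "\<And>P. P \<in> F1.G \<Longrightarrow> W * \<phi> P = hat (u * P)" using unitary_image[OF u] by blast
    obtain B where B: "sum_list us \<in> M1" "B \<in> M2"
      "\<And>P R. P \<in> F1.G \<Longrightarrow> R \<in> F1.G \<Longrightarrow> \<phi> R * B * \<phi> P = \<Theta> P R (R * sum_list us * P)"
      using Cons by auto
    have "\<phi> R * (W + B) * \<phi> P = \<Theta> P R (R * (u + sum_list us) * P)" if PR: "P \<in> F1.G" "R \<in> F1.G" for P R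
      using \<Theta>_add[OF PR hom_compress[OF PR u(1)] hom_compress[OF PR B(1)]] unitary_corner[OF u W(2) PR] B(3)[OF PR]
      by (simp add: distrib_left distrib_right)
    then show ?case using u W(1) B(1,2) by auto
  qed
  then show ?thesis using us(2) by blast
qed

text \<open>By \<open>\<phi>_ext\<close> the corners determine the operator, so the choice is
  unique.\<close>

definition \<psi> :: "'a cop \<Rightarrow> 'b cop" where
  "\<psi> A = (SOME B. B \<in> M2 \<and> (\<forall>P\<in>F1.G. \<forall>R\<in>F1.G. \<phi> R * B * \<phi> P = \<Theta> P R (R * A * P)))"

lemma
  assumes "A \<in> M1"
  shows \<psi>_in: "\<psi> A \<in> M2"
    and \<psi>_corner: "\<And>P R. P \<in> F1.G \<Longrightarrow> R \<in> F1.G \<Longrightarrow> \<phi> R * \<psi> A * \<phi> P = \<Theta> P R (R * A * P)"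
  using someI_ex[OF \<psi>_exists[OF assms, unfolded Bex_def]] unfolding \<psi>_def by auto

lemma \<psi>_eqI:
  assumes "A \<in> M1" "\<And>P R. P \<in> F1.G \<Longrightarrow> R \<in> F1.G \<Longrightarrow> \<phi> R * B * \<phi> P = \<Theta> P R (R * A * P)"
  shows "\<psi> A = B"
  by (rule \<phi>_ext) (use \<psi>_corner[OF assms(1)] assms(2) in simp)

lemma \<psi>_unitary:
  assumes U: "U \<in> M1" "star U * U = 1" and P: "P \<in> F1.G"
  shows "\<psi> U * \<phi> P = hat (U * P)"
proof -
  obtain W where W: "\<And>P. P \<in> F1.G \<Longrightarrow> W * \<phi> P = hat (U * P)" using unitary_image[OF U] by blast
  have "\<psi> U = W" by (rule \<psi>_eqI[OF U(1)]) (rule unitary_corner[OF U W])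
  then show ?thesis using W[OF P] by simp
qed

lemma \<psi>_G: assumes Q: "Q \<in> F1.G" shows "\<psi> Q = \<phi> Q"
proof (rule \<psi>_eqI[OF F1.GD(1)[OF Q]])
  fix P R assume PR: "P \<in> F1.G" "R \<in> F1.G"
  have h: "Q * P \<in> F1.hom P Q" "R * Q \<in> F1.hom Q R"
    using hom_compress[OF PR(1) Q, of 1] hom_compress[OF Q PR(2), of 1] by auto
  have "\<phi> R * \<phi> Q * \<phi> P = (\<phi> R * \<phi> Q) * (\<phi> Q * \<phi> P)"
    using F2.GD(4)[OF \<phi>_in[OF Q]] by (metis mult.assoc)
  also have "\<dots> = \<Theta> P R (R * Q * (Q * P))"
    unfolding \<Theta>_mult[OF PR(1) Q PR(2) h] \<Theta>_proj[OF PR(1) Q] \<Theta>_proj[OF Q PR(2)] ..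
  also have "R * Q * (Q * P) = R * Q * P" using F1.GD(4)[OF Q] by (metis mult.assoc)
  finally show "\<phi> R * \<phi> Q * \<phi> P = \<Theta> P R (R * Q * P)" .
qed

lemma \<psi>_add: assumes A: "A \<in> M1" and B: "B \<in> M1" shows "\<psi> (A + B) = \<psi> A + \<psi> B"
proof (rule \<psi>_eqI)
  show "A + B \<in> M1" using A B by auto
  fix P R assume PR: "P \<in> F1.G" "R \<in> F1.G"
  then show "\<phi> R * (\<psi> A + \<psi> B) * \<phi> P = \<Theta> P R (R * (A + B) * P)"
    using \<Theta>_add[OF PR hom_compress[OF PR A] hom_compress[OF PR B]] \<psi>_corner[OF A PR] \<psi>_corner[OF B PR]
    by (simp add: distrib_left distrib_right)
qed

lemma \<psi>_star: assumes A: "A \<in> M1" shows "\<psi> (star A) = star (\<psi> A)"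
proof (rule \<psi>_eqI)
  show "star A \<in> M1" using A by auto
  fix P R assume PR: "P \<in> F1.G" "R \<in> F1.G"
  have "star (\<phi> P * \<psi> A * \<phi> R) = star (\<Theta> R P (P * A * R))" using \<psi>_corner[OF A PR(2,1)] by simp
  then show "\<phi> R * star (\<psi> A) * \<phi> P = \<Theta> P R (R * star A * P)"
    using \<Theta>_star[OF PR(2,1) hom_compress[OF PR(2,1) A]] F1.GD(5)[OF PR(1)] F1.GD(5)[OF PR(2)]
      F2.GD(5)[OF \<phi>_in[OF PR(1)]] F2.GD(5)[OF \<phi>_in[OF PR(2)]] by (simp add: mult.assoc)
qed

text \<open>Corner identities multiply only through an intermediate member of \<open>G\<close>. For
  \<open>U\<close> there is one, the range projection of \<open>U * P\<close>; a general right
  factor is reduced to this case in \<open>\<psi>_mult\<close> by additivity.\<close>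

lemma \<psi>_mult_unitary:
  assumes A: "A \<in> M1" and U: "U \<in> M1" "star U * U = 1"
  shows "\<psi> (A * U) = \<psi> A * \<psi> U"
proof (rule \<psi>_eqI)
  show "A * U \<in> M1" using A U by auto
  fix P R assume PR: "P \<in> F1.G" "R \<in> F1.G"
  define Q where "Q = U * P * star U"
  have up: "U * P \<in> F1.U P Q" unfolding Q_def by (rule unitary_U[OF U PR(1)])
  have Q: "Q \<in> F1.G" by (rule F1.UD(8)[OF up PR(1)])
  have "\<phi> R * (\<psi> A * \<psi> U) * \<phi> P = \<phi> R * \<psi> A * (\<phi> Q * hat (U * P))"
    using \<psi>_unitary[OF U PR(1)] F2.UD(5)[OF hat_in[OF PR(1) up] \<phi>_in[OF PR(1)]] by (simp add: mult.assoc)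
  also have "\<dots> = \<Theta> Q R (R * A * Q) * \<Theta> P Q (U * P)"
    unfolding \<psi>_corner[OF A Q PR(2), symmetric] \<Theta>_hat[OF PR(1) up] by (simp only: mult.assoc)
  also have "\<dots> = \<Theta> P R (R * A * Q * (U * P))"
    by (rule \<Theta>_mult[OF PR(1) Q PR(2) F1.U_hom[OF up PR(1)] hom_compress[OF Q PR(2) A], symmetric])
  also have "R * A * Q * (U * P) = R * (A * U) * P"
    using F1.UD(5)[OF up PR(1)] by (simp add: mult.assoc)
  finally show "\<phi> R * (\<psi> A * \<psi> U) * \<phi> P = \<Theta> P R (R * (A * U) * P)" .
qed

lemma \<psi>_0: "\<psi> 0 = 0"
  using \<psi>_add[of 0 0] by simp

lemma \<psi>_mult: assumes A: "A \<in> M1" and B: "B \<in> M1" shows "\<psi> (A * B) = \<psi> A * \<psi> B"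
proof -
  obtain us where us: "set us \<subseteq> {u \<in> M1. star u * u = 1 \<and> u * star u = 1}" "sum_list us = B"
    using unitaries[OF B] by blast
  from us(1) have "sum_list us \<in> M1 \<and> \<psi> (A * sum_list us) = \<psi> A * \<psi> (sum_list us)"
  proof (induction us)
    case (Cons u us)
    then have u: "u \<in> M1" "star u * u = 1" and s: "sum_list us \<in> M1" "\<psi> (A * sum_list us) = \<psi> A * \<psi> (sum_list us)"
      by auto
    have "\<psi> (A * u + A * sum_list us) = \<psi> A * \<psi> u + \<psi> A * \<psi> (sum_list us)"
      using A u s \<psi>_mult_unitary[OF A u] by (subst \<psi>_add) auto
    then show ?case using u s by (simp add: \<psi>_add distrib_left)
  qed (simp add: \<psi>_0)
  then show ?thesis using us(2) by simp
qed

end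

section \<open>Invertibility of the induced map\<close>

locale grassmann_iso =
  grassmann_pair M1 \<tau>1 c M2 \<tau>2 \<phi> + inv: grassmann_pair M2 \<tau>2 c M1 \<tau>1 \<phi>'
  for M1 :: "'a :: complex_hilbert cop set" and \<tau>1 c and M2 :: "'b :: complex_hilbert cop set" and \<tau>2 \<phi> \<phi>' +
  assumes inverse1: "P \<in> F1.G \<Longrightarrow> \<phi>' (\<phi> P) = P" and inverse2: "Q \<in> F2.G \<Longrightarrow> \<phi> (\<phi>' Q) = Q"
begin

lemma inv_\<theta>:
  assumes P: "P \<in> F1.G" and u: "u \<in> F1.U P Q" and PQ: "P * Q = 0"
  shows "inv.\<theta> (\<theta> u) = u"
proof (rule inv.\<theta>_eqI[OF \<phi>_in[OF P] \<theta>_in[OF assms]])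
  have Q: "Q \<in> F1.G" by (rule F1.UD(8)[OF u P])
  show "\<phi> P * \<phi> Q = 0" by (rule \<phi>_orth[OF P Q PQ])
  show "u \<in> F1.U (\<phi>' (\<phi> P)) (\<phi>' (\<phi> Q))" using u inverse1 P Q by simp
  show "\<phi>' (gr (\<theta> u)) = gr u"
    unfolding \<phi>_gr_\<theta>[OF assms, symmetric] by (rule inverse1[OF F1.gr_in_G[OF assms]])
qed

lemma inv_hat:
  assumes P: "P \<in> F1.G" and u: "u \<in> F1.U P Q"
  shows "inv.hat (hat u) = u"
proof -
  have Q: "Q \<in> F1.G" by (rule F1.UD(8)[OF u P])
  obtain R w where R: "R \<in> F1.G" "R * P = 0" "R * Q = 0" "P * R = 0" "Q * R = 0" and w: "w \<in> F1.U P R"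
    using hat_witness[OF P, of "{P, Q}"] P Q by auto
  have wu: "w * star u \<in> F1.U Q R" by (rule F1.U_mult[OF F1.U_star[OF u] w Q])
  note h = hat_eq[OF P u R(1-3) w]
  note t = \<theta>_in[OF P w R(4)] and t' = \<theta>_in[OF Q wu R(5)]
  have "\<theta> w * star (hat u) = (\<theta> w * star (\<theta> w)) * \<theta> (w * star u)" unfolding h by (simp add: mult.assoc)
  then have e: "\<theta> w * star (hat u) = \<theta> (w * star u)"
    using F2.UD(3)[OF t \<phi>_in[OF P]] F2.UD(5)[OF t' \<phi>_in[OF Q]] by simp
  have "inv.hat (hat u) = star (inv.\<theta> (\<theta> w * star (hat u))) * inv.\<theta> (\<theta> w)"
    by (rule inv.hat_eq[OF \<phi>_in[OF P] hat_in[OF P u] \<phi>_in[OF R(1)] _ _ t]) (use \<phi>_orth R P Q in auto)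
  also have "\<dots> = star (w * star u) * w" unfolding e inv_\<theta>[OF P w R(4)] inv_\<theta>[OF Q wu R(5)] ..
  also have "\<dots> = u" using F1.UD(2)[OF w P] F1.UD(4)[OF u P] by (simp add: mult.assoc)
  finally show ?thesis .
qed

lemma inv_\<Theta>:
  assumes P: "P \<in> F1.G" and Q: "Q \<in> F1.G" and A: "A \<in> F1.hom P Q"
  shows "inv.\<Theta> (\<phi> P) (\<phi> Q) (\<Theta> P Q A) = A"
proof -
  obtain us where us: "set us \<subseteq> F1.U P Q" "sum_list us = A" using F1.hom_sum[OF P Q A] by blast
  have "set (map hat us) \<subseteq> F2.U (\<phi> P) (\<phi> Q)" using us(1) hat_in[OF P] by auto
  then have "inv.\<Theta> (\<phi> P) (\<phi> Q) (\<Theta> P Q A) = sum_list (map inv.hat (map hat us))"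
    using inv.\<Theta>_eq[OF \<phi>_in[OF P] \<phi>_in[OF Q]] \<Theta>_eq[OF P Q us(1)] us(2) by simp
  also have "map inv.hat (map hat us) = us" using us(1) inv_hat[OF P] by (auto intro!: map_idI)
  finally show ?thesis using us(2) by simp
qed

text \<open>The construction made from \<open>\<phi>'\<close> undoes each stage in turn:
  \<open>\<theta>\<close>, then \<open>hat\<close>, then \<open>\<Theta>\<close>, and finally the
  corners of \<open>\<psi>\<close>.\<close>

lemma inv_\<psi>: assumes A: "A \<in> M1" shows "inv.\<psi> (\<psi> A) = A"
proof (rule F1.G_ext)
  fix P Q assume PQ: "P \<in> F1.G" "Q \<in> F1.G"
  have "\<phi>' (\<phi> Q) * inv.\<psi> (\<psi> A) * \<phi>' (\<phi> P) = inv.\<Theta> (\<phi> P) (\<phi> Q) (\<phi> Q * \<psi> A * \<phi> P)"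
    by (rule inv.\<psi>_corner[OF \<psi>_in[OF A] \<phi>_in[OF PQ(1)] \<phi>_in[OF PQ(2)]])
  also have "\<dots> = Q * A * P"
    unfolding \<psi>_corner[OF A PQ] by (rule inv_\<Theta>[OF PQ hom_compress[OF PQ A]])
  finally show "Q * inv.\<psi> (\<psi> A) * P = Q * A * P" using inverse1 PQ by simp
qed

lemma swap: "grassmann_iso M2 \<tau>2 c M1 \<tau>1 \<phi>' \<phi>"
  by unfold_locales (use inverse1 inverse2 in auto)

lemma \<psi>_inv: assumes "B \<in> M2" shows "\<psi> (inv.\<psi> B) = B"
proof -
  interpret s: grassmann_iso M2 \<tau>2 c M1 \<tau>1 \<phi>' \<phi> by (rule swap)
  show ?thesis by (rule s.inv_\<psi>[OF assms])
qed

lemma \<psi>_bij: "bij_betw \<psi> M1 M2"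
  by (rule bij_betwI[where g = inv.\<psi>]) (use \<psi>_in inv.\<psi>_in inv_\<psi> \<psi>_inv in auto)

lemma \<psi>_surj: "B \<in> M2 \<Longrightarrow> \<exists>A\<in>M1. B = \<psi> A"
  using \<psi>_inv inv.\<psi>_in by metis

end

lemma pos_le_norm: assumes "0 \<le> (A :: 'a :: complex_hilbert cop)" shows "A \<le> norm A *\<^sub>R 1"
proof (rule leI_cop)
  fix x
  have "Re (cinner (A \<cdot> x) x) \<le> norm (A \<cdot> x) * norm x"
    using complex_Re_le_cmod cinner_Cauchy_Schwarz order_trans by blast
  also have "\<dots> \<le> norm A * norm x * norm x" by (intro mult_right_mono norm_app) simp
  finally show "Re (cinner (A \<cdot> x) x) \<le> Re (cinner ((norm A *\<^sub>R 1) \<cdot> x) x)"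
    by (simp add: cinner_scaleR_left cinner_self power2_eq_square mult.assoc)
qed (use pos_selfadj[OF assms] in auto)

text \<open>Positivity makes an additive function monotone, and it fixes the integers; comparison
  with the integer part of \<open>Suc n * x\<close> leaves an error of at most
  \<open>1 / Suc n\<close>.\<close>

lemma additive_pos_real:
  fixes f :: "real \<Rightarrow> real"
  assumes add: "\<And>x y. f (x + y) = f x + f y" and pos: "\<And>x. 0 \<le> x \<Longrightarrow> 0 \<le> f x" and one: "f 1 = 1"
  shows "f x = x"
proof -
  have f0: "f 0 = 0" using add[of 0 0] by simp
  have neg: "f (- x) = - f x" for x using add[of x "- x"] f0 by simp
  have mono: "f x \<le> f y" if "x \<le> y" for x y using pos[of "y - x"] add[of x "y - x"] that by simp
  have nat: "f (real n * x) = real n * f x" for n x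
    by (induction n) (simp_all add: f0 add distrib_right)
  have int: "f (of_int k) = of_int k" for k
  proof (cases "0 \<le> k")
    case True
    then show ?thesis using nat[of "nat k" 1] one by simp
  next
    case False
    then show ?thesis using nat[of "nat (- k)" 1] neg[of "of_int (- k)"] one by simp
  qed
  have "\<bar>f x - x\<bar> \<le> inverse (real (Suc n))" for n
  proof -
    let ?k = "\<lfloor>real (Suc n) * x\<rfloor>"
    have "of_int ?k \<le> real (Suc n) * x" "real (Suc n) * x \<le> of_int (?k + 1)" by linarith+
    then have "of_int ?k \<le> real (Suc n) * f x" "real (Suc n) * f x \<le> of_int (?k + 1)"
      using mono int nat by metis+
    then have "\<bar>real (Suc n) * f x - real (Suc n) * x\<bar> \<le> 1" by linarith
    then have "real (Suc n) * \<bar>f x - x\<bar> \<le> 1" by (simp add: abs_mult flip: right_diff_distrib)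
    then show ?thesis by (simp add: field_simps)
  qed
  then have "\<bar>f x - x\<bar> \<le> 0"
    using LIMSEQ_le_const[OF LIMSEQ_inverse_real_of_nat] by blast
  then show ?thesis by simp
qed

context grassmann_pair
begin

lemma \<psi>_minus: "A \<in> M1 \<Longrightarrow> \<psi> (- A) = - \<psi> A"
  using \<psi>_add[of A "- A"] \<psi>_0 by (simp add: eq_neg_iff_add_eq_0 add.commute)

lemma \<psi>_diff: "A \<in> M1 \<Longrightarrow> B \<in> M1 \<Longrightarrow> \<psi> (A - B) = \<psi> A - \<psi> B"
  using \<psi>_add[of A "- B"] \<psi>_minus[of B] by auto

lemma \<psi>_pos: assumes "A \<in> M1" "0 \<le> A" shows "0 \<le> \<psi> A"
proof -
  have s: "csqrt A \<in> M1" "star (csqrt A) = csqrt A" "csqrt A * csqrt A = A"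
    using F1.csqrt_in csqrt_selfadj csqrt_sq assms by auto
  have "\<psi> A = star (\<psi> (csqrt A)) * \<psi> (csqrt A)"
    using \<psi>_mult[OF s(1) s(1)] \<psi>_star[OF s(1)] s(2,3) by simp
  then show ?thesis by simp
qed

end

section \<open>Action on scalars, continuity and functional calculus\<close>

context grassmann_iso
begin

lemma \<psi>_1: "\<psi> 1 = 1"
proof -
  obtain A where A: "A \<in> M1" "1 = \<psi> A" using \<psi>_surj[of 1] by auto
  have "\<psi> (1 * A) = \<psi> 1 * \<psi> A" by (rule \<psi>_mult) (use A in auto)
  then show ?thesis using A(2) by (metis mult_1 mult_1_right)
qed

lemma one_nonzero: "(1 :: 'b cop) \<noteq> 0"
proof
  assume "(1 :: 'b cop) = 0"
  then have "P = 0" for P :: "'b cop" by (metis mult_1 mult_zero_left)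
  then show False using F2.G_ne F2.G_nonzero unfolding F2.G_def by blast
qed

text \<open>A surjective multiplicative map sends central elements to central ones, and in a factor
  these are scalars.\<close>

lemma scalar_image: "\<exists>l. \<psi> (cof z) = cof l"
proof (rule F2.center)
  show "\<psi> (cof z) \<in> M2" by (rule \<psi>_in) auto
  show "\<psi> (cof z) \<in> comm M2" unfolding comm_def
  proof (intro CollectI ballI)
    fix B assume "B \<in> M2"
    then obtain A where A: "A \<in> M1" "B = \<psi> A" using \<psi>_surj by blast
    have "\<psi> (cof z * A) = \<psi> (A * cof z)" by (simp add: cof_commute)
    then show "\<psi> (cof z) * B = B * \<psi> (cof z)" using A \<psi>_mult[of "cof z" A] \<psi>_mult[of A "cof z"] by auto
  qed
qed

definition lam :: "complex \<Rightarrow> complex" where "lam z = (SOME l. \<psi> (cof z) = cof l)"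

lemma \<psi>_cof: "\<psi> (cof z) = cof (lam z)"
  unfolding lam_def by (rule someI_ex[OF scalar_image])

lemma lam_eqI: "\<psi> (cof z) = cof l \<Longrightarrow> lam z = l"
  using \<psi>_cof[of z] cof_eq_iff[OF one_nonzero] by metis

lemma lam_add: "lam (z + w) = lam z + lam w"
  by (rule lam_eqI) (simp add: cof_simps \<psi>_add \<psi>_cof)

lemma lam_mult: "lam (z * w) = lam z * lam w"
  by (rule lam_eqI) (simp add: cof_simps \<psi>_mult \<psi>_cof)

lemma lam_cnj: "lam (cnj z) = cnj (lam z)"
  using \<psi>_star[of "cof z"] by (intro lam_eqI) (simp add: \<psi>_cof)

lemma lam_1: "lam 1 = 1"
  by (rule lam_eqI) (simp add: \<psi>_1)

text \<open>\<open>lam\<close> maps reals to reals by \<open>lam_cnj\<close>, and a nonnegative real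
  is the square of a real, so \<open>lam\<close> is positive on nonnegative reals and
  \<open>additive_pos_real\<close> applies.\<close>

lemma lam_real: "lam (of_real r) = of_real r"
proof -
  have real: "lam (of_real r) = of_real (Re (lam (of_real r)))" for r
    using lam_cnj[of "of_real r"] by (simp add: complex_eq_iff)
  have "Re (lam (of_real r)) = r"
  proof (rule additive_pos_real[where f = "\<lambda>r. Re (lam (of_real r))"])
    fix x :: real assume "0 \<le> x"
    then have "lam (of_real x) = lam (of_real (sqrt x)) * lam (of_real (sqrt x))"
      by (simp flip: lam_mult of_real_mult)
    also have "\<dots> = of_real (Re (lam (of_real (sqrt x))) * Re (lam (of_real (sqrt x))))"
      using real[of "sqrt x"] by (metis of_real_mult)
    finally show "0 \<le> Re (lam (of_real x))" by simp
  qed (simp_all add: lam_add lam_1)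
  then show ?thesis using real[of r] by simp
qed

lemma lam_cases: "(\<forall>z. lam z = z) \<or> (\<forall>z. lam z = cnj z)"
proof -
  have "lam \<i> * lam \<i> = lam (of_real (- 1))" by (simp flip: lam_mult)
  then have "(lam \<i> - \<i>) * (lam \<i> + \<i>) = 0" unfolding lam_real by (simp add: algebra_simps)
  then have i: "lam \<i> = \<i> \<or> lam \<i> = - \<i>" by (simp add: eq_neg_iff_add_eq_0)
  have z: "lam z = of_real (Re z) + lam \<i> * of_real (Im z)" for z
  proof -
    have "lam (of_real (Re z) + \<i> * of_real (Im z)) = of_real (Re z) + lam \<i> * of_real (Im z)"
      unfolding lam_add lam_mult lam_real ..
    then show ?thesis using complex_eq[of z] by simp
  qed
  from i show ?thesis
  proof
    assume "lam \<i> = \<i>"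
    then have "lam z = z" for z using z[of z] complex_eq[of z] by simp
    then show ?thesis by blast
  next
    assume "lam \<i> = - \<i>"
    then have "lam z = cnj z" for z using z[of z] by (simp add: complex_eq_iff)
    then show ?thesis by blast
  qed
qed

lemma \<psi>_cof_mult: "A \<in> M1 \<Longrightarrow> \<psi> (cof z * A) = cof (lam z) * \<psi> A"
  using \<psi>_mult[of "cof z" A] \<psi>_cof by auto

lemma \<psi>_scaleR: "A \<in> M1 \<Longrightarrow> \<psi> (r *\<^sub>R A) = r *\<^sub>R \<psi> A"
  using \<psi>_cof_mult[of A "of_real r"] by (simp add: lam_real cof_real_mult)

text \<open>Positivity of \<open>norm (star A * A) *\<^sub>R 1 - star A * A\<close> is preserved.
  The resulting continuity lets \<open>\<psi>\<close> commute with \<open>fc\<close>.\<close>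

lemma norm_\<psi>_le: assumes A: "A \<in> M1" shows "norm (\<psi> A) \<le> norm A"
proof -
  let ?m = "norm (star A * A)"
  have "0 \<le> \<psi> (?m *\<^sub>R 1 - star A * A)"
    by (rule \<psi>_pos) (use A pos_le_norm[of "star A * A"] in auto)
  also have "\<psi> (?m *\<^sub>R 1 - star A * A) = ?m *\<^sub>R 1 - star (\<psi> A) * \<psi> A"
    using A \<psi>_star[OF A] by (simp add: \<psi>_diff \<psi>_mult \<psi>_scaleR \<psi>_1)
  finally have le: "star (\<psi> A) * \<psi> A \<le> ?m *\<^sub>R 1" by simp
  have "norm (\<psi> A \<cdot> x) \<le> norm A * norm x" for x
  proof -
    have "(norm (\<psi> A \<cdot> x))\<^sup>2 \<le> Re (cinner ((?m *\<^sub>R 1) \<cdot> x) x)"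
      unfolding norm_app_sq by (rule le_imp_Re_le[OF le])
    also have "\<dots> = (norm A * norm x)\<^sup>2"
      by (simp add: cinner_scaleR_left cinner_self norm_star_mult power_mult_distrib)
    finally show ?thesis by (rule power2_le_imp_le) simp
  qed
  then show ?thesis by (intro norm_cop_bound) simp_all
qed

lemma pop_in: "A \<in> M1 \<Longrightarrow> pop q A \<in> M1"
  by (induction q) (auto simp: pop_pCons)

lemma \<psi>_pop: "A \<in> M1 \<Longrightarrow> \<psi> (pop q A) = pop q (\<psi> A)"
  by (induction q) (auto simp: pop_pCons \<psi>_0 \<psi>_add \<psi>_mult \<psi>_scaleR \<psi>_1 pop_in)

lemma \<psi>_fc:
  assumes A: "A \<in> M1" "star A = A" and f: "continuous_on UNIV f"
  shows "\<psi> (fc f A) = fc f (\<psi> A)"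
proof -
  obtain q where q: "uniform_limit {-norm A..norm A} (\<lambda>n. poly (q n)) f sequentially"
    using poly_approximation[OF f] by blast
  have sA: "star (\<psi> A) = \<psi> A" using \<psi>_star[OF A(1)] A(2) by simp
  have lim: "(\<lambda>n. pop (q n) A) \<longlonglongrightarrow> fc f A" by (rule fc_approx[OF A(2) f order_refl q])
  have fM: "fc f A \<in> M1" by (rule F1.fc_in[OF A f])
  have "(\<lambda>n. \<psi> (pop (q n) A)) \<longlonglongrightarrow> \<psi> (fc f A)"
  proof (rule Lim_null_comparison[THEN LIM_zero_cancel])
    show "\<forall>\<^sub>F n in sequentially. norm (\<psi> (pop (q n) A) - \<psi> (fc f A)) \<le> norm (pop (q n) A - fc f A)"
      using norm_\<psi>_le[of "pop (q _) A - fc f A"] pop_in[OF A(1)] fM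
      by (intro always_eventually allI) (simp add: \<psi>_diff[symmetric])
    show "(\<lambda>n. norm (pop (q n) A - fc f A)) \<longlonglongrightarrow> 0"
      using lim by (simp add: LIM_zero_iff tendsto_norm_zero_iff)
  qed
  moreover have "(\<lambda>n. \<psi> (pop (q n) A)) \<longlonglongrightarrow> fc f (\<psi> A)"
    unfolding \<psi>_pop[OF A(1)] by (rule fc_approx[OF sA f norm_\<psi>_le[OF A(1)] q])
  ultimately show ?thesis by (rule LIMSEQ_unique)
qed

end

section \<open>Preservation of the trace\<close>

context tracial_factor
begin

lemma tr_sum:
  assumes "finite T" "\<And>i. i \<in> T \<Longrightarrow> f i \<in> M" "\<And>i. i \<in> T \<Longrightarrow> 0 \<le> f i"
  shows "\<tau> (\<Sum>i\<in>T. f i) = (\<Sum>i\<in>T. \<tau> (f i))"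
  using assms
proof (induction T rule: finite_induct)
  case (insert i T)
  then show ?case using tr_add[of "f i" "sum f T"] by (simp add: M_sum sum_nonneg)
qed (simp add: tr_0)

text \<open>Every positive contraction \<open>A\<close> below \<open>P\<close> is realised by a distance in the Grassmann space:
  take \<open>Q\<close> to be the range of \<open>(P - s\<^sup>2)\<^sup>1\<^sup>/\<^sup>2 + w s\<close>, where \<open>s\<^sup>2\<^sup>a = A\<close>; then \<open>(P - Q)\<^sup>2 = s\<^sup>2 + w s\<^sup>2 w\<^sup>*\<close>.\<close>

lemma angle_realisation:
  assumes P: "P \<in> G" and R: "R \<in> G" and PR: "P * R = 0" and w: "w \<in> U P R" and a: "0 < a"
    and A: "A \<in> M" "0 \<le> A" "A \<le> 1" "P * A = A"
  shows "\<exists>Q\<in>G. fc (apowr a) ((P - Q) * (P - Q)) = A + w * A * star w"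
proof -
  have sA: "star A = A" by (rule pos_selfadj[OF A(2)])
  have "star (P * A) = star A" using A(4) by simp
  then have AP: "A * P = A" using sA GD(5)[OF P] by simp
  have ia: "0 < inverse a" using a by simp
  note ca = continuous_apowr[OF a] and cia = continuous_apowr[OF ia]
  \<comment> \<open>\<open>E\<close> is the squared sine of the angle that \<open>Q\<close> is to
    make with \<open>P\<close>; its power with exponent \<open>a\<close> is
    \<open>A\<close>.\<close>
  define E where "E = fc (apowr (inverse a)) A"
  have EM: "E \<in> M" unfolding E_def by (rule fc_in[OF A(1) sA cia])
  have sE: "star E = E" unfolding E_def by (rule star_fc[OF sA cia])
  have E0: "0 \<le> E" unfolding E_def by (rule fc_pos[OF sA cia]) simp
  have E1: "E \<le> 1"
  proof -
    have "norm A \<le> 1"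
    proof -
      have le: "norm (csqrt A \<cdot> x) \<le> 1 * norm x" for x
      proof -
        have "(norm (csqrt A \<cdot> x))\<^sup>2 = Re (cinner (A \<cdot> x) x)"
          unfolding norm_app_sq using csqrt_selfadj[OF A(2)] csqrt_sq[OF A(2)] by simp
        also have "\<dots> \<le> (1 * norm x)\<^sup>2" using le_imp_Re_le[OF A(3), of x] by (simp add: norm_sq_cinner)
        finally show ?thesis by (rule power2_le_imp_le) simp
      qed
      then have "norm (csqrt A) \<le> 1" by (intro norm_cop_bound) simp_all
      then have "norm (csqrt A) * norm (csqrt A) \<le> 1" by (simp add: mult_le_one)
      then show ?thesis using norm_mult_ineq[of "csqrt A" "csqrt A"] csqrt_sq[OF A(2)] by simp
    qed
    then show ?thesis unfolding E_def by (intro fc_le_1[OF sA cia]) (use ia in \<open>auto intro!: apowr_le_1\<close>)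
  qed
  have "E * (1 - P) = apowr (inverse a) 0 *\<^sub>R (1 - P)"
    unfolding E_def by (rule fc_eigen[OF sA cia]) (simp add: AP right_diff_distrib)
  then have EP: "E * P = E" by (simp add: right_diff_distrib)
  then have "star (E * P) = star E" by simp
  then have PE: "P * E = E" using sE GD(5)[OF P] by simp
  have "P * E * P \<le> P * 1 * P" using conj_mono[OF E1, of P] GD(5)[OF P] by simp
  then have PE0: "0 \<le> P - E" using PE EP GD(4)[OF P] by simp
  \<comment> \<open>Sine \<open>s\<close> and cosine \<open>t\<close> satisfy
    \<open>s * s + t * t = P\<close>, so that \<open>V = t + w * s\<close> below rotates
    \<open>P\<close> towards \<open>R\<close> and has initial projection \<open>P\<close>.\<close>
  define s where "s = csqrt E"
  define t where "t = csqrt (P - E)"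
  have s: "s \<in> M" "star s = s" "s * s = E" unfolding s_def using csqrt_in csqrt_selfadj csqrt_sq EM E0 by auto
  have t: "t \<in> M" "star t = t" "t * t = P - E"
    unfolding t_def using csqrt_in[OF _ PE0] csqrt_selfadj[OF PE0] csqrt_sq[OF PE0] EM GD(1)[OF P] by auto
  have sP: "s * P = s"
  proof -
    have "s * (1 - P) = 0" unfolding s_def by (rule csqrt_kill[OF E0]) (simp add: EP right_diff_distrib)
    then show ?thesis by (simp add: right_diff_distrib)
  qed
  have tP: "t * P = t"
  proof -
    have "t * (1 - P) = 0" unfolding t_def
      by (rule csqrt_kill[OF PE0]) (simp add: EP right_diff_distrib left_diff_distrib GD(4)[OF P])
    then show ?thesis by (simp add: right_diff_distrib)
  qed
  have Ps: "P * s = s" and Pt: "P * t = t"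
    using arg_cong[OF sP, of star] arg_cong[OF tP, of star] s(2) t(2) GD(5)[OF P] by simp_all
  have sE': "s * E = E * s" unfolding s(3)[symmetric] by (simp only: mult.assoc)
  have "t * s = s * t" unfolding t_def
    by (rule csqrt_commute[OF PE0]) (simp add: left_diff_distrib right_diff_distrib Ps sP sE')
  then have ts: "s * t = t * s" ..
  note w' = UD[OF w P]
  have Pw: "P * w = 0" by (rule U_orth[OF w P PR])
  have wP: "star w * P = 0" using arg_cong[OF Pw, of star] GD(5)[OF P] by simp
  have sw: "s * w = 0" "t * w = 0" "E * w = 0"
    using Pw sP tP EP by (metis mult.assoc mult_zero_right)+
  have ws: "star w * s = 0" "star w * t = 0" "star w * E = 0"
    using wP Ps Pt PE by (metis mult.assoc mult_zero_left)+
  have wws: "star w * (w * s) = s" "star w * (w * t) = t" "star w * (w * E) = E"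
    using w'(2) Ps Pt PE by (simp_all flip: mult.assoc)
  define V where "V = t + w * s"
  define Q where "Q = V * star V"
  have sV: "star V = t + s * star w" by (simp add: V_def s t)
  have "star V * V = t * t + t * w * s + s * (star w * t) + s * (star w * (w * s))"
    unfolding sV by (simp add: V_def distrib_left distrib_right mult.assoc add.assoc)
  then have VV: "star V * V = P" using sw ws wws s t by simp
  have VM: "V \<in> M" unfolding V_def using s t w' by auto
  have Q: "Q \<in> G" unfolding Q_def by (rule G_range[OF VM]) (simp add: VV P)
  \<comment> \<open>The mixed term, cosine times sine. From \<open>Y * Y = (P - E) * E\<close> the
    sum \<open>E * E + Y * Y\<close> in the square of \<open>P - Q\<close> collapses to
    \<open>E\<close>.\<close>
  define Y where "Y = t * s"
  have Yc: "Y * E = E * Y" "Y * Y = (P - E) * E"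
  proof -
    have "t * E = E * t" unfolding s(3)[symmetric] using ts by (metis mult.assoc)
    then show "Y * E = E * Y" unfolding Y_def using sE' by (metis mult.assoc)
    have "Y * Y = t * (s * t) * s" by (simp add: Y_def mult.assoc)
    also have "\<dots> = (t * t) * (s * s)" unfolding ts by (simp add: mult.assoc)
    finally show "Y * Y = (P - E) * E" unfolding t(3) s(3) .
  qed
  have "star w * (w * Y) = (star w * (w * t)) * s" "star w * Y = (star w * t) * s"
    by (simp_all only: Y_def mult.assoc)
  then have Yw: "Y * w = 0" "star w * Y = 0" "star w * (w * Y) = Y" "s * t = Y"
    using sw ws wws ts by (simp_all add: Y_def mult.assoc)
  have PQ: "P - Q = E - Y * star w - w * Y - w * E * star w"
  proof -
    have "s * (s * Z) = E * Z" "t * (s * Z) = Y * Z" for Z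
      by (simp_all only: s(3)[symmetric] Y_def mult.assoc)
    then show ?thesis
      unfolding Q_def sV using t(3) Yw(4) by (simp add: V_def distrib_left distrib_right mult.assoc)
  qed
  have assoc0: "E * (w * Z) = 0" "Y * (w * Z) = 0" "star w * (E * Z) = 0" "star w * (Y * Z) = 0"
    "star w * (w * (E * Z)) = E * Z" "star w * (w * (Y * Z)) = Y * Z" "Y * (E * Z) = E * (Y * Z)" for Z
    using sw ws wws Yw Yc(1) by (simp_all flip: mult.assoc)
  have sq: "(P - Q) * (P - Q) = (E * E + Y * Y) + w * (E * E + Y * Y) * star w"
    unfolding PQ by (simp add: left_diff_distrib right_diff_distrib distrib_left distrib_right mult.assoc
        assoc0 sw ws wws Yw Yc(1))
  have "E * E + Y * Y = E" unfolding Yc(2) using PE by (simp add: left_diff_distrib)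
  then have B: "(P - Q) * (P - Q) = E + w * E * star w" using sq by simp
  define A2 where "A2 = A + w * A * star w"
  have A20: "0 \<le> A2" unfolding A2_def using A(2) conj_pos[OF A(2), of "star w"] by (simp add: add_nonneg_nonneg)
  have sA2: "star A2 = A2" by (rule pos_selfadj[OF A20])
  have Aw: "A * w = 0" "star w * P = 0" using Pw AP wP by (metis mult.assoc mult_zero_right)+
  \<comment> \<open>The power of \<open>A2\<close> is computed piecewise: on \<open>P\<close> and
    along \<open>w\<close> it is intertwined with that of \<open>A\<close>, and on the complement of
    \<open>P + R\<close> it vanishes. Raising \<open>K\<close> to the exponent \<open>a\<close> then
    gives back \<open>A2\<close>.\<close>
  define K where "K = fc (apowr (inverse a)) A2"
  have "K * P = P * E" unfolding K_def E_def
    by (rule fc_intertwine[OF sA2 sA cia]) (simp add: A2_def distrib_right AP A(4) mult.assoc wP)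
  moreover have "K * w = w * E" unfolding K_def E_def
    by (rule fc_intertwine[OF sA2 sA cia]) (simp add: A2_def distrib_right Aw w'(2) mult.assoc AP)
  moreover have "K * (1 - P - R) = apowr (inverse a) 0 *\<^sub>R (1 - P - R)" unfolding K_def
  proof (rule fc_eigen[OF sA2 cia])
    have "star w * R = star w" by (rule w'(6))
    moreover have "A * R = 0" using AP PR by (metis mult.assoc mult_zero_right)
    ultimately show "A2 * (1 - P - R) = 0 *\<^sub>R (1 - P - R)"
      by (simp add: A2_def distrib_right right_diff_distrib AP mult.assoc wP)
  qed
  moreover have "K = K * P + K * w * star w + K * (1 - P - R)"
    using w'(3) by (simp add: right_diff_distrib mult.assoc)
  ultimately have "K = E + w * E * star w" using PE by simp
  then have "fc (apowr a) ((P - Q) * (P - Q)) = fc (apowr a) K" using B by simp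
  also have "\<dots> = fc (\<lambda>t. apowr a (apowr (inverse a) t)) A2"
    unfolding K_def by (rule fc_compose[OF sA2 ca cia])
  also have "\<dots> = A2" using a fc_abs[OF A20] by (simp add: apowr_apowr apowr_one)
  finally show ?thesis using Q unfolding A2_def by blast
qed

text \<open>Maximal orthogonal families in \<open>G\<close> may leave a remainder, but one that is too small to contain an
  element of \<open>G\<close> and hence, by comparison, lies below one.\<close>

lemma exhausting_family:
  "\<exists>L\<subseteq>M. (\<forall>r\<in>L. proj r \<and> (\<exists>P\<in>G. P * r = r)) \<and> (\<forall>r\<in>L. \<forall>s\<in>L. r \<noteq> s \<longrightarrow> r * s = 0) \<and>
    (\<forall>C. (\<forall>r\<in>L. C * r = 0) \<longrightarrow> C = 0)"
proof -
  define \<A> where "\<A> = {H. H \<subseteq> G \<and> (\<forall>r\<in>H. \<forall>s\<in>H. r \<noteq> s \<longrightarrow> r * s = 0)}"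
  have "\<Union>C \<in> \<A>" if C: "subset.chain \<A> C" for C
  proof -
    have CA: "X \<in> \<A>" if "X \<in> C" for X using C that unfolding subset_chain_def by auto
    have lin: "X \<subseteq> Y \<or> Y \<subseteq> X" if "X \<in> C" "Y \<in> C" for X Y
      using C that unfolding subset_chain_def by auto
    have "r * s = 0" if r: "r \<in> \<Union>C" and s: "s \<in> \<Union>C" and ne: "r \<noteq> s" for r s
    proof -
      obtain X where X: "r \<in> X" "X \<in> C" using r by (rule UnionE)
      obtain Y where Y: "s \<in> Y" "Y \<in> C" using s by (rule UnionE)
      obtain Z where Z: "r \<in> Z" "s \<in> Z" "Z \<in> C" using lin[OF X(2) Y(2)] X Y by (metis subsetD)
      then show ?thesis using CA[OF Z(3)] ne unfolding \<A>_def by simp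
    qed
    moreover have "\<Union>C \<subseteq> G" using CA unfolding \<A>_def by auto
    ultimately show ?thesis unfolding \<A>_def by simp
  qed
  then obtain H where H: "H \<in> \<A>" "\<And>X. X \<in> \<A> \<Longrightarrow> H \<subseteq> X \<Longrightarrow> X = H"
    using subset_Zorn'[of \<A>] by blast
  have HG: "H \<subseteq> G" and Ho: "\<And>r s. r \<in> H \<Longrightarrow> s \<in> H \<Longrightarrow> r \<noteq> s \<Longrightarrow> r * s = 0" using H(1) by (auto simp: \<A>_def)
  have max: "P \<in> H" if P: "P \<in> G" and o: "\<And>h. h \<in> H \<Longrightarrow> P * h = 0" for P
  proof -
    have "insert P H \<in> \<A>" using P o HG Ho G_orth_sym[OF P] unfolding \<A>_def by auto
    then show ?thesis using H(2)[of "insert P H"] by blast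
  qed
  obtain P0 where P0: "P0 \<in> H"
  proof (cases "H = {}")
    case True
    obtain P where "P \<in> G" using G_ne by (auto simp: G_def)
    then have "P \<in> H" by (rule max) (simp add: True)
    then show ?thesis using that by blast
  qed (use that in blast)
  have P0G: "P0 \<in> G" using P0 HG by blast
  define e where "e = 1 - join H"
  have eM: "e \<in> M" unfolding e_def using join_in[of H] HG GD(1) by auto
  have pe: "proj e" unfolding e_def by (rule proj_compl) simp
  have eh: "e * h = 0" if "h \<in> H" for h
    unfolding e_def using join_absorb[OF that] by (simp add: left_diff_distrib)
  have he: "h * e = 0" if "h \<in> H" for h
    using proj_orth_commute[OF pe GD(2)] eh that HG by blast
  \<comment> \<open>Compare the remainder \<open>e\<close> with a member \<open>P0\<close> of the
    family. Embedding all of \<open>P0\<close> below \<open>e\<close> contradicts maximality, so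
    \<open>e\<close> is equivalent to a part \<open>q\<close> of \<open>P0\<close>; exchanging
    \<open>q\<close> for \<open>e\<close> in \<open>P0\<close> yields a member of \<open>G\<close>
    above \<open>e\<close>.\<close>
  have eG: "\<exists>P\<in>G. P * e = e"
  proof -
    obtain W where W: "W \<in> M" "proj (star W * W)" "W * P0 = W" "e * W = W"
      "star W * W = P0 \<or> W * star W = e"
      using comparison[OF GD(1,2)[OF P0G] eM pe] by blast
    have "star W * W \<noteq> P0"
    proof
      assume WP: "star W * W = P0"
      have WG: "W * star W \<in> G" by (rule G_range[OF W(1)]) (simp add: WP P0G)
      have "star W * h = 0" if "h \<in> H" for h
      proof -
        have "star W = star W * e" using W(4) projD(2)[OF pe] by (metis star_simps(1))
        then have "star W * h = star W * (e * h)" by (metis mult.assoc)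
        then show ?thesis using eh[OF that] by simp
      qed
      then have "W * star W \<in> H" by (intro max WG) (simp add: mult.assoc)
      then have "(W * star W) * (W * star W) = 0" using eh W(4) by (metis mult.assoc mult_zero_left)
      then have "W * star W = 0" using GD(4)[OF WG] by simp
      then show False using G_nonzero[OF WG] by simp
    qed
    then have e: "W * star W = e" using W(5) by blast
    define q where "q = star W * W"
    have q: "q \<in> M" "proj q" using W by (auto simp: q_def)
    have Pq: "P0 * q = q" unfolding q_def using below_G[OF W(1,2) GD(2)[OF P0G] W(3)] by simp
    have pd: "proj (P0 - q)" by (rule proj_diff[OF GD(2)[OF P0G] q(2) Pq])
    have qe: "q * e = 0"
      using proj_sub_commute[OF GD(2)[OF P0G] q(2) Pq] he[OF P0] by (metis mult.assoc mult_zero_right)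
    have o: "(P0 - q) * e = 0" by (simp add: left_diff_distrib he[OF P0] qe)
    have "\<tau> (P0 - q + e) = \<tau> (P0 - q) + \<tau> e"
      using tr_add[of "P0 - q" e] proj_pos[OF pd] proj_pos[OF pe] GD(1)[OF P0G] q eM by auto
    also have "\<tau> e = \<tau> q" using tr_star[OF W(1)] e by (simp add: q_def)
    also have "\<tau> (P0 - q) + \<tau> q = \<tau> P0"
      using tr_diff[of q P0] q GD(1)[OF P0G] proj_sub_le[OF GD(2)[OF P0G] q(2) Pq] proj_pos[OF q(2)]
      by (simp add: add.commute)
    finally have "P0 - q + e \<in> G" using proj_add[OF pd pe o] GD[OF P0G] q eM by (auto simp: G_def)
    moreover have "(P0 - q + e) * e = e" using o projD(1)[OF pe] by (simp add: distrib_right)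
    ultimately show ?thesis by blast
  qed
  have total: "C = 0" if C: "\<forall>r\<in>insert e H. C * r = 0" for C
  proof -
    have "C * join H = 0" by (rule join_kill) (use C in simp)
    then show ?thesis using C by (simp add: e_def right_diff_distrib)
  qed
  have 1: "insert e H \<subseteq> M" using eM HG GD(1) by auto
  have 2: "\<forall>r\<in>insert e H. proj r \<and> (\<exists>P\<in>G. P * r = r)"
  proof
    fix r assume r: "r \<in> insert e H"
    show "proj r \<and> (\<exists>P\<in>G. P * r = r)"
    proof (cases "r = e")
      case False
      then have "r \<in> G" using r HG by auto
      then show ?thesis using GD(2,4) by (intro conjI bexI[of _ r])
    qed (use pe eG in simp)
  qed
  have 3: "\<forall>r\<in>insert e H. \<forall>s\<in>insert e H. r \<noteq> s \<longrightarrow> r * s = 0"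
  proof (intro ballI impI)
    fix r s assume rs: "r \<in> insert e H" "s \<in> insert e H" "r \<noteq> s"
    then consider "r \<in> H" "s \<in> H" | "r = e" "s \<in> H" | "r \<in> H" "s = e" by blast
    then show "r * s = 0" using Ho eh he rs(3) by cases simp_all
  qed
  have 4: "\<forall>C. (\<forall>r\<in>insert e H. C * r = 0) \<longrightarrow> C = 0" by (intro allI impI total)
  show ?thesis using 1 2 3 4 by (intro exI[of _ "insert e H"] conjI)
qed

lemma family_mult:
  assumes "finite T" "S \<subseteq> T" "\<And>i. i \<in> T \<Longrightarrow> proj (f i)" "\<And>i j. i \<in> T \<Longrightarrow> j \<in> T \<Longrightarrow> i \<noteq> j \<Longrightarrow> f i * f j = 0"
  shows "(\<Sum>i\<in>T. f i) * (\<Sum>j\<in>S. f j) = (\<Sum>j\<in>S. f j)"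
proof -
  have "(\<Sum>i\<in>T. f i) * f j = f j" if j: "j \<in> S" for j
  proof -
    have jT: "j \<in> T" using assms(2) j by blast
    have "f i * f j = (if i = j then f j else 0)" if "i \<in> T" for i
      using assms(4)[OF that jT] projD(1)[OF assms(3)[OF jT]] by simp
    then have "(\<Sum>i\<in>T. f i * f j) = (\<Sum>i\<in>T. if i = j then f j else 0)" by (rule sum.cong[OF refl])
    then show ?thesis using assms(1,2) j by (auto simp: sum_distrib_right)
  qed
  then show ?thesis by (simp add: sum_distrib_left)
qed

lemma
  assumes "finite T" "\<And>i. i \<in> T \<Longrightarrow> proj (f i)" "\<And>i j. i \<in> T \<Longrightarrow> j \<in> T \<Longrightarrow> i \<noteq> j \<Longrightarrow> f i * f j = 0"
  shows family_proj: "proj (\<Sum>i\<in>T. f i)"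
  using family_mult[OF assms(1) order_refl assms(2,3)] assms(2)
  by (auto simp: proj_def star_sum intro!: sum.cong)

text \<open>The vectors approximated by finite sums form a closed complex subspace \<open>Z\<close>
  containing the ranges of all \<open>f i\<close>. By \<open>total\<close> these ranges already span
  the whole space, so \<open>Z\<close> is everything.\<close>

lemma family_approximates:
  fixes f :: "'i \<Rightarrow> 'a cop"
  assumes f: "\<And>i. i \<in> L \<Longrightarrow> proj (f i)" "\<And>i j. i \<in> L \<Longrightarrow> j \<in> L \<Longrightarrow> i \<noteq> j \<Longrightarrow> f i * f j = 0"
    and total: "\<And>C. C \<in> M \<Longrightarrow> (\<And>i. i \<in> L \<Longrightarrow> C * f i = 0) \<Longrightarrow> C = 0" and fM: "\<And>i. i \<in> L \<Longrightarrow> f i \<in> M"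
    and e: "0 < e"
  shows "\<exists>T. finite T \<and> T \<subseteq> L \<and> norm (y - (\<Sum>i\<in>T. f i) \<cdot> y) \<le> e"
proof -
  define F where "F T = (\<Sum>i\<in>T. f i)" for T
  define Z where "Z = {y. \<forall>e>0. \<exists>T. finite T \<and> T \<subseteq> L \<and> norm (y - F T \<cdot> y) \<le> e}"
  have Fp: "proj (F T)" if "finite T" "T \<subseteq> L" for T
    unfolding F_def by (intro family_proj f(1) f(2)) (use that in auto)
  have n1: "norm (1 - F T) \<le> 1" if "finite T" "T \<subseteq> L" for T using norm_proj[OF proj_compl[OF Fp[OF that]]] .
  have mono: "norm (y - F T \<cdot> y) \<le> norm (y - F S \<cdot> y)" if T: "finite T" "T \<subseteq> L" "S \<subseteq> T" for S T y
  proof -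
    have "F T * F S = F S" unfolding F_def by (intro family_mult f(1) f(2)) (use that in auto)
    then have "(1 - F T) * (1 - F S) = 1 - F T" by (simp add: left_diff_distrib right_diff_distrib)
    then have "y - F T \<cdot> y = (1 - F T) \<cdot> (y - F S \<cdot> y)" by (metis app_simps(2,5,6))
    then show ?thesis
      using norm_app[of "1 - F T" "y - F S \<cdot> y"] mult_right_mono[OF n1[OF T(1,2)], of "norm (y - F S \<cdot> y)"]
      by simp
  qed
  have "csubspace Z"
  proof (rule csubspaceI)
    show "0 \<in> Z" unfolding Z_def by (auto intro!: exI[of _ "{}"])
    show "x + y \<in> Z" if x: "x \<in> Z" and y: "y \<in> Z" for x y
      unfolding Z_def
    proof (intro CollectI allI impI)
      fix e :: real assume "0 < e"
      then have e2: "0 < e / 2" by simp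
      obtain S where S: "finite S" "S \<subseteq> L" "norm (x - F S \<cdot> x) \<le> e / 2" using x e2 unfolding Z_def by blast
      obtain T where T: "finite T" "T \<subseteq> L" "norm (y - F T \<cdot> y) \<le> e / 2" using y e2 unfolding Z_def by blast
      have "norm (x - F (S \<union> T) \<cdot> x) \<le> e / 2" "norm (y - F (S \<union> T) \<cdot> y) \<le> e / 2"
        using mono[of "S \<union> T" S x] mono[of "S \<union> T" T y] S T by auto
      then have "norm ((x - F (S \<union> T) \<cdot> x) + (y - F (S \<union> T) \<cdot> y)) \<le> e / 2 + e / 2"
        by (rule norm_triangle_mono)
      then show "\<exists>T. finite T \<and> T \<subseteq> L \<and> norm (x + y - F T \<cdot> (x + y)) \<le> e"
        using S T by (intro exI[of _ "S \<union> T"]) (simp add: algebra_simps)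
    qed
    show "z *\<^sub>C x \<in> Z" if x: "x \<in> Z" for z x
      unfolding Z_def
    proof (intro CollectI allI impI)
      fix e :: real assume e: "0 < e"
      then have "0 < e / (cmod z + 1)" by (simp add: add_nonneg_pos)
      then obtain T where T: "finite T" "T \<subseteq> L" "norm (x - F T \<cdot> x) \<le> e / (cmod z + 1)"
        using x unfolding Z_def by blast
      have "norm (z *\<^sub>C x - F T \<cdot> z *\<^sub>C x) = cmod z * norm (x - F T \<cdot> x)"
        by (simp add: norm_scaleC flip: scaleC_diff_right)
      also have "\<dots> \<le> cmod z * (e / (cmod z + 1))" by (intro mult_left_mono T) simp
      also have "\<dots> \<le> e"
      proof -
        have "0 < cmod z + 1" by (simp add: add_nonneg_pos)
        then show ?thesis using e by (simp add: field_simps)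
      qed
      finally show "\<exists>T. finite T \<and> T \<subseteq> L \<and> norm (z *\<^sub>C x - F T \<cdot> z *\<^sub>C x) \<le> e" using T by blast
    qed
  qed
  moreover have "closed Z"
    unfolding closed_sequential_limits
  proof (intro allI impI, elim conjE)
    fix g l assume g: "\<forall>n. g n \<in> Z" "g \<longlonglongrightarrow> l"
    show "l \<in> Z" unfolding Z_def
    proof (intro CollectI allI impI)
      fix e :: real assume "0 < e"
      then have e2: "0 < e / 2" by simp
      then obtain n where n: "norm (g n - l) < e / 2"
        using LIMSEQ_D[OF g(2), of "e / 2"] by blast
      obtain T where T: "finite T" "T \<subseteq> L" "norm (g n - F T \<cdot> g n) \<le> e / 2" using g(1) e2 unfolding Z_def by blast
      have "l - F T \<cdot> l = (g n - F T \<cdot> g n) - (1 - F T) \<cdot> (g n - l)" by simp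
      moreover have "norm ((1 - F T) \<cdot> (g n - l)) \<le> 1 * norm (g n - l)"
        by (rule order_trans[OF norm_app mult_right_mono[OF n1[OF T(1,2)]]]) simp
      ultimately have "norm (l - F T \<cdot> l) \<le> e / 2 + norm (g n - l)"
        using T(3) norm_triangle_ineq4[of "g n - F T \<cdot> g n" "(1 - F T) \<cdot> (g n - l)"] by simp
      then show "\<exists>T. finite T \<and> T \<subseteq> L \<and> norm (l - F T \<cdot> l) \<le> e" using n T by (intro exI[of _ T]) simp
    qed
  qed
  ultimately obtain p where p: "proj p" "\<And>x. p \<cdot> x \<in> Z" "\<And>x. x \<in> Z \<Longrightarrow> p \<cdot> x = x"
    using proj_onto_exists[of Z] by metis
  have "p = 1"
  proof -
    have rZ: "f i \<cdot> x \<in> Z" if i: "i \<in> L" for i x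
    proof -
      have "F {i} \<cdot> f i \<cdot> x = f i \<cdot> x" unfolding F_def using projD(1)[OF f(1)[OF i]] by (simp flip: app_simps(5))
      then show ?thesis unfolding Z_def using i by (auto intro!: exI[of _ "{i}"])
    qed
    have "(1 - pspan (\<Union>P\<in>f ` L. range ((\<cdot>) P))) = 0"
    proof (rule total)
      show "1 - pspan (\<Union>P\<in>f ` L. range ((\<cdot>) P)) \<in> M"
        using pspan_span_in[of "f ` L"] fM by auto
      show "(1 - pspan (\<Union>P\<in>f ` L. range ((\<cdot>) P))) * f i = 0" if "i \<in> L" for i
        using join_absorb[of "f i" "f ` L"] that by (simp add: join_def left_diff_distrib)
    qed
    moreover have "(1 - p) * pspan (\<Union>P\<in>f ` L. range ((\<cdot>) P)) = 0"
      by (rule pspan_kill) (use rZ p(3) in auto)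
    ultimately show ?thesis by simp
  qed
  then have "y \<in> Z" using p(2)[of y] by simp
  then show ?thesis using e unfolding Z_def F_def by blast
qed

text \<open>Compressions \<open>F * A * F\<close> need not increase with \<open>F\<close>, but
  \<open>S * F * S\<close> with \<open>S = csqrt A\<close> does, and its supremum is
  \<open>A\<close>. Normality is applied to these operators, and \<open>tr_compress\<close> turns
  each \<open>S * f i * S\<close> back into a compression of \<open>A\<close>.\<close>

lemma tr_family:
  fixes f :: "'i \<Rightarrow> 'a cop"
  assumes f: "\<And>i. i \<in> L \<Longrightarrow> proj (f i)" "\<And>i j. i \<in> L \<Longrightarrow> j \<in> L \<Longrightarrow> i \<noteq> j \<Longrightarrow> f i * f j = 0"
    and total: "\<And>C. C \<in> M \<Longrightarrow> (\<And>i. i \<in> L \<Longrightarrow> C * f i = 0) \<Longrightarrow> C = 0" and fM: "\<And>i. i \<in> L \<Longrightarrow> f i \<in> M"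
    and A: "A \<in> M" "0 \<le> A"
  shows "\<tau> A = (SUP T\<in>{T. finite T \<and> T \<subseteq> L}. \<Sum>i\<in>T. \<tau> (f i * A * f i))"
proof -
  define \<F> where "\<F> = {T. finite T \<and> T \<subseteq> L}"
  define F where "F T = (\<Sum>i\<in>T. f i)" for T
  define S where "S = csqrt A"
  have S: "S \<in> M" "star S = S" "S * S = A" unfolding S_def using csqrt_in csqrt_selfadj csqrt_sq A by auto
  define X where "X T = S * F T * S" for T
  have Fp: "proj (F T)" if "T \<in> \<F>" for T
    unfolding F_def by (intro family_proj f(1) f(2)) (use that in \<open>auto simp: \<F>_def\<close>)
  have FM: "F T \<in> M" if "T \<in> \<F>" for T unfolding F_def using that fM by (intro M_sum) (auto simp: \<F>_def)
  have Xmono: "X T \<le> X T'" if "T \<in> \<F>" "T' \<in> \<F>" "T \<subseteq> T'" for T T'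
  proof -
    have "F T' * F T = F T" unfolding F_def by (intro family_mult f(1) f(2)) (use that in \<open>auto simp: \<F>_def\<close>)
    then have "F T \<le> F T'" using proj_sub_le Fp that by blast
    then show ?thesis unfolding X_def using conj_mono[of "F T" "F T'" S] S(2) by simp
  qed
  have Xpos: "0 \<le> X T" if "T \<in> \<F>" for T
    unfolding X_def using conj_pos[OF proj_pos[OF Fp[OF that]], of S] S(2) by simp
  have "\<tau> A = (SUP B\<in>X ` \<F>. \<tau> B)"
  proof (rule tr_normal)
    show "X ` \<F> \<subseteq> M" unfolding X_def using S FM by auto
    show "X ` \<F> \<noteq> {}" unfolding \<F>_def by auto
    show "\<exists>E\<in>X ` \<F>. B \<le> E \<and> C \<le> E" if BC: "B \<in> X ` \<F>" "C \<in> X ` \<F>" for B C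
    proof -
      obtain T T' where T: "T \<in> \<F>" "B = X T" "T' \<in> \<F>" "C = X T'" using BC by auto
      then have "T \<union> T' \<in> \<F>" by (auto simp: \<F>_def)
      then show ?thesis using T Xmono[of T "T \<union> T'"] Xmono[of T' "T \<union> T'"] by auto
    qed
    show "B \<le> A" if "B \<in> X ` \<F>" for B
    proof -
      obtain T where T: "T \<in> \<F>" "B = X T" using \<open>B \<in> _\<close> by auto
      have "S * F T * S \<le> S * 1 * S" using conj_mono[OF proj_le_1[OF Fp[OF T(1)]], of S] S(2) by simp
      then show ?thesis using S(3) T(2) by (simp add: X_def)
    qed
    show "A \<le> C" if C: "C \<in> M" "0 \<le> C" "\<And>B. B \<in> X ` \<F> \<Longrightarrow> B \<le> C" for C
    proof (rule leI_cop)
      fix x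
      define y where "y = S \<cdot> x"
      define \<kappa> where "\<kappa> = Re (cinner (C \<cdot> x) x)"
      have \<kappa>0: "0 \<le> \<kappa>" using C(2) unfolding \<kappa>_def pos_iff by blast
      have bd: "norm (F T \<cdot> y) \<le> sqrt \<kappa>" if T: "T \<in> \<F>" for T
      proof -
        have "(norm (F T \<cdot> y))\<^sup>2 = Re (cinner ((star (F T) * F T) \<cdot> y) y)" by (rule norm_app_sq)
        also have "\<dots> = Re (cinner (X T \<cdot> x) x)"
          using projD[OF Fp[OF T]] S(2) by (simp add: X_def y_def cinner_app_left[of S])
        also have "\<dots> \<le> \<kappa>" unfolding \<kappa>_def using C(3) T by (intro le_imp_Re_le) auto
        finally show ?thesis by (rule real_le_rsqrt)
      qed
      \<comment> \<open>Finite sums \<open>F T\<close> applied to \<open>y\<close> come arbitrarily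
        close to \<open>y\<close>, so the uniform bound passes to \<open>norm y\<close>, whose
        square is the quadratic form of \<open>A\<close> at \<open>x\<close>.\<close>
      have "norm y \<le> sqrt \<kappa>"
      proof (rule field_le_epsilon)
        fix e :: real assume e: "0 < e"
        have "\<exists>T. finite T \<and> T \<subseteq> L \<and> norm (y - (\<Sum>i\<in>T. f i) \<cdot> y) \<le> e"
          by (rule family_approximates[where L = L and f = f, OF f(1) f(2) total fM e])
        then obtain T where T: "finite T" "T \<subseteq> L" "norm (y - (\<Sum>i\<in>T. f i) \<cdot> y) \<le> e" by auto
        then have "norm (F T \<cdot> y) \<le> sqrt \<kappa>" by (intro bd) (simp add: \<F>_def)
        then show "norm y \<le> sqrt \<kappa> + e"
          using T(3) norm_triangle_ineq[of "F T \<cdot> y" "y - F T \<cdot> y"] by (simp add: F_def)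
      qed
      then have "(norm y)\<^sup>2 \<le> \<kappa>" using \<kappa>0 by (metis norm_ge_zero power_mono real_sqrt_pow2)
      moreover have "(norm y)\<^sup>2 = Re (cinner (A \<cdot> x) x)" unfolding y_def norm_app_sq S(2,3) ..
      ultimately show "Re (cinner (A \<cdot> x) x) \<le> Re (cinner (C \<cdot> x) x)" by (simp add: \<kappa>_def)
    qed (use pos_selfadj A C in auto)
  qed (use A Xpos in auto)
  also have "\<dots> = (SUP T\<in>\<F>. \<Sum>i\<in>T. \<tau> (f i * A * f i))"
    unfolding image_image
  proof (rule SUP_cong[OF refl])
    fix T assume T: "T \<in> \<F>"
    have "\<tau> (X T) = \<tau> (\<Sum>i\<in>T. S * f i * S)" by (simp add: X_def F_def sum_distrib_left sum_distrib_right)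
    also have "\<dots> = (\<Sum>i\<in>T. \<tau> (S * f i * S))"
    proof (rule tr_sum)
      show "0 \<le> S * f i * S" if "i \<in> T" for i
        using conj_pos[OF proj_pos[OF f(1)], of i S] S(2) that T by (auto simp: \<F>_def)
    qed (use T S fM in \<open>auto simp: \<F>_def\<close>)
    also have "\<dots> = (\<Sum>i\<in>T. \<tau> (f i * A * f i))"
      unfolding S_def by (rule sum.cong) (use T f fM A tr_compress in \<open>auto simp: \<F>_def\<close>)
    finally show "\<tau> (X T) = (\<Sum>i\<in>T. \<tau> (f i * A * f i))" .
  qed
  finally show ?thesis unfolding \<F>_def .
qed

end

section \<open>Comparing the two traces by means of the metric\<close>

locale grassmann_isometry =
  grassmann_iso M1 \<tau>1 c M2 \<tau>2 \<phi> \<phi>'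
  for M1 :: "'a :: complex_hilbert cop set" and \<tau>1 c and M2 :: "'b :: complex_hilbert cop set" and \<tau>2 \<phi> \<phi>' +
  fixes a :: real
  assumes a_pos: "0 < a"
    and isometry: "P \<in> F1.G \<Longrightarrow> Q \<in> F1.G \<Longrightarrow>
      \<tau>1 (fc (apowr a) ((P - Q) * (P - Q))) = \<tau>2 (fc (apowr a) ((\<phi> P - \<phi> Q) * (\<phi> P - \<phi> Q)))"
begin

text \<open>By \<open>F1.angle_realisation\<close> the operator \<open>A + w * A * star w\<close> is
  a power of some \<open>(P - Q)\<^sup>2\<close>, so its trace, twice that of \<open>A\<close>, is
  read off from a distance. As \<open>\<psi>\<close> commutes with the functional calculus, the
  corresponding distance on the other side is twice the trace of \<open>\<psi> A\<close>.\<close>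

lemma trace_contraction:
  assumes P: "P \<in> F1.G" and A: "A \<in> M1" "0 \<le> A" "A \<le> 1" "P * A = A"
  shows "\<tau>1 A = \<tau>2 (\<psi> A)"
proof -
  obtain R w where R: "R \<in> F1.G" "P * R = 0" and w: "w \<in> F1.U P R"
    using hat_witness[OF P, of "{P}"] P by auto
  note w' = F1.UD[OF w P]
  obtain Q where Q: "Q \<in> F1.G" "fc (apowr a) ((P - Q) * (P - Q)) = A + w * A * star w"
    using F1.angle_realisation[OF P R w a_pos A] by blast
  have PM: "P \<in> M1" and QM: "Q \<in> M1" using F1.GD(1) P Q by auto
  have wA: "w * A * star w \<in> M1" using w' A by auto
  have pos: "0 \<le> w * A * star w" using conj_pos[OF A(2), of "star w"] by simp
  have "fc (apowr a) ((\<phi> P - \<phi> Q) * (\<phi> P - \<phi> Q)) = fc (apowr a) (\<psi> ((P - Q) * (P - Q)))"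
    using PM QM by (simp add: \<psi>_mult \<psi>_diff \<psi>_G P Q(1))
  also have "\<dots> = \<psi> (fc (apowr a) ((P - Q) * (P - Q)))"
    by (rule \<psi>_fc[symmetric, OF _ _ continuous_apowr[OF a_pos]])
      (use PM QM F1.GD(5)[OF P] F1.GD(5)[OF Q(1)] in auto)
  also have "\<dots> = \<psi> A + \<psi> w * \<psi> A * star (\<psi> w)"
    unfolding Q(2) using A(1) w'(1) by (simp add: \<psi>_add \<psi>_mult \<psi>_star)
  finally have eq: "\<tau>1 (A + w * A * star w) = \<tau>2 (\<psi> A + \<psi> w * \<psi> A * star (\<psi> w))"
    using isometry[OF P Q(1)] Q(2) by simp
  have "\<tau>1 (A + w * A * star w) = \<tau>1 A + \<tau>1 (w * A * star w)"
    by (rule F1.tr_add) (use A wA pos in auto)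
  moreover have "\<tau>1 (w * A * star w) = \<tau>1 A"
    by (rule F1.tr_conj_isometry) (use A w' in auto)
  moreover have A2: "\<psi> A \<in> M2" "0 \<le> \<psi> A" "\<psi> w \<in> M2" using \<psi>_in \<psi>_pos A w' by auto
  have "\<tau>2 (\<psi> A + \<psi> w * \<psi> A * star (\<psi> w)) = \<tau>2 (\<psi> A) + \<tau>2 (\<psi> w * \<psi> A * star (\<psi> w))"
    by (rule F2.tr_add) (use A2 conj_pos[OF A2(2), of "star (\<psi> w)"] in auto)
  moreover have "\<tau>2 (\<psi> w * \<psi> A * star (\<psi> w)) = \<tau>2 (\<psi> A)"
  proof (rule F2.tr_conj_isometry[OF A2])
    have "star (\<psi> w) * \<psi> w * \<psi> A = \<psi> (star w * w * A)" using A(1) w'(1) by (simp add: \<psi>_mult \<psi>_star)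
    then show "star (\<psi> w) * \<psi> w * \<psi> A = \<psi> A" using w'(2) A(4) by simp
  qed
  ultimately have "\<tau>1 A + \<tau>1 A = \<tau>2 (\<psi> A) + \<tau>2 (\<psi> A)" using eq by simp
  then have "2 * \<tau>1 A = 2 * \<tau>2 (\<psi> A)" by (simp add: mult_2)
  then show ?thesis by (simp add: ennreal_mult_cancel_left)
qed

lemma trace_corner:
  assumes P: "P \<in> F1.G" and A: "A \<in> M1" "0 \<le> A" "P * A = A"
  shows "\<tau>1 A = \<tau>2 (\<psi> A)"
proof -
  \<comment> \<open>The summand \<open>1\<close> avoids division by zero when
    \<open>A = 0\<close>.\<close>
  define m where "m = norm A + 1"
  have m: "0 < m" unfolding m_def by (simp add: add_nonneg_pos)
  define B where "B = (1 / m) *\<^sub>R A"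
  have B: "B \<in> M1" "0 \<le> B" "P * B = B" using A m by (auto simp: B_def scaleR_nonneg_nonneg)
  have "norm A *\<^sub>R (1 :: 'a cop) \<le> m *\<^sub>R 1"
    by (rule scaleR_right_mono) (simp_all add: m_def proj_pos)
  then have "A \<le> m *\<^sub>R 1" by (rule order_trans[OF pos_le_norm[OF A(2)]])
  then have "B \<le> (1 / m) *\<^sub>R (m *\<^sub>R 1)" unfolding B_def using m by (intro scaleR_left_mono) auto
  then have B1: "B \<le> 1" using m by simp
  have A': "A = m *\<^sub>R B" using m by (simp add: B_def)
  have "\<tau>1 A = ennreal m * \<tau>1 B" unfolding A' using F1.tr_scale[of B m] B m by simp
  also have "\<dots> = ennreal m * \<tau>2 (\<psi> B)" using trace_contraction[OF P B(1,2) B1 B(3)] by simp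
  also have "\<dots> = \<tau>2 (m *\<^sub>R \<psi> B)" using F2.tr_scale[of "\<psi> B" m] \<psi>_in \<psi>_pos B m by simp
  also have "m *\<^sub>R \<psi> B = \<psi> A" unfolding A' using \<psi>_scaleR[OF B(1)] by simp
  finally show ?thesis .
qed

text \<open>Compress along an exhausting orthogonal family: each piece lies below some member of
  \<open>G\<close>, where the traces agree. Bijectivity of \<open>\<psi>\<close> keeps the image
  family exhausting, so \<open>tr_family\<close> applies on both sides.\<close>

theorem trace_preserved:
  assumes A: "A \<in> M1" "0 \<le> A" shows "\<tau>1 A = \<tau>2 (\<psi> A)"
proof -
  obtain L where L0: "L \<subseteq> M1" "\<forall>r\<in>L. proj r \<and> (\<exists>P\<in>F1.G. P * r = r)"
    "\<forall>r\<in>L. \<forall>s\<in>L. r \<noteq> s \<longrightarrow> r * s = 0" "\<forall>C. (\<forall>r\<in>L. C * r = 0) \<longrightarrow> C = 0"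
    using F1.exhausting_family by (elim exE conjE)
  have L: "proj r" "\<exists>P\<in>F1.G. P * r = r" "r \<in> M1" if "r \<in> L" for r using L0(1,2) that by auto
  have Lo: "r * s = 0" if "r \<in> L" "s \<in> L" "r \<noteq> s" for r s using L0(3) that by simp
  have total: "C = 0" if "\<And>r. r \<in> L \<Longrightarrow> C * r = 0" for C
    by (rule L0(4)[rule_format]) (rule that)
  have "\<tau>1 A = (SUP T\<in>{T. finite T \<and> T \<subseteq> L}. \<Sum>r\<in>T. \<tau>1 (r * A * r))"
    by (rule F1.tr_family[where f = "\<lambda>r. r", OF L(1) Lo _ L(3) A]; (rule total)?; assumption)
  also have "\<dots> = (SUP T\<in>{T. finite T \<and> T \<subseteq> L}. \<Sum>r\<in>T. \<tau>2 (\<psi> r * \<psi> A * \<psi> r))"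
  proof (rule SUP_cong[OF refl], rule sum.cong[OF refl])
    fix T r assume "T \<in> {T. finite T \<and> T \<subseteq> L}" "r \<in> T"
    then have r: "r \<in> L" by auto
    obtain P where P: "P \<in> F1.G" "P * r = r" using L(2)[OF r] by blast
    have "P * (r * A * r) = (P * r) * A * r" by (simp only: mult.assoc)
    then have "\<tau>1 (r * A * r) = \<tau>2 (\<psi> (r * A * r))"
      using P L(3)[OF r] A conj_proj[OF L(1)[OF r] A(2)] by (intro trace_corner[OF P(1)]) auto
    then show "\<tau>1 (r * A * r) = \<tau>2 (\<psi> r * \<psi> A * \<psi> r)" using L(3)[OF r] A by (simp add: \<psi>_mult)
  qed
  also have "\<dots> = \<tau>2 (\<psi> A)"
  proof (rule F2.tr_family[symmetric])
    show "proj (\<psi> r)" if "r \<in> L" for r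
      using L(1)[OF that] \<psi>_mult[of r r] \<psi>_star[of r] L(3)[OF that] by (simp add: proj_def)
    show "\<psi> r * \<psi> s = 0" if "r \<in> L" "s \<in> L" "r \<noteq> s" for r s
      using Lo[OF that] L(3)[OF that(1)] L(3)[OF that(2)] \<psi>_0 by (simp flip: \<psi>_mult)
    show "C = 0" if C: "C \<in> M2" "\<And>r. r \<in> L \<Longrightarrow> C * \<psi> r = 0" for C
    proof -
      obtain B where B: "B \<in> M1" "C = \<psi> B" using \<psi>_surj[OF C(1)] by blast
      have "B * r = 0" if "r \<in> L" for r
      proof -
        have Br: "B * r \<in> M1" using B(1) L(3)[OF that] by auto
        have "\<psi> (B * r) = \<psi> 0" using C(2)[OF that] B L(3)[OF that] \<psi>_0 by (simp add: \<psi>_mult)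
        then have "inv.\<psi> (\<psi> (B * r)) = inv.\<psi> (\<psi> 0)" by simp
        then show ?thesis unfolding inv_\<psi>[OF Br] inv_\<psi>[OF F1.M_closed(1)] .
      qed
      then have "B = 0" by (rule total)
      then show ?thesis using B(2) \<psi>_0 by simp
    qed
  qed (use A L(3) \<psi>_in \<psi>_pos in auto)
  finally show ?thesis .
qed

end

section \<open>Transfer to algebras of bounded operators\<close>

lemma pos_op_blf: "pos_op (blf A) \<longleftrightarrow> 0 \<le> A"
  by (simp add: pos_op_def less_eq_cop_def cpos_def app.rep_eq)

lemma op_le_blf: "op_le (blf A) (blf B) \<longleftrightarrow> A \<le> B"
  using pos_op_blf[of "B - A"] by (simp add: op_le_def minus_cop.rep_eq)

lemma projection_blf: "projection (blf P) \<longleftrightarrow> proj P"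
  by (simp add: projection_def proj_def times_cop.rep_eq[symmetric] star.rep_eq[symmetric] blf_inject)

lemma commutant_blf:
  assumes "S \<subseteq> bounded_ops"
  shows "blf A \<in> commutant S \<longleftrightarrow> A \<in> comm {B. blf B \<in> S}"
proof
  assume "blf A \<in> commutant S"
  then show "A \<in> comm {B. blf B \<in> S}"
    by (simp add: commutant_def comm_def blf_inject[symmetric] times_cop.rep_eq)
next
  assume A: "A \<in> comm {B. blf B \<in> S}"
  have "blf A o\<^sub>L B = B o\<^sub>L blf A" if "B \<in> S" for B
  proof -
    have B: "blf (Cop B) = B" using assms that by (auto intro: Cop_inverse)
    have "A * Cop B = Cop B * A" using A that B by (simp add: comm_def)
    then show ?thesis using B by (metis times_cop.rep_eq)
  qed
  then show "blf A \<in> commutant S" by (simp add: commutant_def)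
qed

text \<open>The operators quantified over in the definitions lie in \<open>bounded_ops\<close>, so
  each is the image of an element of the operator type, and algebra, order and projections
  correspond under \<open>blf\<close>.\<close>

lemma tracial_factor_blf:
  fixes M :: "('a :: complex_hilbert \<Rightarrow>\<^sub>L 'a) set"
  assumes M: "factor M" and \<tau>: "nsf_tracial_weight M \<tau>" and inf: "\<tau> id_blinfun = \<infinity>"
    and c: "0 < c" and ne: "grassmann M \<tau> c \<noteq> {}"
  shows "tracial_factor {A. blf A \<in> M} (\<lambda>A. \<tau> (blf A)) c"
proof -
  let ?N = "{A. blf A \<in> M}"
  have vn: "M \<subseteq> bounded_ops" "\<And>A. A \<in> M \<Longrightarrow> adj A \<in> M" "commutant (commutant M) = M"
    and cen: "M \<inter> commutant M = range (\<lambda>a. scaleC_op a id_blinfun)"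
    using M by (auto simp: factor_def von_neumann_algebra_def)
  have pc: "blf A \<in> pos_cone M \<longleftrightarrow> A \<in> ?N \<and> 0 \<le> A" for A by (simp add: pos_cone_def pos_op_blf)
  have tw: "tracial_weight M \<tau>" "normal_weight M \<tau>" "faithful_weight M \<tau>"
    using \<tau> by (auto simp: nsf_tracial_weight_def)
  have comm': "{B. blf B \<in> commutant M} = comm ?N" using commutant_blf[OF vn(1)] by auto
  show ?thesis
  proof unfold_locales
    show "star A \<in> ?N" if "A \<in> ?N" for A using that vn(2) by (simp add: star.rep_eq)
    have "commutant M \<subseteq> bounded_ops" by (auto simp: commutant_def)
    then have "blf A \<in> commutant (commutant M) \<longleftrightarrow> A \<in> comm (comm ?N)" for A
      unfolding comm'[symmetric] by (rule commutant_blf)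
    then show "comm (comm ?N) = ?N" unfolding vn(3) by blast
    show "\<exists>a. A = cof a" if A: "A \<in> ?N" "A \<in> comm ?N" for A
    proof -
      have "blf A \<in> M \<inter> commutant M" using A commutant_blf[OF vn(1)] by auto
      then obtain a where "blf A = scaleC_op a id_blinfun" unfolding cen by auto
      then have "A = cof a" by (simp add: blf_inject[symmetric] cof.rep_eq)
      then show ?thesis by blast
    qed
    show "\<tau> (blf (A + B)) = \<tau> (blf A) + \<tau> (blf B)" if "A \<in> ?N" "0 \<le> A" "B \<in> ?N" "0 \<le> B" for A B
      using tw(1) pc that by (simp add: tracial_weight_def plus_cop.rep_eq)
    show "\<tau> (blf (r *\<^sub>R A)) = ennreal r * \<tau> (blf A)" if "A \<in> ?N" "0 \<le> A" "0 \<le> r" for A r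
      using tw(1) pc that by (simp add: tracial_weight_def scaleR_cop.rep_eq)
    show "\<tau> (blf (star A * A)) = \<tau> (blf (A * star A))" if "A \<in> ?N" for A
      using tw(1) that by (simp add: tracial_weight_def times_cop.rep_eq star.rep_eq)
    show "A = 0" if "A \<in> ?N" "0 \<le> A" "\<tau> (blf A) = 0" for A
    proof -
      have "blf A = 0" using tw(3) pc that by (simp add: faithful_weight_def)
      then show ?thesis by (simp add: blf_inject[symmetric] zero_cop.rep_eq)
    qed
    show "\<tau> (blf A) = (SUP B\<in>D. \<tau> (blf B))"
      if D: "D \<subseteq> ?N" "D \<noteq> {}" "\<And>B. B \<in> D \<Longrightarrow> 0 \<le> B"
        and dir: "\<And>B C. B \<in> D \<Longrightarrow> C \<in> D \<Longrightarrow> \<exists>E\<in>D. B \<le> E \<and> C \<le> E"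
        and A: "A \<in> ?N" "0 \<le> A" and ub: "\<And>B. B \<in> D \<Longrightarrow> B \<le> A"
        and least: "\<And>C. C \<in> ?N \<Longrightarrow> 0 \<le> C \<Longrightarrow> (\<And>B. B \<in> D \<Longrightarrow> B \<le> C) \<Longrightarrow> A \<le> C" for D A
    proof -
      have "\<tau> (blf A) = (SUP B\<in>blf ` D. \<tau> B)"
      proof (rule tw(2)[unfolded normal_weight_def, rule_format], intro conjI ballI impI)
        show "blf ` D \<subseteq> pos_cone M" using D pc by auto
        show "blf ` D \<noteq> {}" using D by simp
        show "blf A \<in> pos_cone M" using A pc by simp
      next
        fix B C assume "B \<in> blf ` D" "C \<in> blf ` D"
        then obtain B' C' where "B = blf B'" "C = blf C'" "B' \<in> D" "C' \<in> D" by auto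
        then show "\<exists>E\<in>blf ` D. op_le B E \<and> op_le C E" using dir[of B' C'] by (auto simp: op_le_blf)
      next
        fix B assume "B \<in> blf ` D"
        then show "op_le B (blf A)" using ub by (auto simp: op_le_blf)
      next
        fix C assume C: "C \<in> pos_cone M" "\<forall>B\<in>blf ` D. op_le B C"
        have "C \<in> bounded_ops" using C(1) vn(1) by (auto simp: pos_cone_def)
        then obtain C' where C': "C = blf C'" by (metis Cop_inverse)
        have "A \<le> C'"
        proof (rule least)
          show "C' \<in> ?N" "0 \<le> C'" using C(1) C' pc by auto
          show "B \<le> C'" if "B \<in> D" for B using C(2) C' that by (simp add: op_le_blf)
        qed
        then show "op_le (blf A) C" using C' by (simp add: op_le_blf)
      qed
      then show ?thesis by (simp add: image_image)
    qed
    show "\<tau> (blf 1) = \<infinity>" using inf by (simp add: one_cop.rep_eq)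
    show "\<exists>P\<in>?N. proj P \<and> \<tau> (blf P) = ennreal c"
    proof -
      obtain P where P: "P \<in> grassmann M \<tau> c" using ne by auto
      then have "blf (Cop P) = P" using vn(1) by (auto simp: grassmann_def intro: Cop_inverse)
      then show ?thesis using P projection_blf[of "Cop P"] by (intro bexI[of _ "Cop P"]) (auto simp: grassmann_def)
    qed
  qed (rule c)
qed

lemma lp_norm_blf:
  assumes p: "0 < p" and "star A = A"
  shows "lp_norm \<tau> p (blf A) = enn2real (\<tau> (blf (fc (apowr (p / 2)) (A * A)))) powr (1 / p)"
  unfolding lp_norm_def using cfc_abs_op[OF p, of A] assms(2) by simp

lemma powr_inject:
  fixes x y :: real
  assumes "0 < p" "0 \<le> x" "0 \<le> y" and eq: "x powr (1 / p) = y powr (1 / p)"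
  shows "x = y"
proof -
  have *: "(z powr (1 / p)) powr p = z" if "0 \<le> z" for z :: real using assms(1) that by (simp add: powr_powr)
  have "x = (x powr (1 / p)) powr p" by (rule *[OF assms(2), symmetric])
  also have "\<dots> = (y powr (1 / p)) powr p" by (simp only: eq)
  also have "\<dots> = y" by (rule *[OF assms(3)])
  finally show ?thesis .
qed

theorem theorem1p2:
  fixes c p :: real
    and M1 :: "('a::complex_hilbert \<Rightarrow>\<^sub>L 'a) set"
    and M2 :: "('b::complex_hilbert \<Rightarrow>\<^sub>L 'b) set"
    and \<tau>1 :: "('a \<Rightarrow>\<^sub>L 'a) \<Rightarrow> ennreal"
    and \<tau>2 :: "('b \<Rightarrow>\<^sub>L 'b) \<Rightarrow> ennreal"
    and \<phi> :: "('a \<Rightarrow>\<^sub>L 'a) \<Rightarrow> ('b \<Rightarrow>\<^sub>L 'b)"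
  assumes "0 < c" and "0 < p"
    and "factor M1" and "nsf_tracial_weight M1 \<tau>1" and "\<tau>1 id_blinfun = \<infinity>"
    and "factor M2" and "nsf_tracial_weight M2 \<tau>2" and "\<tau>2 id_blinfun = \<infinity>"
    and "grassmann M1 \<tau>1 c \<noteq> {}" and "grassmann M2 \<tau>2 c \<noteq> {}"
    and "surjective_lp_isometry p c M1 \<tau>1 M2 \<tau>2 \<phi>"
  shows "\<exists>\<psi>. (star_isomorphism M1 M2 \<psi> \<or> star_anti_isomorphism M1 M2 \<psi>) \<and>
    (\<forall>A\<in>pos_cone M1. \<tau>1 A = \<tau>2 (\<psi> A)) \<and>
    (\<forall>P\<in>grassmann M1 \<tau>1 c. \<phi> P = \<psi> P)"
proof -
  define N1 where "N1 = {A. blf A \<in> M1}"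
  define N2 where "N2 = {A. blf A \<in> M2}"
  define t1 where "t1 A = \<tau>1 (blf A)" for A
  define t2 where "t2 A = \<tau>2 (blf A)" for A
  have p2: "0 < p / 2" using assms(2) by simp
  interpret F1: tracial_factor N1 t1 c
    unfolding N1_def t1_def by (rule tracial_factor_blf[OF assms(3-5,1,9)])
  interpret F2: tracial_factor N2 t2 c
    unfolding N2_def t2_def by (rule tracial_factor_blf[OF assms(6-8,1,10)])
  have bd: "M1 \<subseteq> bounded_ops" "M2 \<subseteq> bounded_ops"
    using assms(3,6) by (auto simp: factor_def von_neumann_algebra_def)
  have mem: "A \<in> N1 \<longleftrightarrow> blf A \<in> M1" "B \<in> N2 \<longleftrightarrow> blf B \<in> M2" for A B
    by (simp_all add: N1_def N2_def)
  have g1: "blf P \<in> grassmann M1 \<tau>1 c \<longleftrightarrow> P \<in> F1.G" for P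
    by (simp add: grassmann_def F1.G_def mem t1_def projection_blf)
  have g2: "blf P \<in> grassmann M2 \<tau>2 c \<longleftrightarrow> P \<in> F2.G" for P
    by (simp add: grassmann_def F2.G_def mem t2_def projection_blf)
  have G1: "P \<in> grassmann M1 \<tau>1 c \<Longrightarrow> blf (Cop P) = P" and G2: "Q \<in> grassmann M2 \<tau>2 c \<Longrightarrow> blf (Cop Q) = Q" for P Q
    using bd by (auto simp: grassmann_def intro!: Cop_inverse)
  have onto: "\<phi> ` grassmann M1 \<tau>1 c = grassmann M2 \<tau>2 c"
    and iso: "\<And>P Q. P \<in> grassmann M1 \<tau>1 c \<Longrightarrow> Q \<in> grassmann M1 \<tau>1 c \<Longrightarrow>
      lp_norm \<tau>1 p (P - Q) = lp_norm \<tau>2 p (\<phi> P - \<phi> Q)"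
    using assms(11) by (auto simp: surjective_lp_isometry_def)
  define f where "f P = Cop (\<phi> (blf P))" for P
  have blf_f: "blf (f P) = \<phi> (blf P)" if "P \<in> F1.G" for P
    unfolding f_def by (rule G2) (use onto g1 that in auto)
  have fG: "f P \<in> F2.G" if "P \<in> F1.G" for P using g2[of "f P"] blf_f[OF that] onto g1 that by auto
  have f_onto: "f ` F1.G = F2.G"
  proof (intro equalityI subsetI)
    fix Q assume "Q \<in> F2.G"
    then have "blf Q \<in> \<phi> ` grassmann M1 \<tau>1 c" using onto g2 by simp
    then obtain P where P: "P \<in> grassmann M1 \<tau>1 c" "blf Q = \<phi> P" by auto
    then have "Q = f (Cop P)" unfolding f_def using G1 by (metis blf_inverse)
    moreover have "Cop P \<in> F1.G" using g1 G1 P(1) by metis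
    ultimately show "Q \<in> f ` F1.G" by blast
  qed (use fG in auto)
  let ?d = "fc (apowr (p / 2))"
  have dist: "t1 (?d ((P - Q) * (P - Q))) = t2 (?d ((f P - f Q) * (f P - f Q)))"
    if P: "P \<in> F1.G" and Q: "Q \<in> F1.G" for P Q
  proof -
    have "lp_norm \<tau>1 p (blf (P - Q)) = lp_norm \<tau>2 p (blf (f P - f Q))"
      using iso[of "blf P" "blf Q"] g1 P Q by (simp add: minus_cop.rep_eq blf_f)
    then have "enn2real (t1 (?d ((P - Q) * (P - Q)))) powr (1 / p) =
        enn2real (t2 (?d ((f P - f Q) * (f P - f Q)))) powr (1 / p)"
      using lp_norm_blf[OF assms(2), of "P - Q" \<tau>1] lp_norm_blf[OF assms(2), of "f P - f Q" \<tau>2]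
        F1.GD(5) F2.GD(5) P Q fG by (simp add: t1_def t2_def)
    then have "enn2real (t1 (?d ((P - Q) * (P - Q)))) = enn2real (t2 (?d ((f P - f Q) * (f P - f Q))))"
      by (rule powr_inject[OF assms(2), rotated 2]) simp_all
    \<comment> \<open>\<open>enn2real\<close> sends \<open>\<infinity>\<close> to \<open>0\<close>,
      so equal real values give equal extended values only once both are finite;
      \<open>dist_le\<close> provides this.\<close>
    moreover have "t1 (?d ((P - Q) * (P - Q))) < \<infinity>" "t2 (?d ((f P - f Q) * (f P - f Q))) < \<infinity>"
      using F1.dist_le[OF p2 P Q] F2.dist_le[OF p2 fG[OF P] fG[OF Q]] by (auto simp: order_le_less_trans)
    ultimately show ?thesis by (metis ennreal_enn2real infinity_ennreal_def)
  qed
  have orth: "P * Q = 0 \<longleftrightarrow> f P * f Q = 0" if "P \<in> F1.G" "Q \<in> F1.G" for P Q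
    using F1.orth_iff_dist[OF p2 that] F2.orth_iff_dist[OF p2 fG[OF that(1)] fG[OF that(2)]] dist[OF that] by simp
  interpret gp: grassmann_pair N1 t1 c N2 t2 f
    by unfold_locales (use f_onto orth in auto)
  define f' where "f' = inv_into F1.G f"
  have inv1: "f' (f P) = P" if "P \<in> F1.G" for P unfolding f'_def by (rule inv_into_f_f[OF gp.\<phi>_inj that])
  have inv2: "f (f' Q) = Q" if "Q \<in> F2.G" for Q unfolding f'_def using f_inv_into_f f_onto that by metis
  have f'G: "f' Q \<in> F1.G" if "Q \<in> F2.G" for Q unfolding f'_def using inv_into_into f_onto that by metis
  interpret gi: grassmann_isometry N1 t1 c N2 t2 f f' "p / 2"
  proof unfold_locales
    show "f' ` F2.G = F1.G" using f'G inv1 fG by (auto intro!: image_eqI)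
    show "P * Q = 0 \<longleftrightarrow> f' P * f' Q = 0" if "P \<in> F2.G" "Q \<in> F2.G" for P Q
      using orth[OF f'G[OF that(1)] f'G[OF that(2)]] inv2 that by simp
  qed (use inv1 inv2 dist p2 in auto)
  have Cop1: "Cop A \<in> N1" "blf (Cop A) = A" if "A \<in> M1" for A
  proof -
    show "blf (Cop A) = A" by (rule Cop_inverse) (use that bd(1) in blast)
    then show "Cop A \<in> N1" using that by (simp add: mem)
  qed
  have rep: "Cop (A + B) = Cop A + Cop B" "Cop (A o\<^sub>L B) = Cop A * Cop B" "Cop (adj A) = star (Cop A)"
    "Cop (scaleC_op z A) = cof z * Cop A" if "A \<in> M1" "B \<in> M1" for A B z
  proof -
    have "scaleC_op z A = scaleC_op z id_blinfun o\<^sub>L A" by (rule blinfun_eqI) (simp add: scaleC_op.rep_eq)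
    then have "A + B = blf (Cop A + Cop B)" "A o\<^sub>L B = blf (Cop A * Cop B)" "adj A = blf (star (Cop A))"
      "scaleC_op z A = blf (cof z * Cop A)"
      using Cop1(2) that by (simp_all add: plus_cop.rep_eq times_cop.rep_eq star.rep_eq cof.rep_eq)
    then show "Cop (A + B) = Cop A + Cop B" "Cop (A o\<^sub>L B) = Cop A * Cop B" "Cop (adj A) = star (Cop A)"
      "Cop (scaleC_op z A) = cof z * Cop A"
      by (simp_all only: blf_inverse)
  qed
  have scale: "blf (cof z * B) = scaleC_op z (blf B)" for z and B :: "'b cop"
    by (rule blinfun_eqI) (simp add: times_cop.rep_eq cof.rep_eq scaleC_op.rep_eq)
  have bijC: "bij_betw Cop M1 N1"
    by (rule bij_betwI[where g = blf]) (use Cop1 in \<open>auto simp: mem blf_inverse\<close>)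
  have bijB: "bij_betw blf N2 M2"
  proof (rule bij_betwI[where g = Cop])
    show "blf (Cop B) = B" if "B \<in> M2" for B using that bd(2) by (auto intro: Cop_inverse)
    then show "Cop \<in> M2 \<rightarrow> N2" by (auto simp: mem)
  qed (auto simp: mem blf_inverse)
  from gi.lam_cases show ?thesis
  proof
    assume lam: "\<forall>z. gi.lam z = z"
    define \<Psi> where "\<Psi> A = blf (gp.\<psi> (Cop A))" for A
    have "bij_betw \<Psi> M1 M2"
      using bij_betw_trans[OF bij_betw_trans[OF bijC gi.\<psi>_bij] bijB] by (simp add: comp_def \<Psi>_def[abs_def])
    moreover have "\<Psi> (A + B) = \<Psi> A + \<Psi> B" "\<Psi> (A o\<^sub>L B) = \<Psi> A o\<^sub>L \<Psi> B" if "A \<in> M1" "B \<in> M1" for A B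
      using gp.\<psi>_add[OF Cop1(1)[OF that(1)] Cop1(1)[OF that(2)]] gp.\<psi>_mult[OF Cop1(1)[OF that(1)] Cop1(1)[OF that(2)]]
      by (simp_all add: \<Psi>_def rep that plus_cop.rep_eq times_cop.rep_eq)
    moreover have "\<Psi> (scaleC_op z A) = scaleC_op z (\<Psi> A)" "\<Psi> (adj A) = adj (\<Psi> A)" if "A \<in> M1" for A z
      using gi.\<psi>_cof_mult[OF Cop1(1)[OF that], of z] gp.\<psi>_star[OF Cop1(1)[OF that]] lam
      by (simp_all add: \<Psi>_def rep[OF that that] scale star.rep_eq)
    ultimately have "star_isomorphism M1 M2 \<Psi>" by (simp add: star_isomorphism_def star_linear_bijection_def)
    moreover have "\<tau>1 A = \<tau>2 (\<Psi> A)" if "A \<in> pos_cone M1" for A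
    proof -
      have A: "A \<in> M1" "0 \<le> Cop A" using that Cop1(2)[of A] pos_op_blf[of "Cop A"] by (auto simp: pos_cone_def)
      show ?thesis using gi.trace_preserved[OF Cop1(1)[OF A(1)] A(2)] Cop1(2)[OF A(1)] by (simp add: t1_def t2_def \<Psi>_def)
    qed
    moreover have "\<phi> P = \<Psi> P" if P: "P \<in> grassmann M1 \<tau>1 c" for P
    proof -
      have C: "Cop P \<in> F1.G" using g1[of "Cop P"] G1 P by simp
      then show ?thesis using gp.\<psi>_G[OF C] blf_f[OF C] G1[OF P] by (simp add: \<Psi>_def)
    qed
    ultimately show ?thesis by blast
  next
    assume lam: "\<forall>z. gi.lam z = cnj z"
    \<comment> \<open>Conjugating scalars twice restores linearity, and \<open>star\<close> reverses
      products. Positive operators and projections are self-adjoint, so the trace identity and the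
      values on the Grassmann space are unaffected.\<close>
    define \<Psi> where "\<Psi> A = blf (gp.\<psi> (star (Cop A)))" for A
    have sN: "star A \<in> N1" if "A \<in> N1" for A using that by auto
    have bijS: "bij_betw star N1 N1" by (rule bij_betwI[where g = star]) (use sN in auto)
    have "bij_betw \<Psi> M1 M2"
      using bij_betw_trans[OF bij_betw_trans[OF bij_betw_trans[OF bijC bijS] gi.\<psi>_bij] bijB]
      by (simp add: comp_def \<Psi>_def[abs_def])
    moreover have "\<Psi> (A + B) = \<Psi> A + \<Psi> B" "\<Psi> (A o\<^sub>L B) = \<Psi> B o\<^sub>L \<Psi> A" if "A \<in> M1" "B \<in> M1" for A B
      using gp.\<psi>_add[OF sN[OF Cop1(1)[OF that(1)]] sN[OF Cop1(1)[OF that(2)]]]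
        gp.\<psi>_mult[OF sN[OF Cop1(1)[OF that(2)]] sN[OF Cop1(1)[OF that(1)]]]
      by (simp_all add: \<Psi>_def rep that plus_cop.rep_eq times_cop.rep_eq)
    moreover have "\<Psi> (scaleC_op z A) = scaleC_op z (\<Psi> A)" "\<Psi> (adj A) = adj (\<Psi> A)" if "A \<in> M1" for A z
      using gi.\<psi>_cof_mult[OF sN[OF Cop1(1)[OF that]], of "cnj z"] gp.\<psi>_star[OF sN[OF Cop1(1)[OF that]]] lam
      by (simp_all add: \<Psi>_def rep[OF that that] scale star.rep_eq[symmetric] cof_commute)
    ultimately have "star_anti_isomorphism M1 M2 \<Psi>" by (simp add: star_anti_isomorphism_def star_linear_bijection_def)
    moreover have "\<tau>1 A = \<tau>2 (\<Psi> A)" if "A \<in> pos_cone M1" for A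
    proof -
      have A: "A \<in> M1" "0 \<le> Cop A" using that Cop1(2)[of A] pos_op_blf[of "Cop A"] by (auto simp: pos_cone_def)
      show ?thesis using gi.trace_preserved[OF Cop1(1)[OF A(1)] A(2)] Cop1(2)[OF A(1)] pos_selfadj[OF A(2)]
        by (simp add: t1_def t2_def \<Psi>_def)
    qed
    moreover have "\<phi> P = \<Psi> P" if P: "P \<in> grassmann M1 \<tau>1 c" for P
    proof -
      have C: "Cop P \<in> F1.G" using g1[of "Cop P"] G1 P by simp
      then show ?thesis using gp.\<psi>_G[OF C] blf_f[OF C] G1[OF P] F1.GD(5)[OF C] by (simp add: \<Psi>_def)
    qed
    ultimately show ?thesis by blast
  qed
qed

end
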